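(* Let $p$ be a prime, $k$ a perfect field of characteristic $p$, and $E$ an elementary abelian $p$-group of rank $r$. Suppose that $M$ is a finitely generated $kE$-module of stable constant Jordan type $[1]^s$. Then $p$ divides the Chern numbers $c_m(\mathcal F_1(M))$ for $1\le m\le p-2$.
   Context: Write $E=\langle g_1,\dots,g_r\rangle$ and $X_i=g_i-1\in kE$. The $X_i$ give a basis of $J(kE)/J^2(kE)$ ($J(kE)$ the augmentation ideal), regarded as affine space $\mathbb A^r_k$ with coordinate ring $k[Y_1,\dots,Y_r]$, $Y_i(X_j)=\delta_{ij}$; $\mathbb P^{r-1}$ is the corresponding projective space over $k$, with structure sheaf $\mathcal O$. For a field extension $K/k$ and $0\ne\alpha=(\lambda_1,\dots,\lambda_r)\in\mathbb A^r_K=K^r$, put $X_\alpha=\lambda_1X_1+\dots+\lambda_rX_r\in KE$; then $X_\alpha^p=0$. A finitely generated $kE$-module $M$ has constant Jordan type $[p]^{a_p}\cdots[1]^{a_1}$ if for all $K/k$ and all $0\neq\alpha\in K^r$ the nilpotent operator $X_\alpha$ on $M\otimes_kK$ has exactly $a_i$ Jordan blocks of length $i$ for each $1\le i\le p$. It then has stable constant Jordan type $[p-1]^{a_{p-1}}\cdots[1]^{a_1}$ (blocks of length $p$ are ignored). So stable constant Jordan type $[1]^s$ means $a_1=s$ and $a_2=\dots=a_{p-1}=0$, with $a_p$ arbitrary. For a finitely generated $kE$-module $M$ let $\widetilde M=M\otimes_k\mathcal O$, $\widetilde M(j)=M\otimes_k\mathcal O(j)$, and let $\theta_M\colon\widetilde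 M(j)\to\widetilde M(j+1)$ be $\theta_M(m\otimes f)=\sum_{i=1}^rX_i(m)\otimes Y_if$ (same notation for all $j\in\mathbb Z$); then $\theta_M^p=0$. Define $$\mathcal F_1(M)=\frac{\operatorname{Ker}\theta_M}{\operatorname{Ker}\theta_M\cap\operatorname{Im}\theta_M},$$ a subquotient of $\widetilde M$, where $\operatorname{Im}\theta_M$ denotes the image of $\theta_M\colon\widetilde M(-1)\to\widetilde M$. When $M$ has constant Jordan type, $\mathcal F_1(M)$ is a vector bundle (locally free of rank $a_1$). The Chow ring of $\mathbb P^{r-1}$ is $A^*(\mathbb P^{r-1})\cong\mathbb Z[h]/(h^r)$. For a vector bundle $\mathcal F$ on $\mathbb P^{r-1}$, the Chern numbers $c_j(\mathcal F)\in\mathbb Z$ ($1\le j\le r-1$) are the integers with total Chern class $c(\mathcal F,h)=\sum_{j\ge0}c_j(\mathcal F)h^j\in A^*(\mathbb P^{r-1})$, $c_0(\mathcal F)=1$ (only $m\le r-1$ is meaningful; $c_m=0$ for $m\geq r$). *)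

theory Defs
  imports
    "HOL-Algebra.Module"
    "HOL-Algebra.Algebraic_Closure_Type"
    "HOL-Library.Poly_Mapping"
    "HOL-Library.Cardinality"
    "HOL-Computational_Algebra.Fraction_Field"
begin

section \<open>The group algebra of an elementary abelian group and its modules\<close>

text \<open>
  Groups are written additively, so the type \<open>'e \<Rightarrow>\<^sub>0 'k\<close> of finitely supported functions with
  its convolution product is the group algebra \<open>kE\<close>, the group element \<open>x\<close> being
  \<open>Poly_Mapping.single x 1\<close>. A \<open>kE\<close>-module is a scalar multiplication \<open>scl\<close> satisfying
  \<open>Modules.module scl\<close>. The index type \<open>'r\<close> of the generators has \<open>r\<close> elements, \<open>r \<ge> 1\<close>.
\<close>

definition elementary_abelian_gens :: "nat \<Rightarrow> ('r::finite \<Rightarrow> 'e::ab_group_add) \<Rightarrow> bool" where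
  "elementary_abelian_gens p g \<longleftrightarrow>
     (\<forall>x::'e. (\<Sum>_<p. x) = 0) \<and>
     card (UNIV :: 'e set) = p ^ CARD('r) \<and>
     (\<forall>x. \<exists>n :: 'r \<Rightarrow> nat. x = (\<Sum>i\<in>UNIV. \<Sum>_<n i. g i))"

definition fin_gen :: "('a::comm_ring_1 \<Rightarrow> 'm::ab_group_add \<Rightarrow> 'm) \<Rightarrow> bool" where
  "fin_gen scl \<longleftrightarrow> (\<exists>B. finite B \<and> Modules.module.span scl B = UNIV)"

definition X_gen :: "('r \<Rightarrow> 'e::ab_group_add) \<Rightarrow> 'r \<Rightarrow> ('e \<Rightarrow>\<^sub>0 'k::field)" where
  "X_gen g i = Poly_Mapping.single (g i) 1 - 1"

definition kscale :: "(('e::ab_group_add \<Rightarrow>\<^sub>0 'k::field) \<Rightarrow> 'm \<Rightarrow> 'm) \<Rightarrow> 'k \<Rightarrow> 'm \<Rightarrow> 'm" where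
  "kscale scl a = scl (Poly_Mapping.single 0 a)"

definition kdim :: "(('e::ab_group_add \<Rightarrow>\<^sub>0 'k::field) \<Rightarrow> 'm::ab_group_add \<Rightarrow> 'm) \<Rightarrow> nat" where
  "kdim scl = vector_space.dim (kscale scl) UNIV"

text \<open>
  Tensor products \<open>M \<otimes>\<^sub>k V\<close> are written in coordinates: a \<open>k\<close>-basis of \<open>M\<close> with \<open>d\<close> elements is
  chosen once and for all, and \<open>M \<otimes>\<^sub>k V\<close> is \<open>V\<^sup>d\<close>. A \<open>k\<close>-linear operator on \<open>M\<close> then acts on
  \<open>V\<^sup>d\<close> through its matrix.
\<close>

definition kbasis :: "(('e::ab_group_add \<Rightarrow>\<^sub>0 'k::field) \<Rightarrow> 'm::ab_group_add \<Rightarrow> 'm) \<Rightarrow> nat \<Rightarrow> 'm" where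
  "kbasis scl = (SOME b. inj_on b {..<kdim scl} \<and>
      \<not> Modules.module.dependent (kscale scl) (b ` {..<kdim scl}) \<and>
      Modules.module.span (kscale scl) (b ` {..<kdim scl}) = UNIV)"

text \<open>Entry in row \<open>a\<close> and column \<open>b\<close> of the matrix of \<open>X\<^sub>i = g\<^sub>i - 1\<close> on \<open>M\<close>.\<close>

definition X_mat :: "(('e::ab_group_add \<Rightarrow>\<^sub>0 'k::field) \<Rightarrow> 'm::ab_group_add \<Rightarrow> 'm) \<Rightarrow>
    ('r \<Rightarrow> 'e) \<Rightarrow> 'r \<Rightarrow> nat \<Rightarrow> nat \<Rightarrow> 'k" where
  "X_mat scl g i a b = Modules.module.representation (kscale scl) (kbasis scl ` {..<kdim scl})
      (scl (X_gen g i) (kbasis scl b)) (kbasis scl a)"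


section \<open>Constant Jordan type\<close>

text \<open>\<open>X\<^sub>\<alpha>\<close> acting on \<open>M \<otimes>\<^sub>k K = K\<^sup>d\<close>, for an extension \<open>\<iota>\<close> from \<open>k\<close> to \<open>K\<close>.\<close>

definition X_alpha :: "(('e::ab_group_add \<Rightarrow>\<^sub>0 'k::field) \<Rightarrow> 'm::ab_group_add \<Rightarrow> 'm) \<Rightarrow>
    ('r::finite \<Rightarrow> 'e) \<Rightarrow> 'u ring \<Rightarrow> ('k \<Rightarrow> 'u) \<Rightarrow> ('r \<Rightarrow> 'u) \<Rightarrow> (nat \<Rightarrow> 'u) \<Rightarrow> nat \<Rightarrow> 'u" where
  "X_alpha scl g K \<iota> \<alpha> v = (\<lambda>a\<in>{..<kdim scl}. finsum K
      (\<lambda>b. finsum K (\<lambda>i. \<alpha> i \<otimes>\<^bsub>K\<^esub> \<iota> (X_mat scl g i a b)) UNIV \<otimes>\<^bsub>K\<^esub> v b) {..<kdim scl})"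

text \<open>
  \<open>T\<close> is an operator on \<open>K\<^sup>d\<close>. The list \<open>ns\<close> collects the sizes of the Jordan blocks (for the
  eigenvalue zero), and \<open>v l 0, v l 1, \<dots>\<close> is the Jordan string of the \<open>l\<close>-th block.
\<close>

definition nilpotent_jordan_blocks ::
    "'u ring \<Rightarrow> nat \<Rightarrow> ((nat \<Rightarrow> 'u) \<Rightarrow> (nat \<Rightarrow> 'u)) \<Rightarrow> nat list \<Rightarrow> bool" where
  "nilpotent_jordan_blocks K d T ns \<longleftrightarrow> 0 \<notin> set ns \<and>
     (\<exists>v :: nat \<Rightarrow> nat \<Rightarrow> nat \<Rightarrow> 'u.
        (\<forall>l<length ns. \<forall>t<ns ! l. v l t \<in> {..<d} \<rightarrow>\<^sub>E carrier K) \<and>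
        (\<forall>l<length ns. T (v l 0) = (\<lambda>a\<in>{..<d}. \<zero>\<^bsub>K\<^esub>)) \<and>
        (\<forall>l<length ns. \<forall>t. Suc t < ns ! l \<longrightarrow> T (v l (Suc t)) = v l t) \<and>
        (let I = (SIGMA l:{..<length ns}. {..<ns ! l}) in
         \<forall>w \<in> {..<d} \<rightarrow>\<^sub>E carrier K. \<exists>!x. x \<in> I \<rightarrow>\<^sub>E carrier K \<and>
           w = (\<lambda>a\<in>{..<d}. finsum K (\<lambda>(l, t). x (l, t) \<otimes>\<^bsub>K\<^esub> v l t a) I)))"

type_synonym ('k, 'r) hpoly = "('r \<Rightarrow>\<^sub>0 nat) \<Rightarrow>\<^sub>0 'k"
type_synonym ('k, 'r) hfrac = "('k, 'r) hpoly fract"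

text \<open>
  HOL cannot quantify over types inside a definition, so the extension fields \<open>K\<close> have
  their carrier in the fixed type of sets of rational functions in \<open>r\<close> variables over \<open>k\<close>. This is
  no restriction: a point of \<open>K\<^sup>r\<close> has its coordinates in a finitely generated subextension of
  \<open>k\<close>, such a field has cardinality at most that of \<open>k(Y\<^sub>1, \<dots>, Y\<^sub>r)\<close>, hence has a copy carried by
  this type, and Jordan types do not change under field extension.
\<close>

definition constant_jordan_type :: "nat \<Rightarrow> (('e::ab_group_add \<Rightarrow>\<^sub>0 'k::field) \<Rightarrow> 'm::ab_group_add \<Rightarrow> 'm) \<Rightarrow>
    ('r::{finite,linorder} \<Rightarrow> 'e) \<Rightarrow> (nat \<Rightarrow> nat) \<Rightarrow> bool" where
  "constant_jordan_type p scl g n \<longleftrightarrow>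
     (\<forall>(K :: ('k, 'r) hfrac set ring) \<iota> \<alpha>.
        Ring.field K \<longrightarrow> \<iota> \<in> ring_hom (ring_of_type_algebra :: 'k ring) K \<longrightarrow>
        (\<forall>i. \<alpha> i \<in> carrier K) \<longrightarrow> (\<exists>i. \<alpha> i \<noteq> \<zero>\<^bsub>K\<^esub>) \<longrightarrow>
        (\<exists>ns. nilpotent_jordan_blocks K (kdim scl) (X_alpha scl g K \<iota> \<alpha>) ns \<and>
              set ns \<subseteq> {1..p} \<and> (\<forall>i\<in>{1..p}. count_list ns i = n i)))"

definition stable_constant_jordan_type :: "nat \<Rightarrow> (('e::ab_group_add \<Rightarrow>\<^sub>0 'k::field) \<Rightarrow> 'm::ab_group_add \<Rightarrow> 'm) \<Rightarrow>
    ('r::{finite,linorder} \<Rightarrow> 'e) \<Rightarrow> (nat \<Rightarrow> nat) \<Rightarrow> bool" where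
  "stable_constant_jordan_type p scl g n \<longleftrightarrow>
     (\<exists>n'. constant_jordan_type p scl g n' \<and> (\<forall>i\<in>{1..<p}. n' i = n i))"


section \<open>Projective space\<close>

definition homogeneous :: "nat \<Rightarrow> ('k::field, 'r::{finite,linorder}) hpoly \<Rightarrow> bool" where
  "homogeneous e f \<longleftrightarrow> (\<forall>t\<in>Poly_Mapping.keys f. (\<Sum>i\<in>UNIV. Poly_Mapping.lookup t i) = e)"

definition hcomponent :: "nat \<Rightarrow> ('k::field, 'r::{finite,linorder}) hpoly \<Rightarrow> ('k, 'r) hpoly" where
  "hcomponent e f = (\<Sum>t\<in>{t \<in> Poly_Mapping.keys f. (\<Sum>i\<in>UNIV. Poly_Mapping.lookup t i) = e}.
      Poly_Mapping.single t (Poly_Mapping.lookup f t))"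

definition Y_var :: "'r \<Rightarrow> ('k::field, 'r::{finite,linorder}) hpoly" where
  "Y_var i = Poly_Mapping.single (Poly_Mapping.single i 1) 1"

type_synonym ('k, 'r) point = "('k, 'r) hpoly set"

text \<open>\<open>Proj k[Y\<^sub>1, \<dots>, Y\<^sub>r]\<close>: homogeneous prime ideals not containing the irrelevant ideal.\<close>

definition proj_space :: "('k::field, 'r::{finite,linorder}) point set" where
  "proj_space = {P. 0 \<in> P \<and> (\<forall>f\<in>P. \<forall>h\<in>P. f + h \<in> P) \<and> (\<forall>f. \<forall>h\<in>P. f * h \<in> P) \<and>
     1 \<notin> P \<and> (\<forall>f h. f * h \<in> P \<longrightarrow> f \<in> P \<or> h \<in> P) \<and>
     (\<forall>f\<in>P. \<forall>e. hcomponent e f \<in> P) \<and> (\<exists>i. Y_var i \<notin> P)}"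

definition zopen :: "('k::field, 'r::{finite,linorder}) point set \<Rightarrow> bool" where
  "zopen U \<longleftrightarrow> (\<exists>T. (\<forall>f\<in>T. \<exists>e. homogeneous e f) \<and> U = {P \<in> proj_space. \<not> T \<subseteq> P})"

text \<open>
  Sections of \<open>\<O>(j)\<close>: functions to the fractions that are locally of the form \<open>f / h\<close> with
  \<open>f\<close>, \<open>h\<close> homogeneous, \<open>deg f - deg h = j\<close>. All homogeneous localizations are
  subrings of the field of fractions, since the polynomial ring is a domain.
\<close>

definition O_sections :: "int \<Rightarrow> ('k::field, 'r::{finite,linorder}) point set \<Rightarrow>
    (('k, 'r) point \<Rightarrow> ('k, 'r) hfrac) set" where
  "O_sections j U = {s \<in> extensional U. \<forall>P\<in>U. \<exists>V f h e e'. zopen V \<and> P \<in> V \<and> V \<subseteq> U \<and>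
     homogeneous e f \<and> homogeneous e' h \<and> int e = int e' + j \<and>
     (\<forall>Q\<in>V. h \<notin> Q \<and> s Q = Fract f h)}"

definition O_ring :: "('k::field, 'r::{finite,linorder}) point set \<Rightarrow>
    (('k, 'r) point \<Rightarrow> ('k, 'r) hfrac) ring" where
  "O_ring U = \<lparr>carrier = O_sections 0 U, monoid.mult = (\<lambda>s t. \<lambda>P\<in>U. s P * t P), one = (\<lambda>P\<in>U. 1),
     zero = (\<lambda>P\<in>U. 0), add = (\<lambda>s t. \<lambda>P\<in>U. s P + t P)\<rparr>"


section \<open>Sheaves of modules on projective space\<close>

record ('x, 's, 'a) presheaf_of_modules =
  sections :: "'x set \<Rightarrow> ('s, 'a) module"
  res :: "'x set \<Rightarrow> 'x set \<Rightarrow> 'a \<Rightarrow> 'a"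

type_synonym ('k, 'r, 'a) psheaf =
  "(('k, 'r) point, ('k, 'r) point \<Rightarrow> ('k, 'r) hfrac, 'a) presheaf_of_modules"

definition O_module_sheaf :: "('k::field, 'r::{finite,linorder}, 'a) psheaf \<Rightarrow> bool" where
  "O_module_sheaf F \<longleftrightarrow>
     (\<forall>U. zopen U \<longrightarrow> Module.module (O_ring U) (sections F U)) \<and>
     (\<forall>U V. zopen U \<longrightarrow> zopen V \<longrightarrow> V \<subseteq> U \<longrightarrow>
        res F U V \<in> carrier (sections F U) \<rightarrow> carrier (sections F V) \<and>
        (\<forall>s\<in>carrier (sections F U). \<forall>t\<in>carrier (sections F U).
           res F U V (s \<oplus>\<^bsub>sections F U\<^esub> t) = res F U V s \<oplus>\<^bsub>sections F V\<^esub> res F U V t) \<and>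
        (\<forall>f\<in>carrier (O_ring U). \<forall>s\<in>carrier (sections F U).
           res F U V (f \<odot>\<^bsub>sections F U\<^esub> s) = restrict f V \<odot>\<^bsub>sections F V\<^esub> res F U V s)) \<and>
     (\<forall>U. zopen U \<longrightarrow> (\<forall>s\<in>carrier (sections F U). res F U U s = s)) \<and>
     (\<forall>U V W. zopen U \<longrightarrow> zopen V \<longrightarrow> zopen W \<longrightarrow> W \<subseteq> V \<longrightarrow> V \<subseteq> U \<longrightarrow>
        (\<forall>s\<in>carrier (sections F U). res F V W (res F U V s) = res F U W s)) \<and>
     (\<forall>\<C> \<sigma>. (\<forall>V\<in>\<C>. zopen V \<and> \<sigma> V \<in> carrier (sections F V)) \<longrightarrow>
        (\<forall>V\<in>\<C>. \<forall>W\<in>\<C>. res F V (V \<inter> W) (\<sigma> V) = res F W (V \<inter> W) (\<sigma> W)) \<longrightarrow>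
        (\<exists>!s. s \<in> carrier (sections F (\<Union>\<C>)) \<and> (\<forall>V\<in>\<C>. res F (\<Union>\<C>) V s = \<sigma> V)))"

text \<open>Morphisms \<open>F|\<^sub>W \<rightarrow> G|\<^sub>W\<close>.\<close>

definition O_hom_on :: "('k::field, 'r::{finite,linorder}) point set \<Rightarrow> ('k, 'r, 'a) psheaf \<Rightarrow>
    ('k, 'r, 'b) psheaf \<Rightarrow> (('k, 'r) point set \<Rightarrow> 'a \<Rightarrow> 'b) \<Rightarrow> bool" where
  "O_hom_on W F G \<phi> \<longleftrightarrow>
     (\<forall>U. zopen U \<longrightarrow> U \<subseteq> W \<longrightarrow>
        \<phi> U \<in> carrier (sections F U) \<rightarrow> carrier (sections G U) \<and>
        (\<forall>s\<in>carrier (sections F U). \<forall>t\<in>carrier (sections F U).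
           \<phi> U (s \<oplus>\<^bsub>sections F U\<^esub> t) = \<phi> U s \<oplus>\<^bsub>sections G U\<^esub> \<phi> U t) \<and>
        (\<forall>f\<in>carrier (O_ring U). \<forall>s\<in>carrier (sections F U).
           \<phi> U (f \<odot>\<^bsub>sections F U\<^esub> s) = f \<odot>\<^bsub>sections G U\<^esub> \<phi> U s)) \<and>
     (\<forall>U V. zopen U \<longrightarrow> zopen V \<longrightarrow> V \<subseteq> U \<longrightarrow> U \<subseteq> W \<longrightarrow>
        (\<forall>s\<in>carrier (sections F U). \<phi> V (res F U V s) = res G U V (\<phi> U s)))"

definition O_iso_on :: "('k::field, 'r::{finite,linorder}) point set \<Rightarrow> ('k, 'r, 'a) psheaf \<Rightarrow>
    ('k, 'r, 'b) psheaf \<Rightarrow> bool" where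
  "O_iso_on W F G \<longleftrightarrow> (\<exists>\<phi>. O_hom_on W F G \<phi> \<and>
     (\<forall>U. zopen U \<longrightarrow> U \<subseteq> W \<longrightarrow> bij_betw (\<phi> U) (carrier (sections F U)) (carrier (sections G U))))"

text \<open>\<open>0 \<rightarrow> F' \<rightarrow> F \<rightarrow> F'' \<rightarrow> 0\<close>; only local surjectivity of the second map is required.\<close>

definition short_exact :: "('k::field, 'r::{finite,linorder}, 'a) psheaf \<Rightarrow> ('k, 'r, 'b) psheaf \<Rightarrow>
    ('k, 'r, 'c) psheaf \<Rightarrow> bool" where
  "short_exact F' F F'' \<longleftrightarrow> (\<exists>\<phi> \<psi>. O_hom_on proj_space F' F \<phi> \<and> O_hom_on proj_space F F'' \<psi> \<and>
     (\<forall>U. zopen U \<longrightarrow> inj_on (\<phi> U) (carrier (sections F' U)) \<and>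
        {s \<in> carrier (sections F U). \<psi> U s = \<zero>\<^bsub>sections F'' U\<^esub>} = \<phi> U ` carrier (sections F' U) \<and>
        (\<forall>t\<in>carrier (sections F'' U). \<forall>P\<in>U. \<exists>V. zopen V \<and> P \<in> V \<and> V \<subseteq> U \<and>
           res F'' U V t \<in> \<psi> V ` carrier (sections F V))))"

text \<open>
  \<open>\<O>(j)\<^sup>n\<close>. For \<open>n = dim M\<close> this is also \<open>M \<otimes>\<^sub>k \<O>(j)\<close>.
  The fields \<open>mult\<close> and \<open>one\<close> of a module record carry no information.
\<close>

definition free_sections :: "nat \<Rightarrow> int \<Rightarrow> ('k::field, 'r::{finite,linorder}) point set \<Rightarrow>
    (('k, 'r) point \<Rightarrow> nat \<Rightarrow> ('k, 'r) hfrac) set" where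
  "free_sections n j U = {s \<in> extensional U. (\<forall>P\<in>U. \<forall>a\<ge>n. s P a = 0) \<and>
     (\<forall>a<n. (\<lambda>P\<in>U. s P a) \<in> O_sections j U)}"

definition free_sheaf :: "nat \<Rightarrow> int \<Rightarrow>
    ('k::field, 'r::{finite,linorder}, ('k, 'r) point \<Rightarrow> nat \<Rightarrow> ('k, 'r) hfrac) psheaf" where
  "free_sheaf n j =
     \<lparr>sections = (\<lambda>U. \<lparr>carrier = free_sections n j U, monoid.mult = undefined, one = undefined,
        zero = (\<lambda>P\<in>U. \<lambda>a. 0), add = (\<lambda>s t. \<lambda>P\<in>U. \<lambda>a. s P a + t P a),
        module.smult = (\<lambda>f s. \<lambda>P\<in>U. \<lambda>a. f P * s P a)\<rparr>),
      res = (\<lambda>U V s. restrict s V)\<rparr>"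

definition vector_bundle :: "('k::field, 'r::{finite,linorder}, 'a) psheaf \<Rightarrow> bool" where
  "vector_bundle F \<longleftrightarrow> O_module_sheaf F \<and>
     (\<forall>P\<in>proj_space. \<exists>U n. zopen U \<and> P \<in> U \<and> O_iso_on U F (free_sheaf n 0))"

text \<open>
  The quotient sheaf \<open>S/G\<close> of sheaves of submodules \<open>G \<subseteq> S\<close> of some \<open>\<O>(j)\<^sup>n\<close>, as a sheaf of
  functions with values in the stalks \<open>S\<^sub>P/G\<^sub>P\<close>. Stalks of \<open>\<O>(j)\<^sup>n\<close> and its subsheaves are
  subgroups of the \<open>n\<close>-tuples of fractions, the germ of a section at \<open>P\<close> being its value there;
  elements of \<open>S\<^sub>P/G\<^sub>P\<close> are cosets.
\<close>

type_synonym ('k, 'r) subsheaf =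
  "('k, 'r) point set \<Rightarrow> (('k, 'r) point \<Rightarrow> nat \<Rightarrow> ('k, 'r) hfrac) set"

definition stalk :: "('k::field, 'r::{finite,linorder}) subsheaf \<Rightarrow> ('k, 'r) point \<Rightarrow>
    (nat \<Rightarrow> ('k, 'r) hfrac) set" where
  "stalk G P = {s P |s V. zopen V \<and> P \<in> V \<and> s \<in> G V}"

definition germ_coset :: "('k::field, 'r::{finite,linorder}) subsheaf \<Rightarrow> ('k, 'r) point \<Rightarrow>
    (nat \<Rightarrow> ('k, 'r) hfrac) \<Rightarrow> (nat \<Rightarrow> ('k, 'r) hfrac) set" where
  "germ_coset G P u = {\<lambda>a. u a + w a |w. w \<in> stalk G P}"

definition quotient_sheaf :: "('k::field, 'r::{finite,linorder}) subsheaf \<Rightarrow> ('k, 'r) subsheaf \<Rightarrow>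
    ('k, 'r, ('k, 'r) point \<Rightarrow> (nat \<Rightarrow> ('k, 'r) hfrac) set) psheaf" where
  "quotient_sheaf S G =
     \<lparr>sections = (\<lambda>U. \<lparr>
        carrier = {\<sigma> \<in> extensional U. \<forall>P\<in>U. \<exists>V t. zopen V \<and> P \<in> V \<and> V \<subseteq> U \<and> t \<in> S V \<and>
                     (\<forall>Q\<in>V. \<sigma> Q = germ_coset G Q (t Q))},
        monoid.mult = undefined, one = undefined,
        zero = (\<lambda>P\<in>U. stalk G P),
        add = (\<lambda>\<sigma> \<tau>. \<lambda>P\<in>U. {\<lambda>a. u a + w a |u w. u \<in> \<sigma> P \<and> w \<in> \<tau> P}),
        module.smult = (\<lambda>f \<sigma>. \<lambda>P\<in>U. {\<lambda>a. f P * u a + w a |u w. u \<in> \<sigma> P \<and> w \<in> stalk G P})\<rparr>),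
      res = (\<lambda>U V \<sigma>. restrict \<sigma> V)\<rparr>"


section \<open>The operator \<open>\<theta>\<^sub>M\<close> and the sheaf \<open>\<F>\<^sub>1(M)\<close>\<close>

definition theta :: "(('e::ab_group_add \<Rightarrow>\<^sub>0 'k::field) \<Rightarrow> 'm::ab_group_add \<Rightarrow> 'm) \<Rightarrow>
    ('r::{finite,linorder} \<Rightarrow> 'e) \<Rightarrow> ('k, 'r) point set \<Rightarrow>
    (('k, 'r) point \<Rightarrow> nat \<Rightarrow> ('k, 'r) hfrac) \<Rightarrow> ('k, 'r) point \<Rightarrow> nat \<Rightarrow> ('k, 'r) hfrac" where
  "theta scl g U s = (\<lambda>P\<in>U. \<lambda>a. if a < kdim scl then
      (\<Sum>i\<in>UNIV. \<Sum>b<kdim scl.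
         Fract (Poly_Mapping.single 0 (X_mat scl g i a b)) 1 * (Fract (Y_var i) 1 * s P b))
      else 0)"

definition Ker_theta :: "(('e::ab_group_add \<Rightarrow>\<^sub>0 'k::field) \<Rightarrow> 'm::ab_group_add \<Rightarrow> 'm) \<Rightarrow>
    ('r::{finite,linorder} \<Rightarrow> 'e) \<Rightarrow> ('k, 'r) subsheaf" where
  "Ker_theta scl g U = {s \<in> free_sections (kdim scl) 0 U. theta scl g U s = (\<lambda>P\<in>U. \<lambda>a. 0)}"

definition Im_theta :: "(('e::ab_group_add \<Rightarrow>\<^sub>0 'k::field) \<Rightarrow> 'm::ab_group_add \<Rightarrow> 'm) \<Rightarrow>
    ('r::{finite,linorder} \<Rightarrow> 'e) \<Rightarrow> ('k, 'r) subsheaf" where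
  "Im_theta scl g U = {t \<in> free_sections (kdim scl) 0 U. \<forall>P\<in>U. \<exists>V. zopen V \<and> P \<in> V \<and> V \<subseteq> U \<and>
     restrict t V \<in> theta scl g V ` free_sections (kdim scl) (-1) V}"

definition F_one :: "(('e::ab_group_add \<Rightarrow>\<^sub>0 'k::field) \<Rightarrow> 'm::ab_group_add \<Rightarrow> 'm) \<Rightarrow>
    ('r::{finite,linorder} \<Rightarrow> 'e) \<Rightarrow>
    ('k, 'r, ('k, 'r) point \<Rightarrow> (nat \<Rightarrow> ('k, 'r) hfrac) set) psheaf" where
  "F_one scl g = quotient_sheaf (Ker_theta scl g) (\<lambda>U. Ker_theta scl g U \<inter> Im_theta scl g U)"


section \<open>Chern classes\<close>

text \<open>
  \<open>chern_theory C\<close> says that \<open>C\<close> assigns to vector bundles on \<open>\<P>\<^sup>r\<^sup>-\<^sup>1\<close> their total Chern classes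
  in \<open>A\<^sup>*(\<P>\<^sup>r\<^sup>-\<^sup>1) = \<int>[h]/(h\<^sup>r)\<close>, classes being represented by polynomials of degree less than \<open>r\<close>:
  the values have constant term 1, \<open>C(\<O>(j)) = 1 + j h\<close>, and the Whitney sum formula
  holds. On projective space these axioms have exactly one solution, the Chern classes of the
  literature, since every vector bundle has a finite resolution by direct sums of bundles
  \<open>\<O>(j)\<close> (with bundles as syzygies); the invariance under isomorphisms is a case of the Whitney
  formula. The axioms are used for sections in the type
  \<open>('k, 'r) point \<Rightarrow> (nat \<Rightarrow> ('k, 'r) hfrac) set\<close>, which is large enough to carry a copy of
  every vector bundle on \<open>\<P>\<^sup>r\<^sup>-\<^sup>1\<close>. \<open>C\<close> is arbitrary on all other presheaves.
\<close>

definition chern_theory :: "(('k::field, 'r::{finite,linorder}, 'a) psheaf \<Rightarrow> int poly) \<Rightarrow> bool" where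
  "chern_theory C \<longleftrightarrow>
     (\<forall>F. vector_bundle F \<longrightarrow> degree (C F) < CARD('r) \<and> coeff (C F) 0 = 1) \<and>
     (\<forall>F j. vector_bundle F \<longrightarrow> O_iso_on proj_space F (free_sheaf 1 j) \<longrightarrow>
        monom 1 CARD('r) dvd C F - [:1, j:]) \<and>
     (\<forall>F' F F''. vector_bundle F' \<longrightarrow> vector_bundle F \<longrightarrow> vector_bundle F'' \<longrightarrow>
        short_exact F' F F'' \<longrightarrow> monom 1 CARD('r) dvd C F - C F' * C F'')"

end

theory Submission
  imports Defs "HOL-Library.Function_Algebras" "HOL-Computational_Algebra.Primes"
    "HOL-Computational_Algebra.Polynomial"
begin

text \<open>
  Write \<open>\<theta>\<close> for \<open>\<theta>\<^sub>M\<close> and \<open>G\<close> for the image of \<open>\<theta>\<^sup>p\<^sup>-\<^sup>1\<close>, a vector bundle since the Jordan type is constant.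
  As all blocks have length \<open>1\<close> or \<open>p\<close>, there are exact sequences \<open>0 \<rightarrow> G \<rightarrow> Ker \<theta> \<rightarrow> \<F>\<^sub>1 \<rightarrow> 0\<close> and
  \<open>0 \<rightarrow> Ker \<theta>\<^sup>i \<rightarrow> Ker \<theta>\<^sup>i\<^sup>+\<^sup>1 \<rightarrow> G(i) \<rightarrow> 0\<close> for \<open>1 \<le> i < p\<close>, and \<open>Ker \<theta>\<^sup>p\<close> is free. Hence
  \<open>c(\<F>\<^sub>1) \<cdot> c(G) c(G(1)) \<dots> c(G(p - 1)) = 1\<close>. A finite resolution by sums of line bundles reduces the
  product of the \<open>c(G(i))\<close> to the products \<open>\<Prod>\<^sub>i (1 + (i - \<delta>) h)\<close>, which are \<open>1 - h\<^sup>p\<^sup>-\<^sup>1\<close> modulo \<open>p\<close>, so that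
  \<open>c(\<F>\<^sub>1)\<close> is \<open>1\<close> modulo \<open>p\<close> below degree \<open>p - 1\<close>.
\<close>

section \<open>Free modules over subrings of a field\<close>

text \<open>Two obstacles shape the development. Chern classes are given by axioms only, without a
  splitting principle, so every class has to be reached from line bundles by Whitney sums. This is
  why \<open>G\<close> is presented as the sheaf of the graded module generated by the columns of
  \<open>\<theta> ^^ (p - 1)\<close>: a single graded resolution serves all twists at once, and each
  line bundle in it contributes a product over a full set of residues modulo \<open>p\<close>.
  Secondly, exactness and local freeness concern stalks, while the hypothesis speaks of operators
  over fields. As projective space is integral, every sheaf involved is a family of lattices in one
  vector space over a fraction field, and Nakayama's lemma lifts Jordan strings from the residue
  field of each point. Lifted strings close only modulo the maximal ideal; a comparison with the
  rank at the generic point repairs this. The quotient \<open>F_one\<close> becomes a lattice as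
  well, namely the image of the kernel under a linear map that kills exactly the span of
  \<open>G\<close> over the fraction field.\<close>

definition vsc :: "'a::field \<Rightarrow> (nat \<Rightarrow> 'a) \<Rightarrow> nat \<Rightarrow> 'a" (infixr "*v" 75) where
  "c *v v = (\<lambda>a. c * v a)"

declare plus_fun_apply [simp del] zero_fun_apply [simp del] minus_apply [simp del] uminus_apply [simp del]

lemma vsc_apply: "(c *v v) a = c * v a"
  by (simp add: vsc_def)

lemmas vec_apply = vsc_apply plus_fun_apply zero_fun_apply minus_apply uminus_apply

interpretation vec: vector_space vsc
  by unfold_locales (auto simp: vec_apply algebra_simps fun_eq_iff)

lemma sum_fun_apply: "(\<Sum>i\<in>I. f i) a = (\<Sum>i\<in>I. f i a)"
  by (induction I rule: infinite_finite_induct) (auto simp: vec_apply)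

definition lin :: "((nat \<Rightarrow> 'a::field) \<Rightarrow> nat \<Rightarrow> 'a) \<Rightarrow> bool" where
  "lin f \<longleftrightarrow> (\<forall>u v. f (u + v) = f u + f v) \<and> (\<forall>c u. f (c *v u) = c *v f u)"

lemma lin_add: "lin f \<Longrightarrow> f (u + v) = f u + f v"
  and lin_scale: "lin f \<Longrightarrow> f (c *v u) = c *v f u"
  by (auto simp: lin_def)

lemma lin_0: "lin f \<Longrightarrow> f 0 = 0"
  using lin_scale[of f 0 0] by simp

lemma lin_minus: "lin f \<Longrightarrow> f (- u) = - f u"
  using lin_scale[of f "-1" u] by simp

lemma lin_diff: "lin f \<Longrightarrow> f (u - v) = f u - f v"
  using lin_add[of f u "- v"] lin_minus[of f v] by simp

lemma lin_sum:
  assumes "lin f"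
  shows "f (\<Sum>i\<in>I. g i) = (\<Sum>i\<in>I. f (g i))"
  by (induction I rule: infinite_finite_induct) (simp_all add: lin_0[OF assms] lin_add[OF assms])

lemma lin_funpow: "lin f \<Longrightarrow> lin (f ^^ n)"
  by (induction n) (simp_all add: lin_def)

definition lincomb :: "('i \<Rightarrow> 'a::field) \<Rightarrow> 'i set \<Rightarrow> ('i \<Rightarrow> nat \<Rightarrow> 'a) \<Rightarrow> nat \<Rightarrow> 'a" where
  "lincomb x I J = (\<Sum>i\<in>I. x i *v J i)"

text \<open>Coefficients range over the whole field, even where spans are taken over a subring.
  Independence is therefore the same condition at every point of projective space, and only the span
  has to be compared from stalk to stalk.\<close>

definition indep :: "'i set \<Rightarrow> ('i \<Rightarrow> nat \<Rightarrow> 'a::field) \<Rightarrow> bool" where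
  "indep I J \<longleftrightarrow> (\<forall>x. lincomb x I J = 0 \<longrightarrow> (\<forall>i\<in>I. x i = 0))"

definition aspan :: "'a::field set \<Rightarrow> 'i set \<Rightarrow> ('i \<Rightarrow> nat \<Rightarrow> 'a) \<Rightarrow> (nat \<Rightarrow> 'a) set" where
  "aspan A I J = {lincomb x I J |x. \<forall>i\<in>I. x i \<in> A}"

definition submod :: "'a::field set \<Rightarrow> (nat \<Rightarrow> 'a) set \<Rightarrow> bool" where
  "submod A M \<longleftrightarrow> 0 \<in> M \<and> (\<forall>u\<in>M. \<forall>v\<in>M. u + v \<in> M) \<and> (\<forall>c\<in>A. \<forall>u\<in>M. c *v u \<in> M)"

lemma aspan_iff: "v \<in> aspan A I J \<longleftrightarrow> (\<exists>x. v = lincomb x I J \<and> (\<forall>i\<in>I. x i \<in> A))"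
  by (auto simp: aspan_def)

lemma aspanI: "v = lincomb x I J \<Longrightarrow> (\<And>i. i \<in> I \<Longrightarrow> x i \<in> A) \<Longrightarrow> v \<in> aspan A I J"
  by (auto simp: aspan_def)

lemma aspanE: "v \<in> aspan A I J \<Longrightarrow> (\<And>x. v = lincomb x I J \<Longrightarrow> (\<And>i. i \<in> I \<Longrightarrow> x i \<in> A) \<Longrightarrow> P) \<Longrightarrow> P"
  by (auto simp: aspan_def)

lemma lincomb_add: "lincomb x I J + lincomb y I J = lincomb (\<lambda>i. x i + y i) I J"
  by (simp add: lincomb_def sum.distrib vec.scale_left_distrib)

lemma lincomb_diff: "lincomb x I J - lincomb y I J = lincomb (\<lambda>i. x i - y i) I J"
  by (simp add: lincomb_def sum_subtractf vec.scale_left_diff_distrib)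

lemma lincomb_scale: "c *v lincomb x I J = lincomb (\<lambda>i. c * x i) I J"
  by (simp add: lincomb_def vec.scale_sum_right)

lemma lincomb_0: "lincomb (\<lambda>i. 0) I J = 0"
  by (simp add: lincomb_def)

lemma lincomb_cong: "(\<And>i. i \<in> I \<Longrightarrow> x i = y i) \<Longrightarrow> (\<And>i. i \<in> I \<Longrightarrow> J i = J' i) \<Longrightarrow>
    lincomb x I J = lincomb y I J'"
  by (simp add: lincomb_def)

lemma lincomb_neutral: "(\<And>i. i \<in> I \<Longrightarrow> J i = 0) \<Longrightarrow> lincomb x I J = 0"
  by (simp add: lincomb_def)

lemma lincomb_zero: "(\<And>i. i \<in> I \<Longrightarrow> x i = 0) \<Longrightarrow> lincomb x I J = 0"
  by (simp add: lincomb_def)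

lemma lincomb_delta: "finite I \<Longrightarrow> c \<in> I \<Longrightarrow> lincomb (\<lambda>i. if i = c then 1 else 0) I J = J c"
proof -
  assume I: "finite I" "c \<in> I"
  have "(\<Sum>i\<in>I. (if i = c then 1 else 0) *v J i) = (\<Sum>i\<in>I. if i = c then J i else 0)"
    by (rule sum.cong) auto
  thus ?thesis using I by (simp add: lincomb_def)
qed

lemma lincomb_remove: "finite I \<Longrightarrow> c \<in> I \<Longrightarrow> lincomb x I J = x c *v J c + lincomb x (I - {c}) J"
  by (simp add: lincomb_def sum.remove)

lemma lin_lincomb: "lin f \<Longrightarrow> f (lincomb x I J) = lincomb x I (\<lambda>i. f (J i))"
proof -
  assume f: "lin f"
  show ?thesis unfolding lincomb_def lin_sum[OF f] lin_scale[OF f] ..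
qed

lemma lincomb_reindex: "bij_betw f I Y \<Longrightarrow> lincomb x Y J = lincomb (x \<circ> f) I (J \<circ> f)"
  unfolding lincomb_def by (simp add: sum.reindex_bij_betw[of f I Y, symmetric])

lemma aspan_reindex:
  assumes "bij_betw f I Y"
  shows "aspan A Y J = aspan A I (J \<circ> f)"
proof
  show "aspan A Y J \<subseteq> aspan A I (J \<circ> f)"
    using assms unfolding aspan_def lincomb_reindex[OF assms]
    by (force dest: bij_betwE)
  show "aspan A I (J \<circ> f) \<subseteq> aspan A Y J"
  proof
    fix v assume "v \<in> aspan A I (J \<circ> f)"
    then obtain x where x: "v = lincomb x I (J \<circ> f)" "\<And>i. i \<in> I \<Longrightarrow> x i \<in> A" by (auto simp: aspan_iff)
    have inv: "bij_betw (inv_into I f) Y I" using assms by (rule bij_betw_inv_into)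
    have "v = lincomb (x \<circ> inv_into I f) Y J"
      unfolding lincomb_reindex[OF assms] x(1)
      by (rule lincomb_cong) (use assms in \<open>auto simp: bij_betw_def\<close>)
    thus "v \<in> aspan A Y J"
      by (rule aspanI) (use inv x in \<open>auto dest: bij_betwE\<close>)
  qed
qed

lemma indep_reindex:
  assumes "bij_betw f I Y"
  shows "indep Y J \<longleftrightarrow> indep I (J \<circ> f)"
proof
  assume *: "indep Y J"
  show "indep I (J \<circ> f)" unfolding indep_def
  proof (intro allI impI ballI)
    fix x i assume x: "lincomb x I (J \<circ> f) = 0" and i: "i \<in> I"
    have "lincomb (x \<circ> inv_into I f) Y J = lincomb x I (J \<circ> f)"
      unfolding lincomb_reindex[OF assms]
      by (rule lincomb_cong) (use assms in \<open>auto simp: bij_betw_def\<close>)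
    hence "(x \<circ> inv_into I f) (f i) = 0" 
      using * x i assms unfolding indep_def by (metis bij_betwE)
    thus "x i = 0" using i assms by (auto simp: bij_betw_def)
  qed
next
  assume *: "indep I (J \<circ> f)"
  show "indep Y J" unfolding indep_def
  proof (intro allI impI ballI)
    fix x i assume x: "lincomb x Y J = 0" and i: "i \<in> Y"
    then obtain j where j: "j \<in> I" "i = f j" using assms by (auto simp: bij_betw_def)
    have "(x \<circ> f) j = 0" using * x j unfolding indep_def lincomb_reindex[OF assms] by blast
    thus "x i = 0" using j by simp
  qed
qed

lemma indep_unique: "indep I J \<Longrightarrow> lincomb x I J = lincomb y I J \<Longrightarrow> i \<in> I \<Longrightarrow> x i = y i"
  unfolding indep_def using lincomb_diff[of x I J y] by force

lemma indep_mono: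
  assumes "indep I J" "finite I" "Y \<subseteq> I"
  shows "indep Y J"
  unfolding indep_def
proof (intro allI impI ballI)
  fix x i assume x: "lincomb x Y J = 0" and i: "i \<in> Y"
  have "lincomb (\<lambda>i. if i \<in> Y then x i else 0) I J = lincomb x Y J"
    unfolding lincomb_def using assms by (intro sum.mono_neutral_cong_right) auto
  thus "x i = 0" using assms x i unfolding indep_def by force
qed

lemma submod_0: "submod A M \<Longrightarrow> 0 \<in> M"
  and submod_add: "submod A M \<Longrightarrow> u \<in> M \<Longrightarrow> v \<in> M \<Longrightarrow> u + v \<in> M"
  and submod_scale: "submod A M \<Longrightarrow> c \<in> A \<Longrightarrow> u \<in> M \<Longrightarrow> c *v u \<in> M"
  unfolding submod_def by blast+

lemma submod_sum:
  assumes "submod A M" "\<And>i. i \<in> I \<Longrightarrow> f i \<in> M"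
  shows "(\<Sum>i\<in>I. f i) \<in> M"
  using assms(2)
  by (induction I rule: infinite_finite_induct) (simp_all add: submod_0[OF assms(1)] submod_add[OF assms(1)])

lemma submod_lincomb: "submod A M \<Longrightarrow> (\<And>i. i \<in> I \<Longrightarrow> x i \<in> A) \<Longrightarrow> (\<And>i. i \<in> I \<Longrightarrow> J i \<in> M) \<Longrightarrow>
    lincomb x I J \<in> M"
  unfolding lincomb_def by (rule submod_sum) (auto intro: submod_scale)

lemma submod_aspan_subset: "submod A M \<Longrightarrow> (\<And>i. i \<in> I \<Longrightarrow> J i \<in> M) \<Longrightarrow> aspan A I J \<subseteq> M"
  by (auto elim!: aspanE intro: submod_lincomb)

section \<open>Spans over a subring of a field\<close>

locale subring_of_field =
  fixes A :: "'a::field set"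
  assumes zero_in [simp]: "0 \<in> A" and one_in [simp]: "1 \<in> A"
    and add_in: "x \<in> A \<Longrightarrow> y \<in> A \<Longrightarrow> x + y \<in> A"
    and mult_in: "x \<in> A \<Longrightarrow> y \<in> A \<Longrightarrow> x * y \<in> A"
    and uminus_in: "x \<in> A \<Longrightarrow> - x \<in> A"
begin

lemma sum_in: "(\<And>i. i \<in> I \<Longrightarrow> f i \<in> A) \<Longrightarrow> (\<Sum>i\<in>I. f i) \<in> A"
  by (induction I rule: infinite_finite_induct) (auto intro: add_in)

lemma submod_diff: "submod A M \<Longrightarrow> u \<in> M \<Longrightarrow> v \<in> M \<Longrightarrow> u - v \<in> M"
proof -
  assume M: "submod A M" "u \<in> M" "v \<in> M"
  have "- 1 \<in> A" using uminus_in[of 1] by simp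
  hence "(- 1) *v v \<in> M" using M by (auto simp: submod_def)
  hence "u + (- 1) *v v \<in> M" using M submod_add by blast
  thus ?thesis by simp
qed

lemma submod_aspan: "submod A (aspan A I J)"
  unfolding submod_def
proof (intro conjI ballI)
  show "0 \<in> aspan A I J" by (rule aspanI[of _ "\<lambda>_. 0"]) (auto simp: lincomb_0)
  show "u + v \<in> aspan A I J" if "u \<in> aspan A I J" "v \<in> aspan A I J" for u v
    using that by (auto elim!: aspanE simp: lincomb_add intro!: aspanI add_in)
  show "c *v v \<in> aspan A I J" if "c \<in> A" "v \<in> aspan A I J" for c v
    using that by (auto elim!: aspanE simp: lincomb_scale intro!: aspanI mult_in)
qed

lemma aspan_base: "finite I \<Longrightarrow> i \<in> I \<Longrightarrow> J i \<in> aspan A I J"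
  by (rule aspanI[of _ "\<lambda>j. if j = i then 1 else 0"]) (auto simp: lincomb_delta)

lemma aspan_eqI:
  assumes "finite I" "finite Y" "\<And>i. i \<in> I \<Longrightarrow> J i \<in> aspan A Y J'" "\<And>i. i \<in> Y \<Longrightarrow> J' i \<in> aspan A I J"
  shows "aspan A I J = aspan A Y J'"
  using assms by (intro equalityI submod_aspan_subset submod_aspan) auto

text \<open>Exchange of one basis vector, possible because the pivot is a unit of \<open>A\<close>.\<close>

lemma replace_basis:
  assumes I: "finite I" "indep I J" "c \<in> I"
    and e: "e = lincomb x I J" "\<And>i. i \<in> I \<Longrightarrow> x i \<in> A" "x c \<noteq> 0" "inverse (x c) \<in> A"
  shows "indep I (J(c := e))" "aspan A I (J(c := e)) = aspan A I J"
proof -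
  have e': "e = x c *v J c + lincomb x (I - {c}) J" using I e by (simp add: lincomb_remove)
  show "indep I (J(c := e))" unfolding indep_def
  proof (intro allI impI)
    fix y assume y: "lincomb y I (J(c := e)) = 0"
    have eq: "lincomb y (I - {c}) (J(c := e)) = lincomb y (I - {c}) J"
      by (rule lincomb_cong) auto
    have "lincomb y I (J(c := e)) = y c *v e + lincomb y (I - {c}) J"
      using I eq by (simp add: lincomb_remove)
    also have "\<dots> = lincomb (\<lambda>i. y c * x i + (if i = c then 0 else y i)) I J"
    proof -
      have "lincomb (\<lambda>i. if i = c then 0 else y i) I J = lincomb y (I - {c}) J"
        using I lincomb_remove[of I c "\<lambda>i. if i = c then 0 else y i" J]
          lincomb_cong[of "I - {c}" "\<lambda>i. if i = c then 0 else y i" y J J] by auto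
      thus ?thesis unfolding lincomb_add[symmetric] e(1) lincomb_scale by simp
    qed
    finally have "lincomb (\<lambda>i. y c * x i + (if i = c then 0 else y i)) I J = 0" using y by simp
    hence *: "\<forall>i\<in>I. y c * x i + (if i = c then 0 else y i) = 0"
      using I(2) unfolding indep_def by blast
    hence "y c = 0" using I e by force
    thus "\<forall>i\<in>I. y i = 0" using * by (metis add.left_neutral mult_zero_left)
  qed
  have "J c = inverse (x c) *v (e - lincomb x (I - {c}) J)"
    unfolding e(1)[symmetric] by (subst e') (simp add: e)
  also have "\<dots> = inverse (x c) *v e - inverse (x c) *v lincomb x (I - {c}) (J(c := e))"
    by (subst vec.scale_right_diff_distrib, subst lincomb_cong[of _ x x J "J(c := e)"]) auto
  finally have Jc: "J c = inverse (x c) *v e - inverse (x c) *v lincomb x (I - {c}) (J(c := e))" .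
  have e_in: "e \<in> aspan A I (J(c := e))" using aspan_base[of I c "J(c := e)"] I by simp
  have sm: "submod A (aspan A I (J(c := e)))" by (rule submod_aspan)
  have "lincomb x (I - {c}) (J(c := e)) \<in> aspan A I (J(c := e))"
    by (rule submod_lincomb[OF sm]) (use I e aspan_base[of I _ "J(c := e)"] in \<open>auto simp del: fun_upd_apply intro: aspan_base\<close>)
  hence "J c \<in> aspan A I (J(c := e))"
    unfolding Jc using sm e_in e by (intro submod_diff[OF sm] submod_scale[OF sm]) auto
  moreover have "i \<in> I \<Longrightarrow> i \<noteq> c \<Longrightarrow> J i \<in> aspan A I (J(c := e))" for i
    using aspan_base[of I i "J(c := e)"] I by (metis fun_upd_other)
  ultimately show "aspan A I (J(c := e)) = aspan A I J"
    using I e by (intro aspan_eqI) (auto intro: aspan_base aspanI)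
qed

end

section \<open>Local subrings: lifting of bases and direct summands\<close>

locale local_subring = subring_of_field A for A :: "'a::field set" +
  fixes m :: "'a set"
  assumes m_sub: "x \<in> m \<Longrightarrow> x \<in> A" and m_zero [simp]: "0 \<in> m" and m_one [simp]: "1 \<notin> m"
    and m_add: "x \<in> m \<Longrightarrow> y \<in> m \<Longrightarrow> x + y \<in> m"
    and m_mult: "x \<in> A \<Longrightarrow> y \<in> m \<Longrightarrow> x * y \<in> m"
    and m_unit: "x \<in> A \<Longrightarrow> x \<notin> m \<Longrightarrow> inverse x \<in> A"
begin

lemma submod_aspan_m: "submod A (aspan m I J)"
  unfolding submod_def
proof (intro conjI ballI)
  show "0 \<in> aspan m I J" by (rule aspanI[of _ "\<lambda>_. 0"]) (auto simp: lincomb_0)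
  show "u + v \<in> aspan m I J" if "u \<in> aspan m I J" "v \<in> aspan m I J" for u v
    using that by (auto elim!: aspanE simp: lincomb_add intro!: aspanI m_add)
  show "c *v v \<in> aspan m I J" if "c \<in> A" "v \<in> aspan m I J" for c v
    using that by (auto elim!: aspanE simp: lincomb_scale intro!: aspanI m_mult)
qed

lemma aspan_m_subset: "aspan m I J \<subseteq> aspan A I J"
  by (auto elim!: aspanE intro!: aspanI m_sub)

text \<open>The set \<open>aspan m I J\<close> is the product of \<open>m\<close> with the module
  spanned by \<open>J\<close>, so it depends on that module and not on its generators. Hence the
  basis may change during an exchange argument while reduction modulo \<open>m\<close> stays the
  same.\<close>

lemma aspan_m_mono:
  assumes "finite I" "aspan A I J \<subseteq> aspan A Y J'"
  shows "aspan m I J \<subseteq> aspan m Y J'"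
proof
  fix v assume "v \<in> aspan m I J"
  then obtain x where x: "v = lincomb x I J" "\<And>i. i \<in> I \<Longrightarrow> x i \<in> m" by (auto simp: aspan_iff)
  have "x i *v J i \<in> aspan m Y J'" if i: "i \<in> I" for i
  proof -
    have "J i \<in> aspan A Y J'" using assms(2) aspan_base[OF assms(1) i, of J] by blast
    then obtain y where y: "J i = lincomb y Y J'" "\<And>i. i \<in> Y \<Longrightarrow> y i \<in> A" by (auto simp: aspan_iff)
    show ?thesis unfolding y(1) lincomb_scale
      by (rule aspanI[OF refl]) (use m_mult[OF y(2) x(2)[OF i]] in \<open>simp add: mult.commute\<close>)
  qed
  thus "v \<in> aspan m Y J'" unfolding x(1) lincomb_def by (intro submod_sum[OF submod_aspan_m])
qed

lemma unit_of_sum_1: "x \<in> A \<Longrightarrow> y \<in> A \<Longrightarrow> x + y = 1 \<Longrightarrow> x \<notin> m \<or> y \<notin> m"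
  using m_add[of x y] by auto

text \<open>Nakayama's lemma, proved by Steinitz exchange.\<close>

lemma basis_lift:
  fixes E :: "'i \<Rightarrow> nat \<Rightarrow> 'a" and J :: "'j \<Rightarrow> nat \<Rightarrow> 'a"
  assumes I: "finite I" and Y: "finite Y" "indep Y J"
    and EM: "\<And>i. i \<in> I \<Longrightarrow> E i \<in> aspan A Y J"
    and ind: "\<And>x. (\<And>i. i \<in> I \<Longrightarrow> x i \<in> A) \<Longrightarrow> lincomb x I E \<in> aspan m Y J \<Longrightarrow> \<forall>i\<in>I. x i \<in> m"
    and spn: "\<And>u. u \<in> aspan A Y J \<Longrightarrow> \<exists>x. (\<forall>i\<in>I. x i \<in> A) \<and> u - lincomb x I E \<in> aspan m Y J"
  shows "indep I E" "aspan A I E = aspan A Y J"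
proof -
  \<comment> \<open>The map \<open>f\<close> records which members of the basis have been exchanged
    for the vectors \<open>E i\<close> with \<open>i \<in> Z\<close>; the span never
    changes.\<close>
  have "Z \<subseteq> I \<Longrightarrow> \<exists>J' f. inj_on f Z \<and> f ` Z \<subseteq> Y \<and> (\<forall>i\<in>Z. J' (f i) = E i) \<and> indep Y J' \<and>
      aspan A Y J' = aspan A Y J" if "finite Z" for Z
    using that
  proof (induction Z rule: finite_induct)
    case empty
    show ?case using Y by (intro exI[of _ J]) auto
  next
    case (insert z Z)
    from insert obtain J' f where f: "inj_on f Z" "f ` Z \<subseteq> Y" "\<And>i. i \<in> Z \<Longrightarrow> J' (f i) = E i" "indep Y J'"
      and span: "aspan A Y J' = aspan A Y J" by (metis (no_types, lifting) insert_subset)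
    have zX: "z \<in> I" and ZX: "Z \<subseteq> I" using insert by auto
    have "E z \<in> aspan A Y J'" using EM[OF zX] span by simp
    then obtain x where x: "E z = lincomb x Y J'" "\<And>i. i \<in> Y \<Longrightarrow> x i \<in> A" by (auto simp: aspan_iff)
    have "\<exists>c\<in>Y - f ` Z. x c \<notin> m"
    proof (rule ccontr)
      assume "\<not> ?thesis"
      hence xm: "x c \<in> m" if "c \<in> Y - f ` Z" for c using that by blast
      define y where "y i = (if i = z then 1 else if i \<in> Z then - x (f i) else 0)" for i
      have fb: "bij_betw f Z (f ` Z)" using f by (auto simp: bij_betw_def)
      have yX: "lincomb y I E = E z - lincomb (x \<circ> f) Z (J' \<circ> f)"
      proof -
        have "lincomb y I E = lincomb y (insert z Z) E"
          unfolding lincomb_def using I insert by (intro sum.mono_neutral_right) (auto simp: y_def)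
        also have "\<dots> = E z + lincomb y Z E"
          using insert by (simp add: lincomb_def y_def)
        also have "lincomb y Z E = lincomb (\<lambda>i. 0 - (x \<circ> f) i) Z (J' \<circ> f)"
          by (rule lincomb_cong) (use insert f in \<open>auto simp: y_def\<close>)
        finally show ?thesis unfolding lincomb_diff[symmetric] lincomb_0 by (simp add: comp_def)
      qed
      have "lincomb x Y J' = lincomb x (f ` Z) J' + lincomb x (Y - f ` Z) J'"
        unfolding lincomb_def using f Y by (subst sum.subset_diff[of "f ` Z"]) (auto simp: add.commute)
      hence "lincomb y I E = lincomb x (Y - f ` Z) J'"
        unfolding yX x(1) lincomb_reindex[OF fb] by simp
      also have "\<dots> = lincomb (\<lambda>i. if i \<in> f ` Z then 0 else x i) Y J'"
        unfolding lincomb_def using Y by (intro sum.mono_neutral_cong_left) auto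
      also have "\<dots> \<in> aspan m Y J'" by (rule aspanI[OF refl]) (use xm in auto)
      also have "\<dots> \<subseteq> aspan m Y J" by (rule aspan_m_mono) (use Y span in auto)
      finally have yI: "lincomb y I E \<in> aspan m Y J" .
      have "y i \<in> A" for i using f(2) x(2) by (auto simp: y_def image_subset_iff intro!: uminus_in)
      from ind[OF this yI] have "\<forall>i\<in>I. y i \<in> m" .
      hence "y z \<in> m" using zX by blast
      thus False by (simp add: y_def)
    qed
    then obtain c where c: "c \<in> Y" "c \<notin> f ` Z" "x c \<notin> m" by auto
    have "indep Y (J'(c := E z))" "aspan A Y (J'(c := E z)) = aspan A Y J"
      using replace_basis[OF Y(1) f(4) c(1) x(1) x(2)] c m_unit[OF x(2)[OF c(1)] c(3)] span by force+
    moreover have "inj_on (f(z := c)) (insert z Z)" "f(z := c) ` insert z Z \<subseteq> Y"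
      using f c insert by (auto simp: inj_on_def)
    moreover have "\<forall>i\<in>insert z Z. (J'(c := E z)) ((f(z := c)) i) = E i" using f c insert by auto
    ultimately show ?case by blast
  qed
  from this[OF I] obtain J' f where f: "inj_on f I" "f ` I \<subseteq> Y" "\<And>i. i \<in> I \<Longrightarrow> J' (f i) = E i" "indep Y J'"
      and span: "aspan A Y J' = aspan A Y J" by auto
  have "f ` I = Y"
  proof (rule ccontr)
    assume "f ` I \<noteq> Y"
    then obtain b where b: "b \<in> Y" "b \<notin> f ` I" using f by auto
    have "J' b \<in> aspan A Y J" using aspan_base[of Y b J'] Y b span by auto
    then obtain x where x: "\<And>i. i \<in> I \<Longrightarrow> x i \<in> A" "J' b - lincomb x I E \<in> aspan m Y J"
      using spn by blast
    have "aspan m Y J \<subseteq> aspan m Y J'" by (rule aspan_m_mono) (use Y span in auto)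
    hence "J' b - lincomb x I E \<in> aspan m Y J'" using x(2) by (rule subsetD)
    then obtain y where y: "J' b - lincomb x I E = lincomb y Y J'" "\<And>i. i \<in> Y \<Longrightarrow> y i \<in> m"
      unfolding aspan_iff by blast
    have fb: "bij_betw f I (f ` I)" using f by (auto simp: bij_betw_def)
    define x' where "x' i = (if i \<in> f ` I then x (inv_into I f i) else 0)" for i
    have "lincomb x' Y J' = lincomb x' (f ` I) J'"
      unfolding lincomb_def using f Y by (intro sum.mono_neutral_right) (auto simp: x'_def)
    also have "\<dots> = lincomb x I E"
      unfolding lincomb_reindex[OF fb] by (rule lincomb_cong) (use f in \<open>auto simp: x'_def\<close>)
    finally have "J' b = lincomb (\<lambda>i. x' i + y i) Y J'"
      using y by (metis lincomb_add add.commute diff_add_cancel)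
    hence "lincomb (\<lambda>i. if i = b then 1 else 0) Y J' = lincomb (\<lambda>i. x' i + y i) Y J'"
      using Y b by (simp add: lincomb_delta)
    from indep_unique[OF f(4) this b(1)] have "y b = 1" using b by (simp add: x'_def)
    thus False using y(2)[OF b(1)] by simp
  qed
  hence fb: "bij_betw f I Y" using f by (auto simp: bij_betw_def)
  have "indep I (J' \<circ> f)" using indep_reindex[OF fb] f by blast
  moreover have "aspan A I (J' \<circ> f) = aspan A Y J" using aspan_reindex[OF fb] span by metis
  moreover have "lincomb x I (J' \<circ> f) = lincomb x I E" for x
    by (rule lincomb_cong) (use f in auto)
  ultimately show "indep I E" "aspan A I E = aspan A Y J" by (simp_all add: indep_def aspan_def)
qed

text \<open>Over a local ring, a direct summand of a free module is free.\<close>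

lemma basis_adapted:
  assumes Y: "finite Y" "indep Y J"
    and K: "K \<subseteq> aspan A Y J" and B: "B \<subseteq> aspan A Y J"
    and dec: "\<And>u. u \<in> aspan A Y J \<Longrightarrow> \<exists>v\<in>K. \<exists>w\<in>B. u = v + w"
  shows "\<exists>J'. indep Y J' \<and> aspan A Y J' = aspan A Y J \<and> (\<forall>i\<in>Y. J' i \<in> K \<or> J' i \<in> B)"
proof -
  have "Z \<subseteq> Y \<Longrightarrow> \<exists>J'. indep Y J' \<and> aspan A Y J' = aspan A Y J \<and> (\<forall>i\<in>Z. J' i \<in> K \<or> J' i \<in> B)"
    if "finite Z" for Z
    using that
  proof (induction Z rule: finite_induct)
    case empty
    show ?case using Y by (intro exI[of _ J]) auto
  next
    case (insert z Z)
    then obtain J' where J': "indep Y J'" "aspan A Y J' = aspan A Y J" "\<And>i. i \<in> Z \<Longrightarrow> J' i \<in> K \<or> J' i \<in> B"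
      by auto
    have z: "z \<in> Y" using insert by auto
    have "J' z \<in> aspan A Y J" using aspan_base[of Y z J'] Y z J' by auto
    then obtain v w where vw: "v \<in> K" "w \<in> B" "J' z = v + w" using dec by blast
    obtain x where x: "v = lincomb x Y J'" "\<And>i. i \<in> Y \<Longrightarrow> x i \<in> A"
      using subsetD[OF K vw(1)] unfolding J'(2)[symmetric] aspan_iff by blast
    obtain y where y: "w = lincomb y Y J'" "\<And>i. i \<in> Y \<Longrightarrow> y i \<in> A"
      using subsetD[OF B vw(2)] unfolding J'(2)[symmetric] aspan_iff by blast
    have "lincomb (\<lambda>i. if i = z then 1 else 0) Y J' = lincomb (\<lambda>i. x i + y i) Y J'"
      using vw x y Y z by (simp add: lincomb_delta lincomb_add)
    from indep_unique[OF J'(1) this z] have "x z + y z = 1" by simp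
    \<comment> \<open>The two components of \<open>J' z\<close> have coordinates at \<open>z\<close>
      with sum 1, so one of these is a unit, and that component may replace
      \<open>J' z\<close>.\<close>
    hence "x z \<notin> m \<or> y z \<notin> m" using unit_of_sum_1 x y z by blast
    then obtain e x where e: "e \<in> K \<or> e \<in> B" "e = lincomb x Y J'" "\<And>i. i \<in> Y \<Longrightarrow> x i \<in> A" "x z \<notin> m"
      using x y vw by blast
    have "indep Y (J'(z := e))" "aspan A Y (J'(z := e)) = aspan A Y J"
      using replace_basis[OF Y(1) J'(1) z e(2,3)] e m_unit[OF e(3)[OF z] e(4)] J'(2) by force+
    moreover have "\<forall>i\<in>insert z Z. (J'(z := e)) i \<in> K \<or> (J'(z := e)) i \<in> B" using e(1) J'(3) by auto
    ultimately show ?case by blast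
  qed
  from this[OF Y(1)] show ?thesis by auto
qed

end

section \<open>Local rings of projective space\<close>

definition mdeg :: "('r::finite \<Rightarrow>\<^sub>0 nat) \<Rightarrow> nat" where
  "mdeg t = (\<Sum>i\<in>UNIV. Poly_Mapping.lookup t i)"

lemma mdeg_0 [simp]: "mdeg 0 = 0"
  and mdeg_add [simp]: "mdeg (s + t) = mdeg s + mdeg t"
  by (simp_all add: mdeg_def lookup_add sum.distrib)

lemma mdeg_single [simp]: "mdeg (Poly_Mapping.single (i :: 'r::finite) n) = n"
proof -
  have "(\<Sum>j\<in>UNIV. Poly_Mapping.lookup (Poly_Mapping.single i n) j) = (\<Sum>j\<in>UNIV. if j = i then n else 0)"
    by (rule sum.cong) (auto simp: lookup_single when_def)
  thus ?thesis by (simp add: mdeg_def)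
qed

lemma mdeg_eq_0_iff [simp]: "mdeg t = 0 \<longleftrightarrow> t = 0"
  by (auto simp: mdeg_def intro: poly_mapping_eqI)

lemma homogeneous_iff: "homogeneous e f \<longleftrightarrow> (\<forall>t\<in>Poly_Mapping.keys f. mdeg t = e)"
  by (simp add: homogeneous_def mdeg_def)

lemma homogeneous_0 [simp]: "homogeneous e 0"
  and homogeneous_const [simp]: "homogeneous 0 (Poly_Mapping.single 0 c)"
  and homogeneous_1 [simp]: "homogeneous 0 1"
  and homogeneous_Y [simp]: "homogeneous 1 (Y_var i)" "homogeneous (Suc 0) (Y_var i)"
  by (simp_all add: homogeneous_iff Y_var_def)

lemma homogeneous_add: "homogeneous e f \<Longrightarrow> homogeneous e h \<Longrightarrow> homogeneous e (f + h)"
  unfolding homogeneous_iff using keys_add[of f h] by blast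

lemma homogeneous_uminus: "homogeneous e f \<Longrightarrow> homogeneous e (- f)"
  by (simp add: homogeneous_iff in_keys_iff)

lemma homogeneous_mult: "homogeneous e f \<Longrightarrow> homogeneous e' h \<Longrightarrow> homogeneous (e + e') (f * h)"
  unfolding homogeneous_iff using keys_mult[of f h] by fastforce

lemma homogeneous_sum: "(\<And>i. i \<in> I \<Longrightarrow> homogeneous e (f i)) \<Longrightarrow> homogeneous e (\<Sum>i\<in>I. f i)"
  by (induction I rule: infinite_finite_induct) (auto intro: homogeneous_add)

lemma homogeneous_power: "homogeneous e f \<Longrightarrow> homogeneous (n * e) (f ^ n)"
  by (induction n) (auto dest: homogeneous_mult)

lemma homogeneous_prod:
  "finite I \<Longrightarrow> (\<And>i. i \<in> I \<Longrightarrow> homogeneous (e i) (f i)) \<Longrightarrow> homogeneous (\<Sum>i\<in>I. e i) (\<Prod>i\<in>I. f i)"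
  by (induction I rule: finite_induct) (auto intro: homogeneous_mult)

lemma Y_var_nonzero [simp]: "Y_var i \<noteq> 0"
  unfolding Y_var_def by (metis in_keys_iff keys_single lookup_zero one_neq_zero singletonI)

section \<open>Points and open sets of projective space\<close>

lemma point_facts:
  assumes "P \<in> proj_space"
  shows "0 \<in> P" "f \<in> P \<Longrightarrow> h \<in> P \<Longrightarrow> f + h \<in> P" "h \<in> P \<Longrightarrow> f * h \<in> P" "1 \<notin> P"
    "f * h \<in> P \<Longrightarrow> f \<in> P \<or> h \<in> P" "\<exists>i. Y_var i \<notin> P"
  using assms unfolding proj_space_def by blast+

lemma prod_notin_point:
  "finite I \<Longrightarrow> P \<in> proj_space \<Longrightarrow> (\<And>i. i \<in> I \<Longrightarrow> f i \<notin> P) \<Longrightarrow> (\<Prod>i\<in>I. f i) \<notin> P"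
  by (induction I rule: finite_induct) (auto simp: point_facts(4) dest: point_facts(5))

lemma power_notin_point: "P \<in> proj_space \<Longrightarrow> f \<notin> P \<Longrightarrow> f ^ n \<notin> P"
  by (induction n) (auto simp: point_facts(4) dest: point_facts(5))

definition generic_point :: "('k::field, 'r::{finite,linorder}) point" where
  "generic_point = {0}"

lemma generic_in_proj_space: "generic_point \<in> proj_space"
  by (auto simp: proj_space_def generic_point_def hcomponent_def)

lemma zopen_subset: "zopen U \<Longrightarrow> U \<subseteq> proj_space"
  by (auto simp: zopen_def)

text \<open>A form outside a prime is nonzero, hence outside the zero ideal. Every nonempty open set
  thus contains the generic point, which is where sections and vectors are compared
  throughout.\<close>

lemma zopen_generic: "zopen U \<Longrightarrow> P \<in> U \<Longrightarrow> generic_point \<in> U"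
proof -
  assume "zopen U" "P \<in> U"
  then obtain T where T: "U = {P \<in> proj_space. \<not> T \<subseteq> P}" "P \<in> proj_space" "\<not> T \<subseteq> P"
    unfolding zopen_def by auto
  hence "\<not> T \<subseteq> generic_point" using point_facts(1)[OF T(2)] by (auto simp: generic_point_def)
  thus ?thesis using T(1) generic_in_proj_space by auto
qed

lemma zopen_nonvanishing: "homogeneous e h \<Longrightarrow> zopen {P \<in> proj_space. h \<notin> P}"
  unfolding zopen_def by (rule exI[of _ "{h}"]) auto

lemma zopen_proj_space: "zopen proj_space"
  unfolding zopen_def by (rule exI[of _ "{1}"]) (auto simp: point_facts(4) intro: exI[of _ 0])

lemma zopen_Int:
  assumes "zopen U" "zopen V"
  shows "zopen (U \<inter> V)"
proof -
  obtain S T where S: "\<forall>f\<in>S. \<exists>e. homogeneous e f" "U = {P \<in> proj_space. \<not> S \<subseteq> P}"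
    and T: "\<forall>f\<in>T. \<exists>e. homogeneous e f" "V = {P \<in> proj_space. \<not> T \<subseteq> P}"
    using assms unfolding zopen_def by blast
  show ?thesis unfolding zopen_def
  proof (intro exI[of _ "{f * h |f h. f \<in> S \<and> h \<in> T}"] conjI)
    show "\<forall>f\<in>{f * h |f h. f \<in> S \<and> h \<in> T}. \<exists>e. homogeneous e f"
      using S T homogeneous_mult by blast
    show "U \<inter> V = {P \<in> proj_space. \<not> {f * h |f h. f \<in> S \<and> h \<in> T} \<subseteq> P}"
    proof (intro equalityI subsetI)
      fix P assume P: "P \<in> U \<inter> V"
      then obtain f h where "f \<in> S" "f \<notin> P" "h \<in> T" "h \<notin> P" "P \<in> proj_space" using S T by blast
      thus "P \<in> {P \<in> proj_space. \<not> {f * h |f h. f \<in> S \<and> h \<in> T} \<subseteq> P}"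
        using point_facts(5) by blast
    next
      fix P assume "P \<in> {P \<in> proj_space. \<not> {f * h |f h. f \<in> S \<and> h \<in> T} \<subseteq> P}"
      then obtain f h where fh: "f \<in> S" "h \<in> T" "f * h \<notin> P" and P: "P \<in> proj_space" by blast
      hence "f \<notin> P" "h \<notin> P" using point_facts(3)[OF P] mult.commute[of f h] by metis+
      thus "P \<in> U \<inter> V" using S T fh P by blast
    qed
  qed
qed

lemma zopen_Union:
  assumes "\<And>U. U \<in> \<C> \<Longrightarrow> zopen U"
  shows "zopen (\<Union>\<C>)"
proof -
  have "\<forall>U\<in>\<C>. \<exists>T. (\<forall>f\<in>T. \<exists>e. homogeneous e f) \<and> U = {P \<in> proj_space. \<not> T \<subseteq> P}"
    using assms unfolding zopen_def by blast
  then obtain T where T: "\<And>U. U \<in> \<C> \<Longrightarrow> (\<forall>f\<in>T U. \<exists>e. homogeneous e f)"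
      "\<And>U. U \<in> \<C> \<Longrightarrow> U = {P \<in> proj_space. \<not> T U \<subseteq> P}"
    by metis
  have "\<Union>\<C> = {P \<in> proj_space. \<not> (\<Union>U\<in>\<C>. T U) \<subseteq> P}"
  proof (intro equalityI subsetI)
    fix P assume "P \<in> \<Union>\<C>"
    then obtain U where U: "U \<in> \<C>" "P \<in> U" by blast
    have "P \<in> {P \<in> proj_space. \<not> T U \<subseteq> P}" using T(2)[OF U(1)] U(2) by simp
    thus "P \<in> {P \<in> proj_space. \<not> (\<Union>U\<in>\<C>. T U) \<subseteq> P}" using U by blast
  next
    fix P assume P: "P \<in> {P \<in> proj_space. \<not> (\<Union>U\<in>\<C>. T U) \<subseteq> P}"
    then obtain U where U: "U \<in> \<C>" "\<not> T U \<subseteq> P" by blast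
    hence "P \<in> {P \<in> proj_space. \<not> T U \<subseteq> P}" using P by blast
    thus "P \<in> \<Union>\<C>" using T(2)[OF U(1)] U(1) by blast
  qed
  moreover have "\<forall>f\<in>\<Union>(T ` \<C>). \<exists>e. homogeneous e f" using T(1) by blast
  ultimately show ?thesis unfolding zopen_def by (intro exI[of _ "\<Union>(T ` \<C>)"] conjI)
qed

section \<open>Properties that hold on a neighbourhood of a point\<close>

definition near :: "('k::field, 'r::{finite,linorder}) point \<Rightarrow> (('k, 'r) point \<Rightarrow> bool) \<Rightarrow> bool" where
  "near P \<phi> \<longleftrightarrow> (\<exists>V. zopen V \<and> P \<in> V \<and> (\<forall>R\<in>V. \<phi> R))"

lemma nearI: "zopen V \<Longrightarrow> P \<in> V \<Longrightarrow> (\<And>R. R \<in> V \<Longrightarrow> \<phi> R) \<Longrightarrow> near P \<phi>"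
  unfolding near_def by blast

lemma near_self: "near P \<phi> \<Longrightarrow> \<phi> P"
  unfolding near_def by blast

lemma near_mono: "near P \<phi> \<Longrightarrow> (\<And>R. R \<in> proj_space \<Longrightarrow> \<phi> R \<Longrightarrow> \<psi> R) \<Longrightarrow> near P \<psi>"
  unfolding near_def using zopen_subset by blast

lemma near_conj: "near P \<phi> \<Longrightarrow> near P \<psi> \<Longrightarrow> near P (\<lambda>R. \<phi> R \<and> \<psi> R)"
  unfolding near_def using zopen_Int by blast

lemma near_always: "P \<in> proj_space \<Longrightarrow> (\<And>R. R \<in> proj_space \<Longrightarrow> \<phi> R) \<Longrightarrow> near P \<phi>"
  using nearI zopen_proj_space by blast

lemma near_ball: "finite I \<Longrightarrow> P \<in> proj_space \<Longrightarrow> (\<And>i. i \<in> I \<Longrightarrow> near P (\<phi> i)) \<Longrightarrow>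
    near P (\<lambda>R. \<forall>i\<in>I. \<phi> i R)"
proof (induction I rule: finite_induct)
  case empty
  thus ?case by (auto intro: near_always)
next
  case (insert x F)
  hence "near P (\<lambda>R. \<phi> x R \<and> (\<forall>i\<in>F. \<phi> i R))" by (intro near_conj) auto
  thus ?case by simp
qed

lemma near_nonvanishing: "homogeneous e h \<Longrightarrow> P \<in> proj_space \<Longrightarrow> h \<notin> P \<Longrightarrow> near P (\<lambda>R. h \<notin> R)"
  by (rule nearI[OF zopen_nonvanishing]) auto

section \<open>Stalks of the sheaves O(j) inside the fraction field\<close>

definition Oj :: "int \<Rightarrow> ('k::field, 'r::{finite,linorder}) point \<Rightarrow> ('k, 'r) hfrac set" where
  "Oj j P = {Fract f h |f h e e'. homogeneous e f \<and> homogeneous e' h \<and> int e = int e' + j \<and> h \<notin> P}"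

definition max_ideal :: "('k::field, 'r::{finite,linorder}) point \<Rightarrow> ('k, 'r) hfrac set" where
  "max_ideal P = {Fract f h |f h e. homogeneous e f \<and> homogeneous e h \<and> h \<notin> P \<and> f \<in> P}"

lemma OjI: "homogeneous e f \<Longrightarrow> homogeneous e' h \<Longrightarrow> int e = int e' + j \<Longrightarrow> h \<notin> P \<Longrightarrow> Fract f h \<in> Oj j P"
  unfolding Oj_def by blast

lemma OjE:
  assumes "q \<in> Oj j P" "P \<in> proj_space"
  obtains f h e e' where "q = Fract f h" "homogeneous e f" "homogeneous e' h" "int e = int e' + j"
    "h \<notin> P" "h \<noteq> 0"
proof -
  obtain f h e e' where "q = Fract f h" "homogeneous e f" "homogeneous e' h" "int e = int e' + j" "h \<notin> P"
    using assms(1) unfolding Oj_def by blast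
  moreover from this have "h \<noteq> 0" using point_facts(1)[OF assms(2)] by blast
  ultimately show thesis by (rule that)
qed

lemma Oj_0: "P \<in> proj_space \<Longrightarrow> 0 \<in> Oj j P"
proof -
  assume "P \<in> proj_space"
  then obtain i where i: "Y_var i \<notin> P" using point_facts(6) by blast
  \<comment> \<open>For negative \<open>j\<close> the denominator must have positive degree, and a
    power of a variable outside \<open>P\<close> provides it. For \<open>j \<ge> 0\<close> this
    power is 1, and zero counts as a form of degree \<open>j\<close>.\<close>
  have "Fract 0 (Y_var i ^ nat (- j)) \<in> Oj j P"
    using power_notin_point[OF \<open>P \<in> proj_space\<close> i] homogeneous_power[OF homogeneous_Y(1), of "nat (- j)" i]
    by (intro OjI[of "nat j"]) auto
  thus ?thesis by (simp add: fract_collapse)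
qed

lemma Oj_1: "P \<in> proj_space \<Longrightarrow> 1 \<in> Oj 0 P"
  unfolding One_fract_def by (rule OjI[of 0]) (auto dest: point_facts(4))

lemma Oj_mult: "P \<in> proj_space \<Longrightarrow> x \<in> Oj i P \<Longrightarrow> y \<in> Oj j P \<Longrightarrow> x * y \<in> Oj (i + j) P"
proof -
  assume P: "P \<in> proj_space" and x: "x \<in> Oj i P" and y: "y \<in> Oj j P"
  obtain f h e e' where f: "x = Fract f h" "homogeneous e f" "homogeneous e' h" "int e = int e' + i" "h \<notin> P" "h \<noteq> 0"
    using OjE[OF x P] by metis
  obtain f2 h2 d d' where f2: "y = Fract f2 h2" "homogeneous d f2" "homogeneous d' h2" "int d = int d' + j" "h2 \<notin> P" "h2 \<noteq> 0"
    using OjE[OF y P] by metis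
  have "Fract (f * f2) (h * h2) \<in> Oj (i + j) P"
    by (rule OjI[OF homogeneous_mult[OF f(2) f2(2)] homogeneous_mult[OF f(3) f2(3)]])
      (use f f2 P in \<open>auto dest: point_facts(5)\<close>)
  thus ?thesis using f f2 by simp
qed

lemma Oj_add: "P \<in> proj_space \<Longrightarrow> x \<in> Oj j P \<Longrightarrow> y \<in> Oj j P \<Longrightarrow> x + y \<in> Oj j P"
proof -
  assume P: "P \<in> proj_space" and x: "x \<in> Oj j P" and y: "y \<in> Oj j P"
  obtain f h e e' where f: "x = Fract f h" "homogeneous e f" "homogeneous e' h" "int e = int e' + j" "h \<notin> P" "h \<noteq> 0"
    using OjE[OF x P] by metis
  obtain f2 h2 d d' where f2: "y = Fract f2 h2" "homogeneous d f2" "homogeneous d' h2" "int d = int d' + j" "h2 \<notin> P" "h2 \<noteq> 0"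
    using OjE[OF y P] by metis
  have "e + d' = d + e'" using f(4) f2(4) by linarith
  hence "homogeneous (e + d') (f * h2 + f2 * h)"
    using homogeneous_mult[OF f(2) f2(3)] homogeneous_mult[OF f2(2) f(3)] by (intro homogeneous_add) auto
  hence "Fract (f * h2 + f2 * h) (h * h2) \<in> Oj j P"
    by (rule OjI[OF _ homogeneous_mult[OF f(3) f2(3)]])
      (use f f2 P in \<open>auto dest: point_facts(5)\<close>)
  thus ?thesis using f f2 by simp
qed

lemma Oj_uminus: "P \<in> proj_space \<Longrightarrow> x \<in> Oj j P \<Longrightarrow> - x \<in> Oj j P"
proof -
  assume P: "P \<in> proj_space" and x: "x \<in> Oj j P"
  obtain f h e e' where f: "x = Fract f h" "homogeneous e f" "homogeneous e' h" "int e = int e' + j" "h \<notin> P" "h \<noteq> 0"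
    using OjE[OF x P] by metis
  have "Fract (- f) h \<in> Oj j P"
    using OjI[OF homogeneous_uminus[OF f(2)] f(3,4,5)] .
  thus ?thesis using f by simp
qed

lemma subring_O: "P \<in> proj_space \<Longrightarrow> subring_of_field (Oj 0 P)"
  using Oj_0[of P 0] Oj_1[of P] Oj_add[of P _ 0] Oj_mult[of P _ 0 _ 0] Oj_uminus[of P _ 0]
  by unfold_locales auto

lemma max_ideal_subset: "max_ideal P \<subseteq> Oj 0 P"
  unfolding max_ideal_def Oj_def by fastforce

text \<open>Any fraction representing the element can be used for the test: cross-multiplication
  puts \<open>f * h'\<close> into \<open>P\<close>, and \<open>h'\<close> lies outside this
  prime.\<close>

lemma max_ideal_iff:
  assumes P: "P \<in> proj_space" and f: "homogeneous e f" "homogeneous e h" "h \<notin> P"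
  shows "Fract f h \<in> max_ideal P \<longleftrightarrow> f \<in> P"
proof
  assume "Fract f h \<in> max_ideal P"
  then obtain f' h' where f': "Fract f h = Fract f' h'" "h' \<notin> P" "f' \<in> P"
    unfolding max_ideal_def by blast
  have "h \<noteq> 0" "h' \<noteq> 0" using f f' P point_facts(1) by auto
  hence "f * h' = f' * h" using f' by (simp add: eq_fract)
  hence "f * h' \<in> P" using point_facts(3)[OF P f'(3), of h] by (simp add: mult.commute)
  thus "f \<in> P" using point_facts(5)[OF P] f' by blast
qed (use f in \<open>auto simp: max_ideal_def\<close>)

lemma local_O: "P \<in> proj_space \<Longrightarrow> local_subring (Oj 0 P) (max_ideal P)"
proof -
  assume P: "P \<in> proj_space"
  interpret subring_of_field "Oj 0 P" by (rule subring_O[OF P])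
  show ?thesis
  proof
    show "x \<in> Oj 0 P" if "x \<in> max_ideal P" for x using that max_ideal_subset by blast
    have "Fract 0 1 \<in> max_ideal P"
      by (subst max_ideal_iff[OF P, of 0]) (auto simp: point_facts[OF P])
    thus "0 \<in> max_ideal P" by (simp add: fract_collapse)
    show "1 \<notin> max_ideal P"
      unfolding One_fract_def by (subst max_ideal_iff[OF P, of 0]) (auto simp: point_facts[OF P])
  next
    fix x y assume "x \<in> max_ideal P" "y \<in> max_ideal P"
    then obtain f h e f' h' e' where f: "x = Fract f h" "homogeneous e f" "homogeneous e h" "h \<notin> P" "f \<in> P"
      and f': "y = Fract f' h'" "homogeneous e' f'" "homogeneous e' h'" "h' \<notin> P" "f' \<in> P"
      unfolding max_ideal_def by blast
    have nz: "h \<noteq> 0" "h' \<noteq> 0" using f f' P point_facts(1) by auto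
    have "homogeneous (e + e') (f * h' + f' * h)"
      using homogeneous_mult[OF f(2) f'(3)] homogeneous_mult[OF f'(2) f(3)]
      by (intro homogeneous_add) (auto simp: add.commute)
    moreover have "h * h' \<notin> P" using f f' P point_facts(5) by blast
    moreover have "f * h' + f' * h \<in> P"
      using point_facts(2)[OF P] point_facts(3)[OF P f(5), of h'] point_facts(3)[OF P f'(5), of h]
      by (simp add: mult.commute)
    ultimately have "Fract (f * h' + f' * h) (h * h') \<in> max_ideal P"
      using homogeneous_mult[OF f(3) f'(3)] by (subst max_ideal_iff[OF P]) auto
    thus "x + y \<in> max_ideal P" using f f' nz by simp
  next
    fix x y assume x: "x \<in> Oj 0 P" and "y \<in> max_ideal P"
    then obtain f' h' e' where f': "y = Fract f' h'" "homogeneous e' f'" "homogeneous e' h'" "h' \<notin> P" "f' \<in> P"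
      unfolding max_ideal_def by blast
    obtain f h e d where f: "x = Fract f h" "homogeneous e f" "homogeneous d h" "int e = int d + 0" "h \<notin> P" "h \<noteq> 0"
      using OjE[OF x P] by metis
    have "d = e" using f by simp
    hence "Fract (f * f') (h * h') \<in> max_ideal P"
      using f f' homogeneous_mult[OF f(2) f'(2)] homogeneous_mult[OF f(3) f'(3)] point_facts(3,5)[OF P]
      by (subst max_ideal_iff[OF P]) blast+
    thus "x * y \<in> max_ideal P" using f f' by simp
  next
    fix x assume x: "x \<in> Oj 0 P" "x \<notin> max_ideal P"
    obtain f h e d where f: "x = Fract f h" "homogeneous e f" "homogeneous d h" "int e = int d + 0" "h \<notin> P" "h \<noteq> 0"
      using OjE[OF x(1) P] by metis
    have de: "d = e" using f by simp
    hence "f \<notin> P" using x(2) max_ideal_iff[OF P, of e f h] f by auto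
    thus "inverse x \<in> Oj 0 P" using f de by (auto intro: OjI)
  qed
qed

lemma Oj_near: "P \<in> proj_space \<Longrightarrow> q \<in> Oj j P \<Longrightarrow> near P (\<lambda>R. q \<in> Oj j R)"
proof -
  assume P: "P \<in> proj_space" and q: "q \<in> Oj j P"
  obtain f h e e' where f: "q = Fract f h" "homogeneous e f" "homogeneous e' h" "int e = int e' + j" "h \<notin> P" "h \<noteq> 0"
    using OjE[OF q P] by metis
  show ?thesis
    by (rule near_mono[OF near_nonvanishing[OF f(3) P f(5)]]) (use f in \<open>auto intro: OjI\<close>)
qed

definition yv :: "'r \<Rightarrow> ('k::field, 'r::{finite,linorder}) hfrac" where
  "yv i = Fract (Y_var i) 1"

lemma yv_nonzero [simp]: "yv i \<noteq> 0"
  by (simp add: yv_def Zero_fract_def eq_fract)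

lemma yv_in: "P \<in> proj_space \<Longrightarrow> yv i \<in> Oj 1 P"
  unfolding yv_def by (rule OjI[of 1 _ 0]) (auto simp: point_facts)

lemma yv_inverse_in: "Y_var i \<notin> P \<Longrightarrow> inverse (yv i) \<in> Oj (- 1) P"
  unfolding yv_def by (auto intro: OjI[of 0 _ 1])

lemma Oj_power: "P \<in> proj_space \<Longrightarrow> x \<in> Oj j P \<Longrightarrow> x ^ n \<in> Oj (int n * j) P"
proof (induction n)
  case 0
  thus ?case by (simp add: Oj_1)
next
  case (Suc n)
  thus ?case using Oj_mult[of P x j "x ^ n" "int n * j"] by (simp add: algebra_simps)
qed

lemma yv_powi_in:
  assumes P: "P \<in> proj_space" "Y_var i \<notin> P"
  shows "yv i powi j \<in> Oj j P"
  using Oj_power[OF P(1) yv_in[OF P(1), of i], of "nat j"]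
    Oj_power[OF P(1) yv_inverse_in[OF P(2)], of "nat (- j)"]
  by (cases "j \<ge> 0") (auto simp: power_int_def)

text \<open>A variable outside \<open>P\<close> generates the stalk of O(1) at \<open>P\<close>, so
  its powers identify all twists there, and local questions can be moved to degree 0.\<close>

lemma yv_powi_mult_in: "P \<in> proj_space \<Longrightarrow> Y_var i \<notin> P \<Longrightarrow> yv i powi n * q \<in> Oj (n + j) P \<longleftrightarrow> q \<in> Oj j P"
proof
  assume P: "P \<in> proj_space" "Y_var i \<notin> P" and q: "yv i powi n * q \<in> Oj (n + j) P"
  have "yv i powi (- n) * (yv i powi n * q) \<in> Oj (- n + (n + j)) P"
    by (rule Oj_mult[OF P(1) yv_powi_in[OF P] q])
  moreover have "yv i powi (- n) * (yv i powi n * q) = q"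
    by (simp add: mult.assoc[symmetric] power_int_add[symmetric])
  ultimately show "q \<in> Oj j P" by simp
qed (auto intro: Oj_mult yv_powi_in)

lemma Fract_one_in: "P \<in> proj_space \<Longrightarrow> homogeneous e f \<Longrightarrow> Fract f 1 \<in> Oj (int e) P"
  by (rule OjI[of e _ 0]) (auto simp: point_facts)

text \<open>Each local fraction agrees with the value of the section at the generic point, which
  lies in every nonempty open set. A section is therefore a single fraction that is regular at all
  points of \<open>U\<close>.\<close>

lemma O_sections_eq:
  assumes U: "zopen U"
  shows "O_sections j U = {\<lambda>P\<in>U. q |q. \<forall>P\<in>U. q \<in> Oj j P}" (is "?L = ?R")
proof (intro equalityI subsetI)
  fix s assume s: "s \<in> ?L"
  show "s \<in> ?R"
  proof (intro CollectI exI[of _ "s generic_point"] conjI ballI)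
    have loc: "s P = s generic_point \<and> s P \<in> Oj j P" if P: "P \<in> U" for P
    proof -
      from s P obtain V f h e e' where V: "zopen V" "P \<in> V" "V \<subseteq> U" "homogeneous e f" "homogeneous e' h" "int e = int e' + j"
         "\<forall>Q\<in>V. h \<notin> Q \<and> s Q = Fract f h" unfolding O_sections_def by blast
      thus ?thesis using zopen_generic[OF V(1,2)] by (auto intro: OjI)
    qed
    show "s = (\<lambda>P\<in>U. s generic_point)"
      using s loc unfolding O_sections_def by (intro ext) (auto simp: restrict_def extensional_def)
    show "s generic_point \<in> Oj j P" if "P \<in> U" for P using loc[OF that] by metis
  qed
next
  fix s assume "s \<in> ?R"
  then obtain q where q: "s = (\<lambda>P\<in>U. q)" "\<And>P. P \<in> U \<Longrightarrow> q \<in> Oj j P" by blast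
  show "s \<in> ?L" unfolding O_sections_def
  proof (intro CollectI conjI ballI)
    show "s \<in> extensional U" using q by simp
    fix P assume P: "P \<in> U"
    have P': "P \<in> proj_space" using zopen_subset[OF U] P by blast
    obtain f h e e' where f: "q = Fract f h" "homogeneous e f" "homogeneous e' h" "int e = int e' + j" "h \<notin> P" "h \<noteq> 0"
      using OjE[OF q(2)[OF P] P'] by metis
    show "\<exists>V f h e e'. zopen V \<and> P \<in> V \<and> V \<subseteq> U \<and>
     homogeneous e f \<and> homogeneous e' h \<and> int e = int e' + j \<and> (\<forall>Q\<in>V. h \<notin> Q \<and> s Q = Fract f h)"
      using f q P P' zopen_Int[OF U zopen_nonvanishing[OF f(3)]]
      by (intro exI[of _ "U \<inter> {P \<in> proj_space. h \<notin> P}"] exI[of _ f] exI[of _ h] exI[of _ e] exI[of _ e']) auto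
  qed
qed

section \<open>Locally free lattices\<close>

type_synonym ('k, 'r) lattice = "('k, 'r) point \<Rightarrow> (nat \<Rightarrow> ('k, 'r) hfrac) set"

text \<open>One family \<open>b\<close> must be a basis at all points near \<open>P\<close>, which
  is more than freeness of each stalk. Local freeness of a sheaf can be put this way because all
  stalks lie in the same vector space.\<close>

definition loc_free :: "('k::field, 'r::{finite,linorder}) lattice \<Rightarrow> bool" where
  "loc_free L \<longleftrightarrow> (\<forall>P\<in>proj_space. \<exists>N (b :: nat \<Rightarrow> nat \<Rightarrow> ('k, 'r) hfrac).
     indep {..<N} b \<and> near P (\<lambda>R. L R = aspan (Oj 0 R) {..<N} b))"

lemma loc_freeI:
  fixes L :: "('k::field, 'r::{finite,linorder}) lattice"
  assumes "\<And>P. P \<in> proj_space \<Longrightarrow> \<exists>(I :: 'i set) J. finite I \<and> indep I J \<and> near P (\<lambda>R. L R = aspan (Oj 0 R) I J)"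
  shows "loc_free L"
  unfolding loc_free_def
proof
  fix P :: "('k, 'r) point" assume P: "P \<in> proj_space"
  obtain I :: "'i set" and J where I: "finite I" "indep I J" "near P (\<lambda>R. L R = aspan (Oj 0 R) I J)"
    using assms[OF P] by blast
  obtain f where f: "bij_betw f {..<card I} I" using ex_bij_betw_nat_finite[OF I(1)] by (auto simp: lessThan_atLeast0)
  show "\<exists>N (b :: nat \<Rightarrow> nat \<Rightarrow> ('k, 'r) hfrac). indep {..<N} b \<and> near P (\<lambda>R. L R = aspan (Oj 0 R) {..<N} b)"
    using I(2,3) unfolding indep_reindex[OF f] aspan_reindex[OF f] by blast
qed

lemma aspan_near:
  assumes "P \<in> proj_space" "finite I" "v \<in> aspan (Oj 0 P) I J"
  shows "near P (\<lambda>R. v \<in> aspan (Oj 0 R) I J)"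
proof -
  obtain x where x: "v = lincomb x I J" "\<And>i. i \<in> I \<Longrightarrow> x i \<in> Oj 0 P" using assms by (auto simp: aspan_iff)
  have "near P (\<lambda>R. \<forall>i\<in>I. x i \<in> Oj 0 R)" using assms x by (intro near_ball Oj_near) auto
  thus ?thesis by (rule near_mono) (use x in \<open>auto intro: aspanI\<close>)
qed

text \<open>Two spans agree as soon as each contains the generators of the other. At
  \<open>P\<close> this involves finitely many fractions, each of which stays regular on a
  neighbourhood.\<close>

lemma aspan_eq_near:
  assumes P: "P \<in> proj_space" and fin: "finite I" "finite Y" and eq: "aspan (Oj 0 P) I J = aspan (Oj 0 P) Y J'"
  shows "near P (\<lambda>R. aspan (Oj 0 R) I J = aspan (Oj 0 R) Y J')"
proof -
  interpret subring_of_field "Oj 0 P" by (rule subring_O[OF P])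
  have "J i \<in> aspan (Oj 0 P) Y J'" if "i \<in> I" for i using aspan_base[OF fin(1) that, of J] eq by simp
  hence 1: "near P (\<lambda>R. \<forall>i\<in>I. J i \<in> aspan (Oj 0 R) Y J')" using P fin by (intro near_ball aspan_near)
  have "J' i \<in> aspan (Oj 0 P) I J" if "i \<in> Y" for i using aspan_base[OF fin(2) that, of J'] eq by simp
  hence 2: "near P (\<lambda>R. \<forall>i\<in>Y. J' i \<in> aspan (Oj 0 R) I J)" using P fin by (intro near_ball aspan_near)
  show ?thesis
  proof (rule near_mono[OF near_conj[OF 1 2]])
    fix R assume R: "R \<in> proj_space" and *: "(\<forall>i\<in>I. J i \<in> aspan (Oj 0 R) Y J') \<and> (\<forall>i\<in>Y. J' i \<in> aspan (Oj 0 R) I J)"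
    interpret R: subring_of_field "Oj 0 R" by (rule subring_O[OF R])
    show "aspan (Oj 0 R) I J = aspan (Oj 0 R) Y J'" using * fin by (intro R.aspan_eqI) auto
  qed
qed

lemma loc_freeE:
  fixes L :: "('k::field, 'r::{finite,linorder}) lattice"
  assumes "loc_free L" "P \<in> proj_space"
  obtains N :: nat and b :: "nat \<Rightarrow> nat \<Rightarrow> ('k, 'r) hfrac"
  where "indep {..<N} b" "near P (\<lambda>R. L R = aspan (Oj 0 R) {..<N} b)" "L P = aspan (Oj 0 P) {..<N} b"
proof -
  obtain N :: nat and b where *: "indep {..<N} b" "near P (\<lambda>R. L R = aspan (Oj 0 R) {..<N} b)"
    using assms unfolding loc_free_def by blast
  show thesis using * near_self[OF *(2)] that by blast
qed

lemma loc_free_submod: "loc_free L \<Longrightarrow> P \<in> proj_space \<Longrightarrow> submod (Oj 0 P) (L P)"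
  by (erule (1) loc_freeE) (simp add: subring_O subring_of_field.submod_aspan)

lemma loc_free_near: "loc_free L \<Longrightarrow> P \<in> proj_space \<Longrightarrow> v \<in> L P \<Longrightarrow> near P (\<lambda>R. v \<in> L R)"
proof -
  assume L: "loc_free L" "P \<in> proj_space" "v \<in> L P"
  obtain N :: nat and b where *: "indep {..<N} b" "near P (\<lambda>R. L R = aspan (Oj 0 R) {..<N} b)" "L P = aspan (Oj 0 P) {..<N} b"
    by (rule loc_freeE[OF L(1,2)])
  have "near P (\<lambda>R. v \<in> aspan (Oj 0 R) {..<N} b)" using L * by (intro aspan_near) auto
  from near_conj[OF this *(2)] show ?thesis by (rule near_mono) auto
qed

text \<open>The surjection splits locally; a basis of \<open>L P\<close> adapted to the splitting contains a basis of the kernel.\<close>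

lemma loc_free_kernel:
  assumes L: "loc_free (L :: ('k::field, 'r::{finite,linorder}) lattice)" and L'': "loc_free L''"
    and \<beta>: "lin \<beta>" and surj: "\<And>P. P \<in> proj_space \<Longrightarrow> \<beta> ` L P = L'' P"
  shows "loc_free (\<lambda>P. {v \<in> L P. \<beta> v = 0})"
proof (rule loc_freeI[where ?'i = nat])
  fix P :: "('k, 'r) point" assume P: "P \<in> proj_space"
  interpret local_subring "Oj 0 P" "max_ideal P" by (rule local_O[OF P])
  obtain N :: nat and b where b: "indep {..<N} b" "near P (\<lambda>R. L R = aspan (Oj 0 R) {..<N} b)" "L P = aspan (Oj 0 P) {..<N} b"
    by (rule loc_freeE[OF L P])
  obtain M :: nat and c where c: "indep {..<M} c" "near P (\<lambda>R. L'' R = aspan (Oj 0 R) {..<M} c)" "L'' P = aspan (Oj 0 P) {..<M} c"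
    by (rule loc_freeE[OF L'' P])
  have "\<forall>t\<in>{..<M}. \<exists>u\<in>L P. \<beta> u = c t"
    using aspan_base[of "{..<M}" _ c] c(3) surj[OF P] by (metis finite_lessThan imageE)
  then obtain c' where c': "\<And>t. t < M \<Longrightarrow> c' t \<in> L P" "\<And>t. t < M \<Longrightarrow> \<beta> (c' t) = c t"
    by (metis lessThan_iff)
  have Lsub: "submod (Oj 0 P) (L P)" by (rule loc_free_submod[OF L P])
  have \<beta>c': "\<beta> (lincomb x {..<M} c') = lincomb x {..<M} c" for x
    unfolding lin_lincomb[OF \<beta>] by (rule lincomb_cong) (auto simp: c')
  \<comment> \<open>\<open>K\<close> is the kernel at \<open>P\<close>, and \<open>B\<close> is
    spanned by lifts of a basis of \<open>L'' P\<close>; together they span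
    \<open>L P\<close>.\<close>
  define K B where "K = {v \<in> L P. \<beta> v = 0}" and "B = aspan (Oj 0 P) {..<M} c'"
  have BL: "B \<subseteq> L P" unfolding B_def by (rule submod_aspan_subset[OF Lsub]) (auto simp: c')
  have "\<exists>v\<in>K. \<exists>w\<in>B. u = v + w" if u: "u \<in> L P" for u
  proof -
    have "\<beta> u \<in> L'' P" using u surj[OF P] by blast
    then obtain x where x: "\<beta> u = lincomb x {..<M} c" "\<And>t. t < M \<Longrightarrow> x t \<in> Oj 0 P"
      using c(3) by (auto simp: aspan_iff)
    have w: "lincomb x {..<M} c' \<in> B" unfolding B_def using x by (auto intro: aspanI)
    have "u - lincomb x {..<M} c' \<in> K"
      unfolding K_def using w BL u x by (auto simp: lin_diff[OF \<beta>] \<beta>c' intro!: submod_diff[OF Lsub])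
    thus ?thesis using w by (intro bexI[of _ "u - lincomb x {..<M} c'"] bexI[OF _ w]) auto
  qed
  hence "\<exists>J'. indep {..<N} J' \<and> aspan (Oj 0 P) {..<N} J' = aspan (Oj 0 P) {..<N} b \<and> (\<forall>i\<in>{..<N}. J' i \<in> K \<or> J' i \<in> B)"
    using basis_adapted[of "{..<N}" b K B] b BL unfolding K_def by auto
  then obtain b' where b': "indep {..<N} b'" "aspan (Oj 0 P) {..<N} b' = aspan (Oj 0 P) {..<N} b"
     "\<And>i. i < N \<Longrightarrow> b' i \<in> K \<or> b' i \<in> B" by blast
  define I where "I = {i\<in>{..<N}. \<beta> (b' i) = 0}"
  have "near P (\<lambda>R. L R = aspan (Oj 0 R) {..<N} b \<and> aspan (Oj 0 R) {..<N} b' = aspan (Oj 0 R) {..<N} b)"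
    by (intro near_conj b(2) aspan_eq_near[OF P]) (use b' in auto)
  hence "near P (\<lambda>R. {v \<in> L R. \<beta> v = 0} = aspan (Oj 0 R) I b')"
  proof (rule near_mono, intro equalityI subsetI)
    fix R v assume R: "R \<in> proj_space" and *: "L R = aspan (Oj 0 R) {..<N} b \<and> aspan (Oj 0 R) {..<N} b' = aspan (Oj 0 R) {..<N} b"
      and v: "v \<in> {v \<in> L R. \<beta> v = 0}"
    have "v \<in> aspan (Oj 0 R) {..<N} b'" using v * by simp
    then obtain x where x: "v = lincomb x {..<N} b'" "\<And>i. i < N \<Longrightarrow> x i \<in> Oj 0 R"
      by (auto simp: aspan_iff)
    have I: "I \<subseteq> {..<N}" by (auto simp: I_def)
    have dec: "v = lincomb x I b' + lincomb x ({..<N} - I) b'"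
      unfolding x lincomb_def using I by (subst sum.subset_diff[of I]) (auto simp: add.commute)
    have "\<beta> (lincomb x I b') = 0"
      unfolding lin_lincomb[OF \<beta>] by (rule lincomb_neutral) (auto simp: I_def)
    hence z0: "\<beta> (lincomb x ({..<N} - I) b') = 0" using v dec by (simp add: lin_add[OF \<beta>])
    \<comment> \<open>The basis vectors not killed by \<open>\<beta>\<close> lie in
      \<open>B\<close>. Over the whole field \<open>\<beta>\<close> is injective on the span of
      \<open>c'\<close>, since it carries \<open>c'\<close> to the independent family
      \<open>c\<close>; so this part of \<open>v\<close> vanishes, at \<open>R\<close> as well as at
      \<open>P\<close>.\<close>
    have "lincomb x ({..<N} - I) b' \<in> aspan UNIV {..<M} c'"
    proof (rule submod_lincomb)
      interpret U: subring_of_field "UNIV :: ('k,'r) hfrac set" by unfold_locales auto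
      show "submod UNIV (aspan (UNIV :: ('k,'r) hfrac set) {..<M} c')" by (rule U.submod_aspan)
      show "b' i \<in> aspan UNIV {..<M} c'" if "i \<in> {..<N} - I" for i
      proof -
        have "b' i \<in> B" using that b'(3)[of i] by (auto simp: I_def K_def)
        thus ?thesis unfolding B_def by (auto elim!: aspanE intro: aspanI)
      qed
    qed auto
    then obtain y where y: "lincomb x ({..<N} - I) b' = lincomb y {..<M} c'" by (auto simp: aspan_iff)
    hence "lincomb y {..<M} c = 0" using z0 \<beta>c' by simp
    hence "\<forall>t\<in>{..<M}. y t = 0" using c(1) unfolding indep_def by blast
    hence "lincomb y {..<M} c' = 0" by (intro lincomb_zero) auto
    hence "lincomb x ({..<N} - I) b' = 0" using y by simp
    hence "v = lincomb x I b'" using dec by simp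
    thus "v \<in> aspan (Oj 0 R) I b'" by (rule aspanI) (use x I in auto)
  next
    fix R v assume R: "R \<in> proj_space" and *: "L R = aspan (Oj 0 R) {..<N} b \<and> aspan (Oj 0 R) {..<N} b' = aspan (Oj 0 R) {..<N} b"
      and v: "v \<in> aspan (Oj 0 R) I b'"
    interpret R: subring_of_field "Oj 0 R" by (rule subring_O[OF R])
    have "aspan (Oj 0 R) I b' \<subseteq> aspan (Oj 0 R) {..<N} b'"
      by (rule submod_aspan_subset[OF R.submod_aspan]) (auto simp: I_def intro: R.aspan_base)
    moreover have "\<beta> v = 0"
    proof -
      obtain x where x: "v = lincomb x I b'" using v by (auto simp: aspan_iff)
      show ?thesis unfolding x lin_lincomb[OF \<beta>] by (rule lincomb_neutral) (auto simp: I_def)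
    qed
    ultimately show "v \<in> {v \<in> L R. \<beta> v = 0}" using * v by auto
  qed
  moreover have "indep I b'" by (rule indep_mono[OF b'(1)]) (auto simp: I_def)
  moreover have "finite I" by (simp add: I_def)
  ultimately show "\<exists>(I :: nat set) J. finite I \<and> indep I J \<and> near P (\<lambda>R. {v \<in> L R. \<beta> v = 0} = aspan (Oj 0 R) I J)"
    by blast
qed

section \<open>Sheaves represented by lattices\<close>

definition gsec :: "('k::field, 'r::{finite,linorder}) lattice \<Rightarrow> ('k, 'r) point set \<Rightarrow> (nat \<Rightarrow> ('k, 'r) hfrac) set" where
  "gsec L U = {v. \<forall>P\<in>U. v \<in> L P}"

definition sec :: "(('k, 'r) point \<Rightarrow> (nat \<Rightarrow> ('k::field, 'r::{finite,linorder}) hfrac) \<Rightarrow> 'b) \<Rightarrow> ('k, 'r) point set \<Rightarrow>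
    (nat \<Rightarrow> ('k, 'r) hfrac) \<Rightarrow> ('k, 'r) point \<Rightarrow> 'b" where
  "sec \<epsilon> U v = (\<lambda>P\<in>U. \<epsilon> P v)"

text \<open>
  Sections over a nonempty open set are constant since they agree at the generic point, so a sheaf
  is described by its stalks \<open>L P\<close> inside one vector space over the function field; \<open>\<epsilon> P\<close> encodes the
  elements of the stalk as values of sections (identity, singletons, or cosets).
\<close>

definition represents :: "('k::field, 'r::{finite,linorder}, ('k, 'r) point \<Rightarrow> 'b) psheaf \<Rightarrow> ('k, 'r) lattice \<Rightarrow>
    (('k, 'r) point \<Rightarrow> (nat \<Rightarrow> ('k, 'r) hfrac) \<Rightarrow> 'b) \<Rightarrow> bool" where
  "represents F L \<epsilon> \<longleftrightarrow>
     (\<forall>P\<in>proj_space. inj_on (\<epsilon> P) (L P)) \<and>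
     (\<forall>U. zopen U \<longrightarrow>
        carrier (sections F U) = sec \<epsilon> U ` gsec L U \<and>
        \<zero>\<^bsub>sections F U\<^esub> = sec \<epsilon> U 0 \<and>
        (\<forall>v\<in>gsec L U. \<forall>w\<in>gsec L U. sec \<epsilon> U v \<oplus>\<^bsub>sections F U\<^esub> sec \<epsilon> U w = sec \<epsilon> U (v + w)) \<and>
        (\<forall>c. (\<forall>P\<in>U. c \<in> Oj 0 P) \<longrightarrow>
           (\<forall>v\<in>gsec L U. (\<lambda>P\<in>U. c) \<odot>\<^bsub>sections F U\<^esub> sec \<epsilon> U v = sec \<epsilon> U (c *v v))) \<and>
        (\<forall>V. zopen V \<longrightarrow> V \<subseteq> U \<longrightarrow> (\<forall>v\<in>gsec L U. res F U V (sec \<epsilon> U v) = sec \<epsilon> V v)))"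

lemma sec_empty: "sec \<epsilon> {} v = sec \<epsilon> {} w"
  by (simp add: sec_def restrict_def)

lemma gsec_mono: "V \<subseteq> U \<Longrightarrow> v \<in> gsec L U \<Longrightarrow> v \<in> gsec L V"
  by (auto simp: gsec_def)

lemma O_ring_carrier: "zopen U \<Longrightarrow> carrier (O_ring U) = {\<lambda>P\<in>U. q |q. \<forall>P\<in>U. q \<in> Oj 0 P}"
  by (simp add: O_ring_def O_sections_eq)

lemma O_ring_ops:
  "(\<lambda>P\<in>U. c) \<oplus>\<^bsub>O_ring U\<^esub> (\<lambda>P\<in>U. d) = (\<lambda>P\<in>U. c + d)"
  "(\<lambda>P\<in>U. c) \<otimes>\<^bsub>O_ring U\<^esub> (\<lambda>P\<in>U. d) = (\<lambda>P\<in>U. c * d)"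
  "\<zero>\<^bsub>O_ring U\<^esub> = (\<lambda>P\<in>U. 0)" "\<one>\<^bsub>O_ring U\<^esub> = (\<lambda>P\<in>U. 1)"
  by (auto simp: O_ring_def)

lemma cring_O_ring:
  assumes U: "zopen U"
  shows "cring (O_ring U)"
proof -
  have P: "P \<in> U \<Longrightarrow> P \<in> proj_space" for P using zopen_subset[OF U] by blast
  note [simp] = O_ring_carrier[OF U] O_ring_ops
  show ?thesis
  proof (intro cringI abelian_groupI comm_monoidI)
    fix x y assume x: "x \<in> carrier (O_ring U)" and y: "y \<in> carrier (O_ring U)"
    obtain c where c: "x = (\<lambda>P\<in>U. c)" "\<forall>P\<in>U. c \<in> Oj 0 P" using x by auto
    obtain d where d: "y = (\<lambda>P\<in>U. d)" "\<forall>P\<in>U. d \<in> Oj 0 P" using y by auto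
    have "\<forall>P\<in>U. c + d \<in> Oj 0 P" using c d P Oj_add by blast
    thus "x \<oplus>\<^bsub>O_ring U\<^esub> y \<in> carrier (O_ring U)" using c d by auto
    have "\<forall>P\<in>U. c * d \<in> Oj 0 P" using c d P Oj_mult[of _ c 0 d 0] by simp
    thus "x \<otimes>\<^bsub>O_ring U\<^esub> y \<in> carrier (O_ring U)" using c d by auto
    show "x \<oplus>\<^bsub>O_ring U\<^esub> y = y \<oplus>\<^bsub>O_ring U\<^esub> x" using c d by (simp add: add.commute)
    show "x \<otimes>\<^bsub>O_ring U\<^esub> y = y \<otimes>\<^bsub>O_ring U\<^esub> x" using c d by (simp add: mult.commute)
    fix z assume z: "z \<in> carrier (O_ring U)"
    obtain e where e: "z = (\<lambda>P\<in>U. e)" "\<forall>P\<in>U. e \<in> Oj 0 P" using z by auto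
    show "x \<oplus>\<^bsub>O_ring U\<^esub> y \<oplus>\<^bsub>O_ring U\<^esub> z = x \<oplus>\<^bsub>O_ring U\<^esub> (y \<oplus>\<^bsub>O_ring U\<^esub> z)"
      "x \<otimes>\<^bsub>O_ring U\<^esub> y \<otimes>\<^bsub>O_ring U\<^esub> z = x \<otimes>\<^bsub>O_ring U\<^esub> (y \<otimes>\<^bsub>O_ring U\<^esub> z)"
      "(x \<oplus>\<^bsub>O_ring U\<^esub> y) \<otimes>\<^bsub>O_ring U\<^esub> z = x \<otimes>\<^bsub>O_ring U\<^esub> z \<oplus>\<^bsub>O_ring U\<^esub> y \<otimes>\<^bsub>O_ring U\<^esub> z"
      using c d e by (simp_all add: algebra_simps)
  next
    show "\<zero>\<^bsub>O_ring U\<^esub> \<in> carrier (O_ring U)" using P Oj_0 by auto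
    show "\<one>\<^bsub>O_ring U\<^esub> \<in> carrier (O_ring U)" using P Oj_1 by auto
    fix x assume x: "x \<in> carrier (O_ring U)"
    obtain c where c: "x = (\<lambda>P\<in>U. c)" "\<forall>P\<in>U. c \<in> Oj 0 P" using x by auto
    show "\<zero>\<^bsub>O_ring U\<^esub> \<oplus>\<^bsub>O_ring U\<^esub> x = x" "\<one>\<^bsub>O_ring U\<^esub> \<otimes>\<^bsub>O_ring U\<^esub> x = x" using c by simp_all
    have "\<forall>P\<in>U. - c \<in> Oj 0 P" using c P Oj_uminus by blast
    hence "(\<lambda>P\<in>U. - c) \<in> carrier (O_ring U)" by auto
    moreover have "(\<lambda>P\<in>U. - c) \<oplus>\<^bsub>O_ring U\<^esub> x = \<zero>\<^bsub>O_ring U\<^esub>" using c by simp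
    ultimately show "\<exists>y\<in>carrier (O_ring U). y \<oplus>\<^bsub>O_ring U\<^esub> x = \<zero>\<^bsub>O_ring U\<^esub>" by blast
  qed
qed

section \<open>The sheaf axioms for presheaves given by lattices\<close>

locale represented =
  fixes F :: "('k::field, 'r::{finite,linorder}, ('k, 'r) point \<Rightarrow> 'b) psheaf" and L \<epsilon>
  assumes rep: "represents F L \<epsilon>" and lf: "loc_free L"
begin

lemma submod_L: "P \<in> proj_space \<Longrightarrow> submod (Oj 0 P) (L P)"
  by (rule loc_free_submod[OF lf])

lemma \<epsilon>_inj: "P \<in> proj_space \<Longrightarrow> v \<in> L P \<Longrightarrow> w \<in> L P \<Longrightarrow> \<epsilon> P v = \<epsilon> P w \<Longrightarrow> v = w"
  using rep unfolding represents_def inj_on_def by blast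

lemma L_generic: "P \<in> proj_space \<Longrightarrow> v \<in> L P \<Longrightarrow> v \<in> L generic_point"
  using loc_free_near[OF lf, of P v] zopen_generic unfolding near_def by blast

context
  fixes U :: "('k, 'r) point set"
  assumes U: "zopen U"
begin

lemma carrier_eq: "carrier (sections F U) = sec \<epsilon> U ` gsec L U"
  and zero_eq: "\<zero>\<^bsub>sections F U\<^esub> = sec \<epsilon> U 0"
  and add_eq: "v \<in> gsec L U \<Longrightarrow> w \<in> gsec L U \<Longrightarrow> sec \<epsilon> U v \<oplus>\<^bsub>sections F U\<^esub> sec \<epsilon> U w = sec \<epsilon> U (v + w)"
  and smult_eq: "(\<forall>P\<in>U. c \<in> Oj 0 P) \<Longrightarrow> v \<in> gsec L U \<Longrightarrow>
     (\<lambda>P\<in>U. c) \<odot>\<^bsub>sections F U\<^esub> sec \<epsilon> U v = sec \<epsilon> U (c *v v)"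
  and res_eq: "zopen V \<Longrightarrow> V \<subseteq> U \<Longrightarrow> v \<in> gsec L U \<Longrightarrow> res F U V (sec \<epsilon> U v) = sec \<epsilon> V v"
  using rep U unfolding represents_def by blast+

lemma in_proj: "P \<in> U \<Longrightarrow> P \<in> proj_space"
  using zopen_subset[OF U] by blast

lemma gsec_0: "0 \<in> gsec L U"
  and gsec_add: "v \<in> gsec L U \<Longrightarrow> w \<in> gsec L U \<Longrightarrow> v + w \<in> gsec L U"
  and gsec_scale: "(\<forall>P\<in>U. c \<in> Oj 0 P) \<Longrightarrow> v \<in> gsec L U \<Longrightarrow> c *v v \<in> gsec L U"
  using submod_0[OF submod_L[OF in_proj]] submod_add[OF submod_L[OF in_proj]] submod_scale[OF submod_L[OF in_proj]]
  unfolding gsec_def by blast+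

lemma sec_inj: "P \<in> U \<Longrightarrow> v \<in> gsec L U \<Longrightarrow> w \<in> gsec L U \<Longrightarrow> sec \<epsilon> U v = sec \<epsilon> U w \<Longrightarrow> v = w"
proof -
  assume *: "P \<in> U" "v \<in> gsec L U" "w \<in> gsec L U" "sec \<epsilon> U v = sec \<epsilon> U w"
  have "\<epsilon> P v = \<epsilon> P w" using fun_cong[OF *(4), of P] *(1) by (simp add: sec_def)
  thus ?thesis using \<epsilon>_inj[OF in_proj[OF *(1)]] * by (auto simp: gsec_def)
qed

lemma rep_module: "Module.module (O_ring U) (sections F U)"
proof (rule moduleI)
  show "cring (O_ring U)" by (rule cring_O_ring[OF U])
  have minus: "v \<in> gsec L U \<Longrightarrow> - v \<in> gsec L U" for v
  proof -
    assume v: "v \<in> gsec L U"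
    have "\<forall>P\<in>U. - 1 \<in> Oj 0 P" using in_proj Oj_uminus Oj_1 by blast
    from gsec_scale[OF this v] show ?thesis by simp
  qed
  show "abelian_group (sections F U)"
  proof (rule abelian_groupI)
    fix x y z
    assume "x \<in> carrier (sections F U)" "y \<in> carrier (sections F U)" "z \<in> carrier (sections F U)"
    then obtain u v w where "x = sec \<epsilon> U u" "u \<in> gsec L U" "y = sec \<epsilon> U v" "v \<in> gsec L U"
      "z = sec \<epsilon> U w" "w \<in> gsec L U" by (auto simp: carrier_eq)
    thus "x \<oplus>\<^bsub>sections F U\<^esub> y \<oplus>\<^bsub>sections F U\<^esub> z = x \<oplus>\<^bsub>sections F U\<^esub> (y \<oplus>\<^bsub>sections F U\<^esub> z)"
      by (simp add: add_eq gsec_add add.assoc)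
  next
    fix x y
    assume "x \<in> carrier (sections F U)" "y \<in> carrier (sections F U)"
    then obtain u v where "x = sec \<epsilon> U u" "u \<in> gsec L U" "y = sec \<epsilon> U v" "v \<in> gsec L U"
      by (auto simp: carrier_eq)
    thus "x \<oplus>\<^bsub>sections F U\<^esub> y \<in> carrier (sections F U)" "x \<oplus>\<^bsub>sections F U\<^esub> y = y \<oplus>\<^bsub>sections F U\<^esub> x"
      by (simp_all add: add_eq carrier_eq gsec_add add.commute)
  next
    show "\<zero>\<^bsub>sections F U\<^esub> \<in> carrier (sections F U)" by (simp add: carrier_eq zero_eq gsec_0)
    fix x assume "x \<in> carrier (sections F U)"
    then obtain u where u: "x = sec \<epsilon> U u" "u \<in> gsec L U" by (auto simp: carrier_eq)
    thus "\<zero>\<^bsub>sections F U\<^esub> \<oplus>\<^bsub>sections F U\<^esub> x = x" by (simp add: zero_eq add_eq gsec_0)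
    show "\<exists>y\<in>carrier (sections F U). y \<oplus>\<^bsub>sections F U\<^esub> x = \<zero>\<^bsub>sections F U\<^esub>"
      using u minus[OF u(2)] by (intro bexI[of _ "sec \<epsilon> U (- u)"]) (auto simp: add_eq zero_eq carrier_eq)
  qed
  show "\<one>\<^bsub>O_ring U\<^esub> \<odot>\<^bsub>sections F U\<^esub> x = x" if "x \<in> carrier (sections F U)" for x
  proof -
    obtain u where u: "x = sec \<epsilon> U u" "u \<in> gsec L U" using \<open>x \<in> carrier (sections F U)\<close> carrier_eq by blast
    show ?thesis unfolding O_ring_ops u(1) using in_proj Oj_1 u by (subst smult_eq) auto
  qed
  fix a x assume "a \<in> carrier (O_ring U)" "x \<in> carrier (sections F U)"
  then obtain c u where c: "a = (\<lambda>P\<in>U. c)" "\<forall>P\<in>U. c \<in> Oj 0 P" and u: "x = sec \<epsilon> U u" "u \<in> gsec L U"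
    unfolding O_ring_carrier[OF U] carrier_eq by blast
  show "a \<odot>\<^bsub>sections F U\<^esub> x \<in> carrier (sections F U)"
    unfolding c(1) u(1) smult_eq[OF c(2) u(2)] carrier_eq using gsec_scale[OF c(2) u(2)] by blast
  {
    fix b assume "b \<in> carrier (O_ring U)"
    then obtain d where d: "b = (\<lambda>P\<in>U. d)" "\<forall>P\<in>U. d \<in> Oj 0 P" unfolding O_ring_carrier[OF U] by blast
    have cd: "\<forall>P\<in>U. c + d \<in> Oj 0 P" "\<forall>P\<in>U. c * d \<in> Oj 0 P"
      using c d in_proj Oj_add[of _ c 0 d] Oj_mult[of _ c 0 d 0] by auto
    show "(a \<oplus>\<^bsub>O_ring U\<^esub> b) \<odot>\<^bsub>sections F U\<^esub> x = a \<odot>\<^bsub>sections F U\<^esub> x \<oplus>\<^bsub>sections F U\<^esub> b \<odot>\<^bsub>sections F U\<^esub> x"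
      unfolding c(1) d(1) u(1) O_ring_ops smult_eq[OF c(2) u(2)] smult_eq[OF d(2) u(2)] smult_eq[OF cd(1) u(2)]
      by (simp add: add_eq gsec_scale c d u vec.scale_left_distrib)
    show "(a \<otimes>\<^bsub>O_ring U\<^esub> b) \<odot>\<^bsub>sections F U\<^esub> x = a \<odot>\<^bsub>sections F U\<^esub> (b \<odot>\<^bsub>sections F U\<^esub> x)"
      unfolding c(1) d(1) u(1) O_ring_ops smult_eq[OF d(2) u(2)] smult_eq[OF cd(2) u(2)]
      by (simp add: smult_eq gsec_scale c d u)
  }
  {
    fix y assume "y \<in> carrier (sections F U)"
    then obtain w where w: "y = sec \<epsilon> U w" "w \<in> gsec L U" unfolding carrier_eq by blast
    show "a \<odot>\<^bsub>sections F U\<^esub> (x \<oplus>\<^bsub>sections F U\<^esub> y) = a \<odot>\<^bsub>sections F U\<^esub> x \<oplus>\<^bsub>sections F U\<^esub> a \<odot>\<^bsub>sections F U\<^esub> y"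
      unfolding c(1) u(1) w(1) by (simp add: smult_eq add_eq gsec_scale gsec_add c u w vec.scale_right_distrib)
  }
qed

end

lemma sheaf_glue:
  assumes C: "\<forall>V\<in>\<C>. zopen V \<and> \<sigma> V \<in> carrier (sections F V)"
    and compat: "\<forall>V\<in>\<C>. \<forall>W\<in>\<C>. res F V (V \<inter> W) (\<sigma> V) = res F W (V \<inter> W) (\<sigma> W)"
  shows "\<exists>!s. s \<in> carrier (sections F (\<Union>\<C>)) \<and> (\<forall>V\<in>\<C>. res F (\<Union>\<C>) V s = \<sigma> V)"
proof -
  have zU: "zopen (\<Union>\<C>)" using C zopen_Union by blast
  have "\<forall>V\<in>\<C>. \<exists>v\<in>gsec L V. \<sigma> V = sec \<epsilon> V v" using C carrier_eq by blast
  then obtain v where v: "\<And>V. V \<in> \<C> \<Longrightarrow> v V \<in> gsec L V" "\<And>V. V \<in> \<C> \<Longrightarrow> \<sigma> V = sec \<epsilon> V (v V)" by metis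
  \<comment> \<open>Two nonempty members of the cover meet in the generic point, and there
    compatibility forces the underlying vectors to agree.\<close>
  have const: "v V = v W" if "V \<in> \<C>" "W \<in> \<C>" "P \<in> V" "P' \<in> W" for V W P P'
  proof -
    have z: "zopen V" "zopen W" using that C by auto
    have zVW: "zopen (V \<inter> W)" by (rule zopen_Int[OF z])
    have g: "generic_point \<in> V \<inter> W" using zopen_generic z that by blast
    have "sec \<epsilon> (V \<inter> W) (v V) = sec \<epsilon> (V \<inter> W) (v W)"
      using compat[rule_format, OF that(1,2)] v that res_eq[OF z(1) zVW, of "v V"] res_eq[OF z(2) zVW, of "v W"] by auto
    from sec_inj[OF zVW g _ _ this] show ?thesis
      using v(1)[OF that(1)] v(1)[OF that(2)] by (auto simp: gsec_def)
  qed
  \<comment> \<open>If all members of the cover are empty, the condition on \<open>v0\<close> is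
    void and any vector will do.\<close>
  obtain v0 where v0: "\<And>V P. V \<in> \<C> \<Longrightarrow> P \<in> V \<Longrightarrow> v V = v0"
  proof (cases "\<exists>V\<in>\<C>. \<exists>P. P \<in> V")
    case True
    then obtain V P where "V \<in> \<C>" "P \<in> V" by blast
    thus ?thesis using const that[of "v V"] by blast
  qed auto
  have v0U: "v0 \<in> gsec L (\<Union>\<C>)" using v(1) v0 unfolding gsec_def by fastforce
  show ?thesis
  proof (intro ex1I[of _ "sec \<epsilon> (\<Union>\<C>) v0"] conjI ballI)
    show "sec \<epsilon> (\<Union>\<C>) v0 \<in> carrier (sections F (\<Union>\<C>))" using carrier_eq[OF zU] v0U by blast
    fix V assume V: "V \<in> \<C>"
    have "res F (\<Union>\<C>) V (sec \<epsilon> (\<Union>\<C>) v0) = sec \<epsilon> V v0"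
      using V C by (intro res_eq[OF zU]) (auto simp: v0U)
    also have "\<dots> = \<sigma> V" using v(2)[OF V] v0[OF V] sec_empty[of \<epsilon> v0 "v V"] by (cases "V = {}") auto
    finally show "res F (\<Union>\<C>) V (sec \<epsilon> (\<Union>\<C>) v0) = \<sigma> V" .
  next
    fix s assume s: "s \<in> carrier (sections F (\<Union>\<C>)) \<and> (\<forall>V\<in>\<C>. res F (\<Union>\<C>) V s = \<sigma> V)"
    then obtain w where w: "s = sec \<epsilon> (\<Union>\<C>) w" "w \<in> gsec L (\<Union>\<C>)" using carrier_eq[OF zU] by blast
    show "s = sec \<epsilon> (\<Union>\<C>) v0"
    proof (cases "\<Union>\<C> = {}")
      case True
      thus ?thesis using w sec_empty by metis
    next
      case False
      then obtain V P where V: "V \<in> \<C>" "P \<in> V" by blast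
      have zV: "zopen V" using C V by blast
      have "V \<subseteq> \<Union>\<C>" using V by blast
      hence "sec \<epsilon> V w = sec \<epsilon> V (v V)" using s V w v(2)[OF V(1)] res_eq[OF zU zV _ w(2)] by simp
      hence "w = v V" using sec_inj[OF zV V(2)] v(1)[OF V(1)] w(2) V(1) by (auto simp: gsec_def)
      thus ?thesis using w v0[OF V] by simp
    qed
  qed
qed

lemma rep_sheaf: "O_module_sheaf F"
  unfolding O_module_sheaf_def
proof (intro conjI)
  show "\<forall>U. zopen U \<longrightarrow> Module.module (O_ring U) (sections F U)" using rep_module by blast
  show "\<forall>U. zopen U \<longrightarrow> (\<forall>s\<in>carrier (sections F U). res F U U s = s)"
    by (auto simp: carrier_eq res_eq)
  show "\<forall>U V W. zopen U \<longrightarrow> zopen V \<longrightarrow> zopen W \<longrightarrow> W \<subseteq> V \<longrightarrow> V \<subseteq> U \<longrightarrow>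
        (\<forall>s\<in>carrier (sections F U). res F V W (res F U V s) = res F U W s)"
    by (auto simp: carrier_eq res_eq gsec_mono)
  show "\<forall>\<C> \<sigma>. (\<forall>V\<in>\<C>. zopen V \<and> \<sigma> V \<in> carrier (sections F V)) \<longrightarrow>
        (\<forall>V\<in>\<C>. \<forall>W\<in>\<C>. res F V (V \<inter> W) (\<sigma> V) = res F W (V \<inter> W) (\<sigma> W)) \<longrightarrow>
        (\<exists>!s. s \<in> carrier (sections F (\<Union>\<C>)) \<and> (\<forall>V\<in>\<C>. res F (\<Union>\<C>) V s = \<sigma> V))"
    using sheaf_glue by blast
  show "\<forall>U V. zopen U \<longrightarrow> zopen V \<longrightarrow> V \<subseteq> U \<longrightarrow>
        res F U V \<in> carrier (sections F U) \<rightarrow> carrier (sections F V) \<and>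
        (\<forall>s\<in>carrier (sections F U). \<forall>t\<in>carrier (sections F U).
           res F U V (s \<oplus>\<^bsub>sections F U\<^esub> t) = res F U V s \<oplus>\<^bsub>sections F V\<^esub> res F U V t) \<and>
        (\<forall>f\<in>carrier (O_ring U). \<forall>s\<in>carrier (sections F U).
           res F U V (f \<odot>\<^bsub>sections F U\<^esub> s) = restrict f V \<odot>\<^bsub>sections F V\<^esub> res F U V s)"
  proof (intro allI impI conjI ballI)
    fix U V :: "('k, 'r) point set" assume z: "zopen U" "zopen V" "V \<subseteq> U"
    show "res F U V \<in> carrier (sections F U) \<rightarrow> carrier (sections F V)"
      using z by (auto simp: carrier_eq res_eq gsec_mono)
    fix s assume "s \<in> carrier (sections F U)"
    then obtain u where u: "s = sec \<epsilon> U u" "u \<in> gsec L U" using carrier_eq[OF z(1)] by blast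
    have uV: "u \<in> gsec L V" using u z gsec_mono by blast
    {
      fix t assume "t \<in> carrier (sections F U)"
      then obtain w where w: "t = sec \<epsilon> U w" "w \<in> gsec L U" using carrier_eq[OF z(1)] by blast
      have "w \<in> gsec L V" using w z gsec_mono by blast
      thus "res F U V (s \<oplus>\<^bsub>sections F U\<^esub> t) = res F U V s \<oplus>\<^bsub>sections F V\<^esub> res F U V t"
        using u w uV z by (simp add: add_eq res_eq gsec_add)
    }
    fix f assume "f \<in> carrier (O_ring U)"
    then obtain c where c: "f = (\<lambda>P\<in>U. c)" "\<forall>P\<in>U. c \<in> Oj 0 P" using O_ring_carrier[OF z(1)] by blast
    have fV: "restrict f V = (\<lambda>P\<in>V. c)" using c z by (auto simp: restrict_def fun_eq_iff)
    have cV: "\<forall>P\<in>V. c \<in> Oj 0 P" using c z by blast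
    show "res F U V (f \<odot>\<^bsub>sections F U\<^esub> s) = restrict f V \<odot>\<^bsub>sections F V\<^esub> res F U V s"
      unfolding fV res_eq[OF z u(2)] u(1) smult_eq[OF z(2) cV uV]
      unfolding c(1) smult_eq[OF z(1) c(2) u(2)]
      by (rule res_eq[OF z gsec_scale[OF z(1) c(2) u(2)]])
  qed
qed

end

text \<open>The vector underlying a section is recovered from its value at the generic point, where
  the encoding is injective. Over the empty set the recovered vector is arbitrary, but there only
  one section exists.\<close>

definition hmap :: "('k::field, 'r::{finite,linorder}) lattice \<Rightarrow> (('k, 'r) point \<Rightarrow> (nat \<Rightarrow> ('k, 'r) hfrac) \<Rightarrow> 'b) \<Rightarrow>
    (('k, 'r) point \<Rightarrow> (nat \<Rightarrow> ('k, 'r) hfrac) \<Rightarrow> 'c) \<Rightarrow> ((nat \<Rightarrow> ('k, 'r) hfrac) \<Rightarrow> nat \<Rightarrow> ('k, 'r) hfrac) \<Rightarrow>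
    ('k, 'r) point set \<Rightarrow> (('k, 'r) point \<Rightarrow> 'b) \<Rightarrow> ('k, 'r) point \<Rightarrow> 'c" where
  "hmap L \<epsilon> \<epsilon>' \<beta> U \<sigma> = sec \<epsilon>' U (\<beta> (inv_into (L generic_point) (\<epsilon> generic_point) (\<sigma> generic_point)))"

text \<open>Linearity is asked of \<open>\<beta>\<close> only on the stalks over \<open>W\<close>.
  This covers linear maps of the whole space as well as coordinates with respect to a local basis,
  which make sense only on the span of that basis.\<close>

locale lattice_map = A: represented F L \<epsilon> + B: represented F' L' \<epsilon>'
  for F :: "('k::field, 'r::{finite,linorder}, ('k, 'r) point \<Rightarrow> 'b) psheaf" and L \<epsilon>
    and F' :: "('k, 'r, ('k, 'r) point \<Rightarrow> 'c) psheaf" and L' \<epsilon>' +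
  fixes W :: "('k, 'r) point set" and \<beta>
  assumes \<beta>_in: "P \<in> W \<Longrightarrow> v \<in> L P \<Longrightarrow> \<beta> v \<in> L' P"
    and \<beta>_add: "P \<in> W \<Longrightarrow> v \<in> L P \<Longrightarrow> w \<in> L P \<Longrightarrow> \<beta> (v + w) = \<beta> v + \<beta> w"
    and \<beta>_scale: "P \<in> W \<Longrightarrow> v \<in> L P \<Longrightarrow> c \<in> Oj 0 P \<Longrightarrow> \<beta> (c *v v) = c *v \<beta> v"
begin

lemma hmap_sec: "zopen U \<Longrightarrow> v \<in> gsec L U \<Longrightarrow> hmap L \<epsilon> \<epsilon>' \<beta> U (sec \<epsilon> U v) = sec \<epsilon>' U (\<beta> v)"
proof (cases "U = {}")
  case True
  thus ?thesis unfolding hmap_def using sec_empty by metis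
next
  case False
  assume U: "zopen U" "v \<in> gsec L U"
  hence g: "generic_point \<in> U" using False zopen_generic by blast
  hence "v \<in> L generic_point" using U by (auto simp: gsec_def)
  moreover have "inj_on (\<epsilon> generic_point) (L generic_point)"
    using A.rep generic_in_proj_space unfolding represents_def by blast
  ultimately show ?thesis unfolding hmap_def using g by (simp add: sec_def)
qed

lemma \<beta>_gsec: "U \<subseteq> W \<Longrightarrow> v \<in> gsec L U \<Longrightarrow> \<beta> v \<in> gsec L' U"
  using \<beta>_in by (auto simp: gsec_def)

lemma hom: "O_hom_on W F F' (hmap L \<epsilon> \<epsilon>' \<beta>)"
  unfolding O_hom_on_def
proof (intro conjI allI impI ballI)
  fix U assume U: "zopen U" "U \<subseteq> W"
  show "hmap L \<epsilon> \<epsilon>' \<beta> U \<in> carrier (sections F U) \<rightarrow> carrier (sections F' U)"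
    using U by (auto simp: A.carrier_eq B.carrier_eq hmap_sec \<beta>_gsec)
  fix s assume "s \<in> carrier (sections F U)"
  then obtain u where u: "s = sec \<epsilon> U u" "u \<in> gsec L U" using A.carrier_eq[OF U(1)] by blast
  {
    fix t assume "t \<in> carrier (sections F U)"
    then obtain w where w: "t = sec \<epsilon> U w" "w \<in> gsec L U" using A.carrier_eq[OF U(1)] by blast
    have "sec \<epsilon>' U (\<beta> (u + w)) = sec \<epsilon>' U (\<beta> u + \<beta> w)"
    proof (cases "U = {}")
      case False
      then obtain P where "P \<in> U" by blast
      thus ?thesis using \<beta>_add[of P u w] u w U by (auto simp: gsec_def)
    qed (use sec_empty in metis)
    thus "hmap L \<epsilon> \<epsilon>' \<beta> U (s \<oplus>\<^bsub>sections F U\<^esub> t) = hmap L \<epsilon> \<epsilon>' \<beta> U s \<oplus>\<^bsub>sections F' U\<^esub> hmap L \<epsilon> \<epsilon>' \<beta> U t"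
      using u w U by (simp add: A.add_eq B.add_eq hmap_sec A.gsec_add \<beta>_gsec)
  }
  fix f assume "f \<in> carrier (O_ring U)"
  then obtain c where c: "f = (\<lambda>P\<in>U. c)" "\<forall>P\<in>U. c \<in> Oj 0 P" using O_ring_carrier[OF U(1)] by blast
  have "sec \<epsilon>' U (\<beta> (c *v u)) = sec \<epsilon>' U (c *v \<beta> u)"
  proof (cases "U = {}")
    case False
    then obtain P where "P \<in> U" by blast
    thus ?thesis using \<beta>_scale[of P u c] u c U by (auto simp: gsec_def)
  qed (use sec_empty in metis)
  thus "hmap L \<epsilon> \<epsilon>' \<beta> U (f \<odot>\<^bsub>sections F U\<^esub> s) = f \<odot>\<^bsub>sections F' U\<^esub> hmap L \<epsilon> \<epsilon>' \<beta> U s"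
    unfolding c(1) u(1) A.smult_eq[OF U(1) c(2) u(2)] hmap_sec[OF U(1) u(2)]
      hmap_sec[OF U(1) A.gsec_scale[OF U(1) c(2) u(2)]] B.smult_eq[OF U(1) c(2) \<beta>_gsec[OF U(2) u(2)]] .
next
  fix U V s assume z: "zopen U" "zopen V" "V \<subseteq> U" "U \<subseteq> W" and s: "s \<in> carrier (sections F U)"
  then obtain u where u: "s = sec \<epsilon> U u" "u \<in> gsec L U" using A.carrier_eq[OF z(1)] by blast
  thus "hmap L \<epsilon> \<epsilon>' \<beta> V (res F U V s) = res F' U V (hmap L \<epsilon> \<epsilon>' \<beta> U s)"
    using z gsec_mono[OF z(3) u(2)] \<beta>_gsec[OF z(4) u(2)] by (simp add: hmap_sec A.res_eq B.res_eq)
qed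

lemma iso:
  assumes W: "W \<subseteq> proj_space" and bij: "\<And>P. P \<in> W \<Longrightarrow> bij_betw \<beta> (L P) (L' P)"
  shows "O_iso_on W F F'"
  unfolding O_iso_on_def
proof (intro exI conjI allI impI)
  show "O_hom_on W F F' (hmap L \<epsilon> \<epsilon>' \<beta>)" by (rule hom)
  fix U assume U: "zopen U" "U \<subseteq> W"
  show "bij_betw (hmap L \<epsilon> \<epsilon>' \<beta> U) (carrier (sections F U)) (carrier (sections F' U))"
  proof (cases "U = {}")
    case True
    have "sec \<epsilon> U v = sec \<epsilon> U 0" "sec \<epsilon>' U w = sec \<epsilon>' U 0" for v w
      unfolding True by (rule sec_empty)+
    hence "carrier (sections F U) = {sec \<epsilon> U 0}" "carrier (sections F' U) = {sec \<epsilon>' U 0}"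
      "hmap L \<epsilon> \<epsilon>' \<beta> U (sec \<epsilon> U 0) = sec \<epsilon>' U 0"
      using A.gsec_0[OF U(1)] B.gsec_0[OF U(1)]
      unfolding A.carrier_eq[OF U(1)] B.carrier_eq[OF U(1)] hmap_sec[OF U(1) A.gsec_0[OF U(1)]]
      by blast+
    thus ?thesis by (simp add: bij_betw_def)
  next
    case False
    hence g: "generic_point \<in> U" using U zopen_generic by blast
    have inj: "inj_on \<beta> (L generic_point)" using bij g U by (auto simp: bij_betw_def)
    show ?thesis unfolding bij_betw_def
    proof
      show "inj_on (hmap L \<epsilon> \<epsilon>' \<beta> U) (carrier (sections F U))"
      proof (rule inj_onI)
        fix s t assume s: "s \<in> carrier (sections F U)" and t: "t \<in> carrier (sections F U)"
          and eq: "hmap L \<epsilon> \<epsilon>' \<beta> U s = hmap L \<epsilon> \<epsilon>' \<beta> U t"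
        obtain u w where u: "s = sec \<epsilon> U u" "u \<in> gsec L U" and w: "t = sec \<epsilon> U w" "w \<in> gsec L U"
          using s t A.carrier_eq[OF U(1)] by blast
        have "sec \<epsilon>' U (\<beta> u) = sec \<epsilon>' U (\<beta> w)" using eq u w U by (simp add: hmap_sec)
        hence "\<beta> u = \<beta> w" using B.sec_inj[OF U(1) g] u w U \<beta>_gsec by blast
        hence "u = w" using inj u w g by (auto simp: inj_on_def gsec_def)
        thus "s = t" using u w by simp
      qed
      show "hmap L \<epsilon> \<epsilon>' \<beta> U ` carrier (sections F U) = carrier (sections F' U)"
      proof
        show "hmap L \<epsilon> \<epsilon>' \<beta> U ` carrier (sections F U) \<subseteq> carrier (sections F' U)"
          using hom U unfolding O_hom_on_def by blast
        show "carrier (sections F' U) \<subseteq> hmap L \<epsilon> \<epsilon>' \<beta> U ` carrier (sections F U)"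
        proof
          fix t assume "t \<in> carrier (sections F' U)"
          then obtain w where w: "t = sec \<epsilon>' U w" "w \<in> gsec L' U" using B.carrier_eq[OF U(1)] by blast
          have pre: "\<exists>v\<in>L P. \<beta> v = w" if "P \<in> U" for P
          proof -
            have "w \<in> \<beta> ` L P" using w that bij[of P] U by (auto simp: bij_betw_def gsec_def)
            thus ?thesis by blast
          qed
          obtain v where v: "v \<in> L generic_point" "\<beta> v = w" using pre[OF g] by blast
          \<comment> \<open>The preimages of \<open>w\<close> found at the various points all lie in
            the generic stalk, where \<open>\<beta>\<close> is injective; so a single vector works
            over all of \<open>U\<close>.\<close>
          have "v \<in> L P" if P: "P \<in> U" for P
          proof -
            obtain v' where v': "v' \<in> L P" "\<beta> v' = w" using pre[OF P] by blast
            have "v' \<in> L generic_point" using A.L_generic[OF _ v'(1)] P U W by blast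
            thus ?thesis using inj v v' by (auto simp: inj_on_def)
          qed
          hence "v \<in> gsec L U" by (simp add: gsec_def)
          thus "t \<in> hmap L \<epsilon> \<epsilon>' \<beta> U ` carrier (sections F U)"
            using v w U by (intro image_eqI[of _ _ "sec \<epsilon> U v"]) (auto simp: hmap_sec A.carrier_eq)
        qed
      qed
    qed
  qed
qed

end

text \<open>Exactness is tested on stalks, with the inclusion of lattices as first map. A preimage
  at one point is a section on a neighbourhood, because the middle lattice is locally free; this
  gives local surjectivity.\<close>

lemma short_exactI:
  fixes F :: "('k::field, 'r::{finite,linorder}, ('k, 'r) point \<Rightarrow> 'b) psheaf"
  assumes r': "represented F' L' \<epsilon>'" and r: "represented F L \<epsilon>" and r'': "represented F'' L'' \<epsilon>''"
    and \<beta>: "lin \<beta>"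
    and ker: "\<And>P. P \<in> proj_space \<Longrightarrow> L' P = {v \<in> L P. \<beta> v = 0}"
    and im: "\<And>P. P \<in> proj_space \<Longrightarrow> \<beta> ` L P = L'' P"
  shows "short_exact F' F F''"
proof -
  interpret r': represented F' L' \<epsilon>' by (rule r')
  interpret r: represented F L \<epsilon> by (rule r)
  interpret r'': represented F'' L'' \<epsilon>'' by (rule r'')
  interpret a: lattice_map F' L' \<epsilon>' F L \<epsilon> proj_space id
    by unfold_locales (use ker in auto)
  interpret b: lattice_map F L \<epsilon> F'' L'' \<epsilon>'' proj_space \<beta>
    by unfold_locales (use im in \<open>auto simp: lin_add[OF \<beta>] lin_scale[OF \<beta>]\<close>)
  let ?\<phi> = "hmap L' \<epsilon>' \<epsilon> id" and ?\<psi> = "hmap L \<epsilon> \<epsilon>'' \<beta>"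
  show ?thesis unfolding short_exact_def
  proof (rule exI[of _ ?\<phi>], rule exI[of _ ?\<psi>], intro conjI allI impI ballI)
    show "O_hom_on proj_space F' F ?\<phi>" by (rule a.hom)
    show "O_hom_on proj_space F F'' ?\<psi>" by (rule b.hom)
    fix U :: "('k, 'r) point set" assume U: "zopen U"
    have UP: "U \<subseteq> proj_space" using zopen_subset[OF U] .
    have sub: "v \<in> gsec L' U \<Longrightarrow> v \<in> gsec L U" for v using a.\<beta>_gsec[OF UP] by simp
    show "inj_on (?\<phi> U) (carrier (sections F' U))"
    proof (rule inj_onI)
      fix s t assume s: "s \<in> carrier (sections F' U)" and t: "t \<in> carrier (sections F' U)" and eq: "?\<phi> U s = ?\<phi> U t"
      obtain u w where u: "s = sec \<epsilon>' U u" "u \<in> gsec L' U" and w: "t = sec \<epsilon>' U w" "w \<in> gsec L' U"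
        using s t r'.carrier_eq[OF U] by blast
      have eq': "sec \<epsilon> U u = sec \<epsilon> U w" using eq u w U by (simp add: a.hmap_sec)
      show "s = t"
      proof (cases "U = {}")
        case True
        thus ?thesis using u w sec_empty by metis
      next
        case False
        then obtain P where "P \<in> U" by blast
        from r.sec_inj[OF U this sub[OF u(2)] sub[OF w(2)] eq'] show ?thesis using u w by simp
      qed
    qed
    show "{s \<in> carrier (sections F U). ?\<psi> U s = \<zero>\<^bsub>sections F'' U\<^esub>} = ?\<phi> U ` carrier (sections F' U)"
    proof (intro equalityI subsetI)
      fix s assume "s \<in> {s \<in> carrier (sections F U). ?\<psi> U s = \<zero>\<^bsub>sections F'' U\<^esub>}"
      then obtain u where u: "s = sec \<epsilon> U u" "u \<in> gsec L U" "?\<psi> U s = \<zero>\<^bsub>sections F'' U\<^esub>"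
        using r.carrier_eq[OF U] by blast
      have eq: "sec \<epsilon>'' U (\<beta> u) = sec \<epsilon>'' U 0" using u U by (simp add: b.hmap_sec r''.zero_eq)
      show "s \<in> ?\<phi> U ` carrier (sections F' U)"
      proof (cases "U = {}")
        case True
        have "s = sec \<epsilon> U 0" using u True sec_empty by metis
        thus ?thesis
          using r'.gsec_0[OF U] by (intro image_eqI[of _ _ "sec \<epsilon>' U 0"]) (auto simp: a.hmap_sec U r'.carrier_eq)
      next
        case False
        then obtain P where "P \<in> U" by blast
        from r''.sec_inj[OF U this b.\<beta>_gsec[OF UP u(2)] r''.gsec_0[OF U] eq] have "\<beta> u = 0" .
        hence "u \<in> gsec L' U" using ker u(2) UP by (auto simp: gsec_def)
        thus ?thesis
          using u by (intro image_eqI[of _ _ "sec \<epsilon>' U u"]) (auto simp: a.hmap_sec U r'.carrier_eq)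
      qed
    next
      fix s assume "s \<in> ?\<phi> U ` carrier (sections F' U)"
      then obtain u where u: "s = sec \<epsilon> U u" "u \<in> gsec L' U"
        using r'.carrier_eq[OF U] a.hmap_sec[OF U] by auto
      have eq: "sec \<epsilon>'' U (\<beta> u) = sec \<epsilon>'' U 0"
      proof (cases "U = {}")
        case False
        then obtain P where "P \<in> U" by blast
        hence "\<beta> u = 0" using u(2) ker UP by (auto simp: gsec_def)
        thus ?thesis by simp
      qed (use sec_empty in metis)
      thus "s \<in> {s \<in> carrier (sections F U). ?\<psi> U s = \<zero>\<^bsub>sections F'' U\<^esub>}"
        using u sub[OF u(2)] U by (auto simp: b.hmap_sec r.carrier_eq r''.zero_eq)
    qed
    fix t P assume t: "t \<in> carrier (sections F'' U)" and P: "P \<in> U"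
    obtain w where w: "t = sec \<epsilon>'' U w" "w \<in> gsec L'' U" using t r''.carrier_eq[OF U] by blast
    have P': "P \<in> proj_space" using UP P by blast
    have "w \<in> \<beta> ` L P" using w(2) P im[OF P'] by (auto simp: gsec_def)
    then obtain v where v: "v \<in> L P" "\<beta> v = w" by blast
    obtain V where V: "zopen V" "P \<in> V" "\<forall>R\<in>V. v \<in> L R"
      using loc_free_near[OF r.lf P' v(1)] unfolding near_def by blast
    have z: "zopen (V \<inter> U)" by (rule zopen_Int[OF V(1) U])
    have vV: "v \<in> gsec L (V \<inter> U)" using V by (auto simp: gsec_def)
    have "res F'' U (V \<inter> U) t = ?\<psi> (V \<inter> U) (sec \<epsilon> (V \<inter> U) v)"
      unfolding w(1) b.hmap_sec[OF z vV] v(2) by (rule r''.res_eq[OF U z _ w(2)]) simp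
    thus "\<exists>V. zopen V \<and> P \<in> V \<and> V \<subseteq> U \<and> res F'' U V t \<in> ?\<psi> V ` carrier (sections F V)"
      using z V(2) P vV r.carrier_eq[OF z] by (intro exI[of _ "V \<inter> U"]) auto
  qed
qed

section \<open>Direct sums of line bundles\<close>

definition DS :: "nat set \<Rightarrow> (nat \<Rightarrow> int) \<Rightarrow> ('k::field, 'r::{finite,linorder}) lattice" where
  "DS I m P = {v. (\<forall>a\<in>I. v a \<in> Oj (m a) P) \<and> (\<forall>a. a \<notin> I \<longrightarrow> v a = 0)}"

definition unitv :: "nat \<Rightarrow> nat \<Rightarrow> 'a::field" where
  "unitv a = (\<lambda>b. if b = a then 1 else 0)"

lemma lincomb_scaled_units:
  assumes "finite I"
  shows "lincomb x I (\<lambda>a. y a *v unitv a) = (\<lambda>b. if b \<in> I then x b * y b else 0)"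
proof
  fix b
  have "lincomb x I (\<lambda>a. y a *v unitv a) b = (\<Sum>a\<in>I. if a = b then x b * y b else 0)"
    unfolding lincomb_def sum_fun_apply by (rule sum.cong) (auto simp: vec_apply unitv_def)
  thus "lincomb x I (\<lambda>a. y a *v unitv a) b = (if b \<in> I then x b * y b else 0)" using assms by simp
qed

lemma DS_basis:
  assumes R: "R \<in> proj_space" "Y_var i \<notin> R" and I: "finite I"
  shows "DS I m R = aspan (Oj 0 R) I (\<lambda>a. yv i powi m a *v unitv a)"
proof (intro equalityI subsetI)
  fix v assume v: "v \<in> DS I m R"
  have "yv i powi (- m a) * v a \<in> Oj 0 R" if "a \<in> I" for a
    using yv_powi_mult_in[OF R, of "- m a" "v a" "m a"] v that by (simp add: DS_def)
  moreover have "v = lincomb (\<lambda>a. yv i powi (- m a) * v a) I (\<lambda>a. yv i powi m a *v unitv a)"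
    unfolding lincomb_scaled_units[OF I] using v by (auto simp: DS_def fun_eq_iff power_int_minus)
  ultimately show "v \<in> aspan (Oj 0 R) I (\<lambda>a. yv i powi m a *v unitv a)" by (auto intro: aspanI)
next
  fix v assume "v \<in> aspan (Oj 0 R) I (\<lambda>a. yv i powi m a *v unitv a)"
  then obtain x where x: "v = lincomb x I (\<lambda>a. yv i powi m a *v unitv a)" "\<forall>a\<in>I. x a \<in> Oj 0 R"
    unfolding aspan_iff by blast
  have "x a * yv i powi m a \<in> Oj (m a) R" if "a \<in> I" for a
    using Oj_mult[OF R(1) x(2)[rule_format, OF that] yv_powi_in[OF R, of "m a"]] by simp
  thus "v \<in> DS I m R" unfolding x lincomb_scaled_units[OF I] DS_def by auto
qed

lemma indep_scaled_units: "finite I \<Longrightarrow> (\<And>a. a \<in> I \<Longrightarrow> y a \<noteq> 0) \<Longrightarrow> indep I (\<lambda>a. y a *v unitv a)"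
  unfolding indep_def by (auto simp: lincomb_scaled_units vec_apply fun_eq_iff split: if_splits)

lemma loc_free_DS:
  assumes I: "finite A"
  shows "loc_free (DS A m :: ('k::field, 'r::{finite,linorder}) lattice)"
proof (rule loc_freeI)
  fix P :: "('k, 'r) point" assume P: "P \<in> proj_space"
  obtain i where i: "Y_var i \<notin> P" using point_facts(6)[OF P] by blast
  have "near P (\<lambda>R. DS A m R = aspan (Oj 0 R) A (\<lambda>a. yv i powi m a *v unitv a))"
    by (rule near_mono[OF near_nonvanishing[OF homogeneous_Y(1) P i]]) (rule DS_basis[OF _ _ I])
  moreover have "indep A (\<lambda>a. (yv i :: ('k, 'r) hfrac) powi m a *v unitv a)" by (rule indep_scaled_units[OF I]) simp
  ultimately show "\<exists>(I :: nat set) J. finite I \<and> indep I J \<and> near P (\<lambda>R. DS A m R = aspan (Oj 0 R) I J)"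
    using I by blast
qed

lemma represents_free:
  "represents (free_sheaf n j :: ('k::field, 'r::{finite,linorder}, _) psheaf) (DS {..<n} (\<lambda>_. j)) (\<lambda>P v. v)"
  unfolding represents_def
proof (intro conjI allI impI ballI)
  fix P :: "('k, 'r) point"
  show "inj_on (\<lambda>v. v) (DS {..<n} (\<lambda>_. j) P)" by simp
next
  fix U :: "('k, 'r) point set" assume U: "zopen U"
  have "free_sections n j U = sec (\<lambda>P v. v) U ` gsec (DS {..<n} (\<lambda>_. j)) U"
  proof (intro equalityI subsetI)
    fix s assume s: "s \<in> free_sections n j U"
    hence "\<forall>a<n. \<exists>q. (\<lambda>P\<in>U. s P a) = (\<lambda>P\<in>U. q) \<and> (\<forall>P\<in>U. q \<in> Oj j P)"
      unfolding free_sections_def O_sections_eq[OF U] by blast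
    then obtain q where q: "\<And>a. a < n \<Longrightarrow> (\<lambda>P\<in>U. s P a) = (\<lambda>P\<in>U. q a)" "\<And>a P. a < n \<Longrightarrow> P \<in> U \<Longrightarrow> q a \<in> Oj j P"
      by metis
    define v where "v a = (if a < n then q a else 0)" for a
    have "s P = v" if "P \<in> U" for P
    proof
      fix a
      show "s P a = v a" 
        using s that fun_cong[OF q(1), of a P] by (cases "a < n") (auto simp: v_def free_sections_def)
    qed
    hence "s = sec (\<lambda>P v. v) U v"
      using s by (intro ext) (auto simp: sec_def restrict_def free_sections_def extensional_def)
    moreover have "v \<in> gsec (DS {..<n} (\<lambda>_. j)) U" using q(2) by (auto simp: gsec_def DS_def v_def)
    ultimately show "s \<in> sec (\<lambda>P v. v) U ` gsec (DS {..<n} (\<lambda>_. j)) U" by blast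
  next
    fix s assume "s \<in> sec (\<lambda>P v. v) U ` gsec (DS {..<n} (\<lambda>_. j)) U"
    then obtain v where v: "s = sec (\<lambda>P v. v) U v" "\<forall>P\<in>U. v \<in> DS {..<n} (\<lambda>_. j) P" by (auto simp: gsec_def)
    have "(\<lambda>P\<in>U. s P a) \<in> O_sections j U" if "a < n" for a
      unfolding O_sections_eq[OF U]
    proof (intro CollectI exI[of _ "v a"] conjI)
      show "(\<lambda>P\<in>U. s P a) = (\<lambda>P\<in>U. v a)" by (auto simp: v sec_def restrict_def)
      show "\<forall>P\<in>U. v a \<in> Oj j P" using v that by (auto simp: DS_def)
    qed
    thus "s \<in> free_sections n j U" using v by (auto simp: free_sections_def sec_def DS_def)
  qed
  thus "carrier (sections (free_sheaf n j) U) = sec (\<lambda>P v. v) U ` gsec (DS {..<n} (\<lambda>_. j)) U"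
    by (simp add: free_sheaf_def)
qed (auto simp: free_sheaf_def sec_def restrict_def vec_apply fun_eq_iff)

lemma represented_free: "represented (free_sheaf n j) (DS {..<n} (\<lambda>_. j)) (\<lambda>P v. v)"
  by (simp add: represented_def represents_free loc_free_DS)

text \<open>The value of a section is the singleton of its vector. This places the sheaf in the type
  of presheaves on which the Chern classes \<open>C\<close> are defined.\<close>

definition lsheaf :: "('k::field, 'r::{finite,linorder}) lattice \<Rightarrow>
    ('k, 'r, ('k, 'r) point \<Rightarrow> (nat \<Rightarrow> ('k, 'r) hfrac) set) psheaf" where
  "lsheaf L = \<lparr>sections = (\<lambda>U. \<lparr>carrier = sec (\<lambda>P v. {v}) U ` gsec L U, monoid.mult = undefined, one = undefined,
        zero = sec (\<lambda>P v. {v}) U 0, add = (\<lambda>s t. \<lambda>P\<in>U. {u + w |u w. u \<in> s P \<and> w \<in> t P}),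
        module.smult = (\<lambda>f s. \<lambda>P\<in>U. {f P *v u |u. u \<in> s P})\<rparr>),
      res = (\<lambda>U V s. restrict s V)\<rparr>"

lemma restrict_sec: "V \<subseteq> U \<Longrightarrow> restrict (sec \<epsilon> U v) V = sec \<epsilon> V v"
  by (rule ext) (auto simp: sec_def restrict_def)

lemma represented_lsheaf:
  fixes L :: "('k::field, 'r::{finite,linorder}) lattice"
  assumes "loc_free L"
  shows "represented (lsheaf L) L (\<lambda>P v. {v})"
proof -
  have "{u + w |u w. u \<in> {a} \<and> w \<in> {b}} = {a + b}" "{c *v u |u. u \<in> {a}} = {c *v a}"
    for a b :: "nat \<Rightarrow> ('k, 'r) hfrac" and c by auto
  thus ?thesis using assms
    unfolding represented_def represents_def lsheaf_def
    by (simp add: restrict_sec) (auto simp: sec_def restrict_def inj_on_def intro!: ext)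
qed

lemma (in represented) vector_bundle: "vector_bundle F"
  unfolding vector_bundle_def
proof (intro conjI ballI)
  show "O_module_sheaf F" by (rule rep_sheaf)
  fix P :: "('k, 'r) point" assume P: "P \<in> proj_space"
  obtain N :: nat and b where b: "indep {..<N} b" "near P (\<lambda>R. L R = aspan (Oj 0 R) {..<N} b)"
    by (rule loc_freeE[OF lf P])
  obtain V where V: "zopen V" "P \<in> V" "\<And>R. R \<in> V \<Longrightarrow> L R = aspan (Oj 0 R) {..<N} b"
    using b(2) unfolding near_def by blast
  \<comment> \<open>Coordinates with respect to \<open>b\<close>. They are unique on the span of
    \<open>b\<close>; elsewhere the chosen value is arbitrary.\<close>
  define \<beta> where "\<beta> v = (\<lambda>a. if a < N then (SOME x. v = lincomb x {..<N} b) a else 0)" for v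
  have \<beta>: "\<beta> (lincomb x {..<N} b) = (\<lambda>a. if a < N then x a else 0)" for x
  proof -
    have "lincomb x {..<N} b = lincomb (SOME y. lincomb x {..<N} b = lincomb y {..<N} b) {..<N} b"
      by (rule someI[of _ x]) simp
    from indep_unique[OF b(1) this] show ?thesis unfolding \<beta>_def by auto
  qed
  have LV: "\<exists>x. v = lincomb x {..<N} b \<and> (\<forall>a<N. x a \<in> Oj 0 R)" if "R \<in> V" "v \<in> L R" for R v
    using that V(3)[OF that(1)] by (auto simp: aspan_iff)
  interpret f: represented "free_sheaf N 0" "DS {..<N} (\<lambda>_. 0)" "\<lambda>P v. v" by (rule represented_free)
  interpret lattice_map F L \<epsilon> "free_sheaf N 0" "DS {..<N} (\<lambda>_. 0)" "\<lambda>P v. v" V \<beta>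
  proof unfold_locales
    fix R v assume R: "R \<in> V" and v: "v \<in> L R"
    obtain x where x: "v = lincomb x {..<N} b" "\<forall>a<N. x a \<in> Oj 0 R" using LV[OF R v] by blast
    show "\<beta> v \<in> DS {..<N} (\<lambda>_. 0) R" using x by (auto simp: \<beta> DS_def)
    show "\<beta> (c *v v) = c *v \<beta> v" for c
      unfolding x lincomb_scale \<beta> by (auto simp: vec_apply)
    fix w assume w: "w \<in> L R"
    obtain y where y: "w = lincomb y {..<N} b" using LV[OF R w] by blast
    show "\<beta> (v + w) = \<beta> v + \<beta> w"
      unfolding x y lincomb_add \<beta> by (auto simp: vec_apply)
  qed
  have "O_iso_on V F (free_sheaf N 0)"
  proof (rule iso)
    show "V \<subseteq> proj_space" by (rule zopen_subset[OF V(1)])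
    fix R assume R: "R \<in> V"
    show "bij_betw \<beta> (L R) (DS {..<N} (\<lambda>_. 0) R)"
    proof (rule bij_betw_imageI)
      show "inj_on \<beta> (L R)"
      proof (rule inj_onI)
        fix v w assume v: "v \<in> L R" and w: "w \<in> L R" and eq: "\<beta> v = \<beta> w"
        obtain x where x: "v = lincomb x {..<N} b" using LV[OF R v] by blast
        obtain y where y: "w = lincomb y {..<N} b" using LV[OF R w] by blast
        have "x a = y a" if "a < N" for a using fun_cong[OF eq, of a] that unfolding x y \<beta> by simp
        thus "v = w" unfolding x y by (intro lincomb_cong) auto
      qed
      show "\<beta> ` L R = DS {..<N} (\<lambda>_. 0) R"
      proof
        show "\<beta> ` L R \<subseteq> DS {..<N} (\<lambda>_. 0) R" using \<beta>_in R by blast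
        show "DS {..<N} (\<lambda>_. 0) R \<subseteq> \<beta> ` L R"
        proof
          fix x assume x: "x \<in> DS {..<N} (\<lambda>_. 0) R"
          have "lincomb x {..<N} b \<in> L R" using x V(3)[OF R] by (auto simp: DS_def aspan_iff)
          moreover have "x = \<beta> (lincomb x {..<N} b)" unfolding \<beta> using x by (auto simp: DS_def)
          ultimately show "x \<in> \<beta> ` L R" by blast
        qed
      qed
    qed
  qed
  thus "\<exists>U n. zopen U \<and> P \<in> U \<and> O_iso_on U F (free_sheaf n 0)" using V by blast
qed

section \<open>Congruences between total Chern classes\<close>

text \<open>Congruence modulo the ideal of the integral polynomials in \<open>h\<close> generated by
  \<open>p\<close> and \<open>h^q\<close>. For \<open>q\<close> at most the number of variables,
  representatives modulo \<open>h^r\<close> can be used without further care.\<close>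

definition cg :: "nat \<Rightarrow> nat \<Rightarrow> int poly \<Rightarrow> int poly \<Rightarrow> bool" where
  "cg p q f g \<longleftrightarrow> (\<forall>n<q. int p dvd coeff (f - g) n)"

lemma cg_refl [simp]: "cg p q f f"
  by (simp add: cg_def)

lemma cg_sym: "cg p q f g \<Longrightarrow> cg p q g f"
  unfolding cg_def by (auto simp: dvd_diff_commute)

lemma cg_trans: "cg p q f g \<Longrightarrow> cg p q g h \<Longrightarrow> cg p q f h"
  unfolding cg_def
proof (intro allI impI)
  fix n assume *: "\<forall>n<q. int p dvd coeff (f - g) n" "\<forall>n<q. int p dvd coeff (g - h) n" "n < q"
  have "int p dvd coeff (f - g) n + coeff (g - h) n" using * by (intro dvd_add) auto
  thus "int p dvd coeff (f - h) n" by simp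
qed

lemma cg_mult_left: "cg p q f g \<Longrightarrow> cg p q (h * f) (h * g)"
proof -
  assume *: "cg p q f g"
  have "int p dvd coeff (h * (f - g)) n" if "n < q" for n
    unfolding coeff_mult using * that by (intro dvd_sum) (auto simp: cg_def)
  thus ?thesis unfolding cg_def by (simp add: right_diff_distrib)
qed

lemma cg_mult: "cg p q f g \<Longrightarrow> cg p q f' g' \<Longrightarrow> cg p q (f * f') (g * g')"
  using cg_mult_left[of p q f g f'] cg_mult_left[of p q f' g' g] cg_trans[of p q "f * f'" "g * f'" "g * g'"]
  by (simp add: mult.commute)

lemma cg_prod: "(\<And>i. i \<in> I \<Longrightarrow> cg p q (f i) (g i)) \<Longrightarrow> cg p q (\<Prod>i\<in>I. f i) (\<Prod>i\<in>I. g i)"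
  by (induction I rule: infinite_finite_induct) (auto intro: cg_mult)

text \<open>A polynomial with constant term 1 is invertible as a power series; the cancellation
  solves for the coefficients from the bottom upwards.\<close>

lemma cg_cancel:
  assumes h: "coeff h 0 = 1" and fg: "cg p q (f * h) (g * h)"
  shows "cg p q f g"
  unfolding cg_def
proof (intro allI impI)
  fix n show "n < q \<Longrightarrow> int p dvd coeff (f - g) n"
  proof (induction n rule: less_induct)
    case (less n)
    have "coeff ((f - g) * h) n = (\<Sum>i\<le>n. coeff (f - g) i * coeff h (n - i))" by (rule coeff_mult)
    also have "\<dots> = coeff (f - g) n + (\<Sum>i<n. coeff (f - g) i * coeff h (n - i))"
      using h by (simp add: lessThan_Suc_atMost[symmetric])
    finally have "coeff (f - g) n = coeff ((f - g) * h) n - (\<Sum>i<n. coeff (f - g) i * coeff h (n - i))" by simp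
    moreover have "int p dvd coeff ((f - g) * h) n" using fg less by (simp add: cg_def left_diff_distrib)
    moreover have "int p dvd (\<Sum>i<n. coeff (f - g) i * coeff h (n - i))"
      using less by (intro dvd_sum dvd_mult2) auto
    ultimately show ?case by simp
  qed
qed

lemma cg_monom: "monom 1 r dvd f - g \<Longrightarrow> q \<le> r \<Longrightarrow> cg p q f g"
  unfolding cg_def by (auto simp: monom_1_dvd_iff')

text \<open>
  Modulo \<open>p\<close>, \<open>\<Prod>\<^sub>i (x + i - \<delta>)\<close> is invariant under \<open>x \<mapsto> x + 1\<close>; comparing coefficients from the top
  shows that only the terms of degree \<open>p\<close>, \<open>1\<close> and \<open>0\<close> survive.
\<close>

lemma falling_coeff:
  fixes \<delta> :: int
  assumes p: "prime p" and k: "2 \<le> k" "k < p"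
  shows "int p dvd coeff (\<Prod>i<p. [:int i - \<delta>, 1:]) k"
proof -
  define F where "F = (\<Prod>i<p. [:int i - \<delta>, 1:])"
  define s where "s = coeff F"
  define D where "D = pcompose F [:1, 1:] - F"
  have degF: "degree F = p" and sp: "s p = 1"
  proof -
    have "degree F = (\<Sum>i<p. degree [:int i - \<delta>, 1:])" unfolding F_def by (rule degree_prod_eq_sum_degree) auto
    thus "degree F = p" by simp
    have "lead_coeff F = 1" unfolding F_def by (simp add: lead_coeff_prod)
    thus "s p = 1" unfolding s_def using \<open>degree F = p\<close> by simp
  qed
  have shift: "pcompose F [:1, 1:] = (\<Prod>i<p. [:int (Suc i) - \<delta>, 1:])"
    unfolding F_def pcompose_prod by (rule prod.cong) (auto simp: pcompose_pCons algebra_simps)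
  \<comment> \<open>The shift trades the factor with \<open>i = 0\<close> for one with
    \<open>i = p\<close>. These agree modulo \<open>p\<close>, so \<open>p\<close> divides the
    product of \<open>D\<close> with a monic linear factor, and then \<open>D\<close>
    itself.\<close>
  have "[:int 0 - \<delta>, 1:] * pcompose F [:1, 1:] = F * [:int p - \<delta>, 1:]"
    unfolding shift unfolding F_def
    using prod.lessThan_Suc_shift[of "\<lambda>i. [:int i - \<delta>, 1:]" p] by (metis prod.lessThan_Suc)
  hence "[:- \<delta>, 1:] * pcompose F [:1, 1:] = F * [:int p - \<delta>, 1:]" by (simp only: of_nat_0 diff_0)
  also have "\<dots> = [:- \<delta>, 1:] * F + [:int p:] * F"
    by (simp add: algebra_simps smult_add_left[symmetric])
  finally have "[:- \<delta>, 1:] * D = [:int p:] * F" unfolding D_def by (simp add: algebra_simps)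
  hence dvd: "[:int p:] dvd [:- \<delta>, 1:] * D" by (metis dvd_triv_left)
  have pp: "prime_elem [:int p:]" using p by (simp add: prime_elem_const_poly_iff)
  have "\<not> [:int p:] dvd [:- \<delta>, 1:]"
    unfolding const_poly_dvd_iff using prime_gt_1_nat[OF p] by (auto intro!: exI[of _ 1])
  hence D: "int p dvd coeff D n" for n
    using prime_elem_dvd_multD[OF pp dvd] by (auto simp: const_poly_dvd_iff)
  have coeffD: "coeff D j = (\<Sum>l\<in>{j<..p}. s l * int (l choose j))" if "j < p" for j
  proof -
    have mon: "pcompose (monom c l) r = smult c (r ^ l)" for c :: int and l r
      by (induction l) (simp_all add: monom_0 monom_Suc pcompose_pCons)
    have bin: "coeff ([:1, 1 :: int:] ^ l) i = int (l choose i)" for l i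
      by (induction l arbitrary: i) (auto simp: coeff_pCons split: nat.splits)
    have "F = (\<Sum>l\<le>p. monom (s l) l)" using degF unfolding s_def by (metis poly_as_sum_of_monoms)
    hence "pcompose F [:1, 1:] = (\<Sum>l\<le>p. pcompose (monom (s l) l) [:1, 1:])" by (metis pcompose_sum)
    also have "\<dots> = (\<Sum>l\<le>p. smult (s l) ([:1, 1:] ^ l))"
      by (simp add: mon)
    finally have "coeff (pcompose F [:1, 1:]) j = (\<Sum>l\<le>p. s l * int (l choose j))"
      by (simp add: coeff_sum bin)
    also have "\<dots> = (\<Sum>l\<in>{..j} \<union> {j<..p}. s l * int (l choose j))"
      using that by (intro sum.cong) auto
    also have "\<dots> = (\<Sum>l\<le>j. s l * int (l choose j)) + (\<Sum>l\<in>{j<..p}. s l * int (l choose j))"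
      by (rule sum.union_disjoint) auto
    also have "(\<Sum>l\<le>j. s l * int (l choose j)) = (\<Sum>l\<in>{j}. s l * int (l choose j))"
      by (rule sum.mono_neutral_right) auto
    finally show ?thesis unfolding D_def s_def by simp
  qed
  \<comment> \<open>Downward induction on \<open>k\<close>: coefficient \<open>k - 1\<close> of
    \<open>D\<close> is \<open>s k * k\<close> plus terms with larger \<open>l\<close>, which
    \<open>p\<close> divides through \<open>s l\<close> when \<open>l < p\<close> and through the
    binomial coefficient when \<open>l = p\<close>. Then \<open>p\<close> divides
    \<open>s k\<close>, as it does not divide \<open>k\<close>.\<close>
  have "2 \<le> k \<Longrightarrow> k < p \<Longrightarrow> int p dvd s k" for k
  proof (induction "p - k" arbitrary: k rule: less_induct)
    case less
    have eq: "coeff D (k - 1) = s k * int k + (\<Sum>l\<in>{k<..p}. s l * int (l choose (k - 1)))"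
    proof -
      have "{k - 1<..p} = insert k {k<..p}" using less.prems by auto
      moreover have "k choose (k - 1) = k" using less.prems by (simp add: binomial_symmetric)
      ultimately show ?thesis using less.prems by (simp add: coeffD)
    qed
    have "int p dvd (\<Sum>l\<in>{k<..p}. s l * int (l choose (k - 1)))"
    proof (rule dvd_sum)
      fix l assume l: "l \<in> {k<..p}"
      show "int p dvd s l * int (l choose (k - 1))"
      proof (cases "l = p")
        case True
        \<comment> \<open>Here \<open>k \<ge> 2\<close> matters: \<open>k - 1\<close> is positive
          and smaller than \<open>p\<close>.\<close>
        have "(k - 1) * (p choose (k - 1)) = p * ((p - 1) choose (k - 1 - 1))"
          using less.prems by (intro times_binomial_minus1_eq) auto
        hence "p dvd (k - 1) * (p choose (k - 1))" by simp
        hence "p dvd k - 1 \<or> p dvd p choose (k - 1)" using p by (simp add: prime_dvd_mult_iff)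
        hence "p dvd p choose (k - 1)" using less.prems by (auto dest: dvd_imp_le)
        thus ?thesis using True by simp
      next
        case False
        thus ?thesis using less.hyps[of l] less.prems l by (intro dvd_mult2) auto
      qed
    qed
    hence "int p dvd s k * int k" using D[of "k - 1"] unfolding eq by (simp add: dvd_add_left_iff)
    hence "int p dvd s k \<or> int p dvd int k" using p by (simp add: prime_dvd_mult_iff)
    moreover have "\<not> p dvd k" using less.prems by (auto dest: dvd_imp_le)
    ultimately show ?case by simp
  qed
  thus ?thesis using k unfolding s_def F_def by blast
qed

text \<open>Reversing coefficients turns \<open>[:a, 1:]\<close> into \<open>[:1, a:]\<close>.
  Degrees 1 to \<open>p - 2\<close> then correspond to degrees \<open>p - 1\<close> down to 2 of the
  monic product, where \<open>falling_coeff\<close> applies. The next degree corresponds to the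
  linear term, which explains the bound on \<open>q\<close>.\<close>

lemma twist_product:
  assumes p: "prime p" and q: "q \<le> p - 1"
  shows "cg p q (\<Prod>i<p. [:1, int i - \<delta>:]) 1"
proof -
  define F where "F = (\<Prod>i<p. [:int i - \<delta>, 1:])"
  have refl: "reflect_poly [:a, 1:] = [:1, a:]" for a :: int
    by (cases "a = 0") (auto simp: reflect_poly_def)
  have r: "reflect_poly F = (\<Prod>i<p. [:1, int i - \<delta>:])"
    unfolding F_def reflect_poly_prod refl ..
  have "degree F = (\<Sum>i<p. degree [:int i - \<delta>, 1:])" unfolding F_def by (rule degree_prod_eq_sum_degree) auto
  hence deg: "degree F = p" by simp
  have lc: "coeff F p = 1"
  proof -
    have "lead_coeff F = 1" unfolding F_def by (simp add: lead_coeff_prod)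
    thus ?thesis using deg by simp
  qed
  show ?thesis unfolding cg_def
  proof (intro allI impI)
    fix n assume n: "n < q"
    show "int p dvd coeff ((\<Prod>i<p. [:1, int i - \<delta>:]) - 1) n"
    proof (cases "n = 0")
      case True
      thus ?thesis unfolding r[symmetric] using deg lc by (simp add: coeff_reflect_poly)
    next
      case False
      hence "int p dvd coeff F (p - n)" unfolding F_def using n q by (intro falling_coeff[OF p]) auto
      thus ?thesis unfolding r[symmetric] using deg False n q
        by (simp add: coeff_reflect_poly)
    qed
  qed
qed

section \<open>Consequences of the Chern class axioms\<close>

locale chern =
  fixes C :: "('k::field, 'r::{finite,linorder}, ('k, 'r) point \<Rightarrow> (nat \<Rightarrow> ('k, 'r) hfrac) set) psheaf \<Rightarrow> int poly"
    and p q :: nat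
  assumes C: "chern_theory C" and p: "prime p" and q: "q \<le> CARD('r)" "q \<le> p - 1"
begin

lemma C_0: "represented F L \<epsilon> \<Longrightarrow> coeff (C F) 0 = 1"
  using C represented.vector_bundle unfolding chern_theory_def by blast

lemma whitney:
  assumes r: "represented F' L' \<epsilon>'" "represented F L \<epsilon>" "represented F'' L'' \<epsilon>''"
    and \<beta>: "lin \<beta>"
    and ker: "\<And>P. P \<in> proj_space \<Longrightarrow> L' P = {v \<in> L P. \<beta> v = 0}"
    and im: "\<And>P. P \<in> proj_space \<Longrightarrow> \<beta> ` L P = L'' P"
  shows "cg p q (C F) (C F' * C F'')"
proof -
  have "short_exact F' F F''" by (rule short_exactI[OF r \<beta> ker im])
  hence "monom 1 CARD('r) dvd C F - C F' * C F''"
    using C r[THEN represented.vector_bundle] unfolding chern_theory_def by blast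
  thus ?thesis using q(1) by (rule cg_monom)
qed

lemma C_line:
  assumes r: "represented F (DS {a} m) \<epsilon>"
  shows "cg p q (C F) [:1, m a:]"
proof -
  interpret f: represented "free_sheaf 1 (m a)" "DS {..<1} (\<lambda>_. m a)" "\<lambda>P v. v" by (rule represented_free)
  interpret r: represented F "DS {a} m" \<epsilon> by (rule r)
  define \<beta> :: "(nat \<Rightarrow> ('k, 'r) hfrac) \<Rightarrow> nat \<Rightarrow> ('k, 'r) hfrac" where "\<beta> v = (\<lambda>b. if b = 0 then v a else 0)" for v
  interpret lattice_map F "DS {a} m" \<epsilon> "free_sheaf 1 (m a)" "DS {..<1} (\<lambda>_. m a)" "\<lambda>P v. v" proj_space \<beta>
    by unfold_locales (auto simp: \<beta>_def DS_def vec_apply)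
  have "O_iso_on proj_space F (free_sheaf 1 (m a))"
  proof (rule iso)
    fix P :: "('k, 'r) point"
    show "bij_betw \<beta> (DS {a} m P) (DS {..<1} (\<lambda>_. m a) P)"
      by (rule bij_betw_byWitness[where f' = "\<lambda>w b. if b = a then w 0 else 0"])
        (auto simp: \<beta>_def DS_def fun_eq_iff)
  qed simp
  hence "monom 1 CARD('r) dvd C F - [:1, m a:]"
    using C r.vector_bundle unfolding chern_theory_def by blast
  thus ?thesis using q(1) by (rule cg_monom)
qed

lemma C_zero:
  assumes r: "represented F L \<epsilon>" and 0: "\<And>P. P \<in> proj_space \<Longrightarrow> L P = {0}"
  shows "cg p q (C F) 1"
proof -
  \<comment> \<open>With zero stalks the sequence \<open>0 \<rightarrow> F \<rightarrow> F
    \<rightarrow> F \<rightarrow> 0\<close> is exact, so the class is congruent to its square; its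
    constant term is 1, hence it can be cancelled.\<close>
  have "cg p q (C F) (C F * C F)"
    by (rule whitney[OF r r r, of id]) (auto simp: lin_def 0)
  hence "cg p q (1 * C F) (C F * C F)" by simp
  from cg_cancel[OF C_0[OF r] this] show ?thesis by (rule cg_sym)
qed

lemma C_DS:
  assumes "finite I"
  shows "cg p q (C (lsheaf (DS I m))) (\<Prod>a\<in>I. [:1, m a:])"
  using assms
proof (induction I rule: finite_induct)
  case empty
  have e: "DS {} m = (\<lambda>P. {0} :: (nat \<Rightarrow> ('k, 'r) hfrac) set)" by (auto simp: DS_def fun_eq_iff vec_apply)
  have "represented (lsheaf (DS {} m)) (DS {} m :: ('k, 'r) lattice) (\<lambda>P v. {v})"
    by (intro represented_lsheaf loc_free_DS) simp
  hence "cg p q (C (lsheaf (DS {} m))) 1" unfolding e by (rule C_zero) simp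
  thus ?case by simp
next
  case (insert a I)
  define \<beta> :: "(nat \<Rightarrow> ('k, 'r) hfrac) \<Rightarrow> nat \<Rightarrow> ('k, 'r) hfrac" where "\<beta> v = (\<lambda>b. if b = a then 0 else v b)" for v
  have lf: "loc_free (DS {a} m :: ('k, 'r) lattice)" "loc_free (DS (insert a I) m :: ('k, 'r) lattice)" "loc_free (DS I m :: ('k, 'r) lattice)"
    using insert by (auto intro: loc_free_DS)
  have "cg p q (C (lsheaf (DS (insert a I) m))) (C (lsheaf (DS {a} m)) * C (lsheaf (DS I m)))"
  proof (rule whitney[OF lf[THEN represented_lsheaf]])
    show "lin \<beta>" by (auto simp: lin_def \<beta>_def vec_apply)
    fix P :: "('k, 'r) point" assume P: "P \<in> proj_space"
    show "DS {a} m P = {v \<in> DS (insert a I) m P. \<beta> v = 0}"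
    proof (intro equalityI subsetI)
      fix v assume v: "v \<in> DS {a} m P"
      have "v b \<in> Oj (m b) P" if "b \<in> insert a I" for b
        using v Oj_0[OF P] by (cases "b = a") (auto simp: DS_def)
      thus "v \<in> {v \<in> DS (insert a I) m P. \<beta> v = 0}"
        using v by (auto simp: DS_def \<beta>_def fun_eq_iff vec_apply)
    qed (auto simp: DS_def \<beta>_def fun_eq_iff vec_apply split: if_splits)
    show "\<beta> ` DS (insert a I) m P = DS I m P"
    proof (intro equalityI subsetI)
      fix v assume v: "v \<in> DS I m P"
      hence "v = \<beta> v" "v \<in> DS (insert a I) m P"
        using insert.hyps Oj_0[OF P] by (auto simp: DS_def \<beta>_def fun_eq_iff)
      thus "v \<in> \<beta> ` DS (insert a I) m P" by blast
    qed (use insert.hyps in \<open>auto simp: DS_def \<beta>_def\<close>)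
  qed
  moreover have "cg p q (C (lsheaf (DS {a} m)) * C (lsheaf (DS I m))) ([:1, m a:] * (\<Prod>a\<in>I. [:1, m a:]))"
    using insert.IH C_line[OF represented_lsheaf[OF lf(1)]] by (intro cg_mult)
  ultimately show ?case using insert.hyps cg_trans by simp
qed

text \<open>The twists run over a full set of residues modulo \<open>p\<close>. \<open>Psi\<close>
  is multiplicative on short exact sequences given uniformly in the twist and congruent to 1 on sums
  of line bundles, so it is trivial on every family with a finite resolution by such sums.\<close>

definition Psi :: "(int \<Rightarrow> ('k, 'r) lattice) \<Rightarrow> int poly" where
  "Psi L = (\<Prod>i<p. C (lsheaf (L (int i))))"

lemma Psi_DS:
  assumes I: "finite I"
  shows "cg p q (Psi (\<lambda>j. DS I (\<lambda>a. j - \<delta> a))) 1"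
proof -
  have "cg p q (Psi (\<lambda>j. DS I (\<lambda>a. j - \<delta> a))) (\<Prod>i<p. \<Prod>a\<in>I. [:1, int i - \<delta> a:])"
    unfolding Psi_def by (rule cg_prod) (rule C_DS[OF I])
  also have "(\<Prod>i<p. \<Prod>a\<in>I. [:1, int i - \<delta> a:]) = (\<Prod>a\<in>I. \<Prod>i<p. [:1, int i - \<delta> a:])"
    by (rule prod.swap)
  finally have 1: "cg p q (Psi (\<lambda>j. DS I (\<lambda>a. j - \<delta> a))) (\<Prod>a\<in>I. \<Prod>i<p. [:1, int i - \<delta> a:])" .
  have "cg p q (\<Prod>a\<in>I. \<Prod>i<p. [:1, int i - \<delta> a:]) (\<Prod>a\<in>I. 1)"
    by (rule cg_prod) (rule twist_product[OF p q(2)])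
  thus ?thesis using cg_trans[OF 1] by simp
qed

end

section \<open>Graded modules over the polynomial ring\<close>

definition psc :: "'a::comm_ring_1 \<Rightarrow> (nat \<Rightarrow> 'a) \<Rightarrow> nat \<Rightarrow> 'a" where
  "psc f u = (\<lambda>a. f * u a)"

text \<open>The degree \<open>e\<close> part of the graded free module with a generator of degree
  \<open>\<delta> a\<close> for each \<open>a \<in> I\<close>. The case distinction excludes
  negative degrees, which truncated subtraction would turn into degree 0.\<close>

definition hvec :: "nat set \<Rightarrow> (nat \<Rightarrow> nat) \<Rightarrow> nat \<Rightarrow> (nat \<Rightarrow> ('k::field, 'r::{finite,linorder}) hpoly) set" where
  "hvec I \<delta> e = {u. (\<forall>a. a \<notin> I \<longrightarrow> u a = 0) \<and>
     (\<forall>a\<in>I. if \<delta> a \<le> e then homogeneous (e - \<delta> a) (u a) else u a = 0)}"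

text \<open>Only the homogeneous elements of a graded submodule of a graded free module are recorded.\<close>

definition graded :: "nat set \<Rightarrow> (nat \<Rightarrow> nat) \<Rightarrow> (nat \<Rightarrow> (nat \<Rightarrow> ('k::field, 'r::{finite,linorder}) hpoly) set) \<Rightarrow> bool" where
  "graded I \<delta> K \<longleftrightarrow> (\<forall>e. K e \<subseteq> hvec I \<delta> e \<and> 0 \<in> K e \<and> (\<forall>u\<in>K e. \<forall>w\<in>K e. u + w \<in> K e) \<and>
     (\<forall>d f. \<forall>u\<in>K e. homogeneous d f \<longrightarrow> psc f u \<in> K (e + d)))"

definition gmap :: "nat set \<Rightarrow> (nat \<Rightarrow> nat \<Rightarrow> 'a::comm_ring_1) \<Rightarrow> (nat \<Rightarrow> 'a) \<Rightarrow> nat \<Rightarrow> 'a" where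
  "gmap G g c = (\<Sum>b\<in>G. psc (c b) (g b))"

definition syz :: "nat set \<Rightarrow> (nat \<Rightarrow> nat) \<Rightarrow> (nat \<Rightarrow> nat \<Rightarrow> ('k::field, 'r::{finite,linorder}) hpoly) \<Rightarrow>
    nat \<Rightarrow> (nat \<Rightarrow> ('k, 'r) hpoly) set" where
  "syz G \<delta> g e = {c \<in> hvec G \<delta> e. gmap G g c = 0}"

definition generates :: "nat set \<Rightarrow> (nat \<Rightarrow> nat) \<Rightarrow> (nat \<Rightarrow> nat \<Rightarrow> ('k::field, 'r::{finite,linorder}) hpoly) \<Rightarrow>
    (nat \<Rightarrow> (nat \<Rightarrow> ('k, 'r) hpoly) set) \<Rightarrow> bool" where
  "generates G \<delta> g K \<longleftrightarrow> finite G \<and> (\<forall>b\<in>G. g b \<in> K (\<delta> b)) \<and> (\<forall>e. \<forall>u\<in>K e. \<exists>c\<in>hvec G \<delta> e. u = gmap G g c)"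

text \<open>Membership in the ideal generated by the variables in \<open>A\<close>, read off the monomials.\<close>

definition meets :: "'r set \<Rightarrow> ('k::field, 'r::{finite,linorder}) hpoly \<Rightarrow> bool" where
  "meets A f \<longleftrightarrow> (\<forall>t\<in>Poly_Mapping.keys f. \<exists>i\<in>A. Poly_Mapping.lookup t i \<noteq> 0)"

text \<open>\<open>K \<inter> I S\<^sup>n = I K\<close> for the ideal \<open>I\<close> generated by the variables in \<open>A\<close>.\<close>

definition pure :: "'r set \<Rightarrow> (nat \<Rightarrow> (nat \<Rightarrow> ('k::field, 'r::{finite,linorder}) hpoly) set) \<Rightarrow> bool" where
  "pure A K \<longleftrightarrow> (\<forall>e. \<forall>u\<in>K (Suc e). (\<forall>a. meets A (u a)) \<longrightarrow>
     (\<exists>w. (\<forall>i\<in>A. w i \<in> K e) \<and> u = (\<Sum>i\<in>A. psc (Y_var i) (w i))))"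

lemma psc_apply: "psc f u a = f * u a"
  by (simp add: psc_def)

lemmas pvec_apply = psc_apply plus_fun_apply zero_fun_apply minus_apply uminus_apply

lemma psc_0 [simp]: "psc f 0 = 0" "psc 0 u = 0"
  and psc_diff: "psc f (u - w) = psc f u - psc f w"
  by (auto simp: fun_eq_iff pvec_apply algebra_simps)

lemma gmap_apply: "gmap G g c a = (\<Sum>b\<in>G. c b * g b a)"
  unfolding gmap_def sum_fun_apply psc_apply ..

lemma gmap_add: "gmap G g (c + d) = gmap G g c + gmap G g d"
  by (rule ext) (simp add: gmap_apply pvec_apply distrib_right sum.distrib)

lemma gmap_diff: "gmap G g (c - d) = gmap G g c - gmap G g d"
  by (rule ext) (simp add: gmap_apply pvec_apply left_diff_distrib sum_subtractf)

lemma gmap_0 [simp]: "gmap G g 0 = 0"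
  by (rule ext) (simp add: gmap_apply pvec_apply)

lemma gmap_psc: "gmap G g (psc f c) = psc f (gmap G g c)"
  by (rule ext) (simp add: gmap_apply pvec_apply sum_distrib_left mult.assoc)

lemma gmap_sum: "gmap G g (\<Sum>i\<in>I. c i) = (\<Sum>i\<in>I. gmap G g (c i))"
  by (induction I rule: infinite_finite_induct) (simp_all add: gmap_add)

lemma hvec_graded: "graded I \<delta> (hvec I \<delta>)"
  unfolding graded_def
proof (intro allI conjI ballI impI subset_refl)
  show "0 \<in> hvec I \<delta> e" for e by (simp add: hvec_def pvec_apply)
  show "u + w \<in> hvec I \<delta> e" if "u \<in> hvec I \<delta> e" "w \<in> hvec I \<delta> e" for e u w
    using that by (auto simp: hvec_def pvec_apply intro!: homogeneous_add)
  show "psc f u \<in> hvec I \<delta> (e + d)" if u: "u \<in> hvec I \<delta> e" and f: "homogeneous d f" for e d f u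
  proof -
    have "if \<delta> a \<le> e + d then homogeneous (e + d - \<delta> a) (f * u a) else f * u a = 0" if a: "a \<in> I" for a
    proof (cases "\<delta> a \<le> e")
      case True
      hence "homogeneous (e - \<delta> a) (u a)" using u a by (auto simp: hvec_def)
      from homogeneous_mult[OF f this] show ?thesis using True by (simp add: add.commute)
    next
      case False
      hence "u a = 0" using u a by (auto simp: hvec_def)
      thus ?thesis by simp
    qed
    thus ?thesis using u by (auto simp: hvec_def pvec_apply)
  qed
qed

lemma gradedD:
  assumes "graded I \<delta> K"
  shows "u \<in> K e \<Longrightarrow> u \<in> hvec I \<delta> e" "0 \<in> K e" "u \<in> K e \<Longrightarrow> w \<in> K e \<Longrightarrow> u + w \<in> K e"
    "u \<in> K e \<Longrightarrow> homogeneous d f \<Longrightarrow> psc f u \<in> K (e + d)"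
  using assms unfolding graded_def by blast+

lemma graded_uminus: "graded I \<delta> K \<Longrightarrow> u \<in> K e \<Longrightarrow> - u \<in> K e"
proof -
  assume K: "graded I \<delta> K" "u \<in> K e"
  have "psc (- 1) u \<in> K (e + 0)" by (rule gradedD(4)[OF K]) (simp add: homogeneous_uminus)
  moreover have "psc (- 1) u = - u" by (rule ext) (simp add: pvec_apply)
  ultimately show ?thesis by simp
qed

lemma graded_diff: "graded I \<delta> K \<Longrightarrow> u \<in> K e \<Longrightarrow> w \<in> K e \<Longrightarrow> u - w \<in> K e"
  using gradedD(3)[of I \<delta> K u e "- w"] graded_uminus[of I \<delta> K w e] by simp

lemma graded_sum: "graded I \<delta> K \<Longrightarrow> (\<And>i. i \<in> A \<Longrightarrow> u i \<in> K e) \<Longrightarrow> (\<Sum>i\<in>A. u i) \<in> K e"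
  by (induction A rule: infinite_finite_induct) (auto intro: gradedD)

lemma graded_psc_hvec:
  assumes K: "graded I \<delta> K" and c: "c \<in> hvec G \<delta>' e" and b: "b \<in> G" and g: "g \<in> K (\<delta>' b)"
  shows "psc (c b) g \<in> K e"
proof (cases "\<delta>' b \<le> e")
  case True
  hence "homogeneous (e - \<delta>' b) (c b)" using c b by (auto simp: hvec_def)
  from gradedD(4)[OF K g this] show ?thesis using True by simp
next
  case False
  hence "c b = 0" using c b by (auto simp: hvec_def)
  thus ?thesis using gradedD(2)[OF K] by simp
qed

lemma gmap_in:
  assumes K: "graded I \<delta> K" and c: "c \<in> hvec G \<delta>' e" and g: "\<And>b. b \<in> G \<Longrightarrow> g b \<in> K (\<delta>' b)"
  shows "gmap G g c \<in> K e"
  unfolding gmap_def by (rule graded_sum[OF K]) (rule graded_psc_hvec[OF K c _ g])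

lemma syz_graded: "graded G \<delta> (syz G \<delta> g)"
proof -
  note H = hvec_graded[of G \<delta>]
  show ?thesis unfolding graded_def syz_def
    using gradedD(2,3,4)[OF H] by (auto simp: gmap_add gmap_psc)
qed

subsection \<open>Ideals generated by variables\<close>

lemma hpoly_sum_monomials: "f = (\<Sum>t\<in>Poly_Mapping.keys f. Poly_Mapping.single t (Poly_Mapping.lookup f t))"
proof (rule poly_mapping_eqI)
  fix s
  have "(\<Sum>t\<in>Poly_Mapping.keys f. Poly_Mapping.lookup (Poly_Mapping.single t (Poly_Mapping.lookup f t)) s) =
      (\<Sum>t\<in>Poly_Mapping.keys f. if t = s then Poly_Mapping.lookup f s else 0)"
    by (rule sum.cong) (auto simp: lookup_single when_def)
  thus "Poly_Mapping.lookup f s = Poly_Mapping.lookup (\<Sum>t\<in>Poly_Mapping.keys f. Poly_Mapping.single t (Poly_Mapping.lookup f t)) s"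
    by (simp add: lookup_sum in_keys_iff)
qed

lemma lookup_single_mult:
  fixes f :: "('a::cancel_comm_monoid_add) \<Rightarrow>\<^sub>0 'b::comm_ring_1"
  shows "Poly_Mapping.lookup (Poly_Mapping.single s c * f) (s + t) = c * Poly_Mapping.lookup f t"
proof -
  have "Poly_Mapping.single s c * f =
      Poly_Mapping.single s c * (\<Sum>u\<in>Poly_Mapping.keys f. Poly_Mapping.single u (Poly_Mapping.lookup f u))"
    using hpoly_sum_monomials[of f] by simp
  also have "\<dots> = (\<Sum>u\<in>Poly_Mapping.keys f. Poly_Mapping.single (s + u) (c * Poly_Mapping.lookup f u))"
    by (simp add: sum_distrib_left mult_single)
  also have "Poly_Mapping.lookup \<dots> (s + t) = (\<Sum>u\<in>Poly_Mapping.keys f. if u = t then c * Poly_Mapping.lookup f t else 0)"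
    unfolding lookup_sum by (rule sum.cong) (auto simp: lookup_single when_def)
  finally show ?thesis by (simp add: in_keys_iff)
qed

lemma meets_0 [simp]: "meets A 0"
  by (simp add: meets_def)

lemma meets_add: "meets A f \<Longrightarrow> meets A h \<Longrightarrow> meets A (f + h)"
  unfolding meets_def using keys_add[of f h] by blast

lemma meets_uminus: "meets A f \<Longrightarrow> meets A (- f)"
  unfolding meets_def by (auto simp: in_keys_iff)

lemma meets_sum: "(\<And>i. i \<in> I \<Longrightarrow> meets A (f i)) \<Longrightarrow> meets A (\<Sum>i\<in>I. f i)"
  by (induction I rule: infinite_finite_induct) (auto intro: meets_add)

lemma meets_mult: "meets A f \<Longrightarrow> meets A (f * h)"
  unfolding meets_def
proof
  fix t assume f: "\<forall>t\<in>Poly_Mapping.keys f. \<exists>i\<in>A. Poly_Mapping.lookup t i \<noteq> 0" and t: "t \<in> Poly_Mapping.keys (f * h)"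
  then obtain u v where "t = u + v" "u \<in> Poly_Mapping.keys f" using keys_mult[of f h] by blast
  thus "\<exists>i\<in>A. Poly_Mapping.lookup t i \<noteq> 0" using f by (auto simp: lookup_add)
qed

lemma meets_Y: "i \<in> A \<Longrightarrow> meets A (Y_var i)"
  by (auto simp: meets_def Y_var_def intro!: bexI[of _ i])

text \<open>Multiplication by \<open>Y_var x\<close> only shifts monomials and adds no variable of
  \<open>A\<close>; thus \<open>Y_var x\<close> is a nonzerodivisor modulo the ideal of the
  variables in \<open>A\<close>.\<close>

lemma meets_cancel_Y:
  assumes "meets A (Y_var x * f)" "x \<notin> A"
  shows "meets A f"
  unfolding meets_def
proof
  fix t assume t: "t \<in> Poly_Mapping.keys f"
  have "Poly_Mapping.single x 1 + t \<in> Poly_Mapping.keys (Y_var x * f)"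
    using t unfolding Y_var_def in_keys_iff lookup_single_mult by simp
  then obtain i where "i \<in> A" "Poly_Mapping.lookup (Poly_Mapping.single x 1 + t) i \<noteq> 0"
    using assms(1) unfolding meets_def by blast
  thus "\<exists>i\<in>A. Poly_Mapping.lookup t i \<noteq> 0" using assms(2) by (auto simp: lookup_add lookup_single when_def split: if_splits)
qed

lemma split_variable:
  fixes f :: "('k::field, 'r::{finite,linorder}) hpoly"
  assumes f: "homogeneous (Suc e) f"
  shows "\<exists>h f'. f = Y_var x * h + f' \<and> homogeneous e h \<and> homogeneous (Suc e) f' \<and>
     (\<forall>t\<in>Poly_Mapping.keys f'. t \<in> Poly_Mapping.keys f \<and> Poly_Mapping.lookup t x = 0)"
proof -
  let ?m = "\<lambda>t. Poly_Mapping.single t (Poly_Mapping.lookup f t)"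
  define S where "S = {t \<in> Poly_Mapping.keys f. Poly_Mapping.lookup t x \<noteq> 0}"
  define h where "h = (\<Sum>t\<in>S. Poly_Mapping.single (t - Poly_Mapping.single x 1) (Poly_Mapping.lookup f t))"
  define f' where "f' = (\<Sum>t\<in>Poly_Mapping.keys f - S. ?m t)"
  have eq: "Poly_Mapping.single x 1 + (t - Poly_Mapping.single x 1) = t" if "t \<in> S" for t
    by (rule poly_mapping_eqI) (use that in \<open>auto simp: S_def lookup_add lookup_minus lookup_single when_def\<close>)
  have "Y_var x * h = (\<Sum>t\<in>S. ?m t)"
    unfolding h_def Y_var_def sum_distrib_left mult_single by (rule sum.cong) (simp_all add: eq del: One_nat_def)
  moreover have "(\<Sum>t\<in>Poly_Mapping.keys f. ?m t) = f' + (\<Sum>t\<in>S. ?m t)"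
    unfolding f'_def by (rule sum.subset_diff) (auto simp: S_def)
  ultimately have "f = Y_var x * h + f'" using hpoly_sum_monomials[of f] by (metis add.commute)
  moreover have "homogeneous e h"
    unfolding h_def
  proof (rule homogeneous_sum)
    fix t assume t: "t \<in> S"
    have "mdeg t = Suc e" using f t by (auto simp: homogeneous_iff S_def)
    moreover have "mdeg t = Suc (mdeg (t - Poly_Mapping.single x 1))"
      using eq[OF t] mdeg_add[of "Poly_Mapping.single x 1" "t - Poly_Mapping.single x 1"] by simp
    ultimately show "homogeneous e (Poly_Mapping.single (t - Poly_Mapping.single x 1) (Poly_Mapping.lookup f t))"
      by (simp add: homogeneous_iff)
  qed
  moreover have keys: "Poly_Mapping.keys f' \<subseteq> Poly_Mapping.keys f - S"
    unfolding f'_def using keys_sum[of ?m "Poly_Mapping.keys f - S"] by (auto split: if_splits)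
  moreover have "homogeneous (Suc e) f'" using keys f by (auto simp: homogeneous_iff)
  ultimately show ?thesis unfolding S_def by blast
qed

text \<open>The monomials that involve \<open>x\<close> form a multiple of \<open>Y_var x\<close>.
  Those left over avoid \<open>x\<close>, so they still meet the remaining variables and the
  induction continues.\<close>

lemma meets_decompose:
  fixes f :: "('k::field, 'r::{finite,linorder}) hpoly"
  assumes "homogeneous (Suc e) f" "meets A f"
  shows "\<exists>w. (\<forall>i\<in>A. homogeneous e (w i)) \<and> f = (\<Sum>i\<in>A. Y_var i * w i)"
  using finite[of A] assms
proof (induction A arbitrary: f rule: finite_induct)
  case empty
  hence "Poly_Mapping.keys f = {}" by (auto simp: meets_def)
  thus ?case by simp
next
  case (insert x A)
  obtain h f' where h: "f = Y_var x * h + f'" "homogeneous e h" "homogeneous (Suc e) f'"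
     "\<forall>t\<in>Poly_Mapping.keys f'. t \<in> Poly_Mapping.keys f \<and> Poly_Mapping.lookup t x = 0"
    using split_variable[OF insert.prems(1)] by blast
  have "meets A f'" using insert.prems(2) h(4) unfolding meets_def by fastforce
  then obtain w where w: "\<forall>i\<in>A. homogeneous e (w i)" "f' = (\<Sum>i\<in>A. Y_var i * w i)" using insert.IH[OF h(3)] by blast
  have "f = (\<Sum>i\<in>insert x A. Y_var i * (w(x := h)) i)"
    using insert.hyps h(1) w(2) by (auto intro!: sum.cong)
  moreover have "\<forall>i\<in>insert x A. homogeneous e ((w(x := h)) i)" using w h by auto
  ultimately show ?case by blast
qed

lemma meets_degree_0: "homogeneous 0 f \<Longrightarrow> meets A f \<Longrightarrow> f = 0"
proof -
  assume "homogeneous 0 f" "meets A f"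
  hence "t \<notin> Poly_Mapping.keys f" for t by (cases "t = 0") (auto simp: homogeneous_iff meets_def)
  hence "Poly_Mapping.keys f = {}" by blast
  thus ?thesis by simp
qed

lemma hvec_degree_0: "u \<in> hvec I \<delta> 0 \<Longrightarrow> homogeneous 0 (u a)"
  by (cases "a \<in> I"; cases "\<delta> a = 0") (auto simp: hvec_def)

lemma hvec_pure: "pure A (hvec I \<delta>)"
  unfolding pure_def
proof (intro allI ballI impI)
  fix e and u :: "nat \<Rightarrow> ('k::field, 'r::{finite,linorder}) hpoly" and A :: "'r set"
  assume u: "u \<in> hvec I \<delta> (Suc e)" "\<forall>a. meets A (u a)"
  have "\<exists>w. (\<forall>i\<in>A. if \<delta> a \<le> e then homogeneous (e - \<delta> a) (w i) else w i = 0) \<and> u a = (\<Sum>i\<in>A. Y_var i * w i)"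
    if a: "a \<in> I" for a
  proof (cases "\<delta> a \<le> e")
    case True
    hence "homogeneous (Suc (e - \<delta> a)) (u a)" using u a by (auto simp: hvec_def Suc_diff_le)
    from meets_decompose[OF this u(2)[rule_format]] show ?thesis using True by simp
  next
    case False
    \<comment> \<open>In the boundary degree \<open>\<delta> a = Suc e\<close> the entry is a
      constant, and a constant in an ideal generated by variables vanishes.\<close>
    hence "u a = 0"
      using u a meets_degree_0[of "u a" A] by (cases "\<delta> a = Suc e") (auto simp: hvec_def)
    thus ?thesis using False by (intro exI[of _ "\<lambda>_. 0"]) simp
  qed
  then obtain w where w: "\<And>a i. a \<in> I \<Longrightarrow> i \<in> A \<Longrightarrow> (if \<delta> a \<le> e then homogeneous (e - \<delta> a) (w a i) else w a i = 0)"
     "\<And>a. a \<in> I \<Longrightarrow> u a = (\<Sum>i\<in>A. Y_var i * w a i)" by metis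
  define w' where "w' i a = (if a \<in> I then w a i else 0)" for i a
  have "u = (\<Sum>i\<in>A. psc (Y_var i) (w' i))"
  proof
    fix a show "u a = (\<Sum>i\<in>A. psc (Y_var i) (w' i)) a"
      using u(1) w(2)[of a] by (cases "a \<in> I") (auto simp: sum_fun_apply psc_apply w'_def hvec_def)
  qed
  moreover have "\<forall>i\<in>A. w' i \<in> hvec I \<delta> e" using w(1) by (auto simp: hvec_def w'_def)
  ultimately show "\<exists>w. (\<forall>i\<in>A. w i \<in> hvec I \<delta> e) \<and> u = (\<Sum>i\<in>A. psc (Y_var i) (w i))" by blast
qed

subsection \<open>Syzygies\<close>

text \<open>
  Passing to syzygies gains one variable of purity: this replaces the dimension shift
  \<open>Tor\<^sub>1(S/I, K\<^sub>i) = Tor\<^sub>i\<^sub>+\<^sub>1(S/I, K\<^sub>0)\<close>.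
\<close>

lemma pure_syz:
  fixes K :: "nat \<Rightarrow> (nat \<Rightarrow> ('k::field, 'r::{finite,linorder}) hpoly) set"
  assumes K: "graded I \<delta> K" and gen: "generates G \<delta>' g K"
    and pure: "pure A K" and pure': "pure A (syz G \<delta>' g)" and x: "x \<notin> A"
  shows "pure (insert x A) (syz G \<delta>' g)"
  unfolding pure_def
proof (intro allI ballI impI)
  fix e c assume c: "c \<in> syz G \<delta>' g (Suc e)" "\<forall>a. meets (insert x A) (c a)"
  note H = hvec_graded[of G \<delta>'] and S = syz_graded[of G \<delta>' g]
  obtain w where w: "\<forall>i\<in>insert x A. w i \<in> hvec G \<delta>' e" "c = (\<Sum>i\<in>insert x A. psc (Y_var i) (w i))"
    using hvec_pure[of "insert x A" G \<delta>'] c unfolding pure_def syz_def by blast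
  \<comment> \<open>The term of the new variable is split off and the map to the generators applied:
    \<open>k\<close> is the image of its coefficient, and \<open>psc (Y_var x) k\<close> has entries
    in the ideal of \<open>A\<close> because \<open>c\<close> is a syzygy.\<close>
  define c' where "c' = (\<Sum>i\<in>A. psc (Y_var i) (w i))"
  have ceq: "c = psc (Y_var x) (w x) + c'" unfolding w(2) c'_def using x by simp
  have meet_sum: "meets A ((\<Sum>i\<in>A. psc (Y_var i) (z i)) a)" for z :: "'r \<Rightarrow> nat \<Rightarrow> ('k, 'r) hpoly" and a
    unfolding sum_fun_apply psc_apply by (intro meets_sum meets_mult meets_Y)
  define k where "k = gmap G g (w x)"
  have k: "k \<in> K e" unfolding k_def using w(1) gen by (intro gmap_in[OF K]) (auto simp: generates_def)
  have "0 = psc (Y_var x) k + gmap G g c'"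
    using c(1) unfolding syz_def ceq k_def by (simp add: gmap_add gmap_psc)
  hence "psc (Y_var x) k = - gmap G g c'" by (simp add: eq_neg_iff_add_eq_0)
  also have "gmap G g c' = (\<Sum>i\<in>A. psc (Y_var i) (gmap G g (w i)))"
    unfolding c'_def gmap_sum gmap_psc ..
  finally have Yk: "psc (Y_var x) k = - (\<Sum>i\<in>A. psc (Y_var i) (gmap G g (w i)))" .
  have mk: "meets A (k a)" for a
  proof (rule meets_cancel_Y[OF _ x])
    have "Y_var x * k a = - ((\<Sum>i\<in>A. psc (Y_var i) (gmap G g (w i))) a)"
      using fun_cong[OF Yk, of a] by (simp add: psc_apply uminus_apply)
    thus "meets A (Y_var x * k a)" using meets_uminus[OF meet_sum] by simp
  qed
  \<comment> \<open>Purity of \<open>K\<close> expresses \<open>k\<close> through elements of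
    \<open>K\<close> of degree \<open>e - 1\<close>, which lift to the free module. In degree 0
    nothing lies below, but there \<open>k\<close> is zero.\<close>
  have "\<exists>d. (\<forall>i\<in>A. d i \<in> hvec G \<delta>' (e - 1)) \<and> (e = 0 \<longrightarrow> (\<forall>i\<in>A. d i = 0)) \<and> k = (\<Sum>i\<in>A. psc (Y_var i) (gmap G g (d i)))"
  proof (cases e)
    case 0
    have "k a = 0" for a
      using gradedD(1)[OF K k] 0 mk by (intro meets_degree_0 hvec_degree_0) auto
    hence "k = 0" by (auto simp: fun_eq_iff zero_fun_apply)
    moreover have "0 \<in> hvec G \<delta>' (e - 1)" by (rule gradedD(2)[OF H])
    ultimately show ?thesis by (intro exI[of _ "\<lambda>_. 0"]) auto
  next
    case (Suc e')
    then obtain z where z: "\<forall>i\<in>A. z i \<in> K e'" "k = (\<Sum>i\<in>A. psc (Y_var i) (z i))"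
      using pure k mk unfolding pure_def by blast
    have "\<forall>i\<in>A. \<exists>d\<in>hvec G \<delta>' e'. z i = gmap G g d" using z(1) gen unfolding generates_def by blast
    then obtain d where d: "\<And>i. i \<in> A \<Longrightarrow> d i \<in> hvec G \<delta>' e'" "\<And>i. i \<in> A \<Longrightarrow> z i = gmap G g (d i)" by metis
    thus ?thesis using z(2) Suc by (intro exI[of _ d]) (auto intro!: sum.cong)
  qed
  then obtain d where d: "\<forall>i\<in>A. d i \<in> hvec G \<delta>' (e - 1)" "e = 0 \<longrightarrow> (\<forall>i\<in>A. d i = 0)"
    "k = (\<Sum>i\<in>A. psc (Y_var i) (gmap G g (d i)))" by blast
  define s where "s = (\<Sum>i\<in>A. psc (Y_var i) (d i))"
  have sH: "s \<in> hvec G \<delta>' e"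
    unfolding s_def
  proof (rule graded_sum[OF H])
    fix i assume i: "i \<in> A"
    show "psc (Y_var i) (d i) \<in> hvec G \<delta>' e"
    proof (cases e)
      case 0
      thus ?thesis using d(2) i gradedD(2)[OF H] by simp
    next
      case (Suc e')
      have "psc (Y_var i) (d i) \<in> hvec G \<delta>' (e' + 1)" using d(1) i Suc by (intro gradedD(4)[OF H]) auto
      thus ?thesis using Suc by simp
    qed
  qed
  have gs: "gmap G g s = k" unfolding s_def gmap_sum gmap_psc d(3) ..
  \<comment> \<open>Replacing \<open>w x\<close> by \<open>z\<close> corrects the coefficient of
    \<open>Y_var x\<close> to a syzygy. The remainder of \<open>c\<close> has entries in the ideal
    of \<open>A\<close>, so purity of the syzygies for \<open>A\<close> applies to it.\<close>
  define z where "z = w x - s"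
  have zS: "z \<in> syz G \<delta>' g e"
    unfolding syz_def z_def using graded_diff[OF H _ sH, of "w x"] w(1) gs by (simp add: gmap_diff k_def)
  have YzS: "psc (Y_var x) z \<in> syz G \<delta>' g (Suc e)" using gradedD(4)[OF S zS homogeneous_Y(1)] by simp
  have rest: "c - psc (Y_var x) z = c' + psc (Y_var x) s"
    unfolding ceq z_def by (simp add: psc_diff)
  have "meets A ((c - psc (Y_var x) z) a)" for a
  proof -
    have "meets A (s a * Y_var x)" unfolding s_def by (rule meets_mult[OF meet_sum])
    moreover have "meets A (c' a)" unfolding c'_def by (rule meet_sum)
    ultimately show ?thesis
      unfolding rest plus_fun_apply psc_apply by (intro meets_add) (simp_all add: mult.commute)
  qed
  hence "\<forall>a. meets A ((c - psc (Y_var x) z) a)" by blast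
  moreover have "c - psc (Y_var x) z \<in> syz G \<delta>' g (Suc e)" by (rule graded_diff[OF S c(1) YzS])
  ultimately obtain y where y: "\<forall>i\<in>A. y i \<in> syz G \<delta>' g e" "c - psc (Y_var x) z = (\<Sum>i\<in>A. psc (Y_var i) (y i))"
    using pure' unfolding pure_def by blast
  have "c = psc (Y_var x) z + (\<Sum>i\<in>A. psc (Y_var i) (y i))" using y(2) by (metis add.commute diff_add_cancel)
  also have "(\<Sum>i\<in>A. psc (Y_var i) (y i)) = (\<Sum>i\<in>A. psc (Y_var i) ((y(x := z)) i))"
    using x by (intro sum.cong) auto
  finally have "c = (\<Sum>i\<in>insert x A. psc (Y_var i) ((y(x := z)) i))" using x by simp
  moreover have "\<forall>i\<in>insert x A. (y(x := z)) i \<in> syz G \<delta>' g e" using y zS by auto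
  ultimately show "\<exists>w. (\<forall>i\<in>insert x A. w i \<in> syz G \<delta>' g e) \<and> c = (\<Sum>i\<in>insert x A. psc (Y_var i) (w i))" by blast
qed

lemma pure_empty:
  fixes K :: "nat \<Rightarrow> (nat \<Rightarrow> ('k::field, 'r::{finite,linorder}) hpoly) set"
  shows "pure {} K"
  unfolding pure_def
proof (intro allI ballI impI)
  fix e and u :: "nat \<Rightarrow> ('k, 'r) hpoly" assume "\<forall>a. meets {} (u a)"
  hence "\<forall>a. Poly_Mapping.keys (u a) = {}" by (auto simp: meets_def)
  hence "u = 0" by (simp add: fun_eq_iff zero_fun_apply)
  thus "\<exists>w. (\<forall>i\<in>{}. w i \<in> K e) \<and> u = (\<Sum>i\<in>{}. psc (Y_var i) (w i))" by simp
qed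

lemma pure_syz_card:
  assumes K: "graded I \<delta> K" and gen: "generates G \<delta>' g K" and pure: "\<And>A. card A \<le> n \<Longrightarrow> pure A K"
  shows "card A \<le> Suc n \<Longrightarrow> pure A (syz G \<delta>' g)"
  using finite[of A]
proof (induction A rule: finite_induct)
  case empty
  show ?case by (rule pure_empty)
next
  case (insert x A)
  show ?case by (rule pure_syz[OF K gen pure insert.IH]) (use insert in auto)
qed

text \<open>Purity for all variables turns the condition on the entries into the equality of
  \<open>K\<close> with its product by the irrelevant ideal. In nonnegative degrees this leaves only
  zero, by induction on the degree.\<close>

lemma graded_nakayama:
  assumes K: "graded I \<delta> K" and pure: "pure UNIV K" and mK: "\<And>e u a. u \<in> K e \<Longrightarrow> meets UNIV (u a)"
  shows "K e = {0}"
proof -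
  have "u = 0" if "u \<in> K e" for u
    using that
  proof (induction e arbitrary: u)
    case 0
    have "u a = 0" for a
      using gradedD(1)[OF K 0] mK[OF 0] by (intro meets_degree_0 hvec_degree_0) auto
    thus ?case by (simp add: fun_eq_iff zero_fun_apply)
  next
    case (Suc e)
    have "\<forall>a. meets UNIV (u a)" using mK[OF Suc.prems] by simp
    with pure Suc.prems have "\<exists>w. (\<forall>i\<in>UNIV. w i \<in> K e) \<and> u = (\<Sum>i\<in>UNIV. psc (Y_var i) (w i))"
      unfolding pure_def by simp
    then obtain w where w: "\<forall>i. w i \<in> K e" "u = (\<Sum>i\<in>UNIV. psc (Y_var i) (w i))" by auto
    have "w i = 0" for i using Suc.IH w(1) by blast
    thus ?case using w(2) by simp
  qed
  thus ?thesis using gradedD(2)[OF K] by blast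
qed

subsection \<open>Finite generation\<close>

lemma monotone_subsequence_nat:
  fixes s :: "nat \<Rightarrow> nat"
  shows "\<exists>\<phi> :: nat \<Rightarrow> nat. strict_mono \<phi> \<and> (\<forall>m n. m \<le> n \<longrightarrow> s (\<phi> m) \<le> s (\<phi> n))"
proof -
  obtain g :: "nat \<Rightarrow> nat" where g: "strict_mono g" "monoseq (\<lambda>n. s (g n))" using seq_monosub[of s] by blast
  show ?thesis
  proof (cases "incseq (\<lambda>n. s (g n))")
    case True
    thus ?thesis using g(1) by (intro exI[of _ g]) (auto simp: incseq_def)
  next
    case False
    hence dec: "decseq (\<lambda>n. s (g n))" using g(2) by (auto simp: monoseq_iff)
    obtain n0 where n0: "\<And>n. s (g n0) \<le> s (g n)"
      using exists_least_iff[of "\<lambda>v. \<exists>n. v = s (g n)"] by (metis not_less)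
    have "s (g (n0 + n)) = s (g n0)" for n
      using dec n0[of "n0 + n"] by (auto simp: decseq_def intro: antisym)
    moreover have "strict_mono (\<lambda>n. g (n0 + n))" using g(1) by (auto simp: strict_mono_def)
    ultimately show ?thesis by (intro exI[of _ "\<lambda>n. g (n0 + n)"]) auto
  qed
qed

text \<open>A subsequence that is weakly increasing in some coordinates can be thinned again for the
  next one; after finitely many coordinates any two of its terms are comparable.\<close>

lemma dickson_sequence:
  fixes f :: "nat \<Rightarrow> 'r::finite \<Rightarrow> nat"
  shows "\<exists>i j. i < j \<and> (\<forall>x. f i x \<le> f j x)"
proof -
  have "\<exists>\<phi>. strict_mono (\<phi> :: nat \<Rightarrow> nat) \<and> (\<forall>x\<in>A. \<forall>m n. m \<le> n \<longrightarrow> f (\<phi> m) x \<le> f (\<phi> n) x)" for A :: "'r set"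
    using finite[of A]
  proof (induction A rule: finite_induct)
    case empty
    show ?case by (intro exI[of _ id]) (auto simp: strict_mono_def)
  next
    case (insert a A)
    then obtain \<phi> :: "nat \<Rightarrow> nat" where \<phi>: "strict_mono \<phi>" "\<And>x m n. x \<in> A \<Longrightarrow> m \<le> n \<Longrightarrow> f (\<phi> m) x \<le> f (\<phi> n) x" by blast
    obtain \<psi> :: "nat \<Rightarrow> nat" where \<psi>: "strict_mono \<psi>" "\<And>m n. m \<le> n \<Longrightarrow> f (\<phi> (\<psi> m)) a \<le> f (\<phi> (\<psi> n)) a"
      using monotone_subsequence_nat[of "\<lambda>n. f (\<phi> n) a"] by blast
    have "strict_mono (\<lambda>n. \<phi> (\<psi> n))" using \<phi>(1) \<psi>(1) by (auto simp: strict_mono_def)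
    moreover have "\<psi> m \<le> \<psi> n" if "m \<le> n" for m n using \<psi>(1) that by (simp add: strict_mono_less_eq)
    ultimately show ?case using \<phi> \<psi> by (intro exI[of _ "\<lambda>n. \<phi> (\<psi> n)"]) auto
  qed
  from this[of UNIV] obtain \<phi> :: "nat \<Rightarrow> nat" where \<phi>: "strict_mono \<phi>" "\<And>x m n. m \<le> n \<Longrightarrow> f (\<phi> m) x \<le> f (\<phi> n) x" by blast
  have "\<phi> 0 < \<phi> 1" using \<phi>(1) by (auto simp: strict_mono_def)
  thus ?thesis using \<phi>(2)[of 0 1] by auto
qed

text \<open>\<open>B\<close> consists of the exponents minimal for divisibility. They are pairwise
  incomparable, so infinitely many of them would contradict \<open>dickson_sequence\<close>.\<close>

lemma dickson:
  fixes M :: "('r::finite \<Rightarrow>\<^sub>0 nat) set"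
  shows "\<exists>B\<subseteq>M. finite B \<and> (\<forall>t\<in>M. \<exists>s\<in>B. \<exists>z. t = s + z)"
proof -
  define le :: "('r \<Rightarrow>\<^sub>0 nat) \<Rightarrow> ('r \<Rightarrow>\<^sub>0 nat) \<Rightarrow> bool" where
    "le s t \<longleftrightarrow> (\<forall>x. Poly_Mapping.lookup s x \<le> Poly_Mapping.lookup t x)" for s t
  have le_add: "\<exists>z. t = s + z" if "le s t" for s t
    using that by (intro exI[of _ "t - s"] poly_mapping_eqI) (auto simp: le_def lookup_add lookup_minus)
  define B where "B = {t \<in> M. \<forall>s\<in>M. le s t \<longrightarrow> s = t}"
  have "finite B"
  proof (rule ccontr)
    assume "infinite B"
    then obtain f :: "nat \<Rightarrow> 'r \<Rightarrow>\<^sub>0 nat" where f: "inj f" "range f \<subseteq> B" using infinite_countable_subset by blast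
    obtain i j where ij: "i < j" "\<forall>x. Poly_Mapping.lookup (f i) x \<le> Poly_Mapping.lookup (f j) x"
      using dickson_sequence[of "\<lambda>n. Poly_Mapping.lookup (f n)"] by blast
    hence "f i = f j" using f(2) unfolding B_def le_def by blast
    thus False using f(1) ij(1) by (auto simp: inj_def)
  qed
  moreover have min: "\<exists>s\<in>B. le s t" if "t \<in> M" for t
    using that
  proof (induction "mdeg t" arbitrary: t rule: less_induct)
    case less
    show ?case
    proof (cases "t \<in> B")
      case False
      then obtain s where s: "s \<in> M" "le s t" "s \<noteq> t" using less.prems unfolding B_def by blast
      obtain z where z: "t = s + z" using le_add[OF s(2)] by blast
      hence "mdeg z \<noteq> 0" using s(3) unfolding mdeg_eq_0_iff by auto
      hence "mdeg s < mdeg t" unfolding z mdeg_add by linarith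
      then obtain s' where "s' \<in> B" "le s' s" using less.hyps s(1) by blast
      thus ?thesis using s(2) unfolding le_def by (meson order_trans)
    qed (auto simp: le_def)
  qed
  moreover have "B \<subseteq> M" by (auto simp: B_def)
  ultimately show ?thesis by (intro exI[of _ B] conjI ballI) (use min le_add in metis)+
qed

lemma finite_mdeg: "finite {t :: 'r::finite \<Rightarrow>\<^sub>0 nat. mdeg t = n}"
proof -
  have "Poly_Mapping.lookup ` {t :: 'r \<Rightarrow>\<^sub>0 nat. mdeg t = n} \<subseteq> (\<Pi>\<^sub>E x\<in>UNIV. {..n})"
  proof
    fix f assume "f \<in> Poly_Mapping.lookup ` {t :: 'r \<Rightarrow>\<^sub>0 nat. mdeg t = n}"
    then obtain t :: "'r \<Rightarrow>\<^sub>0 nat" where t: "f = Poly_Mapping.lookup t" "mdeg t = n" by blast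
    have "f x \<le> n" for x
      using member_le_sum[of x UNIV f] t by (simp add: mdeg_def)
    thus "f \<in> (\<Pi>\<^sub>E x\<in>UNIV. {..n})" by auto
  qed
  hence "finite (Poly_Mapping.lookup ` {t :: 'r \<Rightarrow>\<^sub>0 nat. mdeg t = n})"
    by (rule finite_subset) (intro finite_PiE; simp)
  moreover have "inj_on Poly_Mapping.lookup {t :: 'r \<Rightarrow>\<^sub>0 nat. mdeg t = n}"
    by (rule inj_onI) (simp add: lookup_inject)
  ultimately show ?thesis by (rule finite_imageD)
qed

text \<open>Division of \<open>u\<close> by elements with prescribed leading terms (position over term order).\<close>

lemma leading_term_generation:
  fixes K :: "nat \<Rightarrow> (nat \<Rightarrow> ('k::field, 'r::{finite,linorder}) hpoly) set"
  assumes K: "graded I \<delta> K" and G: "finite G" "\<And>b. b \<in> G \<Longrightarrow> g b \<in> K (\<delta>' b)"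
    and lt: "\<And>e u n. u \<in> K e \<Longrightarrow> u n \<noteq> 0 \<Longrightarrow> (\<And>a. a > n \<Longrightarrow> u a = 0) \<Longrightarrow>
      \<exists>b\<in>G. \<exists>z. g b n \<noteq> 0 \<and> (\<forall>a>n. g b a = 0) \<and> Max (Poly_Mapping.keys (u n)) = Max (Poly_Mapping.keys (g b n)) + z"
  shows "u \<in> K e \<Longrightarrow> (\<And>a. a \<ge> N \<Longrightarrow> u a = 0) \<Longrightarrow> \<exists>c\<in>hvec G \<delta>' e. u = gmap G g c"
proof (induction N arbitrary: u)
  case 0
  hence "u = 0" by (auto simp: fun_eq_iff zero_fun_apply)
  thus ?case using gradedD(2)[OF hvec_graded, of G \<delta>' e] by (intro bexI[of _ 0]) auto
next
  case (Suc n)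
  note H = hvec_graded[of G \<delta>']
  \<comment> \<open>Termination measure: the monomials of the fixed degree that lie below some
    monomial of the top entry. They are finite in number because the degree is fixed, and at least
    one is lost when the leading monomial is cancelled.\<close>
  define below where "below u = {t :: 'r \<Rightarrow>\<^sub>0 nat. mdeg t = e - \<delta> n \<and> (\<exists>s\<in>Poly_Mapping.keys (u n). t \<le> s)}"
    for u :: "nat \<Rightarrow> ('k, 'r) hpoly"
  have fin: "finite (below u)" for u
    by (rule finite_subset[OF _ finite_mdeg[of "e - \<delta> n"]]) (auto simp: below_def)
  from Suc.prems show ?case
  proof (induction "card (below u)" arbitrary: u rule: less_induct)
    case less
    show ?case
    proof (cases "u n = 0")
      case True
      have "u a = 0" if "a \<ge> n" for a using True less.prems(2)[of a] that by (cases "a = n") auto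
      thus ?thesis using Suc.IH[OF less.prems(1)] by blast
    next
      case False
      have un: "n \<in> I" "\<delta> n \<le> e" "homogeneous (e - \<delta> n) (u n)"
        using False gradedD(1)[OF K less.prems(1)] unfolding hvec_def by (auto split: if_splits)
      obtain b z where b: "b \<in> G" "g b n \<noteq> 0" "\<forall>a>n. g b a = 0"
        and z: "Max (Poly_Mapping.keys (u n)) = Max (Poly_Mapping.keys (g b n)) + z"
        using lt[OF less.prems(1) False] less.prems(2) by (auto simp: Suc_le_eq)
      define t s where "t = Max (Poly_Mapping.keys (u n))" and "s = Max (Poly_Mapping.keys (g b n))"
      have ts: "t = z + s" using z by (simp add: t_def s_def add.commute)
      have t: "t \<in> Poly_Mapping.keys (u n)" unfolding t_def using False by (intro Max_in) auto
      have s: "s \<in> Poly_Mapping.keys (g b n)" unfolding s_def using b by (intro Max_in) auto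
      have gn: "\<delta> n \<le> \<delta>' b" "homogeneous (\<delta>' b - \<delta> n) (g b n)"
        using b(2) un(1) gradedD(1)[OF K G(2)[OF b(1)]] unfolding hvec_def by (auto split: if_splits)
      have "mdeg t = e - \<delta> n" "mdeg s = \<delta>' b - \<delta> n" using t s un gn by (auto simp: homogeneous_iff)
      hence dz: "e = \<delta>' b + mdeg z" using ts gn(1) un(2) by simp
      define c where "c = Poly_Mapping.lookup (u n) t / Poly_Mapping.lookup (g b n) s"
      define f where "f = Poly_Mapping.single z c"
      have f: "homogeneous (mdeg z) f" by (auto simp: f_def homogeneous_iff)
      define u' where "u' = u - psc f (g b)"
      have fgK: "psc f (g b) \<in> K e" using gradedD(4)[OF K G(2)[OF b(1)] f] dz by simp
      have u'K: "u' \<in> K e" unfolding u'_def by (rule graded_diff[OF K less.prems(1) fgK])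
      have u'0: "u' a = 0" if "a \<ge> Suc n" for a
        using less.prems(2)[OF that] b(3) that by (simp add: u'_def pvec_apply)
      have u'n: "u' n = u n - f * g b n" by (simp add: u'_def pvec_apply)
      have "Poly_Mapping.lookup (f * g b n) t = c * Poly_Mapping.lookup (g b n) s"
        unfolding f_def ts by (rule lookup_single_mult)
      hence "Poly_Mapping.lookup (u' n) t = 0"
        using s unfolding u'n lookup_minus c_def by (simp add: in_keys_iff)
      hence tu': "t \<notin> Poly_Mapping.keys (u' n)" by (simp add: in_keys_iff)
      have lt': "w < t" if w: "w \<in> Poly_Mapping.keys (u' n)" for w
      proof -
        have "w \<in> Poly_Mapping.keys (u n) \<or> w \<in> Poly_Mapping.keys (f * g b n)"
          using w unfolding u'n by (auto simp: in_keys_iff lookup_minus)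
        hence "w \<le> t"
        proof
          assume "w \<in> Poly_Mapping.keys (u n)"
          thus ?thesis unfolding t_def by simp
        next
          assume "w \<in> Poly_Mapping.keys (f * g b n)"
          then obtain v where v: "w = z + v" "v \<in> Poly_Mapping.keys (g b n)"
            using keys_mult[of f "g b n"] unfolding f_def by (auto split: if_splits)
          have "v \<le> s" unfolding s_def using v(2) by simp
          thus ?thesis unfolding v(1) ts by (rule add_left_mono)
        qed
        thus ?thesis using w tu' by (cases "w = t") auto
      qed
      have "below u' \<subset> below u"
      proof
        show "below u' \<subseteq> below u"
        proof
          fix x assume "x \<in> below u'"
          then obtain y where y: "mdeg x = e - \<delta> n" "x \<le> y" "y \<in> Poly_Mapping.keys (u' n)"
            unfolding below_def by blast
          hence "x \<le> t" using lt'[OF y(3)] by order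
          thus "x \<in> below u" unfolding below_def using t y(1) by blast
        qed
        have "t \<in> below u" unfolding below_def using t un(3) by (auto simp: homogeneous_iff)
        moreover have "t \<notin> below u'" unfolding below_def using lt' by (auto simp: not_le)
        ultimately show "below u' \<noteq> below u" by blast
      qed
      hence "card (below u') < card (below u)" using fin by (rule psubset_card_mono[rotated])
      from less.hyps[OF this u'K u'0] obtain d where d: "d \<in> hvec G \<delta>' e" "u' = gmap G g d" by blast
      define d' where "d' = (\<lambda>b'. if b' = b then f else 0)"
      have "d' \<in> hvec G \<delta>' e" using f dz b(1) by (auto simp: d'_def hvec_def)
      hence "d + d' \<in> hvec G \<delta>' e" using gradedD(3)[OF H d(1)] by blast
      moreover have "gmap G g d' = psc f (g b)"
      proof
        fix a
        have "gmap G g d' a = (\<Sum>b'\<in>G. if b' = b then f * g b a else 0)"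
          unfolding gmap_apply by (rule sum.cong) (auto simp: d'_def)
        thus "gmap G g d' a = psc f (g b) a" using G(1) b(1) by (simp add: psc_apply)
      qed
      hence "u = gmap G g (d + d')" using d(2) unfolding gmap_add u'_def by (metis diff_add_cancel)
      ultimately show ?thesis by blast
    qed
  qed
qed

text \<open>For each position Dickson's lemma leaves finitely many leading monomials up to
  multiples, and division by elements that realise them shows that these elements generate: they
  form a Groebner basis of \<open>K\<close>.\<close>

lemma exists_generators:
  fixes K :: "nat \<Rightarrow> (nat \<Rightarrow> ('k::field, 'r::{finite,linorder}) hpoly) set"
  assumes K: "graded I \<delta> K" and I: "finite I"
  shows "\<exists>G \<delta>' g. generates G \<delta>' g K"
proof -
  define lead where "lead n u s \<longleftrightarrow> u n \<noteq> 0 \<and> (\<forall>a>n. u a = 0) \<and> Max (Poly_Mapping.keys (u n)) = s"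
    for n s and u :: "nat \<Rightarrow> ('k, 'r) hpoly"
  define M where "M n = {s. \<exists>e. \<exists>u\<in>K e. lead n u s}" for n
  have "\<forall>n. \<exists>B. B \<subseteq> M n \<and> finite B \<and> (\<forall>t\<in>M n. \<exists>s\<in>B. \<exists>z. t = s + z)" using dickson by blast
  then obtain B where B: "\<And>n. B n \<subseteq> M n" "\<And>n. finite (B n)" "\<And>n t. t \<in> M n \<Longrightarrow> \<exists>s\<in>B n. \<exists>z. t = s + z" by metis
  define S where "S = (SIGMA n:I. B n)"
  have finS: "finite S" unfolding S_def using I B(2) by blast
  have "\<forall>x\<in>S. \<exists>e u. u \<in> K e \<and> lead (fst x) u (snd x)" using B(1) unfolding S_def M_def by fastforce
  then obtain e0 u0 where u0: "\<And>x. x \<in> S \<Longrightarrow> u0 x \<in> K (e0 x)" "\<And>x. x \<in> S \<Longrightarrow> lead (fst x) (u0 x) (snd x)" by metis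
  obtain h where h: "bij_betw h {..<card S} S"
    using ex_bij_betw_nat_finite[OF finS] by (auto simp: lessThan_atLeast0)
  have hS: "h b \<in> S" if "b < card S" for b using bij_betwE[OF h] that by auto
  have gen: "\<exists>c\<in>hvec {..<card S} (e0 \<circ> h) e. u = gmap {..<card S} (u0 \<circ> h) c" if u: "u \<in> K e" for e u
  proof (rule leading_term_generation[OF K])
    show "finite {..<card S}" by simp
    show "(u0 \<circ> h) b \<in> K ((e0 \<circ> h) b)" if "b \<in> {..<card S}" for b using u0(1) hS that by auto
    show "u \<in> K e" by (rule u)
    \<comment> \<open>Inserting 0 keeps the maximum defined when \<open>I\<close> is empty.\<close>
    show "u a = 0" if "a \<ge> Suc (Max (insert 0 I))" for a
    proof -
      have "a \<notin> I" using that I by (meson Max_ge Suc_le_lessD finite_insert insertI2 not_less)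
      thus ?thesis using gradedD(1)[OF K u] by (auto simp: hvec_def)
    qed
    fix e' u n assume u: "u \<in> K e'" "u n \<noteq> 0" "\<And>a. n < a \<Longrightarrow> u a = 0"
    have nI: "n \<in> I" using gradedD(1)[OF K u(1)] u(2) by (auto simp: hvec_def)
    have "Max (Poly_Mapping.keys (u n)) \<in> M n" unfolding M_def lead_def using u by blast
    then obtain s z where s: "s \<in> B n" "Max (Poly_Mapping.keys (u n)) = s + z" using B(3) by blast
    have "(n, s) \<in> S" using s nI by (simp add: S_def)
    hence "(n, s) \<in> h ` {..<card S}" using h by (simp add: bij_betw_def)
    then obtain b where b: "b < card S" "h b = (n, s)" by (metis imageE lessThan_iff)
    have "lead n (u0 (h b)) s" using u0(2)[OF hS[OF b(1)]] b(2) by simp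
    thus "\<exists>b\<in>{..<card S}. \<exists>z. (u0 \<circ> h) b n \<noteq> 0 \<and> (\<forall>a>n. (u0 \<circ> h) b a = 0) \<and>
       Max (Poly_Mapping.keys (u n)) = Max (Poly_Mapping.keys ((u0 \<circ> h) b n)) + z"
      using b(1) s(2) unfolding lead_def by (intro bexI[of _ b] exI[of _ z]) auto
  qed
  have "generates {..<card S} (e0 \<circ> h) (u0 \<circ> h) K"
    unfolding generates_def using gen u0(1) hS by auto
  thus ?thesis by blast
qed

text \<open>Among all homogeneous generating systems one of least size is taken. A syzygy with a
  nonzero constant term in some entry would express that generator by the others, so all entries of
  syzygies lie in the irrelevant ideal.\<close>

lemma exists_minimal_generators:
  fixes K :: "nat \<Rightarrow> (nat \<Rightarrow> ('k::field, 'r::{finite,linorder}) hpoly) set"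
  assumes K: "graded I \<delta> K" and I: "finite I"
  shows "\<exists>G \<delta>' g. generates G \<delta>' g K \<and> (\<forall>e. \<forall>c\<in>syz G \<delta>' g e. \<forall>b. meets UNIV (c b))"
proof -
  define Q where "Q n \<longleftrightarrow> (\<exists>G \<delta>' g. generates G \<delta>' g K \<and> card G = n)" for n
  have "\<exists>n. Q n" using exists_generators[OF K I] unfolding Q_def by blast
  then obtain n where n: "Q n" "\<And>n'. n' < n \<Longrightarrow> \<not> Q n'" using exists_least_iff[of Q] by blast
  obtain G \<delta>' g where G: "generates G \<delta>' g K" "card G = n" using n(1) unfolding Q_def by blast
  have fin: "finite G" using G(1) by (simp add: generates_def)
  note H = hvec_graded
  have "meets UNIV (c b)" if c: "c \<in> syz G \<delta>' g e" for c b e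
  proof (rule ccontr)
    assume nm: "\<not> meets UNIV (c b)"
    then obtain t where t: "t \<in> Poly_Mapping.keys (c b)" "\<forall>i. Poly_Mapping.lookup t i = 0" unfolding meets_def by blast
    have t0: "t = 0" using t(2) by (intro poly_mapping_eqI) simp
    have cH: "c \<in> hvec G \<delta>' e" and c0: "gmap G g c = 0" using c by (auto simp: syz_def)
    have b: "b \<in> G" and eb: "\<delta>' b \<le> e" "homogeneous (e - \<delta>' b) (c b)"
      using cH t(1) unfolding hvec_def by (auto split: if_splits)
    have "e - \<delta>' b = 0" using eb(2) t(1) t0 by (auto simp: homogeneous_iff)
    hence e: "e = \<delta>' b" using eb by simp
    define \<gamma> where "\<gamma> = Poly_Mapping.lookup (c b) 0"
    have \<gamma>: "\<gamma> \<noteq> 0" using t(1) t0 by (simp add: \<gamma>_def in_keys_iff)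
    \<comment> \<open>A homogeneous entry with a constant term is that constant, so it can be
      inverted and the relation solved for \<open>g b\<close>.\<close>
    have cb: "c b = Poly_Mapping.single 0 \<gamma>"
    proof (rule poly_mapping_eqI)
      fix s
      show "Poly_Mapping.lookup (c b) s = Poly_Mapping.lookup (Poly_Mapping.single 0 \<gamma>) s"
        using eb(2) e by (cases "s = 0") (auto simp: \<gamma>_def lookup_single homogeneous_iff in_keys_iff)
    qed
    define d where "d = (\<lambda>b'. if b' = b then 0 else Poly_Mapping.single 0 (- inverse \<gamma>) * c b')"
    let ?G = "G - {b}"
    have dH: "d \<in> hvec ?G \<delta>' (\<delta>' b)"
    proof -
      have "psc (Poly_Mapping.single 0 (- inverse \<gamma>)) c \<in> hvec G \<delta>' (e + 0)" by (rule gradedD(4)[OF H cH]) simp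
      thus ?thesis unfolding e by (auto simp: hvec_def d_def psc_apply)
    qed
    have gb: "g b = gmap ?G g d"
    proof
      fix a
      have "0 = (\<Sum>b'\<in>G. c b' * g b' a)" using fun_cong[OF c0, of a] by (simp add: gmap_apply zero_fun_apply)
      also have "\<dots> = Poly_Mapping.single 0 \<gamma> * g b a + (\<Sum>b'\<in>?G. c b' * g b' a)"
        using fin b by (simp add: sum.remove cb)
      finally have "Poly_Mapping.single 0 (- inverse \<gamma>) * (Poly_Mapping.single 0 \<gamma> * g b a + (\<Sum>b'\<in>?G. c b' * g b' a)) = 0" by simp
      moreover have "Poly_Mapping.single 0 (- inverse \<gamma>) * (Poly_Mapping.single 0 \<gamma> * g b a) = - g b a"
        using \<gamma> by (simp add: mult.assoc[symmetric] mult_single single_uminus)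
      ultimately have "g b a = Poly_Mapping.single 0 (- inverse \<gamma>) * (\<Sum>b'\<in>?G. c b' * g b' a)"
        by (simp add: distrib_left)
      also have "\<dots> = (\<Sum>b'\<in>?G. d b' * g b' a)"
        unfolding sum_distrib_left by (rule sum.cong) (auto simp: d_def mult.assoc)
      finally show "g b a = gmap ?G g d a" by (simp add: gmap_apply)
    qed
    have "generates ?G \<delta>' g K"
      unfolding generates_def
    proof (intro conjI allI ballI)
      show "finite ?G" using fin by simp
      show "g b' \<in> K (\<delta>' b')" if "b' \<in> ?G" for b' using G(1) that by (auto simp: generates_def)
      fix e' u assume u: "u \<in> K e'"
      then obtain x where x: "x \<in> hvec G \<delta>' e'" "u = gmap G g x" using G(1) unfolding generates_def by blast
      define y where "y = (\<lambda>b'. if b' = b then 0 else x b')"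
      have yH: "y \<in> hvec ?G \<delta>' e'" using x(1) by (auto simp: hvec_def y_def)
      have "psc (x b) d \<in> hvec ?G \<delta>' e'" by (rule graded_psc_hvec[OF H x(1) b dH])
      hence "y + psc (x b) d \<in> hvec ?G \<delta>' e'" using gradedD(3)[OF H yH] by blast
      moreover have "u = gmap ?G g (y + psc (x b) d)"
      proof -
        have "gmap G g x = psc (x b) (g b) + gmap ?G g x"
          unfolding gmap_def using fin b by (simp add: sum.remove)
        also have "gmap ?G g x = gmap ?G g y" unfolding gmap_def by (rule sum.cong) (auto simp: y_def)
        finally show ?thesis unfolding x(2) gmap_add gmap_psc gb[symmetric] by (simp add: add.commute)
      qed
      ultimately show "\<exists>c\<in>hvec ?G \<delta>' e'. u = gmap ?G g c" by blast
    qed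
    hence "Q (card ?G)" unfolding Q_def by blast
    moreover have "card ?G < n" using fin b G(2) by (metis card_Diff1_less)
    ultimately show False using n(2) by blast
  qed
  thus ?thesis using G(1) by blast
qed

section \<open>Sheaves associated with graded modules\<close>

text \<open>The stalk at \<open>P\<close> of the sheaf attached to \<open>K\<close>, twisted by
  \<open>j\<close>: the degree \<open>j\<close> part of the homogeneous localization, with a common
  denominator for all coordinates.\<close>

definition gsheaf :: "(nat \<Rightarrow> (nat \<Rightarrow> ('k::field, 'r::{finite,linorder}) hpoly) set) \<Rightarrow> int \<Rightarrow> ('k, 'r) lattice" where
  "gsheaf K j P = {\<lambda>a. Fract (u a) h |u h e e'. u \<in> K e \<and> homogeneous e' h \<and> h \<notin> P \<and> int e = int e' + j}"

lemma loc_free_cong: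
  fixes L :: "('k::field, 'r::{finite,linorder}) lattice"
  assumes L: "loc_free L" and eq: "\<And>P. P \<in> proj_space \<Longrightarrow> L P = L' P"
  shows "loc_free L'"
  unfolding loc_free_def
proof
  fix P :: "('k, 'r) point" assume P: "P \<in> proj_space"
  obtain N :: nat and b where b: "indep {..<N} b" "near P (\<lambda>R. L R = aspan (Oj 0 R) {..<N} b)"
    by (rule loc_freeE[OF L P])
  have "near P (\<lambda>R. L' R = aspan (Oj 0 R) {..<N} b)" by (rule near_mono[OF b(2)]) (simp add: eq)
  thus "\<exists>N (b :: nat \<Rightarrow> nat \<Rightarrow> ('k, 'r) hfrac). indep {..<N} b \<and> near P (\<lambda>R. L' R = aspan (Oj 0 R) {..<N} b)"
    using b(1) by blast
qed

lemma gsheaf_hvec: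
  fixes P :: "('k::field, 'r::{finite,linorder}) point"
  assumes P: "P \<in> proj_space" and I: "finite I"
  shows "gsheaf (hvec I \<delta>) j P = DS I (\<lambda>a. j - int (\<delta> a)) P"
proof (intro equalityI subsetI)
  fix v assume "v \<in> gsheaf (hvec I \<delta>) j P"
  then obtain u h e e' where u: "v = (\<lambda>a. Fract (u a) h)" "u \<in> hvec I \<delta> e" "homogeneous e' h" "h \<notin> P" "int e = int e' + j"
    unfolding gsheaf_def by blast
  have "Fract (u a) h \<in> Oj (j - int (\<delta> a)) P" if a: "a \<in> I" for a
  proof (cases "\<delta> a \<le> e")
    case True
    hence "homogeneous (e - \<delta> a) (u a)" using u(2) a by (auto simp: hvec_def)
    thus ?thesis by (rule OjI[OF _ u(3) _ u(4)]) (use True u(5) in auto)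
  next
    case False
    hence "u a = 0" using u(2) a by (auto simp: hvec_def)
    thus ?thesis using Oj_0[OF P] by (simp add: fract_collapse)
  qed
  moreover have "Fract (u a) h = 0" if "a \<notin> I" for a
    using u(2) that by (simp add: hvec_def fract_collapse)
  ultimately show "v \<in> DS I (\<lambda>a. j - int (\<delta> a)) P" unfolding u(1) DS_def by blast
next
  fix v assume v: "v \<in> DS I (\<lambda>a. j - int (\<delta> a)) P"
  have "\<forall>a\<in>I. \<exists>x. v a = Fract (fst x) (fst (snd x)) \<and> homogeneous (fst (snd (snd x))) (fst x) \<and>
      homogeneous (snd (snd (snd x))) (fst (snd x)) \<and>
      int (fst (snd (snd x))) = int (snd (snd (snd x))) + (j - int (\<delta> a)) \<and> fst (snd x) \<notin> P \<and> fst (snd x) \<noteq> 0"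
  proof
    fix a assume "a \<in> I"
    hence "v a \<in> Oj (j - int (\<delta> a)) P" using v by (simp add: DS_def)
    then obtain f h e e' where "v a = Fract f h" "homogeneous e f" "homogeneous e' h"
      "int e = int e' + (j - int (\<delta> a))" "h \<notin> P" "h \<noteq> 0" using OjE[OF _ P] by metis
    thus "\<exists>x. v a = Fract (fst x) (fst (snd x)) \<and> homogeneous (fst (snd (snd x))) (fst x) \<and>
      homogeneous (snd (snd (snd x))) (fst (snd x)) \<and>
      int (fst (snd (snd x))) = int (snd (snd (snd x))) + (j - int (\<delta> a)) \<and> fst (snd x) \<notin> P \<and> fst (snd x) \<noteq> 0"
      by (intro exI[of _ "(f, h, e, e')"]) simp
  qed
  then obtain F where F: "\<forall>a\<in>I. v a = Fract (fst (F a)) (fst (snd (F a))) \<and> homogeneous (fst (snd (snd (F a)))) (fst (F a)) \<and>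
      homogeneous (snd (snd (snd (F a)))) (fst (snd (F a))) \<and>
      int (fst (snd (snd (F a)))) = int (snd (snd (snd (F a)))) + (j - int (\<delta> a)) \<and> fst (snd (F a)) \<notin> P \<and> fst (snd (F a)) \<noteq> 0"
    by (rule bchoice[THEN exE])
  define f h e e' where "f a = fst (F a)" and "h a = fst (snd (F a))" and "e a = fst (snd (snd (F a)))" and "e' a = snd (snd (snd (F a)))" for a
  have f: "\<And>a. a \<in> I \<Longrightarrow> v a = Fract (f a) (h a)" "\<And>a. a \<in> I \<Longrightarrow> homogeneous (e a) (f a)"
      "\<And>a. a \<in> I \<Longrightarrow> homogeneous (e' a) (h a)" "\<And>a. a \<in> I \<Longrightarrow> int (e a) = int (e' a) + (j - int (\<delta> a))"
      "\<And>a. a \<in> I \<Longrightarrow> h a \<notin> P" "\<And>a. a \<in> I \<Longrightarrow> h a \<noteq> 0"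
    using F unfolding f_def h_def e_def e'_def by blast+
  obtain i where i: "Y_var i \<notin> P" using point_facts(6)[OF P] by blast
  \<comment> \<open>The degree \<open>D + j\<close> of the numerators must not be negative; for
    negative \<open>j\<close> the common denominator is enlarged by this power of a variable outside
    \<open>P\<close>.\<close>
  define n where "n = nat (- j)"
  define H where "H = Y_var i ^ n * (\<Prod>a\<in>I. h a)"
  define D where "D = n + (\<Sum>a\<in>I. e' a)"
  define u where "u a = (if a \<in> I then Y_var i ^ n * (f a * (\<Prod>b\<in>I - {a}. h b)) else 0)" for a
  have Yn: "homogeneous n (Y_var i ^ n :: ('k, 'r) hpoly)" using homogeneous_power[OF homogeneous_Y(1), of n i] by simp
  have H: "homogeneous D H" unfolding H_def D_def
    by (intro homogeneous_mult Yn homogeneous_prod) (use I f in auto)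
  have HP: "H \<notin> P"
  proof -
    have "(\<Prod>a\<in>I. h a) \<notin> P" using prod_notin_point[OF I P, of h] f(5) by blast
    thus ?thesis unfolding H_def using point_facts(5)[OF P] power_notin_point[OF P i] by blast
  qed
  define E where "E = nat (int D + j)"
  have E: "int E = int D + j" unfolding E_def D_def n_def using sum_nonneg[of I "\<lambda>x. int (e' x)"] by auto
  have "u \<in> hvec I \<delta> E" unfolding hvec_def
  proof (intro CollectI conjI allI impI ballI)
    show "u a = 0" if "a \<notin> I" for a using that by (simp add: u_def)
    fix a assume a: "a \<in> I"
    have sum: "(\<Sum>b\<in>I. e' b) = e' a + (\<Sum>b\<in>I - {a}. e' b)" using I a by (rule sum.remove)
    have eE: "int E = int (n + (e a + (\<Sum>b\<in>I - {a}. e' b))) + int (\<delta> a)"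
      using E f(4)[OF a] unfolding D_def sum by simp
    hence "\<delta> a \<le> E" "E - \<delta> a = n + (e a + (\<Sum>b\<in>I - {a}. e' b))" by linarith+
    moreover have "homogeneous (n + (e a + (\<Sum>b\<in>I - {a}. e' b))) (u a)"
      unfolding u_def using a by (simp, intro homogeneous_mult Yn homogeneous_prod) (use I f a in auto)
    ultimately show "if \<delta> a \<le> E then homogeneous (E - \<delta> a) (u a) else u a = 0" by simp
  qed
  moreover have "v = (\<lambda>a. Fract (u a) H)"
  proof
    fix a
    show "v a = Fract (u a) H"
    proof (cases "a \<in> I")
      case True
      have "H \<noteq> 0" using HP point_facts(1)[OF P] by auto
      moreover have "H = Y_var i ^ n * (h a * (\<Prod>b\<in>I - {a}. h b))"
        unfolding H_def using I True by (simp add: prod.remove)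
      ultimately show ?thesis using True f(1,6)[OF True] by (simp add: u_def eq_fract mult_ac)
    next
      case False
      thus ?thesis using v by (simp add: u_def DS_def fract_collapse)
    qed
  qed
  ultimately show "v \<in> gsheaf (hvec I \<delta>) j P" unfolding gsheaf_def using H HP E by blast
qed

definition gmat :: "nat set \<Rightarrow> (nat \<Rightarrow> nat \<Rightarrow> ('k::field, 'r::{finite,linorder}) hpoly) \<Rightarrow> (nat \<Rightarrow> ('k, 'r) hfrac) \<Rightarrow> nat \<Rightarrow> ('k, 'r) hfrac" where
  "gmat G g v = (\<lambda>a. \<Sum>b\<in>G. v b * Fract (g b a) 1)"

lemma lin_gmat: "lin (gmat G g)"
  unfolding lin_def by (auto simp: gmat_def fun_eq_iff vec_apply distrib_right sum.distrib sum_distrib_left mult.assoc)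

lemma Fract_sum_same: "h \<noteq> 0 \<Longrightarrow> (\<Sum>b\<in>G. Fract (f b) h) = Fract (\<Sum>b\<in>G. f b) h"
  by (induction G rule: infinite_finite_induct) (simp_all add: fract_collapse eq_fract algebra_simps)

lemma gmat_Fract:
  assumes "h \<noteq> 0"
  shows "gmat G g (\<lambda>b. Fract (c b) h) = (\<lambda>a. Fract (gmap G g c a) h)"
  by (rule ext) (use assms in \<open>simp add: gmat_def gmap_apply Fract_sum_same\<close>)

lemma Fract_zero_iff: "h \<noteq> 0 \<Longrightarrow> Fract f h = 0 \<longleftrightarrow> f = 0"
  by (simp add: Zero_fract_def eq_fract)

text \<open>Homogeneous localization preserves surjections: a numerator in \<open>K\<close> lifts to
  the free module over the same denominator.\<close>

lemma gsheaf_image: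
  assumes K: "graded I \<delta> K" and gen: "generates G \<delta>' g K" and P: "P \<in> proj_space"
  shows "gmat G g ` gsheaf (hvec G \<delta>') j P = gsheaf K j P"
proof (intro equalityI subsetI)
  fix v assume "v \<in> gmat G g ` gsheaf (hvec G \<delta>') j P"
  then obtain c h e e' where c: "v = gmat G g (\<lambda>b. Fract (c b) h)" "c \<in> hvec G \<delta>' e" "homogeneous e' h" "h \<notin> P" "int e = int e' + j"
    unfolding gsheaf_def by blast
  have "h \<noteq> 0" using c(4) point_facts(1)[OF P] by auto
  moreover have "gmap G g c \<in> K e" using c(2) gen by (intro gmap_in[OF K]) (auto simp: generates_def)
  ultimately show "v \<in> gsheaf K j P" unfolding c(1) gsheaf_def using c gmat_Fract by blast
next
  fix v assume "v \<in> gsheaf K j P"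
  then obtain u h e e' where u: "v = (\<lambda>a. Fract (u a) h)" "u \<in> K e" "homogeneous e' h" "h \<notin> P" "int e = int e' + j"
    unfolding gsheaf_def by blast
  obtain c where c: "c \<in> hvec G \<delta>' e" "u = gmap G g c" using gen u(2) unfolding generates_def by blast
  have "h \<noteq> 0" using u(4) point_facts(1)[OF P] by auto
  hence "v = gmat G g (\<lambda>b. Fract (c b) h)" unfolding u(1) c(2) by (simp add: gmat_Fract)
  thus "v \<in> gmat G g ` gsheaf (hvec G \<delta>') j P" unfolding gsheaf_def using c u by blast
qed

lemma gsheaf_kernel:
  assumes P: "P \<in> proj_space"
  shows "gsheaf (syz G \<delta>' g) j P = {v \<in> gsheaf (hvec G \<delta>') j P. gmat G g v = 0}"
proof (intro equalityI subsetI)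
  fix v assume "v \<in> gsheaf (syz G \<delta>' g) j P"
  then obtain c h e e' where c: "v = (\<lambda>b. Fract (c b) h)" "c \<in> hvec G \<delta>' e" "gmap G g c = 0" "homogeneous e' h" "h \<notin> P" "int e = int e' + j"
    unfolding gsheaf_def syz_def by blast
  have "h \<noteq> 0" using c(5) point_facts(1)[OF P] by auto
  hence "gmat G g v = 0" unfolding c(1) by (simp add: gmat_Fract c(3) fun_eq_iff zero_fun_apply fract_collapse)
  thus "v \<in> {v \<in> gsheaf (hvec G \<delta>') j P. gmat G g v = 0}" unfolding gsheaf_def using c by blast
next
  fix v assume "v \<in> {v \<in> gsheaf (hvec G \<delta>') j P. gmat G g v = 0}"
  then obtain c h e e' where c: "v = (\<lambda>b. Fract (c b) h)" "c \<in> hvec G \<delta>' e" "gmat G g v = 0" "homogeneous e' h" "h \<notin> P" "int e = int e' + j"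
    unfolding gsheaf_def by blast
  have h: "h \<noteq> 0" using c(5) point_facts(1)[OF P] by auto
  have "Fract (gmap G g c a) h = 0" for a
    using c(3) unfolding c(1) gmat_Fract[OF h] by (simp add: fun_eq_iff zero_fun_apply)
  hence "gmap G g c = 0" by (simp add: fun_eq_iff zero_fun_apply Fract_zero_iff h)
  thus "v \<in> gsheaf (syz G \<delta>' g) j P" unfolding gsheaf_def syz_def using c by blast
qed

section \<open>Chern classes of sheaves of graded modules\<close>

context chern
begin

text \<open>Dependence on the stalks alone comes out of the Whitney formula, with the zero sheaf as
  quotient and the zero map onto it.\<close>

lemma C_cong:
  assumes r: "represented F L \<epsilon>" and r': "represented F' L' \<epsilon>'" and eq: "\<And>P. P \<in> proj_space \<Longrightarrow> L P = L' P"
  shows "cg p q (C F) (C F')"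
proof -
  have z: "represented (lsheaf (DS {} undefined)) (DS {} undefined :: ('k, 'r) lattice) (\<lambda>P v. {v})"
    by (intro represented_lsheaf loc_free_DS) simp
  have z0: "DS {} undefined P = {0}" for P :: "('k, 'r) point" by (auto simp: DS_def fun_eq_iff zero_fun_apply)
  have "L P \<noteq> {}" if "P \<in> proj_space" for P
    using submod_0[OF loc_free_submod[OF represented.lf[OF r] that]] by blast
  hence "cg p q (C F) (C F' * C (lsheaf (DS {} undefined)))"
    by (intro whitney[OF r' r z, of "\<lambda>_. 0"]) (auto simp: lin_def eq z0)
  also have "cg p q (C F' * C (lsheaf (DS {} undefined))) (C F' * 1)"
    by (intro cg_mult_left C_zero[OF z z0])
  finally (cg_trans) show ?thesis by simp
qed

lemma Psi_cong:
  assumes "\<And>j. loc_free (L j)" "\<And>j. loc_free (L' j)" "\<And>P j. P \<in> proj_space \<Longrightarrow> L j P = L' j P"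
  shows "cg p q (Psi L) (Psi L')"
  unfolding Psi_def
  by (rule cg_prod, rule C_cong[OF represented_lsheaf[OF assms(1)] represented_lsheaf[OF assms(2)] assms(3)])

lemma Psi_whitney:
  assumes "\<And>j. loc_free (L' j)" "\<And>j. loc_free (L j)" "\<And>j. loc_free (L'' j)" and \<beta>: "lin \<beta>"
    and "\<And>P j. P \<in> proj_space \<Longrightarrow> L' j P = {v \<in> L j P. \<beta> v = 0}"
    and "\<And>P j. P \<in> proj_space \<Longrightarrow> \<beta> ` L j P = L'' j P"
  shows "cg p q (Psi L) (Psi L' * Psi L'')"
  unfolding Psi_def prod.distrib[symmetric]
  by (rule cg_prod, rule whitney[OF represented_lsheaf[OF assms(1)] represented_lsheaf[OF assms(2)]
      represented_lsheaf[OF assms(3)] \<beta> assms(5,6)])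

text \<open>Hilbert's syzygy theorem: a module that is pure for all sets of \<open>n\<close> variables has a resolution of length \<open>r - n\<close>.\<close>

lemma Psi_gsheaf:
  fixes K :: "nat \<Rightarrow> (nat \<Rightarrow> ('k, 'r) hpoly) set"
  shows "finite I \<Longrightarrow> graded I \<delta> K \<Longrightarrow> (\<And>e u a. u \<in> K e \<Longrightarrow> meets UNIV (u a)) \<Longrightarrow>
    (\<And>A. card A \<le> n \<Longrightarrow> pure A K) \<Longrightarrow> (\<And>j. loc_free (gsheaf K j)) \<Longrightarrow> cg p q (Psi (gsheaf K)) 1"
proof (induction "CARD('r) - n" arbitrary: n I \<delta> K rule: less_induct)
  case less
  note I = less.prems(1) and K = less.prems(2) and mK = less.prems(3) and pure = less.prems(4) and lf = less.prems(5)
  show ?case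
  proof (cases "CARD('r) \<le> n")
    case True
    \<comment> \<open>The recursion ends when purity is known for all variables, because then the
      module is zero.\<close>
    have "pure UNIV K" by (rule pure) (use True in simp)
    hence K0: "K e = {0}" for e using graded_nakayama[OF K] mK by blast
    have z: "gsheaf K j P = {0}" if P: "P \<in> proj_space" for j and P :: "('k, 'r) point"
    proof -
      obtain i where i: "Y_var i \<notin> P" using point_facts(6)[OF P] by blast
      have "(\<lambda>a. Fract (0 a) (Y_var i ^ nat (- j))) \<in> gsheaf K j P"
        unfolding gsheaf_def
        by (intro CollectI exI[of _ "0"] exI[of _ "Y_var i ^ nat (- j)"] exI[of _ "nat j"] exI[of _ "nat (- j)"])
          (use power_notin_point[OF P i] homogeneous_power[OF homogeneous_Y(1), of "nat (- j)" i] K0 in \<open>auto simp: zero_fun_apply\<close>)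
      moreover have "gsheaf K j P \<subseteq> {0}"
        unfolding gsheaf_def by (auto simp: K0 fun_eq_iff zero_fun_apply fract_collapse)
      ultimately show ?thesis using subset_singletonD by fastforce
    qed
    have "cg p q (Psi (gsheaf K)) (\<Prod>i<p. 1)"
      unfolding Psi_def by (intro cg_prod C_zero[OF represented_lsheaf[OF lf] z])
    thus ?thesis by simp
  next
    case False
    obtain G \<delta>' g where gen: "generates G \<delta>' g K" and mS: "\<And>e c b. c \<in> syz G \<delta>' g e \<Longrightarrow> meets UNIV (c b)"
      using exists_minimal_generators[OF K I] by blast
    have G: "finite G" using gen by (simp add: generates_def)
    have lfD: "loc_free (DS G m :: ('k, 'r) lattice)" for m by (rule loc_free_DS[OF G])
    have lfH: "loc_free (gsheaf (hvec G \<delta>') j :: ('k, 'r) lattice)" for j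
      by (rule loc_free_cong[OF lfD[of "\<lambda>a. j - int (\<delta>' a)"]]) (simp add: gsheaf_hvec[OF _ G])
    \<comment> \<open>The syzygy module need not be free, but its sheaf is the kernel of a
      surjection between bundles, hence again a bundle to which the Whitney formula applies.\<close>
    have lfS: "loc_free (gsheaf (syz G \<delta>' g) j)" for j
      by (rule loc_free_cong[OF loc_free_kernel[OF lfH lf lin_gmat gsheaf_image[OF K gen]]])
        (simp_all add: gsheaf_kernel)
    have "cg p q (Psi (gsheaf (syz G \<delta>' g))) 1"
    proof (rule less.hyps[of "Suc n" G \<delta>' "syz G \<delta>' g"])
      show "CARD('r) - Suc n < CARD('r) - n" using False by simp
      show "finite G" "graded G \<delta>' (syz G \<delta>' g)" by (rule G syz_graded)+
      show "meets UNIV (u a)" if "u \<in> syz G \<delta>' g e" for e u a using mS that by blast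
      show "pure A (syz G \<delta>' g)" if "card A \<le> Suc n" for A
        by (rule pure_syz_card[OF K gen pure that])
      show "loc_free (gsheaf (syz G \<delta>' g) j)" for j by (rule lfS)
    qed
    hence 1: "cg p q (Psi (gsheaf (syz G \<delta>' g)) * Psi (gsheaf K)) (1 * Psi (gsheaf K))"
      by (rule cg_mult) simp
    have 2: "cg p q (Psi (gsheaf (hvec G \<delta>'))) (Psi (gsheaf (syz G \<delta>' g)) * Psi (gsheaf K))"
      by (rule Psi_whitney[OF lfS lfH lf lin_gmat gsheaf_kernel gsheaf_image[OF K gen]])
    have 3: "cg p q (Psi (gsheaf (hvec G \<delta>'))) (Psi (\<lambda>j. DS G (\<lambda>a. j - int (\<delta>' a))))"
      by (rule Psi_cong[OF lfH lfD gsheaf_hvec[OF _ G]])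
    have 4: "cg p q (Psi (\<lambda>j. DS G (\<lambda>a. j - int (\<delta>' a)))) 1" by (rule Psi_DS[OF G])
    have "cg p q (Psi (gsheaf K)) (Psi (gsheaf (hvec G \<delta>')))"
      using cg_trans[OF 2 1] by (simp add: cg_sym)
    thus ?thesis using cg_trans 3 4 by blast
  qed
qed

end

section \<open>Lifting Jordan bases from residue fields\<close>

definition cvec :: "'a::field set \<Rightarrow> nat \<Rightarrow> (nat \<Rightarrow> 'a) set" where
  "cvec A d = {v. (\<forall>a<d. v a \<in> A) \<and> (\<forall>a\<ge>d. v a = 0)}"

lemma lincomb_units: "lincomb x {..<d} unitv = (\<lambda>a. if a < d then x a else 0)"
  using lincomb_scaled_units[of "{..<d}" x "\<lambda>_. 1"] by (auto simp: fun_eq_iff)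

lemma cvec_aspan: "cvec A d = aspan A {..<d} unitv"
proof (intro equalityI subsetI)
  fix v assume "v \<in> cvec A d"
  thus "v \<in> aspan A {..<d} unitv"
    by (intro aspanI[of _ v]) (auto simp: lincomb_units cvec_def)
qed (auto simp: aspan_iff lincomb_units cvec_def)

lemma indep_units: "indep {..<d} unitv"
  using indep_scaled_units[of "{..<d}" "\<lambda>_. 1"] by simp

definition lmat :: "nat \<Rightarrow> (nat \<Rightarrow> nat \<Rightarrow> 'a::field) \<Rightarrow> (nat \<Rightarrow> 'a) \<Rightarrow> nat \<Rightarrow> 'a" where
  "lmat d B v = (\<lambda>a. if a < d then \<Sum>b<d. B a b * v b else 0)"

lemma lin_lmat: "lin (lmat d B)"
  unfolding lin_def
  by (auto simp: lmat_def fun_eq_iff vec_apply distrib_left sum.distrib sum_distrib_left mult_ac)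

context local_subring
begin

text \<open>Changing a basis by elements of \<open>m\<close> times its span changes nothing modulo
  \<open>m\<close>, so \<open>basis_lift\<close> applies to the new family.\<close>

lemma basis_perturb:
  assumes I: "finite I" and E0: "indep I E0"
    and E: "\<And>i. i \<in> I \<Longrightarrow> E i - E0 i \<in> aspan m I E0"
  shows "indep I E \<and> aspan A I E = aspan A I E0"
proof -
  have diff: "lincomb x I E - lincomb x I E0 \<in> aspan m I E0" if x: "\<And>i. i \<in> I \<Longrightarrow> x i \<in> A" for x
  proof -
    have "lincomb x I E - lincomb x I E0 = lincomb x I (\<lambda>i. E i - E0 i)"
      by (simp add: lincomb_def sum_subtractf vec.scale_right_diff_distrib)
    thus ?thesis using submod_lincomb[OF submod_aspan_m x E] by simp
  qed
  have EM: "E i \<in> aspan A I E0" if i: "i \<in> I" for i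
  proof -
    have "E i - E0 i \<in> aspan A I E0" using E[OF i] aspan_m_subset by blast
    from submod_add[OF submod_aspan this aspan_base[OF I i, of E0]] show ?thesis by simp
  qed
  have ind: "\<forall>i\<in>I. x i \<in> m" if x: "\<And>i. i \<in> I \<Longrightarrow> x i \<in> A" and z: "lincomb x I E \<in> aspan m I E0" for x
  proof -
    have "lincomb x I E - (lincomb x I E - lincomb x I E0) \<in> aspan m I E0"
      by (rule submod_diff[OF submod_aspan_m z diff[OF x]])
    hence "lincomb x I E0 \<in> aspan m I E0" by simp
    then obtain y where y: "lincomb x I E0 = lincomb y I E0" "\<forall>i\<in>I. y i \<in> m" unfolding aspan_iff by blast
    show ?thesis using indep_unique[OF E0 y(1)] y(2) by metis
  qed
  have spn: "\<exists>x. (\<forall>i\<in>I. x i \<in> A) \<and> u - lincomb x I E \<in> aspan m I E0" if u: "u \<in> aspan A I E0" for u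
  proof -
    obtain x where x: "u = lincomb x I E0" "\<forall>i\<in>I. x i \<in> A" using u unfolding aspan_iff by blast
    have "0 - (lincomb x I E - lincomb x I E0) \<in> aspan m I E0"
      by (rule submod_diff[OF submod_aspan_m submod_0[OF submod_aspan_m] diff]) (use x in auto)
    thus ?thesis using x by auto
  qed
  show ?thesis using basis_lift[OF I I E0 EM ind spn] by blast
qed

section \<open>The residue field of a local subring\<close>

definition lring :: "'a ring" where
  "lring = \<lparr>carrier = A, monoid.mult = (*), one = 1, zero = 0, add = (+)\<rparr>"

definition cls :: "'a \<Rightarrow> 'a set" where
  "cls x = m +>\<^bsub>lring\<^esub> x"

text \<open>The elements are cosets, that is, sets of fractions when \<open>A\<close> is a stalk. So
  the residue field of a point of projective space is among the fields over which
  \<open>constant_jordan_type\<close> quantifies.\<close>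

definition resf :: "'a set ring" where
  "resf = lring Quot m"

lemma lring_simps [simp]: "carrier lring = A" "x \<otimes>\<^bsub>lring\<^esub> y = x * y" "\<one>\<^bsub>lring\<^esub> = 1" "\<zero>\<^bsub>lring\<^esub> = 0" "x \<oplus>\<^bsub>lring\<^esub> y = x + y"
  by (simp_all add: lring_def)

lemma cring_lring: "cring lring"
proof (intro cringI abelian_groupI comm_monoidI)
  fix x assume "x \<in> carrier lring"
  thus "\<exists>y\<in>carrier lring. y \<oplus>\<^bsub>lring\<^esub> x = \<zero>\<^bsub>lring\<^esub>" by (intro bexI[of _ "- x"]) (auto intro: uminus_in)
qed (auto simp: algebra_simps intro: add_in mult_in)

lemma ideal_m: "ideal m lring"
proof (rule idealI)
  show "ring lring" using cring_lring by (rule cring.axioms)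
  interpret cring lring by (rule cring_lring)
  have neg: "x \<in> m \<Longrightarrow> - x \<in> m" for x using m_mult[of "- 1" x] uminus_in[of 1] by simp
  show "subgroup m (add_monoid lring)"
  proof
    show "m \<subseteq> carrier (add_monoid lring)" using m_sub by auto
    fix x assume x: "x \<in> m"
    have "\<ominus>\<^bsub>lring\<^esub> x = - x" by (rule minus_equality) (use x m_sub uminus_in in auto)
    thus "inv\<^bsub>add_monoid lring\<^esub> x \<in> m" using neg[OF x] by (simp add: a_inv_def)
  qed (auto intro: m_add)
next
  fix a x assume a: "a \<in> m" and x: "x \<in> carrier lring"
  hence xa: "x * a \<in> m" by (simp add: m_mult)
  thus "x \<otimes>\<^bsub>lring\<^esub> a \<in> m" by simp
  have "a * x \<in> m" using xa by (metis mult.commute)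
  thus "a \<otimes>\<^bsub>lring\<^esub> x \<in> m" by simp
qed

lemma maximalideal_m: "maximalideal m lring"
proof (rule maximalidealI[OF ideal_m])
  show "carrier lring \<noteq> m" using one_in m_one by (metis lring_simps(1))
  fix J assume J: "ideal J lring" "m \<subseteq> J" "J \<subseteq> carrier lring"
  show "J = m \<or> J = carrier lring"
  proof (cases "J = m")
    case False
    then obtain x where x: "x \<in> J" "x \<notin> m" using J by blast
    hence xA: "x \<in> A" using J by auto
    have "x \<noteq> 0" using x(2) by auto
    moreover have "inverse x \<otimes>\<^bsub>lring\<^esub> x \<in> J"
      using ideal.I_l_closed[OF J(1) x(1)] m_unit[OF xA x(2)] by auto
    ultimately have "\<one>\<^bsub>lring\<^esub> \<in> J" by simp
    thus ?thesis using ideal.one_imp_carrier[OF J(1)] by simp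
  qed simp
qed

lemma field_resf: "Ring.field resf"
  unfolding resf_def by (rule maximalideal.quotient_is_field[OF maximalideal_m cring_lring])

lemma cls_eq: "cls x = {h + x |h. h \<in> m}"
  by (auto simp: cls_def a_r_coset_def r_coset_def)

lemma cls_hom: "cls \<in> ring_hom lring resf"
  using ideal.rcos_ring_hom[OF ideal_m] unfolding cls_def resf_def .

lemma cls_closed: "x \<in> A \<Longrightarrow> cls x \<in> carrier resf"
  and cls_mult: "x \<in> A \<Longrightarrow> y \<in> A \<Longrightarrow> cls (x * y) = cls x \<otimes>\<^bsub>resf\<^esub> cls y"
  and cls_add: "x \<in> A \<Longrightarrow> y \<in> A \<Longrightarrow> cls (x + y) = cls x \<oplus>\<^bsub>resf\<^esub> cls y"
  and cls_1: "cls 1 = \<one>\<^bsub>resf\<^esub>"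
  using ring_hom_memE[OF cls_hom] by auto

lemma cls_iff: "cls x = cls y \<longleftrightarrow> x - y \<in> m"
proof
  assume "cls x = cls y"
  moreover have "x \<in> cls x" unfolding cls_eq by force
  ultimately show "x - y \<in> m" unfolding cls_eq by force
next
  have neg: "z \<in> m \<Longrightarrow> - z \<in> m" for z using m_mult[of "- 1" z] uminus_in[of 1] by simp
  assume xy: "x - y \<in> m"
  hence yx: "y - x \<in> m" using neg[OF xy] by simp
  have "\<exists>h'. h + x = h' + y \<and> h' \<in> m" if "h \<in> m" for h
    using m_add[OF that xy] by (intro exI[of _ "h + (x - y)"]) auto
  moreover have "\<exists>h'. h + y = h' + x \<and> h' \<in> m" if "h \<in> m" for h
    using m_add[OF that yx] by (intro exI[of _ "h + (y - x)"]) auto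
  ultimately show "cls x = cls y" unfolding cls_eq by blast
qed

lemma cls_0: "cls 0 = \<zero>\<^bsub>resf\<^esub>"
  by (simp add: cls_eq resf_def FactRing_def)

lemma cls_zero_iff: "cls x = \<zero>\<^bsub>resf\<^esub> \<longleftrightarrow> x \<in> m"
  using cls_iff[of x 0] by (simp add: cls_0)

lemma cls_surj: "y \<in> carrier resf \<Longrightarrow> \<exists>x\<in>A. y = cls x"
  by (auto simp: resf_def FactRing_def A_RCOSETS_def RCOSETS_def cls_def a_r_coset_def)

lemma cls_sum:
  assumes "finite I" "\<And>i. i \<in> I \<Longrightarrow> f i \<in> A"
  shows "finsum resf (\<lambda>i. cls (f i)) I = cls (\<Sum>i\<in>I. f i)"
  using assms
proof (induction I rule: finite_induct)
  case empty
  interpret Ring.field resf by (rule field_resf)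
  show ?case by (simp add: cls_0)
next
  case (insert x I)
  interpret Ring.field resf by (rule field_resf)
  have "finsum resf (\<lambda>i. cls (f i)) (insert x I) = cls (f x) \<oplus>\<^bsub>resf\<^esub> finsum resf (\<lambda>i. cls (f i)) I"
    using insert by (intro finsum_insert) (auto intro: cls_closed)
  thus ?case using insert by (simp add: cls_add sum_in)
qed

definition red :: "nat \<Rightarrow> (nat \<Rightarrow> 'a) \<Rightarrow> nat \<Rightarrow> 'a set" where
  "red d u = (\<lambda>a\<in>{..<d}. cls (u a))"

lemma red_iff: "u \<in> cvec A d \<Longrightarrow> w \<in> cvec A d \<Longrightarrow> red d u = red d w \<longleftrightarrow> u - w \<in> cvec m d"
  unfolding red_def cvec_def by (auto simp: restrict_def fun_eq_iff cls_iff minus_apply)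

lemma red_surj:
  assumes "w \<in> {..<d} \<rightarrow>\<^sub>E carrier resf"
  shows "\<exists>u\<in>cvec A d. red d u = w"
proof -
  have "\<forall>a\<in>{..<d}. \<exists>x\<in>A. w a = cls x" using assms cls_surj by blast
  then obtain u where u: "\<forall>a\<in>{..<d}. u a \<in> A \<and> w a = cls (u a)" by metis
  define u' where "u' a = (if a < d then u a else 0)" for a
  have "u' \<in> cvec A d" using u by (auto simp: cvec_def u'_def)
  moreover have "red d u' = w"
    using u assms by (auto simp: red_def u'_def restrict_def fun_eq_iff PiE_def extensional_def)
  ultimately show ?thesis by blast
qed

lemma lmat_closed:
  assumes "\<And>a b. B a b \<in> A" "u \<in> cvec A d"
  shows "lmat d B u \<in> cvec A d"
  using assms by (auto simp: cvec_def lmat_def intro!: sum_in mult_in)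

lemma lmat_pow_closed:
  assumes "\<And>a b. B a b \<in> A" "u \<in> cvec A d"
  shows "(lmat d B ^^ k) u \<in> cvec A d"
  by (induction k) (simp_all add: assms lmat_closed)

text \<open>Only the top vector of each string is lifted; the other members are its images under the
  matrix. The relations within a string then hold exactly, except for the last one, which holds
  modulo \<open>m\<close>, and Nakayama's lemma makes the family a basis.\<close>

lemma jordan_basis_lift:
  assumes B: "\<And>a b. B a b \<in> A"
    and T: "\<And>u. u \<in> cvec A d \<Longrightarrow> T (red d u) = red d (lmat d B u)"
    and nj: "nilpotent_jordan_blocks resf d T ns"
  shows "\<exists>b. (\<forall>l<length ns. b l \<in> cvec A d \<and> (lmat d B ^^ (ns ! l)) (b l) \<in> cvec m d) \<and>
    indep (SIGMA l:{..<length ns}. {..<ns ! l}) (\<lambda>(l, k). (lmat d B ^^ k) (b l)) \<and>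
    aspan A (SIGMA l:{..<length ns}. {..<ns ! l}) (\<lambda>(l, k). (lmat d B ^^ k) (b l)) = cvec A d"
proof -
  define I where "I = (SIGMA l:{..<length ns}. {..<ns ! l})"
  let ?\<theta> = "lmat d B"
  interpret K: Ring.field resf by (rule field_resf)
  have fin: "finite I" unfolding I_def by auto
  have pos: "0 < ns ! l" if "l < length ns" for l
    using nj that unfolding nilpotent_jordan_blocks_def by (metis gr0I nth_mem)
  have "\<exists>v. (\<forall>l<length ns. \<forall>t<ns ! l. v l t \<in> {..<d} \<rightarrow>\<^sub>E carrier resf) \<and>
      (\<forall>l<length ns. T (v l 0) = (\<lambda>a\<in>{..<d}. \<zero>\<^bsub>resf\<^esub>)) \<and>
      (\<forall>l<length ns. \<forall>t. Suc t < ns ! l \<longrightarrow> T (v l (Suc t)) = v l t) \<and>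
      (\<forall>w\<in>{..<d} \<rightarrow>\<^sub>E carrier resf. \<exists>!x. x \<in> I \<rightarrow>\<^sub>E carrier resf \<and>
           w = (\<lambda>a\<in>{..<d}. finsum resf (\<lambda>(l, t). x (l, t) \<otimes>\<^bsub>resf\<^esub> v l t a) I))"
    using nj unfolding nilpotent_jordan_blocks_def Let_def I_def by (rule conjunct2)
  then obtain v where v: "\<forall>l<length ns. \<forall>t<ns ! l. v l t \<in> {..<d} \<rightarrow>\<^sub>E carrier resf"
      "\<forall>l<length ns. T (v l 0) = (\<lambda>a\<in>{..<d}. \<zero>\<^bsub>resf\<^esub>)"
      "\<forall>l<length ns. \<forall>t. Suc t < ns ! l \<longrightarrow> T (v l (Suc t)) = v l t"
      "\<forall>w\<in>{..<d} \<rightarrow>\<^sub>E carrier resf. \<exists>!x. x \<in> I \<rightarrow>\<^sub>E carrier resf \<and>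
           w = (\<lambda>a\<in>{..<d}. finsum resf (\<lambda>(l, t). x (l, t) \<otimes>\<^bsub>resf\<^esub> v l t a) I)"
    by (elim exE conjE) (rule that)
  note v1 = v(1)[rule_format] and v2 = v(2)[rule_format] and v3 = v(3)[rule_format] and v4 = v(4)[rule_format]
  \<comment> \<open>In \<open>nilpotent_jordan_blocks\<close> the vector with index 0 is the one
    that is killed, so the top of string \<open>l\<close> has index
    \<open>ns ! l - 1\<close>.\<close>
  have "\<forall>l\<in>{..<length ns}. \<exists>u\<in>cvec A d. red d u = v l (ns ! l - 1)"
  proof
    fix l assume "l \<in> {..<length ns}"
    thus "\<exists>u\<in>cvec A d. red d u = v l (ns ! l - 1)" using pos[of l] by (intro red_surj v1) auto
  qed
  then obtain b where b: "\<And>l. l < length ns \<Longrightarrow> b l \<in> cvec A d" "\<And>l. l < length ns \<Longrightarrow> red d (b l) = v l (ns ! l - 1)"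
    by (metis lessThan_iff)
  have bk: "(?\<theta> ^^ k) (b l) \<in> cvec A d" if "l < length ns" for l k by (rule lmat_pow_closed[OF B b(1)[OF that]])
  have redk: "k < ns ! l \<Longrightarrow> red d ((?\<theta> ^^ k) (b l)) = v l (ns ! l - 1 - k)" if l: "l < length ns" for l k
  proof (induction k)
    case 0
    show ?case using b(2)[OF l] by simp
  next
    case (Suc k)
    have "red d ((?\<theta> ^^ Suc k) (b l)) = T (red d ((?\<theta> ^^ k) (b l)))" using T[OF bk[OF l]] by simp
    also have "\<dots> = T (v l (Suc (ns ! l - 1 - Suc k)))" using Suc by (simp add: Suc_diff_Suc)
    also have "\<dots> = v l (ns ! l - 1 - Suc k)" using Suc.prems by (intro v3[OF l]) auto
    finally show ?case .
  qed
  have zero: "(?\<theta> ^^ (ns ! l)) (b l) \<in> cvec m d" if l: "l < length ns" for l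
  proof -
    obtain k where k: "ns ! l = Suc k" using pos[OF l] by (cases "ns ! l") auto
    have "red d ((?\<theta> ^^ Suc k) (b l)) = T (red d ((?\<theta> ^^ k) (b l)))" using T[OF bk[OF l]] by simp
    also have "\<dots> = (\<lambda>a\<in>{..<d}. \<zero>\<^bsub>resf\<^esub>)" using redk[OF l, of k] v2[OF l] k by simp
    also have "\<dots> = red d 0" by (simp add: red_def cls_0 zero_fun_apply)
    finally have "red d ((?\<theta> ^^ Suc k) (b l)) = red d 0" .
    moreover have "0 \<in> cvec A d" by (simp add: cvec_def zero_fun_apply)
    ultimately have "(?\<theta> ^^ Suc k) (b l) - 0 \<in> cvec m d" using red_iff[OF bk[OF l]] by blast
    thus ?thesis unfolding k by simp
  qed
  \<comment> \<open>The given strings are numbered from the kernel end, the lifted powers from the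
    top; \<open>f\<close> is the reversal between the two numberings.\<close>
  define f where "f = (\<lambda>(l, k). (l, ns ! l - 1 - k))"
  have f: "bij_betw f I I"
    by (rule bij_betw_byWitness[where f' = f]) (auto simp: f_def I_def)
  define E where "E = (\<lambda>(l, t). (?\<theta> ^^ (ns ! l - 1 - t)) (b l))"
  have EM: "E i \<in> cvec A d" if "i \<in> I" for i using that bk by (auto simp: E_def I_def)
  have redE: "red d (E (l, t)) = v l t" if "(l, t) \<in> I" for l t
    using that redk[of l "ns ! l - 1 - t"] by (auto simp: E_def I_def)
  have redl: "red d (lincomb x I E) = (\<lambda>a\<in>{..<d}. finsum resf (\<lambda>(l, t). cls (x (l, t)) \<otimes>\<^bsub>resf\<^esub> v l t a) I)"
    if x: "\<And>i. i \<in> I \<Longrightarrow> x i \<in> A" for x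
  proof
    fix a
    show "red d (lincomb x I E) a = (\<lambda>a\<in>{..<d}. finsum resf (\<lambda>(l, t). cls (x (l, t)) \<otimes>\<^bsub>resf\<^esub> v l t a) I) a"
    proof (cases "a < d")
      case True
      have Ea: "E i a \<in> A" if "i \<in> I" for i using EM[OF that] True by (simp add: cvec_def)
      have "red d (lincomb x I E) a = cls (\<Sum>i\<in>I. x i * E i a)"
        using True by (simp add: red_def lincomb_def sum_fun_apply vec_apply)
      also have "\<dots> = finsum resf (\<lambda>i. cls (x i * E i a)) I"
        using x Ea by (intro cls_sum[OF fin, symmetric] mult_in) auto
      also have "\<dots> = finsum resf (\<lambda>(l, t). cls (x (l, t)) \<otimes>\<^bsub>resf\<^esub> v l t a) I"
      proof (rule K.finsum_cong')
        have eq: "cls (x (l, t) * E (l, t) a) = cls (x (l, t)) \<otimes>\<^bsub>resf\<^esub> v l t a" if i: "(l, t) \<in> I" for l t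
          using fun_cong[OF redE[OF i], of a] True cls_mult[OF x[OF i] Ea[OF i]] by (simp add: red_def)
        thus "\<And>i. i \<in> I \<Longrightarrow> cls (x i * E i a) = (case i of (l, t) \<Rightarrow> cls (x (l, t)) \<otimes>\<^bsub>resf\<^esub> v l t a)" by auto
        have "cls (x i * E i a) \<in> carrier resf" if "i \<in> I" for i by (intro cls_closed mult_in x Ea that)
        thus "(\<lambda>(l, t). cls (x (l, t)) \<otimes>\<^bsub>resf\<^esub> v l t a) \<in> I \<rightarrow> carrier resf" using eq by force
      qed simp
      finally show ?thesis using True by simp
    qed (simp add: red_def)
  qed
  have clos: "lincomb x I E \<in> cvec A d" if "\<And>i. i \<in> I \<Longrightarrow> x i \<in> A" for x
    unfolding cvec_aspan by (rule submod_lincomb[OF submod_aspan]) (use that EM in \<open>auto simp: cvec_aspan\<close>)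
  \<comment> \<open>A combination that vanishes modulo \<open>m\<close> represents the zero vector
    by the residue basis. Uniqueness of this representation forces all residue classes of the
    coefficients to be zero.\<close>
  have ind: "\<forall>i\<in>I. x i \<in> m" if x: "\<And>i. i \<in> I \<Longrightarrow> x i \<in> A" and z: "lincomb x I E \<in> aspan m {..<d} unitv" for x
  proof -
    let ?w = "\<lambda>a\<in>{..<d}. \<zero>\<^bsub>resf\<^esub>"
    have "0 \<in> cvec A d" by (simp add: cvec_def zero_fun_apply)
    hence "red d (lincomb x I E) = red d 0"
      using red_iff[OF clos[OF x]] z by (simp add: cvec_aspan)
    hence r: "red d (lincomb x I E) = ?w" by (simp add: red_def cls_0 zero_fun_apply)
    have 1: "(\<lambda>i\<in>I. cls (x i)) \<in> I \<rightarrow>\<^sub>E carrier resf \<and>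
        ?w = (\<lambda>a\<in>{..<d}. finsum resf (\<lambda>(l, t). (\<lambda>i\<in>I. cls (x i)) (l, t) \<otimes>\<^bsub>resf\<^esub> v l t a) I)"
    proof
      show "(\<lambda>i\<in>I. cls (x i)) \<in> I \<rightarrow>\<^sub>E carrier resf" using x by (auto intro: cls_closed)
      have "?w a = (\<lambda>a\<in>{..<d}. finsum resf (\<lambda>(l, t). (\<lambda>i\<in>I. cls (x i)) (l, t) \<otimes>\<^bsub>resf\<^esub> v l t a) I) a" for a
      proof (cases "a < d")
        case True
        have "finsum resf (\<lambda>(l, t). (\<lambda>i\<in>I. cls (x i)) (l, t) \<otimes>\<^bsub>resf\<^esub> v l t a) I =
            finsum resf (\<lambda>(l, t). cls (x (l, t)) \<otimes>\<^bsub>resf\<^esub> v l t a) I"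
        proof (rule K.finsum_cong')
          show "(\<lambda>(l, t). cls (x (l, t)) \<otimes>\<^bsub>resf\<^esub> v l t a) \<in> I \<rightarrow> carrier resf"
          proof
            fix i assume i: "i \<in> I"
            obtain l t where lt: "i = (l, t)" by (cases i)
            have "v l t a \<in> carrier resf" using v1[of l t] i True unfolding lt I_def by auto
            thus "(case i of (l, t) \<Rightarrow> cls (x (l, t)) \<otimes>\<^bsub>resf\<^esub> v l t a) \<in> carrier resf"
              using cls_closed[OF x[OF i]] lt by simp
          qed
        qed auto
        also have "\<dots> = red d (lincomb x I E) a" using redl[OF x] True by simp
        finally show ?thesis using r True by simp
      qed simp
      thus "?w = (\<lambda>a\<in>{..<d}. finsum resf (\<lambda>(l, t). (\<lambda>i\<in>I. cls (x i)) (l, t) \<otimes>\<^bsub>resf\<^esub> v l t a) I)" by blast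
    qed
    have 2: "(\<lambda>i\<in>I. \<zero>\<^bsub>resf\<^esub>) \<in> I \<rightarrow>\<^sub>E carrier resf \<and>
        ?w = (\<lambda>a\<in>{..<d}. finsum resf (\<lambda>(l, t). (\<lambda>i\<in>I. \<zero>\<^bsub>resf\<^esub>) (l, t) \<otimes>\<^bsub>resf\<^esub> v l t a) I)"
    proof
      have "?w a = (\<lambda>a\<in>{..<d}. finsum resf (\<lambda>(l, t). (\<lambda>i\<in>I. \<zero>\<^bsub>resf\<^esub>) (l, t) \<otimes>\<^bsub>resf\<^esub> v l t a) I) a" for a
      proof (cases "a < d")
        case True
        have "finsum resf (\<lambda>(l, t). (\<lambda>i\<in>I. \<zero>\<^bsub>resf\<^esub>) (l, t) \<otimes>\<^bsub>resf\<^esub> v l t a) I = finsum resf (\<lambda>i. \<zero>\<^bsub>resf\<^esub>) I"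
        proof (rule K.finsum_cong')
          fix i assume i: "i \<in> I"
          obtain l t where lt: "i = (l, t)" by (cases i)
          have "v l t a \<in> carrier resf" using v1[of l t] i True unfolding lt I_def by auto
          thus "(case i of (l, t) \<Rightarrow> (\<lambda>i\<in>I. \<zero>\<^bsub>resf\<^esub>) (l, t) \<otimes>\<^bsub>resf\<^esub> v l t a) = \<zero>\<^bsub>resf\<^esub>"
            using i lt by simp
        qed auto
        thus ?thesis using True by simp
      qed simp
      thus "?w = (\<lambda>a\<in>{..<d}. finsum resf (\<lambda>(l, t). (\<lambda>i\<in>I. \<zero>\<^bsub>resf\<^esub>) (l, t) \<otimes>\<^bsub>resf\<^esub> v l t a) I)" by blast
    qed simp
    have wK: "?w \<in> {..<d} \<rightarrow>\<^sub>E carrier resf" by simp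
    have "(\<lambda>i\<in>I. cls (x i)) = (\<lambda>i\<in>I. \<zero>\<^bsub>resf\<^esub>)"
    proof -
      define Q where "Q y \<longleftrightarrow> y \<in> I \<rightarrow>\<^sub>E carrier resf \<and>
        ?w = (\<lambda>a\<in>{..<d}. finsum resf (\<lambda>(l, t). y (l, t) \<otimes>\<^bsub>resf\<^esub> v l t a) I)" for y
      have "\<exists>!y. Q y" unfolding Q_def by (rule v4[OF wK])
      moreover have "Q (\<lambda>i\<in>I. cls (x i))" unfolding Q_def by (rule 1)
      moreover have "Q (\<lambda>i\<in>I. \<zero>\<^bsub>resf\<^esub>)" unfolding Q_def by (rule 2)
      ultimately show ?thesis by metis
    qed
    hence "cls (x i) = \<zero>\<^bsub>resf\<^esub>" if "i \<in> I" for i using that by (auto dest: fun_cong[of _ _ i])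
    thus ?thesis by (simp add: cls_zero_iff)
  qed
  have spn: "\<exists>x. (\<forall>i\<in>I. x i \<in> A) \<and> u - lincomb x I E \<in> aspan m {..<d} unitv" if u: "u \<in> aspan A {..<d} unitv" for u
  proof -
    have uc: "u \<in> cvec A d" using u by (simp add: cvec_aspan)
    have "red d u \<in> {..<d} \<rightarrow>\<^sub>E carrier resf" using uc by (auto simp: red_def cvec_def intro: cls_closed)
    from ex1_implies_ex[OF v4[OF this]] obtain y where y: "y \<in> I \<rightarrow>\<^sub>E carrier resf"
      "red d u = (\<lambda>a\<in>{..<d}. finsum resf (\<lambda>(l, t). y (l, t) \<otimes>\<^bsub>resf\<^esub> v l t a) I)" by blast
    have "\<forall>i\<in>I. \<exists>x\<in>A. y i = cls x" using y(1) cls_surj by blast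
    then obtain x where x: "\<And>i. i \<in> I \<Longrightarrow> x i \<in> A" "\<And>i. i \<in> I \<Longrightarrow> y i = cls (x i)" by metis
    have eq: "(\<lambda>a\<in>{..<d}. finsum resf (\<lambda>(l, t). cls (x (l, t)) \<otimes>\<^bsub>resf\<^esub> v l t a) I) =
         (\<lambda>a\<in>{..<d}. finsum resf (\<lambda>(l, t). y (l, t) \<otimes>\<^bsub>resf\<^esub> v l t a) I)"
    proof (rule ext)
      fix a
      show "(\<lambda>a\<in>{..<d}. finsum resf (\<lambda>(l, t). cls (x (l, t)) \<otimes>\<^bsub>resf\<^esub> v l t a) I) a =
         (\<lambda>a\<in>{..<d}. finsum resf (\<lambda>(l, t). y (l, t) \<otimes>\<^bsub>resf\<^esub> v l t a) I) a"
      proof (cases "a < d")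
        case True
        have "finsum resf (\<lambda>(l, t). cls (x (l, t)) \<otimes>\<^bsub>resf\<^esub> v l t a) I =
          finsum resf (\<lambda>(l, t). y (l, t) \<otimes>\<^bsub>resf\<^esub> v l t a) I"
        proof (rule K.finsum_cong')
          show "(\<lambda>(l, t). y (l, t) \<otimes>\<^bsub>resf\<^esub> v l t a) \<in> I \<rightarrow> carrier resf"
          proof
            fix i assume i: "i \<in> I"
            obtain l t where lt: "i = (l, t)" by (cases i)
            have "v l t a \<in> carrier resf" using v1[of l t] i True unfolding lt I_def by auto
            thus "(case i of (l, t) \<Rightarrow> y (l, t) \<otimes>\<^bsub>resf\<^esub> v l t a) \<in> carrier resf"
              using y(1) i lt by auto
          qed
        qed (use x(2) in auto)
        thus ?thesis using True by simp
      qed simp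
    qed
    have "red d (lincomb x I E) = (\<lambda>a\<in>{..<d}. finsum resf (\<lambda>(l, t). cls (x (l, t)) \<otimes>\<^bsub>resf\<^esub> v l t a) I)"
      by (rule redl) (rule x(1))
    hence "red d u = red d (lincomb x I E)" unfolding eq y(2)[symmetric] by (rule sym)
    moreover have "lincomb x I E \<in> cvec A d" by (rule clos) (rule x(1))
    ultimately have "u - lincomb x I E \<in> cvec m d" using red_iff[OF uc] by blast
    thus ?thesis using x(1) unfolding cvec_aspan by blast
  qed
  have EM': "E i \<in> aspan A {..<d} unitv" if "i \<in> I" for i using EM[OF that] by (simp add: cvec_aspan)
  have b1: "indep I E"
  proof (rule basis_lift(1)[OF fin finite_lessThan indep_units])
    show "E i \<in> aspan A {..<d} unitv" if "i \<in> I" for i by (rule EM'[OF that])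
    show "\<forall>i\<in>I. x i \<in> m" if "\<And>i. i \<in> I \<Longrightarrow> x i \<in> A" "lincomb x I E \<in> aspan m {..<d} unitv" for x
      using that by (rule ind)
    show "\<exists>x. (\<forall>i\<in>I. x i \<in> A) \<and> u - lincomb x I E \<in> aspan m {..<d} unitv" if "u \<in> aspan A {..<d} unitv" for u
      by (rule spn[OF that])
  qed
  have b2: "aspan A I E = aspan A {..<d} unitv"
  proof (rule basis_lift(2)[OF fin finite_lessThan indep_units])
    show "E i \<in> aspan A {..<d} unitv" if "i \<in> I" for i by (rule EM'[OF that])
    show "\<forall>i\<in>I. x i \<in> m" if "\<And>i. i \<in> I \<Longrightarrow> x i \<in> A" "lincomb x I E \<in> aspan m {..<d} unitv" for x
      using that by (rule ind)
    show "\<exists>x. (\<forall>i\<in>I. x i \<in> A) \<and> u - lincomb x I E \<in> aspan m {..<d} unitv" if "u \<in> aspan A {..<d} unitv" for u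
      by (rule spn[OF that])
  qed
  have Ef: "lincomb x I (E \<circ> f) = lincomb x I (\<lambda>(l, k). (?\<theta> ^^ k) (b l))" for x
    by (rule lincomb_cong) (auto simp: E_def f_def I_def)
  have "indep I (\<lambda>(l, k). (?\<theta> ^^ k) (b l))" "aspan A I (\<lambda>(l, k). (?\<theta> ^^ k) (b l)) = cvec A d"
    using b1 b2 indep_reindex[OF f, of E] aspan_reindex[OF f, of A E]
    by (simp_all add: indep_def aspan_def Ef cvec_aspan)
  thus ?thesis using b(1) zero unfolding I_def by (intro exI[of _ b]) auto
qed

end

section \<open>The operator \<open>\<theta>\<close> for constant Jordan type with blocks of sizes \<open>1\<close> and \<open>p\<close>\<close>

definition cst :: "'k \<Rightarrow> ('k::field, 'r::{finite,linorder}) hfrac" where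
  "cst c = Fract (Poly_Mapping.single 0 c) 1"

lemma cst_add: "cst (a + b) = cst a + cst b"
  and cst_mult: "cst (a * b) = cst a * cst b"
  and cst_1: "cst 1 = 1"
  by (simp_all add: cst_def single_add mult_single One_fract_def)

lemma cst_in: "P \<in> proj_space \<Longrightarrow> cst c \<in> Oj 0 P"
  unfolding cst_def using Fract_one_in[of P 0] by simp

lemma max_ideal_generic: "max_ideal generic_point = {0}"
proof -
  have "max_ideal generic_point \<subseteq> {0}"
    unfolding max_ideal_def generic_point_def by (auto simp: fract_collapse)
  thus ?thesis using local_subring.m_zero[OF local_O[OF generic_in_proj_space]] by blast
qed

lemma funpow_scaled:
  assumes f: "lin f" and h: "\<And>v. h v = c *v f v"
  shows "(h ^^ k) v = c ^ k *v (f ^^ k) v"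
  by (induction k) (simp_all add: h lin_scale[OF f])

lemma span_aspan_UNIV:
  assumes I: "finite I" and inj: "inj_on J I" and v: "v \<in> vec.span (J ` I)"
  shows "\<exists>x. v = lincomb x I J"
proof -
  obtain u where "v = (\<Sum>a\<in>J ` I. u a *v a)" using v I by (auto simp: vec.span_finite)
  thus ?thesis using inj by (intro exI[of _ "u \<circ> J"]) (simp add: lincomb_def sum.reindex)
qed

lemma indep_inj_on:
  assumes I: "finite I" and J: "indep I J"
  shows "inj_on J I"
proof (rule inj_onI)
  fix i j assume i: "i \<in> I" and j: "j \<in> I" and eq: "J i = J j"
  have "lincomb (\<lambda>k. if k = i then 1 else 0) I J = lincomb (\<lambda>k. if k = j then 1 else 0) I J"
    using I i j eq by (simp add: lincomb_delta)
  from indep_unique[OF J this i] show "i = j" by (auto split: if_splits)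
qed

lemma indep_independent:
  assumes I: "finite I" and J: "indep I J"
  shows "vec.independent (J ` I)"
proof
  note inj = indep_inj_on[OF I J]
  assume "vec.dependent (J ` I)"
  then obtain u where u: "\<exists>v\<in>J ` I. u v \<noteq> 0" "(\<Sum>v\<in>J ` I. u v *v v) = 0"
    using I by (auto simp: vec.dependent_finite)
  hence "lincomb (u \<circ> J) I J = 0" using inj by (simp add: lincomb_def sum.reindex)
  hence "\<forall>i\<in>I. (u \<circ> J) i = 0" using J unfolding indep_def by blast
  thus False using u(1) by auto
qed

lemma submod_UNIV_aspan: "submod UNIV (aspan (UNIV :: 'a::field set) I J)"
proof -
  interpret subring_of_field "UNIV :: 'a set" by unfold_locales auto
  show ?thesis by (rule submod_aspan)
qed

lemma cvec_UNIV_aspan: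
  fixes A :: "'a::field set"
  assumes "finite I" "cvec A d = aspan A I J" "0 \<in> A" "1 \<in> A"
  shows "cvec UNIV d \<subseteq> aspan UNIV I J"
proof
  fix v assume v: "v \<in> cvec (UNIV :: 'a set) d"
  have "unitv a \<in> aspan UNIV I J" if "a < d" for a
  proof -
    have "unitv a \<in> cvec A d" using assms(3,4) that by (auto simp: cvec_def unitv_def)
    thus ?thesis unfolding assms(2) by (auto simp: aspan_iff)
  qed
  hence "lincomb v {..<d} unitv \<in> aspan UNIV I J" by (intro submod_lincomb[OF submod_UNIV_aspan]) auto
  moreover have "lincomb v {..<d} unitv = v" unfolding lincomb_units using v by (auto simp: cvec_def fun_eq_iff)
  ultimately show "v \<in> aspan UNIV I J" by simp
qed

text \<open>Only the matrices of the generators are kept of the module. The number \<open>t\<close>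
  counts the blocks of length \<open>p\<close>; it is the same over all fields, which makes the
  ranks of \<open>\<theta>\<close> at different points comparable.\<close>

locale jordan =
  fixes Xm :: "'r::{finite,linorder} \<Rightarrow> nat \<Rightarrow> nat \<Rightarrow> 'k::field" and d p t :: nat
  assumes p2: "2 \<le> p"
    and jt: "\<And>(K :: ('k, 'r) hfrac set ring) \<iota> \<alpha>. Ring.field K \<Longrightarrow> \<iota> \<in> ring_hom (ring_of_type_algebra :: 'k ring) K \<Longrightarrow>
      (\<forall>i. \<alpha> i \<in> carrier K) \<Longrightarrow> (\<exists>i. \<alpha> i \<noteq> \<zero>\<^bsub>K\<^esub>) \<Longrightarrow>
      \<exists>ns. nilpotent_jordan_blocks K d (\<lambda>v. \<lambda>a\<in>{..<d}. finsum K
        (\<lambda>b. finsum K (\<lambda>i. \<alpha> i \<otimes>\<^bsub>K\<^esub> \<iota> (Xm i a b)) UNIV \<otimes>\<^bsub>K\<^esub> v b) {..<d}) ns \<and> set ns \<subseteq> {1, p} \<and> count_list ns p = t"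
begin

definition tmat :: "nat \<Rightarrow> nat \<Rightarrow> ('k, 'r) hfrac" where
  "tmat a b = (\<Sum>i\<in>UNIV. cst (Xm i a b) * yv i)"

definition \<theta> :: "(nat \<Rightarrow> ('k, 'r) hfrac) \<Rightarrow> nat \<Rightarrow> ('k, 'r) hfrac" where
  "\<theta> = lmat d tmat"

text \<open>Division by a variable turns \<open>\<theta>\<close> into an operator of degree 0, which
  acts on the stalks at points where that variable does not vanish.\<close>

definition \<theta>0 :: "'r \<Rightarrow> (nat \<Rightarrow> ('k, 'r) hfrac) \<Rightarrow> nat \<Rightarrow> ('k, 'r) hfrac" where
  "\<theta>0 i = lmat d (\<lambda>a b. inverse (yv i) * tmat a b)"

lemma lin_\<theta>: "lin \<theta>" and lin_\<theta>0: "lin (\<theta>0 i)"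
  by (simp_all add: \<theta>_def \<theta>0_def lin_lmat)

lemma \<theta>0_eq: "\<theta>0 i v = inverse (yv i) *v \<theta> v"
  by (auto simp: \<theta>0_def \<theta>_def lmat_def vec_apply fun_eq_iff sum_distrib_left mult.assoc)

lemma \<theta>0_pow: "(\<theta>0 i ^^ k) v = inverse (yv i) ^ k *v (\<theta> ^^ k) v"
  by (rule funpow_scaled[OF lin_\<theta> \<theta>0_eq])

lemma \<theta>_pow: "(\<theta> ^^ k) v = yv i ^ k *v (\<theta>0 i ^^ k) v"
  by (simp add: \<theta>0_pow power_inverse)

lemma tmat_in:
  assumes P: "P \<in> proj_space" "Y_var i \<notin> P"
  shows "inverse (yv i) * tmat a b \<in> Oj 0 P"
proof -
  interpret subring_of_field "Oj 0 P" by (rule subring_O[OF P(1)])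
  have "inverse (yv i) * (cst (Xm j a b) * yv j) \<in> Oj 0 P" for j
    using Oj_mult[OF P(1) yv_inverse_in[OF P(2)] Oj_mult[OF P(1) cst_in[OF P(1), of "Xm j a b"] yv_in[OF P(1), of j]]] by simp
  thus ?thesis unfolding tmat_def sum_distrib_left by (intro sum_in)
qed

text \<open>Modulo the maximal ideal \<open>\<theta>0 i0\<close> becomes the operator
  \<open>X_alpha\<close> at the point whose coordinates are the residues of the quotients of the
  variables by \<open>Y_var i0\<close>. Thus every point of projective space, closed or not,
  supplies an instance of the hypothesis \<open>jt\<close>.\<close>

lemma local_lift:
  assumes P: "P \<in> proj_space" and i0: "Y_var i0 \<notin> P"
  shows "\<exists>ns b. set ns \<subseteq> {1, p} \<and> count_list ns p = t \<and>
    (\<forall>l<length ns. b l \<in> cvec (Oj 0 P) d \<and> (\<theta>0 i0 ^^ (ns ! l)) (b l) \<in> cvec (max_ideal P) d) \<and>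
    indep (SIGMA l:{..<length ns}. {..<ns ! l}) (\<lambda>(l, k). (\<theta>0 i0 ^^ k) (b l)) \<and>
    aspan (Oj 0 P) (SIGMA l:{..<length ns}. {..<ns ! l}) (\<lambda>(l, k). (\<theta>0 i0 ^^ k) (b l)) = cvec (Oj 0 P) d"
proof -
  interpret L: local_subring "Oj 0 P" "max_ideal P" by (rule local_O[OF P])
  interpret K: Ring.field L.resf by (rule L.field_resf)
  define \<iota> where "\<iota> c = L.cls (cst c)" for c
  define \<alpha> where "\<alpha> i = L.cls (inverse (yv i0) * yv i)" for i
  have y_in: "inverse (yv i0) * yv i \<in> Oj 0 P" for i
    using Oj_mult[OF P yv_inverse_in[OF i0] yv_in[OF P, of i]] by simp
  have c_in: "cst c \<in> Oj 0 P" for c by (rule cst_in[OF P])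
  define T where "T = (\<lambda>v. \<lambda>a\<in>{..<d}. finsum L.resf
        (\<lambda>b. finsum L.resf (\<lambda>i. \<alpha> i \<otimes>\<^bsub>L.resf\<^esub> \<iota> (Xm i a b)) UNIV \<otimes>\<^bsub>L.resf\<^esub> v b) {..<d})"
  have "\<exists>ns. nilpotent_jordan_blocks L.resf d T ns \<and> set ns \<subseteq> {1, p} \<and> count_list ns p = t"
    unfolding T_def
  proof (rule jt[OF L.field_resf])
    show "\<iota> \<in> ring_hom (ring_of_type_algebra :: 'k ring) L.resf"
    proof (rule ring_hom_memI)
      fix x y :: 'k
      show "\<iota> x \<in> carrier L.resf" unfolding \<iota>_def by (rule L.cls_closed[OF c_in])
      show "\<iota> (x \<otimes>\<^bsub>ring_of_type_algebra\<^esub> y) = \<iota> x \<otimes>\<^bsub>L.resf\<^esub> \<iota> y"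
        "\<iota> (x \<oplus>\<^bsub>ring_of_type_algebra\<^esub> y) = \<iota> x \<oplus>\<^bsub>L.resf\<^esub> \<iota> y"
        by (simp_all add: \<iota>_def ring_of_type_algebra_def cst_mult cst_add L.cls_mult L.cls_add c_in)
      show "\<iota> \<one>\<^bsub>ring_of_type_algebra\<^esub> = \<one>\<^bsub>L.resf\<^esub>"
        by (simp add: \<iota>_def ring_of_type_algebra_def cst_1 L.cls_1)
    qed
    show "\<forall>i. \<alpha> i \<in> carrier L.resf" unfolding \<alpha>_def using L.cls_closed[OF y_in] by blast
    \<comment> \<open>The coordinate with index \<open>i0\<close> is the class of 1.\<close>
    have "\<alpha> i0 \<noteq> \<zero>\<^bsub>L.resf\<^esub>" unfolding \<alpha>_def by (simp add: L.cls_zero_iff)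
    thus "\<exists>i. \<alpha> i \<noteq> \<zero>\<^bsub>L.resf\<^esub>" by blast
  qed
  then obtain ns where ns: "nilpotent_jordan_blocks L.resf d T ns" "set ns \<subseteq> {1, p}" "count_list ns p = t" by blast
  define B where "B = (\<lambda>a b. inverse (yv i0) * tmat a b)"
  have B: "B a b \<in> Oj 0 P" for a b unfolding B_def by (rule tmat_in[OF P i0])
  have entry: "finsum L.resf (\<lambda>i. \<alpha> i \<otimes>\<^bsub>L.resf\<^esub> \<iota> (Xm i a b)) UNIV = L.cls (B a b)" for a b
  proof -
    have "finsum L.resf (\<lambda>i. \<alpha> i \<otimes>\<^bsub>L.resf\<^esub> \<iota> (Xm i a b)) UNIV =
        finsum L.resf (\<lambda>i. L.cls (inverse (yv i0) * yv i * cst (Xm i a b))) UNIV"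
      unfolding \<alpha>_def \<iota>_def L.cls_mult[OF y_in c_in] ..
    also have "\<dots> = L.cls (\<Sum>i\<in>UNIV. inverse (yv i0) * yv i * cst (Xm i a b))"
      by (intro L.cls_sum L.mult_in y_in c_in) simp
    also have "(\<Sum>i\<in>UNIV. inverse (yv i0) * yv i * cst (Xm i a b)) = B a b"
      unfolding B_def tmat_def sum_distrib_left by (rule sum.cong) (simp_all add: mult_ac)
    finally show ?thesis .
  qed
  have T: "T (L.red d u) = L.red d (lmat d B u)" if u: "u \<in> cvec (Oj 0 P) d" for u
  proof
    fix a
    show "T (L.red d u) a = L.red d (lmat d B u) a"
    proof (cases "a < d")
      case True
      have ub: "u b \<in> Oj 0 P" if "b < d" for b using u that by (simp add: cvec_def)
      have "T (L.red d u) a = finsum L.resf (\<lambda>b. L.cls (B a b) \<otimes>\<^bsub>L.resf\<^esub> L.red d u b) {..<d}"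
        unfolding T_def entry using True by simp
      also have "\<dots> = finsum L.resf (\<lambda>b. L.cls (B a b * u b)) {..<d}"
        by (rule K.finsum_cong') (use B ub in \<open>auto simp: L.red_def L.cls_mult intro!: L.cls_closed L.mult_in\<close>)
      also have "\<dots> = L.cls (\<Sum>b<d. B a b * u b)"
        by (rule L.cls_sum) (use B ub in \<open>auto intro: L.mult_in\<close>)
      finally show ?thesis using True by (simp add: L.red_def lmat_def)
    qed (simp add: T_def L.red_def)
  qed
  from L.jordan_basis_lift[OF B T ns(1)] show ?thesis
    using ns(2,3) unfolding \<theta>0_def B_def by blast
qed

lemma count_list_card: "count_list ns x = card {l\<in>{..<length ns}. ns ! l = x}"
  by (simp add: count_list_eq_length_filter length_filter_conv_card) (metis (mono_tags, lifting))

text \<open>At the generic point the maximal ideal is zero, so the lifted strings close exactly.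
  They give the nilpotency of \<open>\<theta>\<close> and an upper bound for its rank.\<close>

lemma generic_image:
  "\<exists>S0. finite S0 \<and> card S0 \<le> t * (p - 1) \<and> (\<forall>v\<in>cvec UNIV d. \<theta> v \<in> vec.span S0 \<and> (\<theta> ^^ p) v = 0)"
proof -
  define P :: "('k, 'r) point" where "P = generic_point"
  have P: "P \<in> proj_space" unfolding P_def by (rule generic_in_proj_space)
  obtain i where i: "Y_var i \<notin> P" using point_facts(6)[OF P] by blast
  have m0: "cvec (max_ideal P) d = {0}"
    unfolding P_def max_ideal_generic by (auto simp: cvec_def fun_eq_iff zero_fun_apply) (metis not_le)
  obtain ns b where ns: "set ns \<subseteq> {1, p}" "count_list ns p = t"
    and b: "\<And>l. l < length ns \<Longrightarrow> (\<theta>0 i ^^ (ns ! l)) (b l) = 0"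
    and span: "aspan (Oj 0 P) (SIGMA l:{..<length ns}. {..<ns ! l}) (\<lambda>(l, k). (\<theta>0 i ^^ k) (b l)) = cvec (Oj 0 P) d"
    using local_lift[OF P i] unfolding m0 by blast
  let ?I = "SIGMA l:{..<length ns}. {..<ns ! l}" and ?J = "\<lambda>(l, k). (\<theta>0 i ^^ k) (b l)"
  have finI: "finite ?I" by auto
  have nsl: "ns ! l = 1 \<or> ns ! l = p" if "l < length ns" for l using ns(1) nth_mem[OF that] by auto
  define Vs where "Vs = {l\<in>{..<length ns}. ns ! l = p}"
  have cV: "card Vs = t" using ns(2) by (simp add: count_list_card Vs_def)
  \<comment> \<open>A string of length \<open>p\<close> contributes all its members except the top
    one to the image; a string of length 1 contributes nothing.\<close>
  define S0 where "S0 = ?J ` (Vs \<times> {1..<p})"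
  have zero: "(\<theta>0 i ^^ k) (b l) = 0" if "l < length ns" "ns ! l \<le> k" for l k
  proof -
    have "(\<theta>0 i ^^ k) (b l) = (\<theta>0 i ^^ (k - ns ! l)) ((\<theta>0 i ^^ (ns ! l)) (b l))"
      using that(2) by (simp add: funpow_add[symmetric, THEN fun_cong, unfolded comp_def])
    thus ?thesis using b[OF that(1)] lin_0[OF lin_funpow[OF lin_\<theta>0]] by simp
  qed
  have cU: "cvec UNIV d \<subseteq> aspan UNIV ?I ?J"
    by (rule cvec_UNIV_aspan[OF finI span[symmetric]]) (use Oj_0 Oj_1 P in auto)
  have im: "\<theta> v \<in> vec.span S0 \<and> (\<theta> ^^ p) v = 0" if v: "v \<in> cvec UNIV d" for v
  proof -
    obtain x where x: "v = lincomb x ?I ?J" using subsetD[OF cU v] unfolding aspan_iff by blast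
    have "\<theta>0 i v = lincomb x ?I (\<lambda>j. \<theta>0 i (?J j))" unfolding x by (rule lin_lincomb[OF lin_\<theta>0])
    also have "\<dots> \<in> vec.span S0"
      unfolding lincomb_def
    proof (intro vec.span_sum vec.span_scale)
      fix j assume j: "j \<in> ?I"
      obtain l k where lk: "j = (l, k)" by (cases j)
      have l: "l < length ns" and k: "k < ns ! l" using j lk by auto
      have eq: "\<theta>0 i (?J j) = (\<theta>0 i ^^ Suc k) (b l)" unfolding lk by simp
      show "\<theta>0 i (?J j) \<in> vec.span S0"
      proof (cases "ns ! l \<le> Suc k")
        case True
        thus ?thesis using zero[OF l True] vec.span_zero unfolding eq by simp
      next
        case False
        hence "ns ! l = p" using nsl[OF l] k by auto
        hence "(l, Suc k) \<in> Vs \<times> {1..<p}" using False l by (auto simp: Vs_def)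
        hence "?J (l, Suc k) \<in> S0" unfolding S0_def by (rule imageI)
        thus ?thesis unfolding eq by (intro vec.span_base) simp
      qed
    qed
    finally have "yv i *v \<theta>0 i v \<in> vec.span S0" by (rule vec.span_scale)
    hence 1: "\<theta> v \<in> vec.span S0" using \<theta>_pow[of 1 v i] by simp
    have "(\<theta>0 i ^^ p) v = lincomb x ?I (\<lambda>j. (\<theta>0 i ^^ p) (?J j))"
      unfolding x by (rule lin_lincomb[OF lin_funpow[OF lin_\<theta>0]])
    also have "\<dots> = 0"
    proof (rule lincomb_neutral)
      fix j assume j: "j \<in> ?I"
      obtain l k where lk: "j = (l, k)" by (cases j)
      have l: "l < length ns" using j lk by auto
      have "(\<theta>0 i ^^ p) (?J j) = (\<theta>0 i ^^ (p + k)) (b l)" unfolding lk by (simp add: funpow_add)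
      also have "\<dots> = 0" by (rule zero[OF l]) (use nsl[OF l] p2 in auto)
      finally show "(\<theta>0 i ^^ p) (?J j) = 0" .
    qed
    finally have "(\<theta> ^^ p) v = 0" using \<theta>_pow[of p v i] by simp
    thus ?thesis using 1 by simp
  qed
  have "card S0 \<le> card (Vs \<times> {1..<p})" unfolding S0_def by (rule card_image_le) (auto simp: Vs_def)
  hence "card S0 \<le> t * (p - 1)" by (simp add: cV card_cartesian_product)
  moreover have "finite S0" unfolding S0_def Vs_def by auto
  ultimately show ?thesis using im by blast
qed

lemma \<theta>_p: "v \<in> cvec UNIV d \<Longrightarrow> (\<theta> ^^ p) v = 0"
  using generic_image by blast

definition jfam :: "'r \<Rightarrow> (nat \<Rightarrow> nat \<Rightarrow> ('k, 'r) hfrac) \<Rightarrow> nat \<times> nat \<Rightarrow> nat \<Rightarrow> ('k, 'r) hfrac" where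
  "jfam i b = (\<lambda>(l, k). (\<theta>0 i ^^ k) (b l))"

definition jind :: "nat set \<Rightarrow> nat set \<Rightarrow> (nat \<times> nat) set" where
  "jind V W = V \<times> {..<p} \<union> W \<times> {0}"

text \<open>
  The lifted family has length-one strings only modulo the maximal ideal. Since the rank of \<open>\<theta>\<close>
  at the generic point is already exhausted by the strings of length \<open>p\<close>, the remaining vectors can
  be corrected to lie in the kernel of \<open>\<theta>\<close>.
\<close>

lemma local_jordan:
  assumes P: "P \<in> proj_space" and i: "Y_var i \<notin> P"
  shows "\<exists>V W b. finite V \<and> finite W \<and> V \<inter> W = {} \<and> (\<forall>l\<in>W. \<theta> (b l) = 0) \<and>
     indep (jind V W) (jfam i b) \<and> aspan (Oj 0 P) (jind V W) (jfam i b) = cvec (Oj 0 P) d"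
proof -
  interpret L: local_subring "Oj 0 P" "max_ideal P" by (rule local_O[OF P])
  obtain ns b where ns: "set ns \<subseteq> {1, p}" "count_list ns p = t"
    and b: "\<And>l. l < length ns \<Longrightarrow> b l \<in> cvec (Oj 0 P) d" "\<And>l. l < length ns \<Longrightarrow> (\<theta>0 i ^^ (ns ! l)) (b l) \<in> cvec (max_ideal P) d"
    and ind0: "indep (SIGMA l:{..<length ns}. {..<ns ! l}) (\<lambda>(l, k). (\<theta>0 i ^^ k) (b l))"
    and span0: "aspan (Oj 0 P) (SIGMA l:{..<length ns}. {..<ns ! l}) (\<lambda>(l, k). (\<theta>0 i ^^ k) (b l)) = cvec (Oj 0 P) d"
    using local_lift[OF P i] by blast
  have nsl: "ns ! l = 1 \<or> ns ! l = p" if "l < length ns" for l using ns(1) nth_mem[OF that] by auto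
  define V W where "V = {l\<in>{..<length ns}. ns ! l = p}" and "W = {l\<in>{..<length ns}. ns ! l = 1}"
  have VW: "finite V" "finite W" "V \<inter> W = {}" unfolding V_def W_def using p2 by auto
  have cV: "card V = t" using ns(2) by (simp add: count_list_card V_def)
  define I J where "I = jind V W" and "J = jfam i b"
  have I_eq: "(SIGMA l:{..<length ns}. {..<ns ! l}) = I"
  proof (rule Set.set_eqI)
    fix j :: "nat \<times> nat"
    obtain l k where "j = (l, k)" by (cases j)
    thus "j \<in> (SIGMA l:{..<length ns}. {..<ns ! l}) \<longleftrightarrow> j \<in> I"
      using nsl[of l] by (auto simp: I_def jind_def V_def W_def)
  qed
  have fin: "finite I" using VW by (auto simp: I_def jind_def)
  have ind: "indep I J" and span: "aspan (Oj 0 P) I J = cvec (Oj 0 P) d"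
    using ind0 span0 unfolding I_eq J_def jfam_def by auto
  have mspan: "cvec (max_ideal P) d = aspan (max_ideal P) I J"
    unfolding cvec_aspan
    by (intro equalityI L.aspan_m_mono fin finite_lessThan) (use span in \<open>auto simp: cvec_aspan\<close>)
  \<comment> \<open>The positions below the top of the strings of length \<open>p\<close>; the
    vectors there are images under \<open>\<theta>0 i\<close>.\<close>
  define K where "K = V \<times> {1..<p}"
  have KI: "K \<subseteq> I" by (auto simp: K_def I_def jind_def)
  have finK: "finite K" using KI fin finite_subset by blast
  have indK: "indep K J" by (rule indep_mono[OF ind fin KI])
  define S where "S = J ` K"
  have cS: "card S = t * (p - 1)"
    unfolding S_def card_image[OF indep_inj_on[OF finK indK]] by (simp add: K_def card_cartesian_product cV)
  obtain S0 where S0: "finite S0" "card S0 \<le> t * (p - 1)" "\<And>v. v \<in> cvec UNIV d \<Longrightarrow> \<theta> v \<in> vec.span S0"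
    using generic_image by blast
  have \<theta>0_S0: "\<theta>0 i v \<in> vec.span S0" if "v \<in> cvec UNIV d" for v
    unfolding \<theta>0_eq by (rule vec.span_scale[OF S0(3)[OF that]])
  have cU: "cvec A d \<subseteq> cvec UNIV d" for A :: "('k, 'r) hfrac set" by (auto simp: cvec_def)
  have JU: "J j \<in> cvec UNIV d" if "j \<in> I" for j
    using L.aspan_base[OF fin that, of J] span cU by blast
  have SS0: "S \<subseteq> vec.span S0"
  proof
    fix s assume "s \<in> S"
    then obtain l k where lk: "l \<in> V" "1 \<le> k" "k < p" "s = J (l, k)" by (auto simp: S_def K_def)
    then obtain k' where k': "k = Suc k'" by (cases k) auto
    have "(l, k') \<in> I" using lk k' by (auto simp: I_def jind_def)
    moreover have "s = \<theta>0 i (J (l, k'))" unfolding lk(4) k' J_def jfam_def by simp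
    ultimately show "s \<in> vec.span S0" using \<theta>0_S0 JU by simp
  qed
  have indS: "vec.independent S" unfolding S_def by (rule indep_independent[OF finK indK])
  \<comment> \<open>The independent set \<open>S\<close> already has as many members as the rank at
    the generic point permits, so it spans the whole image over the fraction field.\<close>
  have full: "\<theta>0 i v \<in> vec.span S" if v: "v \<in> cvec UNIV d" for v
  proof (rule ccontr)
    assume *: "\<theta>0 i v \<notin> vec.span S"
    hence nS: "\<theta>0 i v \<notin> S" using vec.span_base by blast
    have "vec.independent (insert (\<theta>0 i v) S)" using * indS nS by (simp add: vec.independent_insert)
    moreover have "insert (\<theta>0 i v) S \<subseteq> vec.span S0" using SS0 \<theta>0_S0[OF v] by blast
    ultimately have "card (insert (\<theta>0 i v) S) \<le> card S0" using vec.independent_span_bound[OF S0(1)] by blast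
    moreover have "finite S" unfolding S_def using finK by blast
    ultimately show False using nS cS S0(2) by simp
  qed
  \<comment> \<open>The image of \<open>b l\<close> is supported on \<open>K\<close> and has
    coordinates in the maximal ideal. Moving each coordinate one position up its string gives a
    vector with the same image and coefficients still in the maximal ideal; this is what will be
    subtracted from \<open>b l\<close>.\<close>
  have "\<forall>l\<in>W. \<exists>z. z \<in> aspan (max_ideal P) I J \<and> \<theta>0 i z = \<theta>0 i (b l)"
  proof
    fix l assume l: "l \<in> W"
    hence ll: "l < length ns" "ns ! l = 1" by (auto simp: W_def)
    have "\<theta>0 i (b l) \<in> vec.span (J ` K)" using full b(1)[OF ll(1)] cU unfolding S_def by blast
    then obtain x where x: "\<theta>0 i (b l) = lincomb x K J"
      using span_aspan_UNIV[OF finK indep_inj_on[OF finK indK]] by blast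
    have "\<theta>0 i (b l) \<in> aspan (max_ideal P) I J" using b(2)[OF ll(1)] unfolding mspan ll(2) by simp
    then obtain y where y: "\<theta>0 i (b l) = lincomb y I J" "\<forall>j\<in>I. y j \<in> max_ideal P" unfolding aspan_iff by blast
    have "lincomb x K J = lincomb (\<lambda>j. if j \<in> K then x j else 0) I J"
      unfolding lincomb_def using fin KI by (intro sum.mono_neutral_cong_left) auto
    hence eq: "lincomb (\<lambda>j. if j \<in> K then x j else 0) I J = lincomb y I J" using x y by simp
    have xy: "x j = y j" if j: "j \<in> K" for j using indep_unique[OF ind eq, of j] j KI by auto
    define pr :: "nat \<times> nat \<Rightarrow> nat \<times> nat" where "pr = (\<lambda>(l, k). (l, k - 1))"
    have prI: "pr j \<in> I" if "j \<in> K" for j using that by (auto simp: pr_def K_def I_def jind_def)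
    define z where "z = lincomb x K (\<lambda>j. J (pr j))"
    have "z \<in> aspan (max_ideal P) I J"
      unfolding z_def lincomb_def
    proof (rule submod_sum[OF L.submod_aspan_m])
      fix j assume j: "j \<in> K"
      have "x j *v J (pr j) = lincomb (\<lambda>j'. x j * (if j' = pr j then 1 else 0)) I J"
        unfolding lincomb_scale[symmetric] lincomb_delta[OF fin prI[OF j]] ..
      also have "\<dots> \<in> aspan (max_ideal P) I J"
        by (rule aspanI[OF refl]) (use xy[OF j] y(2) j KI in auto)
      finally show "x j *v J (pr j) \<in> aspan (max_ideal P) I J" .
    qed
    moreover have "\<theta>0 i z = lincomb x K J"
      unfolding z_def lin_lincomb[OF lin_\<theta>0]
    proof (rule lincomb_cong)
      fix j assume "j \<in> K"
      then obtain l k where j: "j = (l, Suc k)" by (cases j; cases "snd j") (auto simp: K_def)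
      show "\<theta>0 i (J (pr j)) = J j" unfolding j by (simp add: pr_def J_def jfam_def)
    qed simp
    ultimately show "\<exists>z. z \<in> aspan (max_ideal P) I J \<and> \<theta>0 i z = \<theta>0 i (b l)" using x by auto
  qed
  then obtain z where z: "\<And>l. l \<in> W \<Longrightarrow> z l \<in> aspan (max_ideal P) I J" "\<And>l. l \<in> W \<Longrightarrow> \<theta>0 i (z l) = \<theta>0 i (b l)"
    by metis
  define b' where "b' l = (if l \<in> W then b l - z l else b l)" for l
  have "jfam i b' j - J j \<in> aspan (max_ideal P) I J" if j: "j \<in> I" for j
  proof -
    obtain l k where lk: "j = (l, k)" by (cases j)
    show ?thesis
    proof (cases "l \<in> W")
      case True
      hence "k = 0" using j VW(3) by (auto simp: lk I_def jind_def)
      hence "jfam i b' j - J j = 0 - z l" using True by (simp add: lk jfam_def J_def b'_def)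
      thus ?thesis using L.submod_diff[OF L.submod_aspan_m submod_0[OF L.submod_aspan_m] z(1)[OF True]] by simp
    next
      case False
      hence "jfam i b' j - J j = 0" by (simp add: lk jfam_def J_def b'_def)
      thus ?thesis using submod_0[OF L.submod_aspan_m] by simp
    qed
  qed
  hence new: "indep I (jfam i b')" "aspan (Oj 0 P) I (jfam i b') = cvec (Oj 0 P) d"
    using L.basis_perturb[OF fin ind, of "jfam i b'"] span by auto
  have "\<theta> (b' l) = 0" if l: "l \<in> W" for l
  proof -
    have "\<theta>0 i (b' l) = 0" using z(2)[OF l] l by (simp add: b'_def lin_diff[OF lin_\<theta>0])
    thus ?thesis using \<theta>_pow[of 1 "b' l" i] by simp
  qed
  thus ?thesis using new VW unfolding I_def by blast
qed

end

section \<open>Kernels and images in terms of local Jordan bases\<close>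

context jordan
begin

text \<open>\<open>V\<close> numbers the strings of length \<open>p\<close> and \<open>W\<close>
  those of length 1. The data \<open>i\<close>, \<open>V\<close>, \<open>W\<close> and
  \<open>b\<close> do not involve the point \<open>R\<close>, so one choice can serve a whole
  neighbourhood.\<close>

definition jbasis :: "('k, 'r) point \<Rightarrow> 'r \<Rightarrow> nat set \<Rightarrow> nat set \<Rightarrow> (nat \<Rightarrow> nat \<Rightarrow> ('k, 'r) hfrac) \<Rightarrow> bool" where
  "jbasis R i V W b \<longleftrightarrow> R \<in> proj_space \<and> Y_var i \<notin> R \<and> finite V \<and> finite W \<and> V \<inter> W = {} \<and>
     (\<forall>l\<in>W. \<theta> (b l) = 0) \<and> indep (jind V W) (jfam i b) \<and>
     aspan (Oj 0 R) (jind V W) (jfam i b) = cvec (Oj 0 R) d"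

lemma near_jordan:
  assumes P: "P \<in> proj_space"
  shows "\<exists>i V W b. near P (\<lambda>R. jbasis R i V W b)"
proof -
  obtain i where i: "Y_var i \<notin> P" using point_facts(6)[OF P] by blast
  obtain V W b where *: "finite V" "finite W" "V \<inter> W = {}" "\<forall>l\<in>W. \<theta> (b l) = 0"
     "indep (jind V W) (jfam i b)" "aspan (Oj 0 P) (jind V W) (jfam i b) = cvec (Oj 0 P) d"
    using local_jordan[OF P i] by blast
  have fin: "finite (jind V W)" using * by (simp add: jind_def)
  have "near P (\<lambda>R. aspan (Oj 0 R) (jind V W) (jfam i b) = aspan (Oj 0 R) {..<d} unitv)"
    by (rule aspan_eq_near[OF P fin finite_lessThan]) (use *(6) in \<open>simp add: cvec_aspan\<close>)
  from near_conj[OF near_nonvanishing[OF homogeneous_Y(1) P i] this]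
  have "near P (\<lambda>R. jbasis R i V W b)"
    by (rule near_mono) (use * in \<open>auto simp: jbasis_def cvec_aspan\<close>)
  thus ?thesis by blast
qed

context
  fixes R i V W b
  assumes jb: "jbasis R i V W b"
begin

lemma jb_facts: "R \<in> proj_space" "Y_var i \<notin> R" "finite V" "finite W" "V \<inter> W = {}" "l \<in> W \<Longrightarrow> \<theta> (b l) = 0"
  "indep (jind V W) (jfam i b)" "aspan (Oj 0 R) (jind V W) (jfam i b) = cvec (Oj 0 R) d" "finite (jind V W)"
  using jb unfolding jbasis_def jind_def by auto

lemma jfam_in: "j \<in> jind V W \<Longrightarrow> jfam i b j \<in> cvec (Oj 0 R) d"
  using subring_of_field.aspan_base[OF subring_O[OF jb_facts(1)] jb_facts(9), of j "jfam i b"] jb_facts(8) by simp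

lemma cvec_lincomb: "u \<in> cvec (Oj 0 R) d \<Longrightarrow> \<exists>x. u = lincomb x (jind V W) (jfam i b) \<and> (\<forall>j\<in>jind V W. x j \<in> Oj 0 R)"
  unfolding jb_facts(8)[symmetric] aspan_iff .

lemma cvec_UNIV_sub: "v \<in> cvec A d \<Longrightarrow> v \<in> cvec UNIV d"
  by (simp add: cvec_def)

lemma \<theta>0_W: "l \<in> W \<Longrightarrow> 1 \<le> n \<Longrightarrow> (\<theta>0 i ^^ n) (b l) = 0"
proof (induction n)
  case (Suc n)
  show ?case
  proof (cases n)
    case 0
    thus ?thesis using jb_facts(6)[OF Suc.prems(1)] by (simp add: \<theta>0_eq)
  next
    case (Suc n')
    thus ?thesis using Suc.IH Suc.prems lin_0[OF lin_\<theta>0] by simp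
  qed
qed simp

lemma pow_jfam:
  assumes j: "(l, k) \<in> jind V W" and n: "1 \<le> n"
  shows "(\<theta>0 i ^^ n) (jfam i b (l, k)) = (if l \<in> V \<and> k + n < p then jfam i b (l, k + n) else 0)"
proof -
  have eq: "(\<theta>0 i ^^ n) (jfam i b (l, k)) = (\<theta>0 i ^^ (n + k)) (b l)" by (simp add: jfam_def funpow_add)
  show ?thesis
  proof (cases "l \<in> V")
    case True
    have "(l, 0) \<in> jind V W" using True p2 by (auto simp: jind_def)
    from jfam_in[OF this] have bl: "b l \<in> cvec UNIV d" by (auto simp: jfam_def intro: cvec_UNIV_sub)
    show ?thesis
    proof (cases "k + n < p")
      case False
      then obtain e where e: "n + k = e + p" using add.commute le_Suc_ex by (metis add.commute not_less)
      have "(\<theta> ^^ (n + k)) (b l) = (\<theta> ^^ e) 0" unfolding e by (simp add: funpow_add \<theta>_p[OF bl])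
      thus ?thesis using False eq by (simp add: \<theta>0_pow lin_0[OF lin_funpow[OF lin_\<theta>]])
    qed (use True eq in \<open>simp add: jfam_def add.commute\<close>)
  next
    case False
    hence "l \<in> W" using j by (auto simp: jind_def)
    thus ?thesis using False eq \<theta>0_W[of l "n + k"] n by simp
  qed
qed

lemma pow_lincomb:
  assumes n: "1 \<le> n" "n \<le> p"
  shows "(\<theta>0 i ^^ n) (lincomb x (jind V W) (jfam i b)) = lincomb (\<lambda>(l, k). x (l, k - n)) (V \<times> {n..<p}) (jfam i b)"
proof -
  have "(\<theta>0 i ^^ n) (lincomb x (jind V W) (jfam i b)) = lincomb x (jind V W) (\<lambda>j. (\<theta>0 i ^^ n) (jfam i b j))"
    by (rule lin_lincomb[OF lin_funpow[OF lin_\<theta>0]])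
  also have "\<dots> = (\<Sum>j\<in>V \<times> {..<p - n}. x j *v jfam i b (fst j, snd j + n))"
    unfolding lincomb_def
  proof (rule sum.mono_neutral_cong_right)
    show "finite (jind V W)" by (rule jb_facts(9))
    show "V \<times> {..<p - n} \<subseteq> jind V W" by (auto simp: jind_def)
    show "\<forall>j\<in>jind V W - V \<times> {..<p - n}. x j *v (\<theta>0 i ^^ n) (jfam i b j) = 0"
    proof
      fix j assume j: "j \<in> jind V W - V \<times> {..<p - n}"
      obtain l k where lk: "j = (l, k)" by (cases j)
      show "x j *v (\<theta>0 i ^^ n) (jfam i b j) = 0" using j pow_jfam[of l k n] n by (auto simp: lk)
    qed
    fix j assume j: "j \<in> V \<times> {..<p - n}"
    obtain l k where lk: "j = (l, k)" by (cases j)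
    have "(l, k) \<in> jind V W" using j by (auto simp: lk jind_def)
    thus "x j *v (\<theta>0 i ^^ n) (jfam i b j) = x j *v jfam i b (fst j, snd j + n)"
      using j pow_jfam[of l k n] n by (auto simp: lk)
  qed
  also have "\<dots> = lincomb (\<lambda>(l, k). x (l, k - n)) (V \<times> {n..<p}) (jfam i b)"
    unfolding lincomb_def
    by (rule sum.reindex_bij_witness[of _ "\<lambda>(l, k). (l, k - n)" "\<lambda>(l, k). (l, k + n)"]) (use n in auto)
  finally show ?thesis .
qed

lemma pow_zero:
  assumes n: "1 \<le> n" "n \<le> p" and 0: "(\<theta>0 i ^^ n) (lincomb x (jind V W) (jfam i b)) = 0" and l: "l \<in> V" "k + n < p"
  shows "x (l, k) = 0"
proof -
  have "indep (V \<times> {n..<p}) (jfam i b)" by (rule indep_mono[OF jb_facts(7,9)]) (auto simp: jind_def)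
  hence "\<forall>j\<in>V \<times> {n..<p}. (\<lambda>(l, k). x (l, k - n)) j = 0"
    using 0 unfolding pow_lincomb[OF n] indep_def by blast
  from bspec[OF this, of "(l, k + n)"] show ?thesis using l by simp
qed

lemma top_lincomb:
  "(\<theta>0 i ^^ (p - 1)) (lincomb x (jind V W) (jfam i b)) = lincomb (\<lambda>l. x (l, 0)) V (\<lambda>l. jfam i b (l, p - 1))"
proof -
  have "(\<theta>0 i ^^ (p - 1)) (lincomb x (jind V W) (jfam i b)) =
      lincomb (\<lambda>(l, k). x (l, k - (p - 1))) (V \<times> {p - 1..<p}) (jfam i b)"
    by (rule pow_lincomb) (use p2 in auto)
  also have "{p - 1..<p} = {p - 1}" using p2 by auto
  also have "lincomb (\<lambda>(l, k). x (l, k - (p - 1))) (V \<times> {p - 1}) (jfam i b) =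
      lincomb (\<lambda>l. x (l, 0)) V (\<lambda>l. jfam i b (l, p - 1))"
    unfolding lincomb_def
    by (rule sum.reindex_bij_witness[of _ "\<lambda>l. (l, p - 1)" fst]) auto
  finally show ?thesis .
qed

text \<open>Along each long string a vector killed by the power \<open>n + 1\<close> has coordinates
  only in the last \<open>n + 1\<close> positions. The power \<open>n\<close> retains just the first
  of these and moves it to the end of the string, where the top vector arrives under the power
  \<open>p - 1\<close>.\<close>

lemma kernel_image:
  assumes n: "1 \<le> n" "n < p" and u: "u \<in> cvec (Oj 0 R) d" "(\<theta>0 i ^^ Suc n) u = 0"
  shows "\<exists>u'\<in>cvec (Oj 0 R) d. (\<theta>0 i ^^ n) u = (\<theta>0 i ^^ (p - 1)) u'"
proof -
  obtain x where x: "u = lincomb x (jind V W) (jfam i b)" "\<forall>j\<in>jind V W. x j \<in> Oj 0 R"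
    using cvec_lincomb[OF u(1)] by blast
  have x0: "x (l, k) = 0" if "l \<in> V" "k + Suc n < p" for l k
    by (rule pow_zero[of "Suc n"]) (use n u(2) x(1) that in auto)
  \<comment> \<open>The coordinate at position \<open>p - 1 - n\<close> is moved to the top of its
    string.\<close>
  define x' where "x' = (\<lambda>(l :: nat, k :: nat). if l \<in> V \<and> k = 0 then x (l, p - 1 - n) else 0)"
  have "x' j \<in> Oj 0 R" if "j \<in> jind V W" for j
  proof -
    obtain l k where lk: "j = (l, k)" by (cases j)
    have "l \<in> V \<Longrightarrow> (l, p - 1 - n) \<in> jind V W" using p2 by (auto simp: jind_def)
    thus ?thesis using x(2) Oj_0[OF jb_facts(1), of 0] by (auto simp: lk x'_def)
  qed
  hence "lincomb x' (jind V W) (jfam i b) \<in> cvec (Oj 0 R) d"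
    unfolding jb_facts(8)[symmetric] by (auto simp: aspan_iff)
  moreover have "(\<theta>0 i ^^ n) u = (\<theta>0 i ^^ (p - 1)) (lincomb x' (jind V W) (jfam i b))"
  proof -
    have "(\<theta>0 i ^^ n) u = lincomb (\<lambda>(l, k). x (l, k - n)) (V \<times> {n..<p}) (jfam i b)"
      unfolding x(1) by (rule pow_lincomb) (use n in auto)
    also have "\<dots> = lincomb (\<lambda>(l, k). x (l, k - n)) (V \<times> {p - 1}) (jfam i b)"
      unfolding lincomb_def
    proof (rule sum.mono_neutral_right)
      show "\<forall>j\<in>V \<times> {n..<p} - V \<times> {p - 1}. (\<lambda>(l, k). x (l, k - n)) j *v jfam i b j = 0"
      proof
        fix j assume j: "j \<in> V \<times> {n..<p} - V \<times> {p - 1}"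
        obtain l k where lk: "j = (l, k)" by (cases j)
        have "x (l, k - n) = 0" by (rule x0) (use j in \<open>auto simp: lk\<close>)
        thus "(\<lambda>(l, k). x (l, k - n)) j *v jfam i b j = 0" by (simp add: lk)
      qed
    qed (use n jb_facts(3) in auto)
    also have "\<dots> = lincomb (\<lambda>l. x' (l, 0)) V (\<lambda>l. jfam i b (l, p - 1))"
      unfolding lincomb_def
      by (rule sum.reindex_bij_witness[of _ "\<lambda>l. (l, p - 1)" fst]) (auto simp: x'_def)
    finally show ?thesis unfolding top_lincomb .
  qed
  ultimately show ?thesis by blast
qed

lemma top_image: "(\<theta>0 i ^^ (p - 1)) ` cvec (Oj 0 R) d = aspan (Oj 0 R) V (\<lambda>l. jfam i b (l, p - 1))"
proof (intro equalityI subsetI)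
  fix w assume "w \<in> (\<theta>0 i ^^ (p - 1)) ` cvec (Oj 0 R) d"
  then obtain x where x: "w = (\<theta>0 i ^^ (p - 1)) (lincomb x (jind V W) (jfam i b))" "\<forall>j\<in>jind V W. x j \<in> Oj 0 R"
    using cvec_lincomb by blast
  have "l \<in> V \<Longrightarrow> (l, 0) \<in> jind V W" for l using p2 by (auto simp: jind_def)
  thus "w \<in> aspan (Oj 0 R) V (\<lambda>l. jfam i b (l, p - 1))" unfolding x(1) top_lincomb using x(2) by (auto intro!: aspanI)
next
  fix w assume "w \<in> aspan (Oj 0 R) V (\<lambda>l. jfam i b (l, p - 1))"
  then obtain x where x: "w = lincomb x V (\<lambda>l. jfam i b (l, p - 1))" "\<forall>l\<in>V. x l \<in> Oj 0 R" unfolding aspan_iff by blast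
  define x' where "x' = (\<lambda>(l :: nat, k :: nat). if l \<in> V \<and> k = 0 then x l else 0)"
  have "\<forall>j\<in>jind V W. x' j \<in> Oj 0 R" using x(2) Oj_0[OF jb_facts(1), of 0] by (auto simp: x'_def)
  hence "lincomb x' (jind V W) (jfam i b) \<in> cvec (Oj 0 R) d"
    unfolding jb_facts(8)[symmetric] by (auto simp: aspan_iff)
  moreover have "w = (\<theta>0 i ^^ (p - 1)) (lincomb x' (jind V W) (jfam i b))"
    unfolding top_lincomb x(1) by (rule lincomb_cong) (auto simp: x'_def)
  ultimately show "w \<in> (\<theta>0 i ^^ (p - 1)) ` cvec (Oj 0 R) d" by blast
qed

lemma kernel_basis: "{u \<in> cvec (Oj 0 R) d. \<theta> u = 0} = aspan (Oj 0 R) (V \<times> {p - 1} \<union> W \<times> {0}) (jfam i b)"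
proof (intro equalityI subsetI)
  let ?K = "V \<times> {p - 1} \<union> W \<times> {0 :: nat}"
  have KI: "?K \<subseteq> jind V W" using p2 by (auto simp: jind_def)
  {
    fix u assume u: "u \<in> {u \<in> cvec (Oj 0 R) d. \<theta> u = 0}"
    obtain x where x: "u = lincomb x (jind V W) (jfam i b)" "\<forall>j\<in>jind V W. x j \<in> Oj 0 R"
      using cvec_lincomb u by blast
    have "x (l, k) = 0" if "l \<in> V" "k + 1 < p" for l k
      by (rule pow_zero[of 1]) (use p2 u x(1) that in \<open>auto simp: \<theta>0_eq\<close>)
    hence "x j = 0" if "j \<in> jind V W - ?K" for j using that by (auto simp: jind_def)
    hence "u = lincomb x ?K (jfam i b)"
      unfolding x(1) lincomb_def using KI jb_facts(9) by (intro sum.mono_neutral_right) auto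
    thus "u \<in> aspan (Oj 0 R) ?K (jfam i b)" by (rule aspanI) (use x(2) KI in blast)
  }
  fix u assume "u \<in> aspan (Oj 0 R) ?K (jfam i b)"
  then obtain x where x: "u = lincomb x ?K (jfam i b)" "\<forall>j\<in>?K. x j \<in> Oj 0 R" unfolding aspan_iff by blast
  have "u \<in> cvec (Oj 0 R) d"
    unfolding x(1) cvec_aspan
    by (rule submod_lincomb[OF subring_of_field.submod_aspan[OF subring_O[OF jb_facts(1)]]])
      (use x(2) KI jfam_in in \<open>auto simp: cvec_aspan\<close>)
  moreover have "(\<theta>0 i ^^ 1) u = 0"
    unfolding x(1) lin_lincomb[OF lin_funpow[OF lin_\<theta>0]]
  proof (rule lincomb_neutral)
    fix j assume j: "j \<in> ?K"
    obtain l k where lk: "j = (l, k)" by (cases j)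
    have "(l, k) \<in> jind V W" using j KI lk by blast
    moreover have "\<not> (l \<in> V \<and> k + 1 < p)" using j jb_facts(5) by (auto simp: lk)
    ultimately show "(\<theta>0 i ^^ 1) (jfam i b j) = 0"
      unfolding lk by (subst pow_jfam) (simp_all only: if_False order.refl)
  qed
  hence "\<theta> u = 0" using \<theta>_pow[of 1 u i] by simp
  ultimately show "u \<in> {u \<in> cvec (Oj 0 R) d. \<theta> u = 0}" by blast
qed

end

section \<open>The bundles in the exact sequences\<close>

definition MM :: "int \<Rightarrow> ('k, 'r) lattice" where
  "MM j = DS {..<d} (\<lambda>_. j)"

text \<open>Each application of \<open>\<theta>\<close> raises the degree by 1, so the image inside
  degree \<open>j\<close> comes from degree \<open>j - (p - 1)\<close>. With this normalisation
  \<open>GG j\<close> is the twist \<open>G(j)\<close>.\<close>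

definition GG :: "int \<Rightarrow> ('k, 'r) lattice" where
  "GG j P = (\<theta> ^^ (p - 1)) ` MM (j - int (p - 1)) P"

definition KK :: "nat \<Rightarrow> ('k, 'r) lattice" where
  "KK n P = {v \<in> MM 0 P. (\<theta> ^^ n) v = 0}"

lemma MM_0: "MM 0 P = cvec (Oj 0 P) d"
  by (auto simp: MM_def DS_def cvec_def)

lemma MM_UNIV: "v \<in> MM j P \<Longrightarrow> v \<in> cvec UNIV d"
  by (auto simp: MM_def DS_def cvec_def)

lemma MM_scale: "P \<in> proj_space \<Longrightarrow> Y_var i \<notin> P \<Longrightarrow> yv i powi n *v v \<in> MM (n + j) P \<longleftrightarrow> v \<in> MM j P"
  by (auto simp: MM_def DS_def vec_apply yv_powi_mult_in)

lemma loc_free_MM: "loc_free (MM j)"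
  unfolding MM_def by (rule loc_free_DS) simp

lemma \<theta>0_MM: "P \<in> proj_space \<Longrightarrow> Y_var i \<notin> P \<Longrightarrow> u \<in> MM 0 P \<Longrightarrow> (\<theta>0 i ^^ n) u \<in> MM 0 P"
  unfolding MM_0 \<theta>0_def
  by (rule local_subring.lmat_pow_closed[OF local_O tmat_in])

lemma GG_iff:
  assumes P: "P \<in> proj_space" "Y_var i \<notin> P"
  shows "GG j P = (\<lambda>u. yv i powi j *v (\<theta>0 i ^^ (p - 1)) u) ` MM 0 P"
proof -
  have eq: "(\<theta> ^^ (p - 1)) (yv i powi (j - int (p - 1)) *v u) = yv i powi j *v (\<theta>0 i ^^ (p - 1)) u" for u
  proof -
    have "yv i powi (j - int (p - 1)) * yv i ^ (p - 1) = (yv i :: ('k, 'r) hfrac) powi j"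
      by (metis (no_types, lifting) diff_add_cancel power_int_add power_int_of_nat yv_nonzero)
    thus ?thesis by (simp add: lin_scale[OF lin_funpow[OF lin_\<theta>]] \<theta>_pow[of _ u i])
  qed
  have "MM (j - int (p - 1)) P = (\<lambda>u. yv i powi (j - int (p - 1)) *v u) ` MM 0 P"
  proof (intro equalityI subsetI)
    fix v assume v: "v \<in> MM (j - int (p - 1)) P"
    have "yv i powi (- (j - int (p - 1))) *v v \<in> MM (- (j - int (p - 1)) + (j - int (p - 1))) P"
      using MM_scale[OF P] v by blast
    moreover have "v = yv i powi (j - int (p - 1)) *v (yv i powi (- (j - int (p - 1))) *v v)"
      by (simp add: power_int_add[symmetric])
    ultimately show "v \<in> (\<lambda>u. yv i powi (j - int (p - 1)) *v u) ` MM 0 P" by (intro image_eqI) auto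
  next
    fix v assume "v \<in> (\<lambda>u. yv i powi (j - int (p - 1)) *v u) ` MM 0 P"
    thus "v \<in> MM (j - int (p - 1)) P" using MM_scale[OF P, of "j - int (p - 1)" _ 0] by auto
  qed
  thus ?thesis unfolding GG_def by (simp only: image_image eq)
qed

text \<open>The ends of the long strings, multiplied by a power of a nonvanishing variable to
  account for the twist, are a basis at all points near \<open>P\<close>.\<close>

lemma loc_free_GG: "loc_free (GG j)"
proof (rule loc_freeI)
  fix P :: "('k, 'r) point" assume P: "P \<in> proj_space"
  obtain i V W b where jb: "near P (\<lambda>R. jbasis R i V W b)" using near_jordan[OF P] by blast
  note f = jb_facts[OF near_self[OF jb]]
  let ?J = "\<lambda>l. yv i powi j *v jfam i b (l, p - 1)"
  have lc: "lincomb x V ?J = yv i powi j *v lincomb x V (\<lambda>l. jfam i b (l, p - 1))" for x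
    unfolding lincomb_scale unfolding lincomb_def by (rule sum.cong) (simp_all add: mult.commute)
  have "near P (\<lambda>R. GG j R = aspan (Oj 0 R) V ?J)"
  proof (rule near_mono[OF jb])
    fix R assume R: "R \<in> proj_space" and jbR: "jbasis R i V W b"
    have "GG j R = (\<lambda>u. yv i powi j *v u) ` ((\<theta>0 i ^^ (p - 1)) ` MM 0 R)"
      unfolding GG_iff[OF R jb_facts(2)[OF jbR]] image_image ..
    also have "\<dots> = (\<lambda>u. yv i powi j *v u) ` aspan (Oj 0 R) V (\<lambda>l. jfam i b (l, p - 1))"
      unfolding MM_0 top_image[OF jbR] ..
    also have "\<dots> = aspan (Oj 0 R) V ?J"
      unfolding aspan_def lc by blast
    finally show "GG j R = aspan (Oj 0 R) V ?J" .
  qed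
  moreover have "indep V ?J"
    unfolding indep_def
  proof (intro allI impI)
    fix x assume "lincomb x V ?J = 0"
    hence "lincomb x V (\<lambda>l. jfam i b (l, p - 1)) = 0" unfolding lc by (simp add: vec.scale_eq_0_iff)
    moreover have "lincomb x V (\<lambda>l. jfam i b (l, p - 1)) = lincomb (\<lambda>(l, k). x l) (V \<times> {p - 1}) (jfam i b)"
      unfolding lincomb_def by (rule sum.reindex_bij_witness[of _ fst "\<lambda>l. (l, p - 1)"]) auto
    moreover have "indep (V \<times> {p - 1}) (jfam i b)"
      by (rule indep_mono[OF f(7,9)]) (use p2 in \<open>auto simp: jind_def\<close>)
    ultimately have z: "lincomb (\<lambda>(l, k). x l) (V \<times> {p - 1}) (jfam i b) = 0"
      and iV: "indep (V \<times> {p - 1}) (jfam i b)" by simp_all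
    have "\<forall>j\<in>V \<times> {p - 1}. (\<lambda>(l, k). x l) j = 0" using iV z unfolding indep_def by blast
    thus "\<forall>l\<in>V. x l = 0" by auto
  qed
  ultimately show "\<exists>(I :: nat set) J. finite I \<and> indep I J \<and> near P (\<lambda>R. GG j R = aspan (Oj 0 R) I J)"
    using f(3) by blast
qed

text \<open>One inclusion is \<open>kernel_image\<close>. For the other, \<open>\<theta>\<close> to
  the power \<open>p\<close> vanishes, so an image under the power \<open>p - 1 - n\<close> lies in
  \<open>KK (Suc n)\<close>. The twist by \<open>n\<close> is the degree of the map.\<close>

lemma KK_image:
  assumes P: "P \<in> proj_space" and n: "1 \<le> n" "n < p"
  shows "(\<theta> ^^ n) ` KK (Suc n) P = GG (int n) P"
proof -
  obtain i V W b where jb': "near P (\<lambda>R. jbasis R i V W b)" using near_jordan[OF P] by blast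
  note jb = near_self[OF jb']
  note i = jb_facts(2)[OF jb]
  have G: "GG (int n) P = (\<lambda>u. (\<theta> ^^ n) ((\<theta>0 i ^^ (p - 1 - n)) u)) ` MM 0 P"
  proof -
    have "yv i powi int n *v (\<theta>0 i ^^ (p - 1)) u = (\<theta> ^^ n) ((\<theta>0 i ^^ (p - 1 - n)) u)" for u
    proof -
      have "(\<theta>0 i ^^ (p - 1)) u = (\<theta>0 i ^^ n) ((\<theta>0 i ^^ (p - 1 - n)) u)"
        using n funpow_add[of n "p - 1 - n" "\<theta>0 i"] by simp
      thus ?thesis by (simp add: \<theta>_pow[of n _ i])
    qed
    thus ?thesis unfolding GG_iff[OF P i] by simp
  qed
  show ?thesis
  proof (intro equalityI subsetI)
    fix w assume "w \<in> (\<theta> ^^ n) ` KK (Suc n) P"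
    then obtain v where v: "w = (\<theta> ^^ n) v" "v \<in> cvec (Oj 0 P) d" "(\<theta> ^^ Suc n) v = 0" unfolding KK_def MM_0 by blast
    have "(\<theta>0 i ^^ Suc n) v = 0" unfolding \<theta>0_pow v(3) by simp
    then obtain u where u: "u \<in> cvec (Oj 0 P) d" "(\<theta>0 i ^^ n) v = (\<theta>0 i ^^ (p - 1)) u"
      using kernel_image[OF jb n v(2)] by blast
    have "w = yv i powi int n *v (\<theta>0 i ^^ (p - 1)) u" unfolding v(1) \<theta>_pow[of n v i] u(2) by simp
    thus "w \<in> GG (int n) P" unfolding GG_iff[OF P i] MM_0 using u(1) by blast
  next
    fix w assume "w \<in> GG (int n) P"
    then obtain u where u: "w = (\<theta> ^^ n) ((\<theta>0 i ^^ (p - 1 - n)) u)" "u \<in> MM 0 P" unfolding G by blast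
    have "(\<theta>0 i ^^ (p - 1 - n)) u \<in> MM 0 P" by (rule \<theta>0_MM[OF P i u(2)])
    moreover have "(\<theta> ^^ Suc n) ((\<theta>0 i ^^ (p - 1 - n)) u) = 0"
    proof -
      have "(\<theta> ^^ Suc n) ((\<theta> ^^ (p - 1 - n)) u) = (\<theta> ^^ p) u"
        using n funpow_add[of "Suc n" "p - 1 - n" \<theta>] by simp
      hence "(\<theta> ^^ Suc n) ((\<theta> ^^ (p - 1 - n)) u) = 0" using \<theta>_p[OF MM_UNIV[OF u(2)]] by simp
      thus ?thesis unfolding \<theta>0_pow lin_scale[OF lin_funpow[OF lin_\<theta>]] by simp
    qed
    ultimately show "w \<in> (\<theta> ^^ n) ` KK (Suc n) P" unfolding u(1) KK_def by blast
  qed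
qed

lemma KK_p: "KK p P = MM 0 P"
  unfolding KK_def using \<theta>_p MM_UNIV by blast

lemma KK_kernel: "KK n P = {v \<in> KK (Suc n) P. (\<theta> ^^ n) v = 0}"
  unfolding KK_def using lin_0[OF lin_\<theta>] by auto

text \<open>Descending from the free lattice \<open>KK p\<close>, each \<open>KK n\<close> is the
  kernel of a surjection from \<open>KK (Suc n)\<close> onto the bundle \<open>GG n\<close>.\<close>

lemma loc_free_KK: "1 \<le> n \<Longrightarrow> n \<le> p \<Longrightarrow> loc_free (KK n)"
proof (induction "p - n" arbitrary: n)
  case 0
  hence "n = p" by simp
  moreover have "loc_free (KK p)" by (rule loc_free_cong[OF loc_free_MM[of 0]]) (simp add: KK_p)
  ultimately show ?case by simp
next
  case (Suc m)
  have "loc_free (\<lambda>P. {v \<in> KK (Suc n) P. (\<theta> ^^ n) v = 0})"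
    by (rule loc_free_kernel[OF _ loc_free_GG lin_funpow[OF lin_\<theta>] KK_image]) (use Suc in auto)
  thus ?case using KK_kernel[of n] by (simp add: loc_free_cong)
qed

text \<open>If \<open>\<theta> v\<close> lies in the kernel, then \<open>v\<close> is killed by the
  square, and \<open>kernel_image\<close> with \<open>n = 1\<close> puts \<open>\<theta> v\<close>
  into the image of the power \<open>p - 1\<close>. Strings of intermediate length would contribute
  further vectors.\<close>

lemma kernel_inter_image:
  assumes P: "P \<in> proj_space"
  shows "KK 1 P \<inter> \<theta> ` MM (- 1) P = GG 0 P"
proof -
  obtain i V W b where jb': "near P (\<lambda>R. jbasis R i V W b)" using near_jordan[OF P] by blast
  note jb = near_self[OF jb']
  note i = jb_facts(2)[OF jb]
  have im: "\<theta> ` MM (- 1) P = \<theta>0 i ` MM 0 P"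
  proof (intro equalityI subsetI)
    fix w assume "w \<in> \<theta> ` MM (- 1) P"
    then obtain v where v: "w = \<theta> v" "v \<in> MM (- 1) P" by blast
    have "yv i powi 1 *v v \<in> MM (1 + - 1) P" using MM_scale[OF P i] v(2) by blast
    moreover have "w = \<theta>0 i (yv i powi 1 *v v)" unfolding v(1) \<theta>0_eq lin_scale[OF lin_\<theta>] by simp
    ultimately show "w \<in> \<theta>0 i ` MM 0 P" by auto
  next
    fix w assume "w \<in> \<theta>0 i ` MM 0 P"
    then obtain v where v: "w = \<theta>0 i v" "v \<in> MM 0 P" by blast
    have "yv i powi (- 1) *v v \<in> MM (- 1 + 0) P" using MM_scale[OF P i] v(2) by blast
    moreover have "w = \<theta> (yv i powi (- 1) *v v)" unfolding v(1) \<theta>0_eq lin_scale[OF lin_\<theta>] by (simp add: power_int_minus)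
    ultimately show "w \<in> \<theta> ` MM (- 1) P" by auto
  qed
  have G: "GG 0 P = (\<theta>0 i ^^ (p - 1)) ` MM 0 P" unfolding GG_iff[OF P i] by simp
  show ?thesis unfolding im G
  proof (intro equalityI subsetI)
    fix w assume w: "w \<in> KK 1 P \<inter> \<theta>0 i ` MM 0 P"
    then obtain v where v: "w = (\<theta>0 i ^^ 1) v" "v \<in> MM 0 P" "\<theta> w = 0" unfolding KK_def by auto
    have "\<theta>0 i w = 0" using v(3) by (simp add: \<theta>0_eq)
    hence "(\<theta>0 i ^^ Suc 1) v = 0" using v(1) by simp
    from kernel_image[OF jb _ _ _ this] show "w \<in> (\<theta>0 i ^^ (p - 1)) ` MM 0 P"
      using v p2 unfolding MM_0 by auto
  next
    fix w assume "w \<in> (\<theta>0 i ^^ (p - 1)) ` MM 0 P"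
    then obtain u where u: "w = (\<theta>0 i ^^ (p - 1)) u" "u \<in> MM 0 P" by blast
    have w: "w \<in> MM 0 P" unfolding u(1) by (rule \<theta>0_MM[OF P i u(2)])
    obtain n where n: "p - 1 = Suc n" using p2 by (cases "p - 1") auto
    have "w = \<theta>0 i ((\<theta>0 i ^^ n) u)" unfolding u(1) n by simp
    moreover have "\<theta> w = 0"
    proof -
      have "p = Suc (p - 1)" using p2 by simp
      hence "\<theta> ((\<theta> ^^ (p - 1)) u) = (\<theta> ^^ p) u" by (metis comp_apply funpow.simps(2))
      hence "\<theta> ((\<theta> ^^ (p - 1)) u) = 0" using \<theta>_p[OF MM_UNIV[OF u(2)]] by simp
      thus ?thesis unfolding u(1) \<theta>0_pow lin_scale[OF lin_\<theta>] by simp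
    qed
    ultimately show "w \<in> KK 1 P \<inter> \<theta>0 i ` MM 0 P" using w \<theta>0_MM[OF P i u(2)] unfolding KK_def by auto
  qed
qed

subsection \<open>The image of \<open>\<theta>\<^sup>p\<^sup>-\<^sup>1\<close> as the sheaf of a graded module\<close>

definition pmat :: "nat \<Rightarrow> nat \<Rightarrow> ('k, 'r) hpoly" where
  "pmat a b = (\<Sum>i\<in>UNIV. Poly_Mapping.single 0 (Xm i a b) * Y_var i)"

definition p\<theta> :: "(nat \<Rightarrow> ('k, 'r) hpoly) \<Rightarrow> nat \<Rightarrow> ('k, 'r) hpoly" where
  "p\<theta> u = (\<lambda>a. if a < d then \<Sum>b<d. pmat a b * u b else 0)"

definition pgen :: "nat \<Rightarrow> nat \<Rightarrow> ('k, 'r) hpoly" where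
  "pgen b = (p\<theta> ^^ (p - 1)) (\<lambda>a. if a = b then 1 else 0)"

text \<open>The columns \<open>pgen b\<close> are forms of degree \<open>p - 1\<close>. Placing the
  generators of the source in that degree makes the map homogeneous of degree 0, so that
  \<open>GG j\<close> is the sheaf of this module twisted by exactly \<open>j\<close>.\<close>

definition pmod :: "nat \<Rightarrow> (nat \<Rightarrow> ('k, 'r) hpoly) set" where
  "pmod e = gmap {..<d} pgen ` hvec {..<d} (\<lambda>_. p - 1) e"

lemma homogeneous_pmat: "homogeneous 1 (pmat a b)"
  unfolding pmat_def using homogeneous_mult[OF homogeneous_const homogeneous_Y(1)] by (intro homogeneous_sum) auto

lemma p\<theta>_hvec: "u \<in> hvec {..<d} (\<lambda>_. 0) e \<Longrightarrow> p\<theta> u \<in> hvec {..<d} (\<lambda>_. 0) (Suc e)"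
  using homogeneous_mult[OF homogeneous_pmat] by (auto simp: hvec_def p\<theta>_def intro!: homogeneous_sum)

lemma pgen_hvec: "b < d \<Longrightarrow> pgen b \<in> hvec {..<d} (\<lambda>_. 0) (p - 1)"
proof -
  assume b: "b < d"
  have "(p\<theta> ^^ n) (\<lambda>a. if a = b then 1 else 0) \<in> hvec {..<d} (\<lambda>_. 0) n" for n
  proof (induction n)
    case 0
    show ?case using b by (auto simp: hvec_def)
  next
    case (Suc n)
    show ?case using p\<theta>_hvec[OF Suc] by simp
  qed
  thus ?thesis unfolding pgen_def .
qed

lemma Fract_pmat: "Fract (pmat a b) 1 = tmat a b"
  unfolding pmat_def tmat_def cst_def yv_def by (simp add: Fract_sum_same[symmetric])

lemma \<theta>_emb: "\<theta> (\<lambda>a. Fract (u a) 1) = (\<lambda>a. Fract (p\<theta> u a) 1)"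
  by (rule ext)
    (simp add: \<theta>_def lmat_def p\<theta>_def Fract_pmat[symmetric] Fract_sum_same[symmetric] fract_collapse)

lemma pgen_emb: "(\<lambda>a. Fract (pgen b a) 1) = (\<theta> ^^ (p - 1)) (unitv b)"
proof -
  have "(\<theta> ^^ n) (unitv b) = (\<lambda>a. Fract ((p\<theta> ^^ n) (\<lambda>a. if a = b then 1 else 0) a) 1)" for n
  proof (induction n)
    case 0
    show ?case by (auto simp: unitv_def fract_collapse)
  qed (simp add: \<theta>_emb)
  thus ?thesis unfolding pgen_def by simp
qed

lemma gmat_pgen:
  assumes v: "v \<in> cvec UNIV d"
  shows "gmat {..<d} pgen v = (\<theta> ^^ (p - 1)) v"
proof -
  have "gmat {..<d} pgen v = lincomb v {..<d} (\<lambda>b a. Fract (pgen b a) 1)"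
    by (rule ext) (simp add: gmat_def lincomb_def sum_fun_apply vec_apply)
  also have "\<dots> = (\<theta> ^^ (p - 1)) (lincomb v {..<d} unitv)"
    unfolding pgen_emb lin_lincomb[OF lin_funpow[OF lin_\<theta>]] ..
  also have "lincomb v {..<d} unitv = v" unfolding lincomb_units using v by (auto simp: cvec_def fun_eq_iff)
  finally show ?thesis .
qed

lemma pmod_graded: "graded {..<d} (\<lambda>_. 0) pmod"
proof -
  note H = hvec_graded[of "{..<d}" "\<lambda>_. p - 1"] and H0 = hvec_graded[of "{..<d}" "\<lambda>_. 0"]
  show ?thesis unfolding graded_def
  proof (intro allI conjI ballI impI)
    show "pmod e \<subseteq> hvec {..<d} (\<lambda>_. 0) e" for e
      unfolding pmod_def using pgen_hvec by (auto intro!: gmap_in[OF H0])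
    show "0 \<in> pmod e" for e
      unfolding pmod_def using gradedD(2)[OF H] by (intro image_eqI[of _ _ 0]) auto
    show "u + w \<in> pmod e" if "u \<in> pmod e" "w \<in> pmod e" for e u w
      using that gradedD(3)[OF H] unfolding pmod_def by (auto simp: gmap_add[symmetric] intro!: imageI)
    show "psc f u \<in> pmod (e + n)" if "u \<in> pmod e" "homogeneous n f" for e n f u
      using that gradedD(4)[OF H] unfolding pmod_def by (auto simp: gmap_psc[symmetric] intro!: imageI)
  qed
qed

lemma gmap_delta: "finite G \<Longrightarrow> b \<in> G \<Longrightarrow> gmap G g (\<lambda>b'. if b' = b then 1 else 0) = g b"
proof
  fix a assume "finite G" "b \<in> G"
  have "(\<Sum>b'\<in>G. (if b' = b then 1 else 0) * g b' a) = (\<Sum>b'\<in>G. if b' = b then g b a else 0)"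
    by (rule sum.cong) auto
  thus "gmap G g (\<lambda>b'. if b' = b then 1 else 0) a = g b a"
    using \<open>finite G\<close> \<open>b \<in> G\<close> by (simp add: gmap_apply)
qed

lemma pmod_generates: "generates {..<d} (\<lambda>_. p - 1) pgen pmod"
  unfolding generates_def
proof (intro conjI allI ballI)
  fix b assume b: "b \<in> {..<d}"
  have "(\<lambda>b'. if b' = b then 1 else 0) \<in> hvec {..<d} (\<lambda>_. p - 1) (p - 1)"
    using b by (auto simp: hvec_def)
  thus "pgen b \<in> pmod (p - 1)" unfolding pmod_def gmap_delta[OF finite_lessThan b, of pgen, symmetric] by (rule imageI)
qed (auto simp: pmod_def)

lemma pmod_meets: "u \<in> pmod e \<Longrightarrow> meets UNIV (u a)"
proof -
  assume "u \<in> pmod e"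
  then obtain c where c: "u = gmap {..<d} pgen c" unfolding pmod_def by blast
  have "meets UNIV (pgen b a)" if b: "b < d" for b
    unfolding meets_def
  proof
    fix m assume m: "m \<in> Poly_Mapping.keys (pgen b a)"
    have "homogeneous (p - 1) (pgen b a)"
      using pgen_hvec[OF b] by (cases "a < d") (auto simp: hvec_def)
    hence "mdeg m \<noteq> 0" using m p2 by (auto simp: homogeneous_iff)
    hence "m \<noteq> 0" by auto
    thus "\<exists>i\<in>UNIV. Poly_Mapping.lookup m i \<noteq> 0" by (metis UNIV_I lookup_zero poly_mapping_eqI)
  qed
  thus ?thesis unfolding c gmap_apply
    by (intro meets_sum) (auto simp: mult.commute[of "c _"] intro!: meets_mult)
qed

lemma gsheaf_pmod:
  assumes P: "P \<in> proj_space"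
  shows "gsheaf pmod j P = GG j P"
proof -
  have "gsheaf pmod j P = gmat {..<d} pgen ` gsheaf (hvec {..<d} (\<lambda>_. p - 1)) j P"
    by (rule gsheaf_image[OF pmod_graded pmod_generates P, symmetric])
  also have "gsheaf (hvec {..<d} (\<lambda>_. p - 1)) j P = MM (j - int (p - 1)) P"
    unfolding MM_def by (rule gsheaf_hvec[OF P]) simp
  also have "gmat {..<d} pgen ` MM (j - int (p - 1)) P = GG j P"
    unfolding GG_def by (rule image_cong[OF refl]) (rule gmat_pgen[OF MM_UNIV])
  finally show ?thesis .
qed

end

section \<open>The quotient \<open>\<F>\<^sub>1\<close> of the kernel of \<open>\<theta>\<close>\<close>

text \<open>A basis of \<open>S\<close> is sent to zero and the vectors that extend it are fixed.
  The quotient by \<open>S\<close> is thereby realised inside the same space, so that a quotient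
  sheaf can again be described by a lattice.\<close>

lemma exists_lin_kernel:
  fixes S :: "(nat \<Rightarrow> 'a::field) set"
  assumes S: "vec.subspace S"
  shows "\<exists>\<beta>. lin \<beta> \<and> (\<forall>v. \<beta> v = 0 \<longleftrightarrow> v \<in> S)"
proof -
  interpret vp: vector_space_pair "vsc :: 'a \<Rightarrow> _" "vsc :: 'a \<Rightarrow> _" by unfold_locales
  obtain B where B: "B \<subseteq> S" "vec.independent B" "S \<subseteq> vec.span B" using vec.maximal_independent_subset[of S] by blast
  have spB: "vec.span B = S" using B S by (metis vec.span_subspace)
  define B' where "B' = vec.extend_basis B"
  have B': "B \<subseteq> B'" "vec.independent B'" "vec.span B' = UNIV"
    unfolding B'_def using B(2) vec.extend_basis_superset vec.independent_extend_basis vec.span_extend_basis by auto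
  obtain f where f: "Vector_Spaces.linear vsc vsc f" "\<forall>x\<in>B'. f x = (if x \<in> B then 0 else x)"
    using vp.linear_independent_extend[OF B'(2), of "\<lambda>x. if x \<in> B then 0 else x"] by blast
  have lin: "lin f" using f(1) unfolding lin_def by (simp add: Vector_Spaces.linear_iff)
  have fB: "f v = 0" if "v \<in> vec.span B" for v
    using that
  proof (induction rule: vec.span_induct_alt)
    case base
    show ?case by (rule lin_0[OF lin])
  next
    case (step c x y)
    thus ?case using f(2) B'(1) by (auto simp: lin_add[OF lin] lin_scale[OF lin])
  qed
  have fR: "f v = v" if "v \<in> vec.span (B' - B)" for v
    using that
  proof (induction rule: vec.span_induct_alt)
    case base
    show ?case by (rule lin_0[OF lin])
  next
    case (step c x y)
    thus ?case using f(2) by (auto simp: lin_add[OF lin] lin_scale[OF lin])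
  qed
  have "f v = 0 \<longleftrightarrow> v \<in> S" for v
  proof
    assume 0: "f v = 0"
    have "v \<in> vec.span (B \<union> (B' - B))" using B'(1,3) by (simp add: Un_absorb1)
    then obtain x y where xy: "v = x + y" "x \<in> vec.span B" "y \<in> vec.span (B' - B)"
      unfolding vec.span_Un by blast
    have "y = 0" using 0 fB[OF xy(2)] fR[OF xy(3)] by (simp add: xy(1) lin_add[OF lin])
    thus "v \<in> S" using xy(1,2) spB by simp
  qed (use fB spB in blast)
  thus ?thesis using lin by blast
qed

context jordan
begin

text \<open>The span of \<open>G\<close> over the fraction field, common to all points.\<close>

definition W0 :: "(nat \<Rightarrow> ('k, 'r) hfrac) set" where
  "W0 = (\<theta> ^^ (p - 1)) ` cvec UNIV d"

lemma subspace_W0: "vec.subspace W0"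
proof -
  note l = lin_funpow[OF lin_\<theta>, of "p - 1"]
  have c: "0 \<in> cvec UNIV d" "u \<in> cvec UNIV d \<Longrightarrow> v \<in> cvec UNIV d \<Longrightarrow> u + v \<in> cvec UNIV d" "u \<in> cvec UNIV d \<Longrightarrow> c *v u \<in> cvec UNIV d"
    for u v :: "nat \<Rightarrow> ('k, 'r) hfrac" and c by (auto simp: cvec_def vec_apply)
  show ?thesis unfolding vec.subspace_def W0_def
  proof (intro conjI ballI allI)
    show "0 \<in> (\<theta> ^^ (p - 1)) ` cvec UNIV d" using c(1) lin_0[OF l] by (metis imageI)
    show "x + y \<in> (\<theta> ^^ (p - 1)) ` cvec UNIV d"
      if x: "x \<in> (\<theta> ^^ (p - 1)) ` cvec UNIV d" and y: "y \<in> (\<theta> ^^ (p - 1)) ` cvec UNIV d" for x y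
    proof -
      obtain u v where "x = (\<theta> ^^ (p - 1)) u" "u \<in> cvec UNIV d" "y = (\<theta> ^^ (p - 1)) v" "v \<in> cvec UNIV d" using x y by blast
      thus ?thesis using c(2)[of u v] lin_add[OF l, of u v] by (intro image_eqI[of _ _ "u + v"]) simp_all
    qed
    show "a *v x \<in> (\<theta> ^^ (p - 1)) ` cvec UNIV d" if x: "x \<in> (\<theta> ^^ (p - 1)) ` cvec UNIV d" for a x
    proof -
      obtain u where "x = (\<theta> ^^ (p - 1)) u" "u \<in> cvec UNIV d" using x by blast
      thus ?thesis using c(3)[of u a] lin_scale[OF l, of a u] by (intro image_eqI[of _ _ "a *v u"]) simp_all
    qed
  qed
qed

definition \<beta> :: "(nat \<Rightarrow> ('k, 'r) hfrac) \<Rightarrow> nat \<Rightarrow> ('k, 'r) hfrac" where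
  "\<beta> = (SOME f. lin f \<and> (\<forall>v. f v = 0 \<longleftrightarrow> v \<in> W0))"

lemma lin_\<beta>: "lin \<beta>" and \<beta>_zero: "\<beta> v = 0 \<longleftrightarrow> v \<in> W0"
  using someI_ex[OF exists_lin_kernel[OF subspace_W0]] unfolding \<beta>_def by auto

text \<open>The image of \<open>\<theta>\<close> to the power \<open>p - 1\<close> involves only the
  ends of the long strings, even over the fraction field; hence the strings of length 1 stay
  independent modulo \<open>W0\<close>.\<close>

lemma W0_coefficients:
  assumes jb: "jbasis R i V W b" and w: "lincomb x (V \<times> {p - 1} \<union> W \<times> {0}) (jfam i b) \<in> W0" and l: "l \<in> W"
  shows "x (l, 0) = 0"
proof -
  note f = jb_facts[OF jb]
  let ?K = "V \<times> {p - 1} \<union> W \<times> {0 :: nat}"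
  have KI: "?K \<subseteq> jind V W" using p2 by (auto simp: jind_def)
  obtain u where u: "lincomb x ?K (jfam i b) = (\<theta> ^^ (p - 1)) u" "u \<in> cvec UNIV d" using w unfolding W0_def by blast
  have "cvec UNIV d \<subseteq> aspan UNIV (jind V W) (jfam i b)"
    by (rule cvec_UNIV_aspan[OF f(9) f(8)[symmetric]]) (use Oj_0 Oj_1 f(1) in auto)
  then obtain y where y: "u = lincomb y (jind V W) (jfam i b)" using u(2) unfolding aspan_def by blast
  define c :: "('k, 'r) hfrac" where "c = yv i ^ (p - 1)"
  have "lincomb x ?K (jfam i b) = c *v lincomb (\<lambda>l. y (l, 0)) V (\<lambda>l. jfam i b (l, p - 1))"
    unfolding u(1) \<theta>_pow[of _ u i] c_def unfolding y top_lincomb[OF jb] ..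
  also have "\<dots> = lincomb (\<lambda>(l, k). if l \<in> V then c * y (l, 0) else 0) ?K (jfam i b)"
  proof -
    have "lincomb (\<lambda>l. c * y (l, 0)) V (\<lambda>l. jfam i b (l, p - 1)) =
        lincomb (\<lambda>(l, k). if l \<in> V then c * y (l, 0) else 0) (V \<times> {p - 1}) (jfam i b)"
      unfolding lincomb_def by (rule sum.reindex_bij_witness[of _ fst "\<lambda>l. (l, p - 1)"]) auto
    also have "\<dots> = lincomb (\<lambda>(l, k). if l \<in> V then c * y (l, 0) else 0) ?K (jfam i b)"
      unfolding lincomb_def
    proof (rule sum.mono_neutral_left)
      show "\<forall>j\<in>?K - V \<times> {p - 1}. (\<lambda>(l, k). if l \<in> V then c * y (l, 0) else 0) j *v jfam i b j = 0"
        using f(5) by (auto simp: disjoint_iff split: if_splits)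
    qed (use f(3,4) in auto)
    finally show ?thesis unfolding lincomb_scale .
  qed
  finally have eq: "lincomb x ?K (jfam i b) = lincomb (\<lambda>(l, k). if l \<in> V then c * y (l, 0) else 0) ?K (jfam i b)" .
  have "indep ?K (jfam i b)" by (rule indep_mono[OF f(7,9) KI])
  from indep_unique[OF this eq, of "(l, 0)"] show ?thesis using l f(5) by auto
qed

lemma KK_1: "KK 1 P = {u \<in> cvec (Oj 0 P) d. \<theta> u = 0}"
  by (simp add: KK_def MM_0)

text \<open>A kernel vector in \<open>W0\<close> has no coordinates on the short strings, so it is a
  combination of the ends of the long ones with regular coefficients. Hence \<open>G\<close> is
  saturated in the kernel, and \<open>\<beta>\<close> separates precisely its cosets at every
  point.\<close>

lemma GG_0_eq:
  assumes P: "P \<in> proj_space"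
  shows "GG 0 P = {v \<in> KK 1 P. \<beta> v = 0}"
proof -
  obtain i V W b where jb': "near P (\<lambda>R. jbasis R i V W b)" using near_jordan[OF P] by blast
  note jb = near_self[OF jb']
  note i = jb_facts(2)[OF jb]
  let ?K = "V \<times> {p - 1} \<union> W \<times> {0 :: nat}"
  show ?thesis
  proof (intro equalityI subsetI)
    fix v assume v: "v \<in> GG 0 P"
    hence "v \<in> KK 1 P" using kernel_inter_image[OF P] by blast
    moreover have "v \<in> W0" using v MM_UNIV unfolding GG_def W0_def by blast
    ultimately show "v \<in> {v \<in> KK 1 P. \<beta> v = 0}" by (simp add: \<beta>_zero)
  next
    fix v assume "v \<in> {v \<in> KK 1 P. \<beta> v = 0}"
    hence v: "v \<in> aspan (Oj 0 P) ?K (jfam i b)" "v \<in> W0" unfolding KK_1 kernel_basis[OF jb] \<beta>_zero by auto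
    obtain x where x: "v = lincomb x ?K (jfam i b)" "\<forall>j\<in>?K. x j \<in> Oj 0 P" using v(1) unfolding aspan_iff by blast
    have x0: "x (l, 0) = 0" if "l \<in> W" for l by (rule W0_coefficients[OF jb _ that]) (use v(2) x(1) in simp)
    have "v = lincomb (\<lambda>l. x (l, p - 1)) V (\<lambda>l. jfam i b (l, p - 1))"
    proof -
      have "v = lincomb x (V \<times> {p - 1}) (jfam i b)"
        unfolding x(1) lincomb_def
        by (rule sum.mono_neutral_right) (use jb_facts(3,4)[OF jb] x0 in auto)
      also have "\<dots> = lincomb (\<lambda>l. x (l, p - 1)) V (\<lambda>l. jfam i b (l, p - 1))"
        unfolding lincomb_def by (rule sum.reindex_bij_witness[of _ "\<lambda>l. (l, p - 1)" fst]) auto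
      finally show ?thesis .
    qed
    hence "v \<in> aspan (Oj 0 P) V (\<lambda>l. jfam i b (l, p - 1))" by (rule aspanI) (use x(2) in auto)
    thus "v \<in> GG 0 P" unfolding GG_iff[OF P i] MM_0 using top_image[OF jb] by simp
  qed
qed

text \<open>The lattice that models \<open>F_one\<close>: the quotient of the kernel by
  \<open>G\<close>, with the images of the strings of length 1 as local bases.\<close>

definition LL :: "('k, 'r) lattice" where
  "LL P = \<beta> ` KK 1 P"

lemma loc_free_KK_1: "loc_free (KK 1)"
  by (rule loc_free_KK) (use p2 in auto)

lemma loc_free_LL: "loc_free LL"
proof (rule loc_freeI)
  fix P :: "('k, 'r) point" assume P: "P \<in> proj_space"
  obtain i V W b where jb: "near P (\<lambda>R. jbasis R i V W b)" using near_jordan[OF P] by blast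
  let ?K = "V \<times> {p - 1} \<union> W \<times> {0 :: nat}"
  have comb: "\<beta> (lincomb x ?K (jfam i b)) = lincomb (\<lambda>l. x (l, 0)) W (\<lambda>l. \<beta> (b l))"
    if jbR: "jbasis R i V W b" for x R
  proof -
    note f = jb_facts[OF jbR]
    have "\<beta> (jfam i b (l, p - 1)) = 0" if l: "l \<in> V" for l
    proof -
      have "(l, 0) \<in> jind V W" using l p2 by (auto simp: jind_def)
      hence "b l \<in> cvec UNIV d" using jfam_in[OF jbR, of "(l, 0)"] by (auto simp: jfam_def cvec_def)
      hence "(\<theta> ^^ (p - 1)) (b l) \<in> W0" unfolding W0_def by blast
      hence "\<beta> ((\<theta> ^^ (p - 1)) (b l)) = 0" by (simp add: \<beta>_zero)
      thus ?thesis unfolding jfam_def by (simp add: \<theta>0_pow lin_scale[OF lin_\<beta>])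
    qed
    hence "\<beta> (lincomb x ?K (jfam i b)) = lincomb x (W \<times> {0}) (\<lambda>j. \<beta> (jfam i b j))"
      unfolding lin_lincomb[OF lin_\<beta>] unfolding lincomb_def
      by (intro sum.mono_neutral_right) (use f(3,4) in auto)
    also have "\<dots> = lincomb (\<lambda>l. x (l, 0)) W (\<lambda>l. \<beta> (b l))"
      unfolding lincomb_def by (rule sum.reindex_bij_witness[of _ "\<lambda>l. (l, 0)" fst]) (auto simp: jfam_def)
    finally show ?thesis .
  qed
  have "near P (\<lambda>R. LL R = aspan (Oj 0 R) W (\<lambda>l. \<beta> (b l)))"
  proof (rule near_mono[OF jb])
    fix R assume R: "R \<in> proj_space" and jbR: "jbasis R i V W b"
    show "LL R = aspan (Oj 0 R) W (\<lambda>l. \<beta> (b l))"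
      unfolding LL_def KK_1 kernel_basis[OF jbR]
    proof (intro equalityI subsetI)
      fix w assume "w \<in> \<beta> ` aspan (Oj 0 R) ?K (jfam i b)"
      then obtain x where x: "w = \<beta> (lincomb x ?K (jfam i b))" "\<forall>j\<in>?K. x j \<in> Oj 0 R" unfolding aspan_def by blast
      show "w \<in> aspan (Oj 0 R) W (\<lambda>l. \<beta> (b l))" unfolding x(1) comb[OF jbR] using x(2) by (auto intro!: aspanI)
    next
      fix w assume "w \<in> aspan (Oj 0 R) W (\<lambda>l. \<beta> (b l))"
      then obtain x where x: "w = lincomb x W (\<lambda>l. \<beta> (b l))" "\<forall>l\<in>W. x l \<in> Oj 0 R" unfolding aspan_def by blast
      define x' where "x' = (\<lambda>(l :: nat, k :: nat). if l \<in> W then x l else 0)"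
      have "w = \<beta> (lincomb x' ?K (jfam i b))"
        unfolding x(1) comb[OF jbR] by (rule lincomb_cong) (auto simp: x'_def)
      moreover have "lincomb x' ?K (jfam i b) \<in> aspan (Oj 0 R) ?K (jfam i b)"
        by (rule aspanI[OF refl]) (use x(2) Oj_0[OF R, of 0] in \<open>auto simp: x'_def\<close>)
      ultimately show "w \<in> \<beta> ` aspan (Oj 0 R) ?K (jfam i b)" by blast
    qed
  qed
  moreover have "indep W (\<lambda>l. \<beta> (b l))"
    unfolding indep_def
  proof (intro allI impI ballI)
    fix x l assume x: "lincomb x W (\<lambda>l. \<beta> (b l)) = 0" and l: "l \<in> W"
    define x' where "x' = (\<lambda>(l :: nat, k :: nat). x l)"
    have "\<beta> (lincomb x' ?K (jfam i b)) = 0" unfolding comb[OF near_self[OF jb]] x'_def using x by simp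
    hence "lincomb x' ?K (jfam i b) \<in> W0" by (simp add: \<beta>_zero)
    from W0_coefficients[OF near_self[OF jb] this l] show "x l = 0" by (simp add: x'_def)
  qed
  ultimately show "\<exists>(I :: nat set) J. finite I \<and> indep I J \<and> near P (\<lambda>R. LL R = aspan (Oj 0 R) I J)"
    using jb_facts(4)[OF near_self[OF jb]] by blast
qed

text \<open>The fibre of \<open>\<beta>\<close> over a vector of \<open>LL P\<close> is a coset of
  \<open>GG 0 P\<close>, which is the shape of the values of sections of
  \<open>F_one\<close>.\<close>

definition ecoset :: "('k, 'r) point \<Rightarrow> (nat \<Rightarrow> ('k, 'r) hfrac) \<Rightarrow> (nat \<Rightarrow> ('k, 'r) hfrac) set" where
  "ecoset P w = {u \<in> KK 1 P. \<beta> u = w}"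

lemma free_sections_eq: "zopen U \<Longrightarrow> free_sections d j U = sec (\<lambda>P v. v) U ` gsec (MM j) U"
proof -
  assume "zopen U"
  from represented.carrier_eq[OF represented_free this, of d j] show ?thesis
    by (simp add: free_sheaf_def MM_def)
qed

context
  fixes scl :: "('e::ab_group_add \<Rightarrow>\<^sub>0 'k) \<Rightarrow> 'm::ab_group_add \<Rightarrow> 'm" and g :: "'r \<Rightarrow> 'e"
  assumes Xm: "Xm = X_mat scl g" and d: "d = kdim scl"
begin

lemma theta_eq: "theta scl g U s = (\<lambda>P\<in>U. \<theta> (s P))"
proof -
  have "(\<Sum>i\<in>UNIV. \<Sum>b<d. cst (Xm i a b) * (yv i * u b)) = (\<Sum>b<d. tmat a b * u b)" for u :: "nat \<Rightarrow> ('k, 'r) hfrac" and a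
    unfolding tmat_def sum_distrib_right by (subst sum.swap) (simp add: mult.assoc)
  thus ?thesis
    unfolding theta_def \<theta>_def lmat_def by (auto simp: d[symmetric] Xm[symmetric] cst_def yv_def fun_eq_iff restrict_def)
qed

lemma Ker_theta_eq:
  assumes U: "zopen U"
  shows "Ker_theta scl g U = sec (\<lambda>P v. v) U ` gsec (KK 1) U"
proof (intro equalityI subsetI)
  fix s assume "s \<in> Ker_theta scl g U"
  hence "s \<in> free_sections d 0 U" "theta scl g U s = (\<lambda>P\<in>U. \<lambda>a. 0)" by (simp_all add: Ker_theta_def d)
  then obtain v where v: "s = sec (\<lambda>P v. v) U v" "v \<in> gsec (MM 0) U" "(\<lambda>P\<in>U. \<theta> (s P)) = (\<lambda>P\<in>U. \<lambda>a. 0)"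
    unfolding free_sections_eq[OF U] theta_eq by blast
  have "\<theta> v = 0" if "P \<in> U" for P
    using fun_cong[OF v(3), of P] that by (simp add: v(1) sec_def zero_fun_def)
  hence "v \<in> gsec (KK 1) U" using v(2) by (auto simp: gsec_def KK_def)
  thus "s \<in> sec (\<lambda>P v. v) U ` gsec (KK 1) U" using v(1) by blast
next
  fix s assume "s \<in> sec (\<lambda>P v. v) U ` gsec (KK 1) U"
  then obtain v where v: "s = sec (\<lambda>P v. v) U v" "v \<in> gsec (KK 1) U" by blast
  have "v \<in> gsec (MM 0) U" using v(2) by (auto simp: gsec_def KK_def)
  hence "s \<in> free_sections d 0 U" unfolding free_sections_eq[OF U] v(1) by blast
  moreover have "theta scl g U s = (\<lambda>P\<in>U. \<lambda>a. 0)"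
    unfolding theta_eq
  proof (rule ext)
    fix P
    show "(\<lambda>P\<in>U. \<theta> (s P)) P = (\<lambda>P\<in>U. \<lambda>a. 0) P"
      using v(2) by (auto simp: v(1) sec_def gsec_def KK_def zero_fun_def)
  qed
  ultimately show "s \<in> Ker_theta scl g U" by (simp add: Ker_theta_def d)
qed

text \<open>Preimages under \<open>\<theta>\<close> are required only locally, and a preimage at one
  point stays regular nearby. So the germs are exactly the vectors described by
  \<open>kernel_inter_image\<close>.\<close>

lemma stalk_eq:
  assumes P: "P \<in> proj_space"
  shows "stalk (\<lambda>U. Ker_theta scl g U \<inter> Im_theta scl g U) P = GG 0 P"
proof (intro equalityI subsetI)
  fix v assume "v \<in> stalk (\<lambda>U. Ker_theta scl g U \<inter> Im_theta scl g U) P"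
  then obtain s V where V: "zopen V" "P \<in> V" "s \<in> Ker_theta scl g V" "s \<in> Im_theta scl g V" "v = s P"
    unfolding stalk_def by blast
  have 1: "v \<in> KK 1 P" using V(2,3,5) unfolding Ker_theta_eq[OF V(1)] by (auto simp: sec_def gsec_def)
  obtain V' where V': "zopen V'" "P \<in> V'" "restrict s V' \<in> theta scl g V' ` free_sections d (- 1) V'"
    using V(2,4) unfolding Im_theta_def d by blast
  then obtain w where w: "restrict s V' = theta scl g V' (sec (\<lambda>P v. v) V' w)" "w \<in> gsec (MM (- 1)) V'"
    unfolding free_sections_eq[OF V'(1)] by blast
  have "v = \<theta> w" using fun_cong[OF w(1), of P] V'(2) V(5) by (simp add: theta_eq sec_def)
  moreover have "w \<in> MM (- 1) P" using w(2) V'(2) by (auto simp: gsec_def)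
  ultimately show "v \<in> GG 0 P" using 1 kernel_inter_image[OF P] by blast
next
  fix v assume v: "v \<in> GG 0 P"
  obtain V where V: "zopen V" "P \<in> V" "\<And>R. R \<in> V \<Longrightarrow> v \<in> GG 0 R"
    using loc_free_near[OF loc_free_GG P v] unfolding near_def by blast
  have vR: "v \<in> KK 1 R \<and> v \<in> \<theta> ` MM (- 1) R" if "R \<in> V" for R
    using V(3)[OF that] kernel_inter_image[of R] zopen_subset[OF V(1)] that by blast
  define s where "s = sec (\<lambda>P v. v) V v"
  have sK: "s \<in> Ker_theta scl g V"
    unfolding Ker_theta_eq[OF V(1)] s_def using vR by (auto simp: gsec_def)
  have "s \<in> Im_theta scl g V"
    unfolding Im_theta_def d[symmetric]
  proof (intro CollectI conjI ballI)
    show "s \<in> free_sections d 0 V" using sK by (simp add: Ker_theta_def d)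
    fix Q assume Q: "Q \<in> V"
    have Qp: "Q \<in> proj_space" using zopen_subset[OF V(1)] Q by blast
    obtain w where w: "v = \<theta> w" "w \<in> MM (- 1) Q" using vR[OF Q] by blast
    obtain V' where V': "zopen V'" "Q \<in> V'" "\<And>R. R \<in> V' \<Longrightarrow> w \<in> MM (- 1) R"
      using loc_free_near[OF loc_free_MM Qp w(2)] unfolding near_def by blast
    have z: "zopen (V \<inter> V')" by (rule zopen_Int[OF V(1) V'(1)])
    have "w \<in> gsec (MM (- 1)) (V \<inter> V')" using V'(3) by (auto simp: gsec_def)
    hence "sec (\<lambda>P v. v) (V \<inter> V') w \<in> free_sections d (- 1) (V \<inter> V')" unfolding free_sections_eq[OF z] by blast
    moreover have "restrict s (V \<inter> V') = theta scl g (V \<inter> V') (sec (\<lambda>P v. v) (V \<inter> V') w)"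
      by (auto simp: theta_eq s_def sec_def restrict_def fun_eq_iff w(1))
    ultimately show "\<exists>V'. zopen V' \<and> Q \<in> V' \<and> V' \<subseteq> V \<and> restrict s V' \<in> theta scl g V' ` free_sections d (- 1) V'"
      using z Q V'(2) by (intro exI[of _ "V \<inter> V'"]) auto
  qed
  moreover have "v = s P" using V(2) by (simp add: s_def sec_def)
  ultimately show "v \<in> stalk (\<lambda>U. Ker_theta scl g U \<inter> Im_theta scl g U) P"
    unfolding stalk_def using sK V(1,2) by blast
qed

lemma coset_eq:
  assumes P: "P \<in> proj_space" and u: "u \<in> KK 1 P"
  shows "germ_coset (\<lambda>U. Ker_theta scl g U \<inter> Im_theta scl g U) P u = ecoset P (\<beta> u)"
proof -
  interpret subring_of_field "Oj 0 P" by (rule subring_O[OF P])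
  note sm = loc_free_submod[OF loc_free_KK_1 P]
  have "germ_coset (\<lambda>U. Ker_theta scl g U \<inter> Im_theta scl g U) P u = {u + w |w. w \<in> KK 1 P \<and> \<beta> w = 0}"
    unfolding germ_coset_def stalk_eq[OF P] GG_0_eq[OF P] by (auto simp: plus_fun_def)
  also have "\<dots> = ecoset P (\<beta> u)"
  proof (intro equalityI subsetI)
    fix z assume "z \<in> {u + w |w. w \<in> KK 1 P \<and> \<beta> w = 0}"
    then obtain w where "z = u + w" "w \<in> KK 1 P" "\<beta> w = 0" by blast
    thus "z \<in> ecoset P (\<beta> u)" using submod_add[OF sm u] by (simp add: ecoset_def lin_add[OF lin_\<beta>])
  next
    fix z assume "z \<in> ecoset P (\<beta> u)"
    hence z: "z \<in> KK 1 P" "\<beta> z = \<beta> u" by (simp_all add: ecoset_def)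
    have "z - u \<in> KK 1 P" "\<beta> (z - u) = 0" using submod_diff[OF sm z(1) u] z(2) by (simp_all add: lin_diff[OF lin_\<beta>])
    moreover have "z = u + (z - u)" by simp
    ultimately show "z \<in> {u + w |w. w \<in> KK 1 P \<and> \<beta> w = 0}" by blast
  qed
  finally show ?thesis .
qed

lemma ecoset_inj: "P \<in> proj_space \<Longrightarrow> inj_on (ecoset P) (LL P)"
proof (rule inj_onI)
  fix v w assume v: "v \<in> LL P" and eq: "ecoset P v = ecoset P w"
  obtain u where u: "u \<in> KK 1 P" "\<beta> u = v" using v unfolding LL_def by blast
  hence "u \<in> ecoset P v" by (simp add: ecoset_def)
  thus "v = w" unfolding eq using u(2) by (simp add: ecoset_def)
qed

lemma carrier_F_one:
  assumes U: "zopen U"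
  shows "carrier (sections (F_one scl g) U) = sec ecoset U ` gsec LL U"
proof -
  let ?G = "\<lambda>U. Ker_theta scl g U \<inter> Im_theta scl g U"
  have "{\<sigma> \<in> extensional U. \<forall>P\<in>U. \<exists>V t. zopen V \<and> P \<in> V \<and> V \<subseteq> U \<and> t \<in> Ker_theta scl g V \<and>
      (\<forall>Q\<in>V. \<sigma> Q = germ_coset ?G Q (t Q))} = sec ecoset U ` gsec LL U"
  proof (intro equalityI subsetI)
    fix \<sigma> assume "\<sigma> \<in> {\<sigma> \<in> extensional U. \<forall>P\<in>U. \<exists>V t. zopen V \<and> P \<in> V \<and> V \<subseteq> U \<and> t \<in> Ker_theta scl g V \<and>
      (\<forall>Q\<in>V. \<sigma> Q = germ_coset ?G Q (t Q))}"
    hence ext: "\<sigma> \<in> extensional U" and loc: "\<And>P. P \<in> U \<Longrightarrow> \<exists>V t. zopen V \<and> P \<in> V \<and> V \<subseteq> U \<and> t \<in> Ker_theta scl g V \<and>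
      (\<forall>Q\<in>V. \<sigma> Q = germ_coset ?G Q (t Q))" by blast+
    \<comment> \<open>The neighbourhood of a local representative \<open>v\<close> contains the
      generic point. Comparison of the values there makes \<open>\<beta> v\<close> the same for all
      points of \<open>U\<close>.\<close>
    have loc': "\<exists>v. \<beta> v \<in> LL P \<and> \<sigma> P = ecoset P (\<beta> v) \<and> \<beta> v \<in> LL generic_point \<and> \<sigma> generic_point = ecoset generic_point (\<beta> v)"
      if PU: "P \<in> U" for P
    proof -
      obtain V s where V: "zopen V" "P \<in> V" "s \<in> Ker_theta scl g V" "\<forall>Q\<in>V. \<sigma> Q = germ_coset ?G Q (s Q)"
        using loc[OF PU] by blast
      obtain v where v: "s = sec (\<lambda>P v. v) V v" "v \<in> gsec (KK 1) V" using V(3) unfolding Ker_theta_eq[OF V(1)] by blast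
      have "\<sigma> Q = ecoset Q (\<beta> v) \<and> \<beta> v \<in> LL Q" if Q: "Q \<in> V" for Q
      proof -
        have "v \<in> KK 1 Q" using v(2) Q by (simp add: gsec_def)
        moreover have "s Q = v" using Q by (simp add: v(1) sec_def)
        ultimately show ?thesis
          using V(4) Q coset_eq[of Q v] zopen_subset[OF V(1)] by (auto simp: LL_def)
      qed
      thus ?thesis using V(2) zopen_generic[OF V(1,2)] by blast
    qed
    show "\<sigma> \<in> sec ecoset U ` gsec LL U"
    proof (cases "U = {}")
      case True
      have "\<sigma> = sec ecoset U 0" using ext True by (auto simp: sec_def extensional_def restrict_def)
      moreover have "0 \<in> gsec LL U" using True by (simp add: gsec_def)
      ultimately show ?thesis by blast
    next
      case False
      then obtain P0 where P0: "P0 \<in> U" by blast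
      obtain v0 where v0: "\<beta> v0 \<in> LL generic_point" "\<sigma> generic_point = ecoset generic_point (\<beta> v0)"
        using loc'[OF P0] by blast
      have all: "\<sigma> P = ecoset P (\<beta> v0) \<and> \<beta> v0 \<in> LL P" if PU: "P \<in> U" for P
      proof -
        obtain v where v: "\<beta> v \<in> LL P" "\<sigma> P = ecoset P (\<beta> v)" "\<beta> v \<in> LL generic_point" "\<sigma> generic_point = ecoset generic_point (\<beta> v)"
          using loc'[OF PU] by blast
        have "\<beta> v = \<beta> v0"
          using ecoset_inj[OF generic_in_proj_space] v(3,4) v0 unfolding inj_on_def by metis
        thus ?thesis using v by simp
      qed
      have "\<sigma> = sec ecoset U (\<beta> v0)" using ext all by (auto simp: sec_def extensional_def restrict_def fun_eq_iff)
      moreover have "\<beta> v0 \<in> gsec LL U" using all by (simp add: gsec_def)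
      ultimately show ?thesis by blast
    qed
  next
    fix \<sigma> assume "\<sigma> \<in> sec ecoset U ` gsec LL U"
    then obtain w where w: "\<sigma> = sec ecoset U w" "w \<in> gsec LL U" by blast
    have "\<exists>V t. zopen V \<and> P \<in> V \<and> V \<subseteq> U \<and> t \<in> Ker_theta scl g V \<and> (\<forall>Q\<in>V. \<sigma> Q = germ_coset ?G Q (t Q))"
      if PU: "P \<in> U" for P
    proof -
      have P: "P \<in> proj_space" using zopen_subset[OF U] PU by blast
      obtain v where v: "v \<in> KK 1 P" "w = \<beta> v" using w(2) PU unfolding gsec_def LL_def by blast
      obtain V where V: "zopen V" "P \<in> V" "\<And>R. R \<in> V \<Longrightarrow> v \<in> KK 1 R"
        using loc_free_near[OF loc_free_KK_1 P v(1)] unfolding near_def by blast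
      have z: "zopen (V \<inter> U)" by (rule zopen_Int[OF V(1) U])
      have "sec (\<lambda>P v. v) (V \<inter> U) v \<in> Ker_theta scl g (V \<inter> U)"
        unfolding Ker_theta_eq[OF z] using V(3) by (auto simp: gsec_def)
      moreover have "\<forall>Q\<in>V \<inter> U. \<sigma> Q = germ_coset ?G Q (sec (\<lambda>P v. v) (V \<inter> U) v Q)"
        using V(3) coset_eq zopen_subset[OF U] by (auto simp: w(1) v(2) sec_def)
      ultimately show ?thesis
        using z V(2) PU by (intro exI[of _ "V \<inter> U"] exI[of _ "sec (\<lambda>P v. v) (V \<inter> U) v"]) auto
    qed
    moreover have "\<sigma> \<in> extensional U" by (simp add: w(1) sec_def)
    ultimately show "\<sigma> \<in> {\<sigma> \<in> extensional U. \<forall>P\<in>U. \<exists>V t. zopen V \<and> P \<in> V \<and> V \<subseteq> U \<and> t \<in> Ker_theta scl g V \<and>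
      (\<forall>Q\<in>V. \<sigma> Q = germ_coset ?G Q (t Q))}" by blast
  qed
  thus ?thesis by (simp add: F_one_def quotient_sheaf_def)
qed

lemma ecoset_add:
  assumes P: "P \<in> proj_space" and v: "v \<in> LL P" and w: "w \<in> LL P"
  shows "{\<lambda>a. u a + u' a |u u'. u \<in> ecoset P v \<and> u' \<in> ecoset P w} = ecoset P (v + w)"
proof -
  interpret subring_of_field "Oj 0 P" by (rule subring_O[OF P])
  note sm = loc_free_submod[OF loc_free_KK_1 P]
  have "{u + u' |u u'. u \<in> ecoset P v \<and> u' \<in> ecoset P w} = ecoset P (v + w)"
  proof (intro equalityI subsetI)
    fix z assume "z \<in> {u + u' |u u'. u \<in> ecoset P v \<and> u' \<in> ecoset P w}"
    thus "z \<in> ecoset P (v + w)" using submod_add[OF sm] by (auto simp: ecoset_def lin_add[OF lin_\<beta>])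
  next
    fix z assume "z \<in> ecoset P (v + w)"
    hence z: "z \<in> KK 1 P" "\<beta> z = v + w" by (simp_all add: ecoset_def)
    obtain u where u: "u \<in> KK 1 P" "\<beta> u = v" using v unfolding LL_def by blast
    have "z - u \<in> ecoset P w" using submod_diff[OF sm z(1) u(1)] z(2) u(2) by (simp add: ecoset_def lin_diff[OF lin_\<beta>])
    moreover have "u \<in> ecoset P v" using u by (simp add: ecoset_def)
    moreover have "z = u + (z - u)" by simp
    ultimately show "z \<in> {u + u' |u u'. u \<in> ecoset P v \<and> u' \<in> ecoset P w}" by blast
  qed
  thus ?thesis by (simp add: plus_fun_def)
qed

lemma ecoset_smult:
  assumes P: "P \<in> proj_space" and v: "v \<in> LL P" and c: "c \<in> Oj 0 P"
  shows "{\<lambda>a. c * u a + u' a |u u'. u \<in> ecoset P v \<and> u' \<in> GG 0 P} = ecoset P (c *v v)"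
proof -
  interpret subring_of_field "Oj 0 P" by (rule subring_O[OF P])
  note sm = loc_free_submod[OF loc_free_KK_1 P]
  have "{c *v u + u' |u u'. u \<in> ecoset P v \<and> u' \<in> GG 0 P} = ecoset P (c *v v)"
  proof (intro equalityI subsetI)
    fix z assume "z \<in> {c *v u + u' |u u'. u \<in> ecoset P v \<and> u' \<in> GG 0 P}"
    thus "z \<in> ecoset P (c *v v)" using submod_add[OF sm] submod_scale[OF sm c]
      by (auto simp: ecoset_def GG_0_eq[OF P] lin_add[OF lin_\<beta>] lin_scale[OF lin_\<beta>])
  next
    fix z assume "z \<in> ecoset P (c *v v)"
    hence z: "z \<in> KK 1 P" "\<beta> z = c *v v" by (simp_all add: ecoset_def)
    obtain u where u: "u \<in> KK 1 P" "\<beta> u = v" using v unfolding LL_def by blast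
    have "z - c *v u \<in> GG 0 P"
      using submod_diff[OF sm z(1) submod_scale[OF sm c u(1)]] z(2) u(2)
      by (simp add: GG_0_eq[OF P] lin_diff[OF lin_\<beta>] lin_scale[OF lin_\<beta>])
    moreover have "u \<in> ecoset P v" using u by (simp add: ecoset_def)
    moreover have "z = c *v u + (z - c *v u)" by simp
    ultimately show "z \<in> {c *v u + u' |u u'. u \<in> ecoset P v \<and> u' \<in> GG 0 P}" by blast
  qed
  thus ?thesis by (simp add: plus_fun_def vsc_def)
qed

lemma represented_F_one: "represented (F_one scl g) LL ecoset"
  unfolding represented_def represents_def
proof (intro conjI loc_free_LL allI impI ballI)
  show "inj_on (ecoset P) (LL P)" if "P \<in> proj_space" for P by (rule ecoset_inj[OF that])
  fix U :: "('k, 'r) point set" assume U: "zopen U"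
  have UP: "P \<in> U \<Longrightarrow> P \<in> proj_space" for P using zopen_subset[OF U] by blast
  show "carrier (sections (F_one scl g) U) = sec ecoset U ` gsec LL U" by (rule carrier_F_one[OF U])
  show "\<zero>\<^bsub>sections (F_one scl g) U\<^esub> = sec ecoset U 0"
    using stalk_eq UP GG_0_eq by (auto simp: F_one_def quotient_sheaf_def sec_def restrict_def fun_eq_iff ecoset_def)
  fix v assume v: "v \<in> gsec LL U"
  {
    fix w assume w: "w \<in> gsec LL U"
    show "sec ecoset U v \<oplus>\<^bsub>sections (F_one scl g) U\<^esub> sec ecoset U w = sec ecoset U (v + w)"
    proof
      fix P
      show "(sec ecoset U v \<oplus>\<^bsub>sections (F_one scl g) U\<^esub> sec ecoset U w) P = sec ecoset U (v + w) P"
        using ecoset_add[of P v w] v w UP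
        by (cases "P \<in> U") (simp_all add: F_one_def quotient_sheaf_def sec_def gsec_def)
    qed
  }
  {
    fix c assume c: "\<forall>P\<in>U. c \<in> Oj 0 P"
    show "(\<lambda>P\<in>U. c) \<odot>\<^bsub>sections (F_one scl g) U\<^esub> sec ecoset U v = sec ecoset U (c *v v)"
    proof
      fix P
      show "((\<lambda>P\<in>U. c) \<odot>\<^bsub>sections (F_one scl g) U\<^esub> sec ecoset U v) P = sec ecoset U (c *v v) P"
        using ecoset_smult[of P v c] v c UP stalk_eq[of P]
        by (cases "P \<in> U") (simp_all add: F_one_def quotient_sheaf_def sec_def gsec_def)
    qed
  }
  fix V :: "('k, 'r) point set" assume "zopen V" "V \<subseteq> U"
  thus "res (F_one scl g) U V (sec ecoset U v) = sec ecoset V v"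
    by (simp add: F_one_def quotient_sheaf_def restrict_sec)
qed

end

end

section \<open>Chern classes of \<open>\<F>\<^sub>1\<close>\<close>

locale chern_jordan = chern C p q + jordan Xm d p t
  for C :: "('k::field, 'r::{finite,linorder}, ('k, 'r) point \<Rightarrow> (nat \<Rightarrow> ('k, 'r) hfrac) set) psheaf \<Rightarrow> int poly"
    and p q :: nat and Xm :: "'r \<Rightarrow> nat \<Rightarrow> nat \<Rightarrow> 'k" and d t :: nat
begin

lemma Psi_GG: "cg p q (Psi GG) 1"
proof -
  have lf: "loc_free (gsheaf pmod j)" for j
    by (rule loc_free_cong[OF loc_free_GG[of j]]) (simp add: gsheaf_pmod)
  have "cg p q (Psi (gsheaf pmod)) 1"
  \<comment> \<open>The recursion starts with \<open>n = 0\<close>, where purity concerns only the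
    empty set of variables.\<close>
  proof (rule Psi_gsheaf[of "{..<d}" "\<lambda>_. 0" pmod 0])
    show "pure A pmod" if "card A \<le> 0" for A :: "'r set" using that pure_empty by simp
  qed (use pmod_graded pmod_meets lf in auto)
  moreover have "cg p q (Psi (gsheaf pmod)) (Psi GG)"
    by (rule Psi_cong[OF lf loc_free_GG gsheaf_pmod])
  ultimately show ?thesis using cg_sym cg_trans by blast
qed

text \<open>Whitney sums along the filtration by kernels of powers. The untwisted factor is missing
  here; it comes from the sequence that presents \<open>F_one\<close>.\<close>

lemma C_KK:
  assumes "n < p"
  shows "cg p q (C (lsheaf (KK (Suc n)))) (C (lsheaf (KK 1)) * (\<Prod>i\<in>{1..n}. C (lsheaf (GG (int i)))))"
  using assms
proof (induction n)
  case (Suc n)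
  let ?\<Pi> = "\<lambda>n. \<Prod>i\<in>{1..n}. C (lsheaf (GG (int i)))"
  have "cg p q (C (lsheaf (KK (Suc (Suc n))))) (C (lsheaf (KK (Suc n))) * C (lsheaf (GG (int (Suc n)))))"
    by (rule whitney[OF represented_lsheaf represented_lsheaf represented_lsheaf
          lin_funpow[OF lin_\<theta>, of "Suc n"] KK_kernel KK_image])
      (use Suc.prems in \<open>auto intro!: loc_free_KK loc_free_GG\<close>)
  moreover have "cg p q (C (lsheaf (KK (Suc n))) * C (lsheaf (GG (int (Suc n)))))
      (C (lsheaf (KK 1)) * ?\<Pi> n * C (lsheaf (GG (int (Suc n)))))"
    using Suc by (intro cg_mult cg_refl) auto
  moreover have "?\<Pi> (Suc n) = ?\<Pi> n * C (lsheaf (GG (int (Suc n))))"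
    by (simp add: atLeastAtMostSuc_conv mult.commute)
  ultimately show ?case unfolding mult.assoc by (simp only: cg_trans)
qed simp

lemma C_MM_0: "cg p q (C (lsheaf (MM 0))) 1"
  using C_DS[of "{..<d}" "\<lambda>_. 0"] by (simp add: MM_def flip: one_pCons)

lemma C_F_one:
  assumes "Xm = X_mat scl g" and "d = kdim scl"
  shows "cg p q (C (F_one scl g)) 1"
proof -
  note rF = represented_F_one[OF assms]
  let ?F = "C (F_one scl g)"
  have "cg p q (C (lsheaf (KK 1))) (C (lsheaf (GG 0)) * ?F)"
    by (rule whitney[OF represented_lsheaf[OF loc_free_GG] represented_lsheaf[OF loc_free_KK_1] rF lin_\<beta> GG_0_eq])
      (simp_all add: LL_def)
  moreover have "cg p q (C (lsheaf (KK p))) (C (lsheaf (KK 1)) * (\<Prod>i\<in>{1..p - 1}. C (lsheaf (GG (int i)))))"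
    using C_KK[of "p - 1"] p2 by simp
  ultimately have "cg p q (C (lsheaf (KK p))) (C (lsheaf (GG 0)) * ?F * (\<Prod>i\<in>{1..p - 1}. C (lsheaf (GG (int i)))))"
    by (blast intro: cg_trans cg_mult[OF _ cg_refl])
  \<comment> \<open>The sequence for \<open>F_one\<close> contributes the untwisted factor and the
    filtration the twists 1 to \<open>p - 1\<close>; together they complete the product over all
    residues.\<close>
  moreover have "Psi GG = C (lsheaf (GG 0)) * (\<Prod>i\<in>{1..p - 1}. C (lsheaf (GG (int i))))"
  proof -
    have "{..<p} = insert 0 {1..p - 1}" using p2 by auto
    thus ?thesis unfolding Psi_def by simp
  qed
  ultimately have 1: "cg p q (C (lsheaf (KK p))) (?F * Psi GG)" by (simp add: mult_ac)
  have 2: "cg p q (C (lsheaf (KK p))) (C (lsheaf (MM 0)))"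
    by (rule C_cong[OF represented_lsheaf represented_lsheaf KK_p]) (use p2 in \<open>auto intro!: loc_free_KK loc_free_MM\<close>)
  have 3: "cg p q (?F * Psi GG) ?F" using cg_mult_left[OF Psi_GG, of ?F] by simp
  show ?thesis
    by (rule cg_trans[OF cg_sym[OF cg_trans[OF 1 3]] cg_trans[OF 2 C_MM_0]])
qed

end

theorem theorem1p2:
  fixes scl :: "('e::ab_group_add \<Rightarrow>\<^sub>0 'k::field) \<Rightarrow> 'm::ab_group_add \<Rightarrow> 'm"
    and g :: "'r::{finite,linorder} \<Rightarrow> 'e"
    and C :: "('k, 'r, ('k, 'r) point \<Rightarrow> (nat \<Rightarrow> ('k, 'r) hfrac) set) psheaf \<Rightarrow> int poly"
    and p s m :: nat
  assumes "prime p"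
    and "CHAR('k) = p"
    and "surj (\<lambda>x::'k. x ^ p)"
    and "elementary_abelian_gens p g"
    and "Modules.module scl"
    and "fin_gen scl"
    and "stable_constant_jordan_type p scl g (\<lambda>i. if i = 1 then s else 0)"
    and "chern_theory C"
    and "1 \<le> m" and "m \<le> p - 2"
  shows "int p dvd coeff (C (F_one scl g)) m"
proof -
  have p2: "2 \<le> p" using \<open>prime p\<close> by (rule prime_ge_2_nat)
  obtain n' where n': "constant_jordan_type p scl g n'" "\<forall>i\<in>{1..<p}. n' i = (if i = 1 then s else 0)"
    using assms(7) unfolding stable_constant_jordan_type_def by blast
  interpret jordan "X_mat scl g" "kdim scl" p "n' p"
  proof
    fix K :: "('k, 'r) hfrac set ring" and \<iota> and \<alpha> :: "'r \<Rightarrow> ('k, 'r) hfrac set"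
    assume K: "Ring.field K" "\<iota> \<in> ring_hom (ring_of_type_algebra :: 'k ring) K"
      "\<forall>i. \<alpha> i \<in> carrier K" "\<exists>i. \<alpha> i \<noteq> \<zero>\<^bsub>K\<^esub>"
    then obtain ns where ns: "nilpotent_jordan_blocks K (kdim scl) (X_alpha scl g K \<iota> \<alpha>) ns"
      "set ns \<subseteq> {1..p}" "\<forall>i\<in>{1..p}. count_list ns i = n' i"
      using n'(1) unfolding constant_jordan_type_def by blast
    \<comment> \<open>Lengths strictly between 1 and \<open>p\<close> have multiplicity zero by the
      stable type.\<close>
    have "i = 1 \<or> i = p" if i: "i \<in> set ns" for i
    proof (rule ccontr)
      assume no: "\<not> (i = 1 \<or> i = p)"
      hence ip: "i \<in> {1..<p}" "i \<in> {1..p}" using ns(2) i by force+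
      have "count_list ns i = 0" using ns(3) n'(2) ip no by auto
      thus False using i by (simp add: count_list_0_iff)
    qed
    hence "set ns \<subseteq> {1, p}" by blast
    moreover have "count_list ns p = n' p" using ns(3) p2 by simp
    moreover have "X_alpha scl g K \<iota> \<alpha> = (\<lambda>v. \<lambda>a\<in>{..<kdim scl}. finsum K
        (\<lambda>b. finsum K (\<lambda>i. \<alpha> i \<otimes>\<^bsub>K\<^esub> \<iota> (X_mat scl g i a b)) UNIV \<otimes>\<^bsub>K\<^esub> v b) {..<kdim scl})"
      by (rule ext) (simp add: X_alpha_def)
    ultimately show "\<exists>ns. nilpotent_jordan_blocks K (kdim scl) (\<lambda>v. \<lambda>a\<in>{..<kdim scl}. finsum K
        (\<lambda>b. finsum K (\<lambda>i. \<alpha> i \<otimes>\<^bsub>K\<^esub> \<iota> (X_mat scl g i a b)) UNIV \<otimes>\<^bsub>K\<^esub> v b) {..<kdim scl}) ns \<and>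
        set ns \<subseteq> {1, p} \<and> count_list ns p = n' p"
      using ns(1) by metis
  qed (rule p2)
  \<comment> \<open>The minimum combines two limits: classes are determined only modulo
    \<open>h^r\<close>, and \<open>twist_product\<close> gives triviality modulo \<open>p\<close>
    only below degree \<open>p - 1\<close>.\<close>
  interpret chern_jordan C p "min CARD('r) (p - 1)" "X_mat scl g" "kdim scl" "n' p"
    by unfold_locales (use assms in auto)
  show ?thesis
  proof (cases "m < CARD('r)")
    case True
    hence "m < min CARD('r) (p - 1)" using assms(9,10) by simp
    \<comment> \<open>As \<open>m \<ge> 1\<close>, the class 1 has coefficient 0 in degree
      \<open>m\<close>.\<close>
    thus ?thesis using C_F_one[OF refl refl] assms(9) unfolding cg_def by fastforce
  next
    case False
    have "degree (C (F_one scl g)) < CARD('r)"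
      using assms(8) represented.vector_bundle[OF represented_F_one[OF refl refl]] unfolding chern_theory_def by blast
    thus ?thesis using False by (simp add: coeff_eq_0)
  qed
qed

end
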